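(* Let $h\in[1,n]$ and let $A=(a_{i,j}),C=(c_{i,j})\in\Xi_{N,2r}$ with $C=E^\theta_{h+1,h}+\mathrm{diag}(\widehat\gamma)$ for some $\gamma\in\Lambda(n+1,r-1)$, and assume $\mathrm{ro}(C)=\widehat\lambda$, $\mathrm{co}(C)=\mathrm{ro}(A)=\widehat\mu$, $\mathrm{co}(A)=\widehat\nu$ with $\lambda,\mu,\nu\in\Lambda(n+1,r)$. Let $\varepsilon=\mathrm{sgn}(A)$ and $$g'_{h,A,\overline p}=\begin{cases}\boldsymbol q^{\sum_{j<p}a_{h+1,j}}[\![a_{h+1,p}+1]\!],&\text{if }a_{h,p}>0\text{ and }(h<n\text{ or }p\ne n+1),\\ \boldsymbol q^{\sum_{j<n+1}a_{n+1,j}}\big([\![a_{n+1,n+1}+1]\!]+\boldsymbol q^{\frac{a_{n+1,n+1}}2}\big),&\text{if }h=n,\ p=n+1,\ a_{n,n+1}>0,\\0,&\text{if }a_{h,p}=0.\end{cases}$$ Suppose $c_{n+1,n+1}\ne0$ (i.e. $C\in\Xi^{\bullet}$). Then the following hold in $S^{D}_{\boldsymbol q}(n,r)$ (terms with coefficient $g'_{h,A,\overline p}=0$ being zero): (1) If $A\in\Xi^{\bullet}$, then $\phi_{\dot C}\,\phi_{\dot A}=\sum_{1\le p\le N}g'_{h,A,\overline p}\,\phi_{{}_h\dot A_{\overline p}}$. (2) If $A\in\Xi^{\bullet\circ\circ}\sqcup\Xi^{\bullet\circ\bullet}$, then $$\phi_{\dot C}\,\phi_{{}^{+}A^{\varepsilon}}=\begin{cases}\displaystyle\sum_{1\le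 p\le N}g'_{h,A,\overline p}\,\phi_{{}^{+}({}_hA_{\overline p})^{\varepsilon}},&h<n,\\[2ex]\displaystyle\sum_{1\le p<n+1}g'_{n,A,\overline p}\,\phi_{{}^{+}({}_nA_{\overline p})^{\varepsilon}}+\tfrac12g'_{n,A,\overline{n+1}}\,\phi_{{}_n\dot A_{\overline{n+1}}}+\sum_{p>n+1}g'_{n,A,\overline p}\,\phi_{{}^{-}({}_nA_{\overline p})^{\varepsilon}},&h=n,\end{cases}$$ $$\phi_{\dot C}\,\phi_{{}^{-}A^{-\varepsilon}}=\begin{cases}\displaystyle\sum_{1\le p\le N}g'_{h,A,\overline p}\,\phi_{{}^{-}({}_hA_{\overline p})^{-\varepsilon}},&h<n,\\[2ex]\displaystyle\sum_{1\le p<n+1}g'_{n,A,\overline p}\,\phi_{{}^{-}({}_nA_{\overline p})^{-\varepsilon}}+\tfrac12g'_{n,A,\overline{n+1}}\,\phi_{{}_n\dot A_{\overline{n+1}}}+\sum_{p>n+1}g'_{n,A,\overline p}\,\phi_{{}^{+}({}_nA_{\overline p})^{-\varepsilon}},&h=n.\end{cases}$$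
   Context: Let $n\ge1$, $r\ge4$, $N=2n+1$, $[a,b]=\{x\in\mathbb Z:a\le x\le b\}$, $\mathcal A=\mathbb Z[\boldsymbol q]$ with $\boldsymbol q$ an indeterminate, $[\![m]\!]=(\boldsymbol q^m-1)/(\boldsymbol q-1)$. $W$ is the group of permutations $w$ of $[1,2r]$ with $w(i)+w(2r+1-i)=2r+1$ for all $i$ (type $B_r$), with Coxeter generators $s_i=(i,i+1)(2r-i,2r+1-i)$ ($1\le i<r$) and $s_r=(r,r+1)$. $H=H_{\boldsymbol q,1}$ is the $\mathcal A$-algebra generated by $T_1,\dots,T_r$ with relations $T_iT_j=T_jT_i$ ($|i-j|\ge2$), $T_jT_{j+1}T_j=T_{j+1}T_jT_{j+1}$ ($1\le j<r-1$), $T_{r-1}T_rT_{r-1}T_r=T_rT_{r-1}T_rT_{r-1}$, $T_i^2=(\boldsymbol q-1)T_i+\boldsymbol q$ ($i<r$), $T_r^2=1$; it has basis $\{T_w\}_{w\in W}$ defined via reduced expressions. $\Lambda(n+1,m)=\{\lambda\in\mathbb N^{n+1}:\sum\lambda_i=m\}$, $\widehat\lambda=(\lambda_1,\dots,\lambda_n,2\lambda_{n+1},\lambda_n,\dots,\lambda_1)$. For $\lambda\in\Lambda(n+1,r)$, $W_\lambda$ is generated by the $s_j$, $j\in[1,r]$, with $j\notin\{\lambda_1+\dots+\lambda_i:i\in[1,n]\}$. $\Xi_{N,2r}$ is the set of $N\times N$ matrices $A=(a_{i,j})$ over $\mathbb N$ with $a_{i,j}=a_{N+1-i,N+1-j}$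 and $\sum a_{i,j}=2r$; $\mathrm{ro}(A),\mathrm{co}(A)$ are the row sum and column sum vectors. Let $R_i^{\widehat\lambda}$ ($1\le i\le N$) be the consecutive intervals of lengths $\widehat\lambda_i$ partitioning $[1,2r]$. The map $(\lambda,d,\mu)\mapsto(|R_i^{\widehat\lambda}\cap dR_j^{\widehat\mu}|)_{i,j}$, with $\lambda,\mu\in\Lambda(n+1,r)$ and $d$ a minimal length representative of a $W_\lambda$-$W_\mu$ double coset, is a bijection onto $\Xi_{N,2r}$; if $A$ is the image of $(\lambda,d,\mu)$ write $d_A=d$ (then $\mathrm{ro}(A)=\widehat\lambda$, $\mathrm{co}(A)=\widehat\mu$). $\check W\le W$ is the subgroup of $w$ with $\#\{i\in[1,r]:w(i)>r\}$ even (type $D_r$), with Coxeter generators $s_1,\dots,s_{r-1},s_rs_{r-1}s_r$; $\check H\subset H$ is the subalgebra generated by $T_1,\dots,T_{r-1},T_rT_{r-1}T_r$, with basis $\{T_w\}_{w\in\check W}$. $\Lambda^{D}(n,r)$ consists of symbols $\lambda^\bullet$ ($\lambda\in\Lambda(n+1,r)$, $\lambda_{n+1}\ne0$) and $\lambda^+,\lambda^-$ ($\lambda_{n+1}=0$); $\check W_{\lambda^\bullet}=W_\lambda\cap\check W$, $\check W_{\lambda^+}=W_\lambda$, $\check W_{\lambda^-}=s_rW_\lambda s_r$; $\check x_\alpha=\sum_{w\in\check W_\alpha}T_w$; $S^{D}_{\boldsymbol q}(n,r)=\mathrm{End}_{\check H}(\bigoplus_{\alpha\in\Lambda^{D}(n,r)}\check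 x_\alpha\check H)$, product being composition (also written $*$). For $\alpha,\beta\in\Lambda^{D}(n,r)$ and $d$ the minimal length representative (for $\check W$) of a $\check W_\alpha$-$\check W_\beta$ double coset in $\check W$, $\phi^d_{\alpha,\beta}(\check x_\gamma h)=\delta_{\beta,\gamma}\sum_{w\in\check W_\alpha d\check W_\beta}T_wh$. $\mathrm{sgn}(A)\in\{+,-\}$ is $+$ iff $\sum_{i\in[1,n],\,j\in[n+2,N]}a_{i,j}$ is even; signs multiply as usual and $-\varepsilon$ is the opposite sign. One has symbols $\dot A$ for $A\in\Xi_{N,2r}$ with $a_{n+1,n+1}\ne0$ and ${}^{\varepsilon}A^{\varepsilon'}$ for $A\in\Xi_{N,2r}$ with $a_{n+1,n+1}=0$ and $\varepsilon\varepsilon'=\mathrm{sgn}(A)$. With $\mathrm{ro}(A)=\widehat\lambda$, $\mathrm{co}(A)=\widehat\mu$, put $\lambda^{[\varepsilon]}=\lambda^\varepsilon$ if $\lambda_{n+1}=0$, $\lambda^{[\varepsilon]}=\lambda^\bullet$ otherwise (same for $\mu$), $s^{+}=1$, $s^{-}=s_r$. Then $\phi_{\dot A}=\phi^{d}_{\lambda^\bullet,\mu^\bullet}$, $d$ the minimal representative of $\check W_{\lambda^\bullet}d_A\check W_{\mu^\bullet}$ if $d_A\in\check W$, of $\check W_{\lambda^\bullet}s_rd_A\check W_{\mu^\bullet}$ if $d_A\notin\check W$; and $\phi_{{}^{\varepsilon}A^{\varepsilon'}}=\phi^{d}_{\lambda^{[\varepsilon]},\mu^{[\varepsilon']}}$,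 $d$ the minimal representative of $\check W_{\lambda^{[\varepsilon]}}s^{\varepsilon}d_As^{\varepsilon'}\check W_{\mu^{[\varepsilon']}}$. $\Xi^{\bullet}=\{A\in\Xi_{N,2r}:a_{n+1,n+1}\ne0\}$. With $\mathrm{ro}(A)=\widehat\lambda,\mathrm{co}(A)=\widehat\mu$: $\Xi^{\bullet\circ\circ}$ is the set of $A\in\Xi_{N,2r}$ with $a_{n+1,n+1}=0$, $\lambda_{n+1}\ne0=\mu_{n+1}$, and $\Xi^{\bullet\circ\bullet}$ the set of those with $a_{n+1,n+1}=0$, $\lambda_{n+1}\ne0\ne\mu_{n+1}$. $E^\theta_{i,j}=E_{i,j}+E_{N+1-i,N+1-j}$ ($E_{i,j}$ matrix units), ${}_hA_{\overline p}=A-E^\theta_{h,p}+E^\theta_{h+1,p}$, and ${}_h\dot A_{\overline p}$ denotes the symbol $\dot M$ for $M={}_hA_{\overline p}$. *)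

theory Defs
  imports
    "HOL-Library.Cardinality"
    "HOL-Library.Poly_Mapping"
    "HOL-Library.Function_Algebras"
    "HOL-Computational_Algebra.Polynomial"
    "HOL-Combinatorics.Permutations"
begin

section \<open>Quantum integers\<close>

abbreviation q :: "int poly" where "q \<equiv> [:0, 1:]"

text \<open>The division is exact in \<open>\<int>[q]\<close>.\<close>

definition qint :: "nat \<Rightarrow> int poly" where
  "qint m = (q ^ m - 1) div (q - 1)"


section \<open>The Weyl groups of types B and D\<close>

definition WB :: "nat \<Rightarrow> (nat \<Rightarrow> nat) set" where
  "WB r = {w. w permutes {1..2*r} \<and> (\<forall>i\<in>{1..2*r}. w i + w (2*r+1-i) = 2*r+1)}"

definition sgen :: "nat \<Rightarrow> nat \<Rightarrow> nat \<Rightarrow> nat" where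
  "sgen r i = (if i < r then transpose i (i+1) \<circ> transpose (2*r-i) (2*r+1-i)
            else transpose r (r+1))"

definition gensB :: "nat \<Rightarrow> (nat \<Rightarrow> nat) set" where
  "gensB r = sgen r ` {1..r}"

definition WD :: "nat \<Rightarrow> (nat \<Rightarrow> nat) set" where
  "WD r = {w \<in> WB r. even (card {i\<in>{1..r}. w i > r})}"

definition gensD :: "nat \<Rightarrow> (nat \<Rightarrow> nat) set" where
  "gensD r = sgen r ` {1..<r} \<union> {sgen r r \<circ> sgen r (r-1) \<circ> sgen r r}"

definition compose_list :: "('a \<Rightarrow> 'a) list \<Rightarrow> 'a \<Rightarrow> 'a" where
  "compose_list ws = foldr (\<circ>) ws id"

definition wlength :: "('a \<Rightarrow> 'a) set \<Rightarrow> ('a \<Rightarrow> 'a) \<Rightarrow> nat" where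
  "wlength S w = (LEAST k. \<exists>ws. set ws \<subseteq> S \<and> length ws = k \<and> compose_list ws = w)"

inductive_set gen_subgroup :: "('a \<Rightarrow> 'a) set \<Rightarrow> ('a \<Rightarrow> 'a) set" for S where
  one: "id \<in> gen_subgroup S"
| gen: "g \<in> S \<Longrightarrow> g \<in> gen_subgroup S"
| mult: "g \<in> gen_subgroup S \<Longrightarrow> g' \<in> gen_subgroup S \<Longrightarrow> g \<circ> g' \<in> gen_subgroup S"
| inverse: "g \<in> gen_subgroup S \<Longrightarrow> inv g \<in> gen_subgroup S"

definition double_coset :: "('a \<Rightarrow> 'a) set \<Rightarrow> ('a \<Rightarrow> 'a) \<Rightarrow> ('a \<Rightarrow> 'a) set \<Rightarrow> ('a \<Rightarrow> 'a) set" where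
  "double_coset U d V = {u \<circ> d \<circ> v |u v. u \<in> U \<and> v \<in> V}"

definition is_min_rep :: "('a \<Rightarrow> 'a) set \<Rightarrow> ('a \<Rightarrow> 'a) set \<Rightarrow> ('a \<Rightarrow> 'a) \<Rightarrow> bool" where
  "is_min_rep S D d \<longleftrightarrow> d \<in> D \<and> (\<forall>x\<in>D. wlength S d \<le> wlength S x)"

definition min_rep :: "('a \<Rightarrow> 'a) set \<Rightarrow> ('a \<Rightarrow> 'a) set \<Rightarrow> 'a \<Rightarrow> 'a" where
  "min_rep S D = (THE d. is_min_rep S D d)"


section \<open>Compositions, parabolic subgroups and matrices\<close>

text \<open>Vectors and matrices are indexed from 1 and vanish outside their index range, so that
  equality of functions is equality of vectors or matrices. Throughout, \<open>N = 2 n + 1\<close>, and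
  sums and differences of matrices are pointwise.\<close>

type_synonym vect = "nat \<Rightarrow> nat"
type_synonym mat = "nat \<Rightarrow> nat \<Rightarrow> nat"

definition Lam :: "nat \<Rightarrow> nat \<Rightarrow> vect set" where
  "Lam n m = {l. (\<forall>i. i \<notin> {1..n+1} \<longrightarrow> l i = 0) \<and> (\<Sum>i=1..n+1. l i) = m}"

definition hat :: "nat \<Rightarrow> vect \<Rightarrow> vect" where
  "hat n l = (\<lambda>i. if i \<in> {1..n} then l i
                  else if i = n+1 then 2 * l (n+1)
                  else if i \<in> {n+2..2*n+1} then l (2*n+2-i)
                  else 0)"

definition Wpar :: "nat \<Rightarrow> nat \<Rightarrow> vect \<Rightarrow> (nat \<Rightarrow> nat) set" where
  "Wpar n r l = gen_subgroup (sgen r ` {j\<in>{1..r}. j \<notin> {\<Sum>k=1..i. l k |i. i \<in> {1..n}}})"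

definition Xi :: "nat \<Rightarrow> nat \<Rightarrow> mat set" where
  "Xi n r = {A. (\<forall>i j. \<not> (i \<in> {1..2*n+1} \<and> j \<in> {1..2*n+1}) \<longrightarrow> A i j = 0)
              \<and> (\<forall>i\<in>{1..2*n+1}. \<forall>j\<in>{1..2*n+1}. A i j = A (2*n+2-i) (2*n+2-j))
              \<and> (\<Sum>i=1..2*n+1. \<Sum>j=1..2*n+1. A i j) = 2*r}"

definition ro :: "nat \<Rightarrow> mat \<Rightarrow> vect" where
  "ro n A = (\<lambda>i. \<Sum>j=1..2*n+1. A i j)"

definition co :: "nat \<Rightarrow> mat \<Rightarrow> vect" where
  "co n A = (\<lambda>j. \<Sum>i=1..2*n+1. A i j)"

text \<open>The composition \<open>l\<close> with \<open>hat n l = v\<close>.\<close>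

definition unhat :: "nat \<Rightarrow> nat \<Rightarrow> vect \<Rightarrow> vect" where
  "unhat n r v = (THE l. l \<in> Lam n r \<and> hat n l = v)"

definition block :: "vect \<Rightarrow> nat \<Rightarrow> nat set" where
  "block v i = {(\<Sum>j=1..<i. v j) + 1 .. \<Sum>j=1..i. v j}"

definition coset_mat :: "nat \<Rightarrow> vect \<Rightarrow> (nat \<Rightarrow> nat) \<Rightarrow> vect \<Rightarrow> mat" where
  "coset_mat n l d m =
     (\<lambda>i j. if i \<in> {1..2*n+1} \<and> j \<in> {1..2*n+1}
            then card (block (hat n l) i \<inter> d ` block (hat n m) j) else 0)"

definition d_of :: "nat \<Rightarrow> nat \<Rightarrow> mat \<Rightarrow> nat \<Rightarrow> nat" where
  "d_of n r A = (THE d. \<exists>l\<in>Lam n r. \<exists>m\<in>Lam n r. \<exists>w\<in>WB r.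
      is_min_rep (gensB r) (double_coset (Wpar n r l) w (Wpar n r m)) d
      \<and> coset_mat n l d m = A)"

definition Xi_bul :: "nat \<Rightarrow> nat \<Rightarrow> mat set" where
  "Xi_bul n r = {A \<in> Xi n r. A (n+1) (n+1) \<noteq> 0}"

definition Xi_bul_circ_circ :: "nat \<Rightarrow> nat \<Rightarrow> mat set" where
  "Xi_bul_circ_circ n r = {A \<in> Xi n r. A (n+1) (n+1) = 0
     \<and> unhat n r (ro n A) (n+1) \<noteq> 0 \<and> unhat n r (co n A) (n+1) = 0}"

definition Xi_bul_circ_bul :: "nat \<Rightarrow> nat \<Rightarrow> mat set" where
  "Xi_bul_circ_bul n r = {A \<in> Xi n r. A (n+1) (n+1) = 0
     \<and> unhat n r (ro n A) (n+1) \<noteq> 0 \<and> unhat n r (co n A) (n+1) \<noteq> 0}"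

definition Emat :: "nat \<Rightarrow> nat \<Rightarrow> mat" where
  "Emat i j = (\<lambda>a b. if a = i \<and> b = j then 1 else 0)"

definition Etheta :: "nat \<Rightarrow> nat \<Rightarrow> nat \<Rightarrow> mat" where
  "Etheta n i j = Emat i j + Emat (2*n+2-i) (2*n+2-j)"

definition diag :: "vect \<Rightarrow> mat" where
  "diag v = (\<lambda>i j. if i = j then v i else 0)"

text \<open>The subtraction is that of natural numbers; it is the integer one when \<open>A h p > 0\<close>
  and \<open>A \<in> Xi n r\<close>, \<open>h \<le> n\<close>, that is, whenever the coefficient of the term involved
  does not vanish.\<close>

definition shift :: "nat \<Rightarrow> nat \<Rightarrow> mat \<Rightarrow> nat \<Rightarrow> mat" where
  "shift n h A p = A - Etheta n h p + Etheta n (h+1) p"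

definition g' :: "nat \<Rightarrow> nat \<Rightarrow> mat \<Rightarrow> nat \<Rightarrow> int poly" where
  "g' n h A p =
     (if A h p = 0 then 0
      else if h < n \<or> p \<noteq> n+1
        then q ^ (\<Sum>j=1..<p. A (h+1) j) * qint (A (h+1) p + 1)
      else q ^ (\<Sum>j=1..<n+1. A (n+1) j)
             * (qint (A (n+1) (n+1) + 1) + q ^ (A (n+1) (n+1) div 2)))"


section \<open>Signs and symbols\<close>

datatype sign = Pos | Neg

instantiation sign :: uminus
begin

fun uminus_sign :: "sign \<Rightarrow> sign" where
  "- Pos = Neg"
| "- Neg = Pos"

instance ..

end

definition sgnM :: "nat \<Rightarrow> mat \<Rightarrow> sign" where
  "sgnM n A = (if even (\<Sum>i=1..n. \<Sum>j=n+2..2*n+1. A i j) then Pos else Neg)"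

definition s_sign :: "nat \<Rightarrow> sign \<Rightarrow> nat \<Rightarrow> nat" where
  "s_sign r e = (case e of Pos \<Rightarrow> id | Neg \<Rightarrow> sgen r r)"

text \<open>\<open>Bul l\<close> is \<open>l\<close> decorated with a bullet, \<open>Sgn e l\<close> is \<open>l\<close> decorated with the sign \<open>e\<close>.\<close>

datatype dweight = Bul vect | Sgn sign vect

definition LamD :: "nat \<Rightarrow> nat \<Rightarrow> dweight set" where
  "LamD n r = {Bul l |l. l \<in> Lam n r \<and> l (n+1) \<noteq> 0}
            \<union> {Sgn e l |e l. l \<in> Lam n r \<and> l (n+1) = 0}"

definition bracket :: "nat \<Rightarrow> vect \<Rightarrow> sign \<Rightarrow> dweight" where
  "bracket n l e = (if l (n+1) = 0 then Sgn e l else Bul l)"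

fun WDpar :: "nat \<Rightarrow> nat \<Rightarrow> dweight \<Rightarrow> (nat \<Rightarrow> nat) set" where
  "WDpar n r (Bul l) = Wpar n r l \<inter> WD r"
| "WDpar n r (Sgn Pos l) = Wpar n r l"
| "WDpar n r (Sgn Neg l) = {sgen r r \<circ> w \<circ> sgen r r |w. w \<in> Wpar n r l}"

text \<open>\<open>DotM A\<close> is meant for \<open>A \<in> Xi n r\<close> with nonzero central entry; \<open>SgnM e A e'\<close>, the matrix
  \<open>A\<close> with left superscript \<open>e\<close> and right superscript \<open>e'\<close>, for \<open>A \<in> Xi n r\<close> with zero central
  entry and \<open>e e' = sgnM n A\<close>.\<close>

datatype msym = DotM mat | SgnM sign mat sign


section \<open>The Hecke algebra of type B with unequal parameters\<close>

text \<open>The free \<open>\<int>[q]\<close>-algebra on letters indexed by the natural numbers is the monoid algebra of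
  the free monoid, the latter written additively so that the library's monoid algebra applies.\<close>

datatype gword = GWord "nat list"

instantiation gword :: monoid_add
begin

definition zero_gword :: gword where "0 = GWord []"

fun plus_gword :: "gword \<Rightarrow> gword \<Rightarrow> gword" where
  "GWord u + GWord v = GWord (u @ v)"

instance
proof
  fix a b c :: gword
  show "a + b + c = a + (b + c)" by (cases a; cases b; cases c) simp
  show "0 + a = a" "a + 0 = a" by (cases a; simp add: zero_gword_def)+
qed

end

type_synonym free_alg = "gword \<Rightarrow>\<^sub>0 int poly"

definition letter :: "nat \<Rightarrow> free_alg" where
  "letter i = Poly_Mapping.single (GWord [i]) 1"

definition scalar :: "int poly \<Rightarrow> free_alg" where
  "scalar c = Poly_Mapping.single 0 c"

text \<open>The last relation only discards the letters that are not generators.\<close>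

inductive hecke_relation :: "nat \<Rightarrow> free_alg \<Rightarrow> free_alg \<Rightarrow> bool" for r where
  commute: "\<lbrakk>i \<in> {1..r}; j \<in> {1..r}; \<bar>int i - int j\<bar> \<ge> 2\<rbrakk>
    \<Longrightarrow> hecke_relation r (letter i * letter j) (letter j * letter i)"
| braid3: "\<lbrakk>1 \<le> j; j + 1 < r\<rbrakk>
    \<Longrightarrow> hecke_relation r (letter j * letter (j+1) * letter j)
                         (letter (j+1) * letter j * letter (j+1))"
| braid4: "2 \<le> r
    \<Longrightarrow> hecke_relation r (letter (r-1) * letter r * letter (r-1) * letter r)
                         (letter r * letter (r-1) * letter r * letter (r-1))"
| quad: "\<lbrakk>1 \<le> i; i < r\<rbrakk>
    \<Longrightarrow> hecke_relation r (letter i * letter i) (scalar (q - 1) * letter i + scalar q)"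
| quad_last: "1 \<le> r \<Longrightarrow> hecke_relation r (letter r * letter r) 1"
| no_letter: "i \<notin> {1..r} \<Longrightarrow> hecke_relation r (letter i) 0"

inductive hecke_cong :: "nat \<Rightarrow> free_alg \<Rightarrow> free_alg \<Rightarrow> bool" for r where
  base: "hecke_relation r x y \<Longrightarrow> hecke_cong r x y"
| refl: "hecke_cong r x x"
| sym: "hecke_cong r x y \<Longrightarrow> hecke_cong r y x"
| trans: "hecke_cong r x y \<Longrightarrow> hecke_cong r y z \<Longrightarrow> hecke_cong r x z"
| add: "hecke_cong r x y \<Longrightarrow> hecke_cong r x' y' \<Longrightarrow> hecke_cong r (x + x') (y + y')"
| mult: "hecke_cong r x y \<Longrightarrow> hecke_cong r x' y' \<Longrightarrow> hecke_cong r (x * x') (y * y')"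

lemma equivp_hecke_cong: "equivp (hecke_cong r)"
  by (intro equivpI reflpI sympI transpI) (blast intro: hecke_cong.intros)+

lemma hecke_cong_uminus: "hecke_cong r x y \<Longrightarrow> hecke_cong r (- x) (- y)"
  using hecke_cong.mult[OF hecke_cong.refl[of r "- 1"], of x y] by simp

text \<open>The character sending the generators to \<open>q, \<dots>, q, 1\<close>, used to see that the algebra defined
  below is nonzero.\<close>

definition index_word :: "nat \<Rightarrow> gword \<Rightarrow> int poly" where
  "index_word r w = (case w of GWord u \<Rightarrow>
     prod_list (map (\<lambda>i. if i \<in> {1..<r} then q else if i = r \<and> 1 \<le> r then 1 else 0) u))"

definition index_hom :: "nat \<Rightarrow> free_alg \<Rightarrow> int poly" where
  "index_hom r x = (\<Sum>w\<in>Poly_Mapping.keys x. Poly_Mapping.lookup x w * index_word r w)"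

lemma index_word_add: "index_word r (v + w) = index_word r v * index_word r w"
  by (cases v; cases w) (simp add: index_word_def)

lemma index_hom_superset:
  "finite S \<Longrightarrow> Poly_Mapping.keys x \<subseteq> S \<Longrightarrow>
    index_hom r x = (\<Sum>w\<in>S. Poly_Mapping.lookup x w * index_word r w)"
  unfolding index_hom_def
  by (rule sum.mono_neutral_left) (auto simp: in_keys_iff)

lemma index_hom_single: "index_hom r (Poly_Mapping.single w c) = c * index_word r w"
  by (subst index_hom_superset[of "{w}"]) auto

lemma index_hom_add: "index_hom r (x + y) = index_hom r x + index_hom r y"
proof -
  let ?S = "Poly_Mapping.keys x \<union> Poly_Mapping.keys y"
  have "Poly_Mapping.keys (x + y) \<subseteq> ?S" by (rule keys_add)
  then show ?thesis
    by (simp add: index_hom_superset[of ?S] lookup_add algebra_simps sum.distrib)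
qed

lemma index_hom_0: "index_hom r 0 = 0"
  by (simp add: index_hom_def)

lemma free_alg_induct:
  fixes x :: free_alg
  assumes "\<And>k c. P (Poly_Mapping.single k c)" and "\<And>y z. P y \<Longrightarrow> P z \<Longrightarrow> P (y + z)"
  shows "P x"
proof -
  have "P (\<Sum>k\<in>S. Poly_Mapping.single k (Poly_Mapping.lookup x k))" if "finite S" for S
    using that
  proof induction
    case empty
    show ?case using assms(1)[of 0 0] by simp
  qed (simp add: assms)
  moreover have "x = (\<Sum>k\<in>Poly_Mapping.keys x. Poly_Mapping.single k (Poly_Mapping.lookup x k))"
    by (rule poly_mapping_eqI) (simp add: lookup_sum lookup_single when_def in_keys_iff)
  ultimately show ?thesis using finite_keys by metis
qed

lemma index_hom_mult: "index_hom r (x * y) = index_hom r x * index_hom r y"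
proof (induction x rule: free_alg_induct)
  case (1 k c)
  show ?case
    by (induction y rule: free_alg_induct)
      (simp_all add: mult_single index_hom_single index_word_add distrib_left index_hom_add)
next
  case (2 y z)
  then show ?case by (simp add: distrib_right index_hom_add)
qed

lemma index_hom_letter: "index_hom r (letter i) =
    (if i \<in> {1..<r} then q else if i = r \<and> 1 \<le> r then 1 else 0)"
  by (simp add: letter_def index_hom_single index_word_def)

lemma index_hom_scalar: "index_hom r (scalar c) = c"
  by (simp add: scalar_def index_hom_single index_word_def zero_gword_def)

lemma index_hom_1: "index_hom r 1 = 1"
  using index_hom_scalar[of r 1] by (simp add: scalar_def)

lemma index_hom_cong: "hecke_cong r x y \<Longrightarrow> index_hom r x = index_hom r y"
proof (induction rule: hecke_cong.induct)
  case (base x y)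
  then show ?case
    by cases (auto simp: index_hom_mult index_hom_add index_hom_letter index_hom_scalar
        index_hom_1 index_hom_0 algebra_simps)
qed (auto simp: index_hom_mult index_hom_add)

text \<open>The rank \<open>r\<close> is the cardinality of the type argument.\<close>

quotient_type 'r hecke = free_alg / "hecke_cong CARD('r::finite)"
  by (rule equivp_hecke_cong)

instantiation hecke :: (finite) ring_1
begin

lift_definition zero_hecke :: "'a hecke" is 0 .
lift_definition one_hecke :: "'a hecke" is 1 .
lift_definition plus_hecke :: "'a hecke \<Rightarrow> 'a hecke \<Rightarrow> 'a hecke" is "(+)"
  by (rule hecke_cong.add)
lift_definition times_hecke :: "'a hecke \<Rightarrow> 'a hecke \<Rightarrow> 'a hecke" is "(*)"
  by (rule hecke_cong.mult)
lift_definition uminus_hecke :: "'a hecke \<Rightarrow> 'a hecke" is uminus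
  by (rule hecke_cong_uminus)
lift_definition minus_hecke :: "'a hecke \<Rightarrow> 'a hecke \<Rightarrow> 'a hecke" is "(-)"
  using hecke_cong.add hecke_cong_uminus by (metis add_uminus_conv_diff)

instance
proof
  fix a b c :: "'a hecke"
  show "a + b + c = a + (b + c)" by transfer (simp add: add.assoc hecke_cong.refl)
  show "a + b = b + a" by transfer (simp add: add.commute hecke_cong.refl)
  show "0 + a = a" by transfer (simp add: hecke_cong.refl)
  show "- a + a = 0" by transfer (simp add: hecke_cong.refl)
  show "a - b = a + - b" by transfer (simp add: hecke_cong.refl)
  show "a * b * c = a * (b * c)" by transfer (simp add: mult.assoc hecke_cong.refl)
  show "1 * a = a" by transfer (simp add: hecke_cong.refl)
  show "a * 1 = a" by transfer (simp add: hecke_cong.refl)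
  show "(a + b) * c = a * c + b * c" by transfer (simp add: distrib_right hecke_cong.refl)
  show "a * (b + c) = a * b + a * c" by transfer (simp add: distrib_left hecke_cong.refl)
  show "(0::'a hecke) \<noteq> 1"
    by transfer (use index_hom_cong index_hom_0 index_hom_1 in \<open>metis zero_neq_one\<close>)
qed

end

lift_definition Tgen :: "nat \<Rightarrow> 'r::finite hecke" is letter .

lift_definition hscalar :: "int poly \<Rightarrow> 'r::finite hecke" is scalar .

text \<open>The value does not depend on the reduced expression, by Matsumoto's theorem.\<close>

definition Tw :: "(nat \<Rightarrow> nat) \<Rightarrow> 'r::finite hecke" where
  "Tw w = (THE h. \<exists>is. set is \<subseteq> {1..CARD('r)}
      \<and> compose_list (map (sgen CARD('r)) is) = w
      \<and> length is = wlength (gensB CARD('r)) w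
      \<and> h = prod_list (map Tgen is))"

inductive_set gen_subalgebra :: "'r::finite hecke set \<Rightarrow> 'r hecke set" for G where
  scalar: "hscalar c \<in> gen_subalgebra G"
| gen: "g \<in> G \<Longrightarrow> g \<in> gen_subalgebra G"
| add: "x \<in> gen_subalgebra G \<Longrightarrow> y \<in> gen_subalgebra G \<Longrightarrow> x + y \<in> gen_subalgebra G"
| mult: "x \<in> gen_subalgebra G \<Longrightarrow> y \<in> gen_subalgebra G \<Longrightarrow> x * y \<in> gen_subalgebra G"

definition heckeD :: "'r::finite hecke set" where
  "heckeD = gen_subalgebra (Tgen ` {1..<CARD('r)} \<union> {Tgen CARD('r) * Tgen (CARD('r) - 1) * Tgen CARD('r)})"


section \<open>The q-Schur algebra of type D\<close>

definition xD :: "nat \<Rightarrow> dweight \<Rightarrow> 'r::finite hecke" where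
  "xD n a = (\<Sum>w\<in>WDpar n CARD('r) a. Tw w)"

text \<open>The direct sum of the right modules \<open>xD n a \<cdot> heckeD\<close>, as families supported on the finite
  set \<open>LamD n r\<close>.\<close>

definition permD :: "nat \<Rightarrow> (dweight \<Rightarrow> 'r::finite hecke) set" where
  "permD n = {v. (\<forall>a\<in>LamD n CARD('r). v a \<in> (\<lambda>h. xD n a * h) ` heckeD)
               \<and> (\<forall>a. a \<notin> LamD n CARD('r) \<longrightarrow> v a = 0)}"

definition inj_at :: "dweight \<Rightarrow> 'r::finite hecke \<Rightarrow> dweight \<Rightarrow> 'r hecke" where
  "inj_at a x = (\<lambda>b. if b = a then x else 0)"

text \<open>Endomorphisms are extended by zero outside \<open>permD n\<close>, so that sums, scalar multiples and
  products in the endomorphism algebra are pointwise sums, pointwise scalar multiples and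
  composites of functions. Linearity over \<open>heckeD\<close> includes linearity over \<open>\<int>[q]\<close>, because
  \<open>heckeD\<close> contains the scalars.\<close>

type_synonym 'r endo = "(dweight \<Rightarrow> 'r hecke) \<Rightarrow> (dweight \<Rightarrow> 'r hecke)"

definition schurD :: "nat \<Rightarrow> 'r::finite endo set" where
  "schurD n = {f. (\<forall>v\<in>permD n. f v \<in> permD n)
      \<and> (\<forall>u\<in>permD n. \<forall>v\<in>permD n. f (u + v) = f u + f v)
      \<and> (\<forall>v\<in>permD n. \<forall>h\<in>heckeD. f (\<lambda>a. v a * h) = (\<lambda>a. f v a * h))
      \<and> (\<forall>v. v \<notin> permD n \<longrightarrow> f v = 0)}"

definition endo_scale :: "int poly \<Rightarrow> 'r::finite endo \<Rightarrow> 'r endo"  (infixr "*\<^sub>S" 75) where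
  "c *\<^sub>S f = (\<lambda>v a. hscalar c * f v a)"

definition phiD :: "nat \<Rightarrow> dweight \<Rightarrow> dweight \<Rightarrow> (nat \<Rightarrow> nat) \<Rightarrow> 'r::finite endo" where
  "phiD n a b d = (THE f. f \<in> schurD n \<and>
     (\<forall>c\<in>LamD n CARD('r). \<forall>h\<in>heckeD.
        f (inj_at c (xD n c * h)) =
          (if b = c
           then inj_at a ((\<Sum>w\<in>double_coset (WDpar n CARD('r) a) d (WDpar n CARD('r) b). Tw w) * h)
           else 0)))"

fun phi :: "nat \<Rightarrow> msym \<Rightarrow> 'r::finite endo" where
  "phi n (DotM A) =
     (let r = CARD('r); a = Bul (unhat n r (ro n A)); b = Bul (unhat n r (co n A));
          dA = d_of n r A; x = (if dA \<in> WD r then dA else sgen r r \<circ> dA)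
      in phiD n a b (min_rep (gensD r) (double_coset (WDpar n r a) x (WDpar n r b))))"
| "phi n (SgnM e A e') =
     (let r = CARD('r); a = bracket n (unhat n r (ro n A)) e;
          b = bracket n (unhat n r (co n A)) e';
          x = s_sign r e \<circ> d_of n r A \<circ> s_sign r e'
      in phiD n a b (min_rep (gensD r) (double_coset (WDpar n r a) x (WDpar n r b))))"

end

theory Submission imports Defs "HOL-Library.Sublist" begin

text \<open>
  Each homomorphism \<open>phi n M\<close> is left multiplication by an element \<open>z\<close> of the Hecke algebra, and it is
  determined by the image of the generator, the sum of the basis elements over a double coset
  (\<open>phi_DotM\<close>, \<open>phi_SgnM\<close>). A product of two homomorphisms is therefore computed in the Hecke algebra
  of type B, as a product \<open>z * T\<close> with \<open>z\<close> attached to \<open>C\<close> and \<open>T\<close> the sum over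
  the double coset of \<open>A\<close>.

  The double coset of \<open>C\<close> is that of the identity, and its elements that are sorted on the blocks of
  \<open>mu\<close> are the elements of the stabiliser of the \<open>lam\<close>-blocks that are sorted on the common refinement of the
  two block decompositions (\<open>sortedR_double_coset\<close>); \<open>z\<close> is the sum over them. On the other hand \<open>T\<close> is the product of
  the sum over the stabiliser of this refinement and the sum of all \<open>TW y\<close>, where \<open>y\<close> runs over the
  elements of the double coset of \<open>A\<close> whose inverse is sorted on the refinement.
  Now \<open>z\<close> times the former sum is the sum \<open>X\<close> over the whole stabiliser of the \<open>lam\<close>-blocks, so the product
  is the sum of all \<open>X * TW y\<close>. Each of these terms is \<open>q ^ e\<close> times the sum over the coset of \<open>y\<close>, because \<open>X\<close> absorbs
  every generator with a factor \<open>q\<close>; the exponent \<open>e\<close> is half the number of inversions of \<open>inv y\<close> within the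
  blocks of \<open>lam\<close> (\<open>stabD_TW\<close>).

  The compositions \<open>lam\<close> and \<open>mu\<close> differ in a single position (and its mirror image), which belongs to block \<open>h+1\<close>
  of \<open>lam\<close> and to block \<open>h\<close> of \<open>mu\<close>. Those \<open>y\<close> in the coset of a given \<open>x\<close> whose inverse is sorted therefore correspond
  to the letters \<open>c\<close>
  that \<open>x\<close> puts into row block \<open>h+1\<close>: \<open>c\<close> is the one that \<open>y\<close> puts at this position. If \<open>c\<close> lies in column
  block \<open>p\<close>, then \<open>y\<close> has matrix \<open>A\<close> exactly when \<open>A h p\<close> is positive and \<open>x\<close> has the matrix \<open>shift n h A p\<close>, and \<open>e\<close> counts
  the letters of row block \<open>h+1\<close> to the left of \<open>c\<close>, without the mirror image of \<open>c\<close>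
  (\<open>product_expansion\<close>, \<open>card_block_inversions_move\<close>). Summed over \<open>c\<close> in one column block, the powers \<open>q ^ e\<close>
  form a geometric progression, which is the coefficient \<open>g'\<close>. For \<open>h = n\<close> and \<open>p = n+1\<close> the letters form mirror
  pairs, and the omitted mirror image makes one exponent occur twice, which is the additional summand of \<open>g'\<close> in
  this case (\<open>coefficient_sum\<close>).

  The signs are a matter of parity. The generator \<open>T r\<close> has square one, and multiplication by it from either side
  only permutes the basis, so that type D is the even part of type B. The elements with a given matrix form
  double cosets of type D according to the parity of their sign changes and, if the central entry is zero, the parity of
  the number of letters that cross the centre into the middle row block (\<open>dcoset_sgn\<close>, \<open>dcoset_bul\<close>). For \<open>h = n\<close> the
  letter \<open>c\<close> enters the middle row block, and it crosses the centre if and only if it comes from the right half: this exchanges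
  the signs for \<open>p > n+1\<close>, and for \<open>p = n+1\<close> it selects one letter of the only mirror pair, hence half of the
  coefficient (\<open>coefficient_middle\<close>).

  The basis elements \<open>Tw\<close> are defined through reduced words, so Matsumoto's theorem comes first. Lengths of signed
  permutations are controlled by the folding condition of Tits, which for both types reduces to comparing the
  positions of two letters.
\<close>

section \<open>Groups generated by involutions with a folding condition\<close>

lemma compose_list_Nil [simp]: "compose_list [] = id"
  by (simp add: compose_list_def)

lemma compose_list_Cons [simp]: "compose_list (x # xs) = x \<circ> compose_list xs"
  by (simp add: compose_list_def)

lemma compose_list_append [simp]: "compose_list (xs @ ys) = compose_list xs \<circ> compose_list ys"
  by (induction xs) (auto simp: fun_eq_iff)

definition words :: "('a \<Rightarrow> 'a) set \<Rightarrow> ('a \<Rightarrow> 'a) set" where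
  "words S = compose_list ` {ws. set ws \<subseteq> S}"

lemma words_id [simp]: "id \<in> words S"
  unfolding words_def by (rule image_eqI[of _ _ "[]"]) auto

lemma words_Cons: "s \<in> S \<Longrightarrow> w \<in> words S \<Longrightarrow> s \<circ> w \<in> words S"
  unfolding words_def by (auto intro!: image_eqI[of _ _ "s # _"])

lemma words_comp: "u \<in> words S \<Longrightarrow> v \<in> words S \<Longrightarrow> u \<circ> v \<in> words S"
  unfolding words_def using compose_list_append by (fastforce intro!: image_eqI[of _ _ "_ @ _"])

lemma words_gen: "s \<in> S \<Longrightarrow> s \<in> words S"
  using words_Cons[OF _ words_id, of s S] by simp

lemma words_mono: "I \<subseteq> S \<Longrightarrow> words I \<subseteq> words S"
  unfolding words_def by auto

lemma wlength_le:
  assumes "set ws \<subseteq> S" shows "wlength S (compose_list ws) \<le> length ws"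
  unfolding wlength_def by (rule Least_le) (use assms in auto)

lemma reduced_word:
  assumes "w \<in> words S"
  obtains ws where "set ws \<subseteq> S" "compose_list ws = w" "length ws = wlength S w"
proof -
  have "\<exists>k ws. set ws \<subseteq> S \<and> length ws = k \<and> compose_list ws = w"
    using assms unfolding words_def by auto
  from LeastI_ex[OF this] show ?thesis
    using that unfolding wlength_def by blast
qed

lemma wlength_id [simp]: "wlength S id = 0"
  using wlength_le[of "[]" S] by simp

text \<open>The predicate \<open>desc s w\<close> stands for \<open>wlength S (s \<circ> w) < wlength S w\<close>, and \<open>fold\<close> is the folding
  condition of Tits. It implies the exchange condition, hence that lengths are governed by \<open>desc\<close>; for
  signed permutations \<open>desc\<close> is an inequality between two positions, so lengths never have to be
  computed.\<close>

locale folding_system =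
  fixes S :: "('a \<Rightarrow> 'a) set" and G :: "('a \<Rightarrow> 'a) set"
    and desc :: "('a \<Rightarrow> 'a) \<Rightarrow> ('a \<Rightarrow> 'a) \<Rightarrow> bool"
  assumes invol: "s \<in> S \<Longrightarrow> s \<circ> s = id"
    and id_in: "id \<in> G"
    and left_in: "s \<in> S \<Longrightarrow> w \<in> G \<Longrightarrow> s \<circ> w \<in> G"
    and not_desc_id: "s \<in> S \<Longrightarrow> \<not> desc s id"
    and desc_flip: "s \<in> S \<Longrightarrow> w \<in> G \<Longrightarrow> desc s (s \<circ> w) \<longleftrightarrow> \<not> desc s w"
    and fold: "s \<in> S \<Longrightarrow> t \<in> S \<Longrightarrow> w \<in> G \<Longrightarrow> \<not> desc s w \<Longrightarrow> desc s (w \<circ> t) \<Longrightarrow> s \<circ> w = w \<circ> t"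
begin

lemma gen_cancel: "s \<in> S \<Longrightarrow> s \<circ> (s \<circ> w) = w"
  by (metis comp_assoc id_comp invol)

lemma gen_cancel_right: "s \<in> S \<Longrightarrow> (w \<circ> s) \<circ> s = w"
  by (metis comp_assoc comp_id invol)

lemma compose_list_in: "set ws \<subseteq> S \<Longrightarrow> compose_list ws \<in> G"
  by (induction ws) (auto simp: id_in left_in)

lemma words_in: "words S \<subseteq> G"
  unfolding words_def using compose_list_in by auto

text \<open>The deleted letter is the one at which \<open>s\<close> becomes a descent when the word is read from left to
  right: there the folding condition turns \<open>s\<close> into that letter.\<close>

lemma exchange:
  assumes "set ws \<subseteq> S" "s \<in> S" "desc s (compose_list ws)"
  shows "\<exists>us t vs. ws = us @ t # vs \<and> s \<circ> compose_list ws = compose_list (us @ vs)"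
  using assms
proof (induction ws rule: rev_induct)
  case Nil
  then show ?case using not_desc_id by (metis compose_list_Nil)
next
  case (snoc t ws)
  show ?case
  proof (cases "desc s (compose_list ws)")
    case True
    have "set ws \<subseteq> S" using snoc.prems(1) by simp
    from snoc.IH[OF this snoc.prems(2) True] obtain us t' vs
      where "ws = us @ t' # vs" "s \<circ> compose_list ws = compose_list (us @ vs)" by blast
    then have "ws @ [t] = us @ t' # (vs @ [t])"
      "s \<circ> compose_list (ws @ [t]) = compose_list (us @ (vs @ [t]))"
      by (simp_all add: comp_assoc[symmetric])
    then show ?thesis by blast
  next
    case False
    have d: "desc s (compose_list ws \<circ> t)"
      using snoc.prems(3) by (metis compose_list_append compose_list_Cons compose_list_Nil comp_id)
    have "s \<circ> compose_list ws = compose_list ws \<circ> t"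
      by (rule fold[OF _ _ _ False d]) (use snoc.prems compose_list_in[of ws] in simp_all)
    then have "s \<circ> compose_list (ws @ [t]) = compose_list ws"
      using gen_cancel_right[of t] snoc.prems by (simp add: comp_assoc[symmetric])
    then have "ws @ [t] = ws @ t # []" "s \<circ> compose_list (ws @ [t]) = compose_list (ws @ [])"
      by simp_all
    then show ?thesis by blast
  qed
qed

lemma desc_wlength_less:
  assumes "w \<in> words S" "s \<in> S" "desc s w"
  shows "wlength S (s \<circ> w) < wlength S w"
proof -
  obtain ws where ws: "set ws \<subseteq> S" "compose_list ws = w" "length ws = wlength S w"
    using reduced_word[OF assms(1)] .
  obtain us t vs where e: "ws = us @ t # vs" "s \<circ> w = compose_list (us @ vs)"
    using exchange[of ws s] ws assms by auto
  have "wlength S (s \<circ> w) \<le> length (us @ vs)"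
    unfolding e using ws e by (intro wlength_le) auto
  then show ?thesis using ws e by simp
qed

lemma wlength_gen_le:
  assumes "w \<in> words S" "s \<in> S" shows "wlength S (s \<circ> w) \<le> Suc (wlength S w)"
proof -
  obtain ws where ws: "set ws \<subseteq> S" "compose_list ws = w" "length ws = wlength S w"
    using reduced_word[OF assms(1)] .
  then show ?thesis using wlength_le[of "s # ws" S] assms by simp
qed

lemma wlength_desc:
  assumes "w \<in> words S" "s \<in> S" "desc s w"
  shows "wlength S w = Suc (wlength S (s \<circ> w))"
  using desc_wlength_less[OF assms] wlength_gen_le[of "s \<circ> w" s]
  by (simp add: words_Cons assms gen_cancel)

lemma wlength_not_desc:
  assumes "w \<in> words S" "s \<in> S" "\<not> desc s w"
  shows "wlength S (s \<circ> w) = Suc (wlength S w)"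
  using wlength_desc[of "s \<circ> w" s] assms words_in desc_flip
  by (auto simp: words_Cons gen_cancel)

text \<open>A word that is not reduced has a shortest suffix that is not reduced; the exchange lemma
  deletes a letter from its tail.\<close>

lemma deletion:
  assumes "set ws \<subseteq> S" "wlength S (compose_list ws) < length ws"
  shows "\<exists>ws'. subseq ws' ws \<and> length ws' < length ws \<and> compose_list ws' = compose_list ws"
  using assms
proof (induction ws)
  case Nil
  then show ?case by simp
next
  case (Cons s ws)
  show ?case
  proof (cases "wlength S (compose_list ws) < length ws")
    case True
    then obtain ws' where "subseq ws' ws" "length ws' < length ws"
      "compose_list ws' = compose_list ws" using Cons by auto
    then show ?thesis by (intro exI[of _ "s # ws'"]) auto
  next
    case False
    have w: "compose_list ws \<in> words S" using Cons.prems unfolding words_def by auto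
    have "wlength S (s \<circ> compose_list ws) < Suc (length ws)"
      using Cons.prems(2) by (metis compose_list_Cons length_Cons)
    then have "desc s (compose_list ws)"
      using wlength_not_desc[OF w, of s] Cons.prems(1) False by fastforce
    then obtain us t vs where e: "ws = us @ t # vs"
      "s \<circ> compose_list ws = compose_list (us @ vs)"
      using exchange[of ws s] Cons.prems by auto
    have "subseq (us @ vs) (s # ws)"
      unfolding e by (intro list_emb_Cons list_emb_append_mono) auto
    then show ?thesis using e by (intro exI[of _ "us @ vs"]) auto
  qed
qed

text \<open>Deleting letters from an expression of \<open>u \<circ> d \<circ> v\<close> may not touch a reduced word of the
  shortest element \<open>d\<close> of the double coset, so that lengths add up.\<close>

lemma min_rep_unique:
  assumes IS: "I \<subseteq> S" "J \<subseteq> S" and x: "x \<in> words S"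
    and d: "is_min_rep S (double_coset (words I) x (words J)) d"
    and e: "is_min_rep S (double_coset (words I) x (words J)) e"
  shows "d = e"
proof -
  let ?D = "double_coset (words I) x (words J)"
  have dc: "u \<circ> y \<circ> v \<in> ?D" if y: "y \<in> ?D" and uv: "u \<in> words I" "v \<in> words J" for u y v
  proof -
    obtain a b where "y = a \<circ> x \<circ> b" "a \<in> words I" "b \<in> words J"
      using y unfolding double_coset_def by blast
    then have "u \<circ> y \<circ> v = (u \<circ> a) \<circ> x \<circ> (b \<circ> v)" "u \<circ> a \<in> words I" "b \<circ> v \<in> words J"
      using uv words_comp by (auto simp: comp_assoc)
    then show ?thesis unfolding double_coset_def by blast
  qed
  have inv: "\<exists>u'\<in>words K. u \<circ> u' = id \<and> u' \<circ> u = id" if u: "u \<in> words K" and KS: "K \<subseteq> S" for u K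
  proof -
    obtain ws where "u = compose_list ws" "set ws \<subseteq> K" using u unfolding words_def by blast
    then show ?thesis
    proof (induction ws arbitrary: u)
      case Nil
      then have "u \<circ> id = id" "id \<circ> u = id" by (metis comp_id compose_list_Nil)+
      then show ?case using words_id by blast
    next
      case (Cons s ws)
      have "set ws \<subseteq> K" using Cons.prems(2) by simp
      then obtain u' where u': "u' \<in> words K" "compose_list ws \<circ> u' = id"
        "u' \<circ> compose_list ws = id"
        using Cons.IH[OF HOL.refl] by blast
      have s: "s \<in> K" "s \<circ> s = id" using Cons.prems KS invol by auto
      have "u' \<circ> s \<in> words K" using u' s words_comp words_gen by blast
      moreover have "u \<circ> (u' \<circ> s) = id" "(u' \<circ> s) \<circ> u = id"
        using u' s Cons.prems(1) by (metis comp_assoc comp_id compose_list_Cons)+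
      ultimately show ?case by blast
    qed
  qed
  have dD: "d \<in> ?D" "\<And>y. y \<in> ?D \<Longrightarrow> wlength S d \<le> wlength S y"
    and eD: "e \<in> ?D" "\<And>y. y \<in> ?D \<Longrightarrow> wlength S e \<le> wlength S y"
    using d e unfolding is_min_rep_def by auto
  have Dw: "?D \<subseteq> words S"
  proof
    fix y assume "y \<in> ?D"
    then obtain a b where "y = a \<circ> x \<circ> b" "a \<in> words I" "b \<in> words J"
      unfolding double_coset_def by blast
    moreover then have "a \<in> words S" "b \<in> words S" using IS words_mono by blast+
    ultimately show "y \<in> words S" using x words_comp by metis
  qed
  obtain ds where ds: "set ds \<subseteq> S" "compose_list ds = d" "length ds = wlength S d"
    using reduced_word[of d S] Dw dD(1) by blast
  let ?P = "\<lambda>k. \<exists>us vs. set us \<subseteq> I \<and> set vs \<subseteq> J \<and> length us + length vs = k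
                \<and> e = compose_list (us @ ds @ vs)"
  have "\<exists>k. ?P k"
  proof -
    obtain a b where ab: "d = a \<circ> x \<circ> b" "a \<in> words I" "b \<in> words J"
      using dD unfolding double_coset_def by blast
    obtain a1 b1 where ab1: "e = a1 \<circ> x \<circ> b1" "a1 \<in> words I" "b1 \<in> words J"
      using eD unfolding double_coset_def by blast
    obtain a' b' where i: "a' \<in> words I" "a' \<circ> a = id" "b' \<in> words J" "b \<circ> b' = id"
      using inv[OF ab(2) IS(1)] inv[OF ab(3) IS(2)] by blast
    have "(a1 \<circ> a') \<circ> d \<circ> (b' \<circ> b1) = a1 \<circ> (a' \<circ> a) \<circ> x \<circ> (b \<circ> b') \<circ> b1"
      unfolding ab by (simp only: comp_assoc)
    then have e: "e = (a1 \<circ> a') \<circ> d \<circ> (b' \<circ> b1)" using i ab1 by simp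
    have "a1 \<circ> a' \<in> words I" "b' \<circ> b1 \<in> words J" using words_comp i ab1 by auto
    then obtain us vs where "set us \<subseteq> I" "set vs \<subseteq> J" "compose_list us = a1 \<circ> a'"
      "compose_list vs = b' \<circ> b1" unfolding words_def by (metis (mono_tags) image_iff mem_Collect_eq)
    moreover then have "e = compose_list (us @ ds @ vs)" using e ds(2) by (simp add: comp_assoc)
    ultimately show ?thesis by blast
  qed
  then obtain k where k: "?P k" "\<And>j. ?P j \<Longrightarrow> k \<le> j"
    using LeastI_ex[of ?P] Least_le[of ?P] by blast
  then obtain us vs where uv: "set us \<subseteq> I" "set vs \<subseteq> J" "length us + length vs = k"
    "e = compose_list (us @ ds @ vs)" by auto
  have "\<not> wlength S (compose_list (us @ ds @ vs)) < length (us @ ds @ vs)"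
  proof
    assume less: "wlength S (compose_list (us @ ds @ vs)) < length (us @ ds @ vs)"
    have "set (us @ ds @ vs) \<subseteq> S" using uv ds IS by auto
    from deletion[OF this less] obtain ws where ws: "subseq ws (us @ ds @ vs)"
      "length ws < length (us @ ds @ vs)" "compose_list ws = e" using uv(4) by metis
    obtain us' ds' vs' where sub: "ws = us' @ ds' @ vs'"
      "subseq us' us" "subseq ds' ds" "subseq vs' vs"
      using ws(1) by (metis subseq_append_iff)
    have sets: "set us' \<subseteq> I" "set vs' \<subseteq> J" "set ds' \<subseteq> S"
      using sub uv ds by (fastforce elim: list_emb_set)+
    have wI: "compose_list us' \<in> words I" and wJ: "compose_list vs' \<in> words J"
      using sets unfolding words_def by auto
    obtain u' v' where i: "u' \<in> words I" "u' \<circ> compose_list us' = id"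
      "v' \<in> words J" "compose_list vs' \<circ> v' = id"
      using inv[OF wI IS(1)] inv[OF wJ IS(2)] by blast
    have "u' \<circ> e \<circ> v' = (u' \<circ> compose_list us') \<circ> compose_list ds' \<circ> (compose_list vs' \<circ> v')"
      by (simp add: ws(3)[symmetric] sub(1) comp_assoc)
    then have "compose_list ds' = u' \<circ> e \<circ> v'" using i by simp
    then have "compose_list ds' \<in> ?D" using dc eD i by simp
    then have "length ds \<le> length ds'" using dD(2) wlength_le[OF sets(3)] ds by fastforce
    then have "ds' = ds" using sub list_emb_length subseq_same_length by (metis le_antisym)
    then have "?P (length us' + length vs')" using ws sub sets by blast
    then have "k \<le> length us' + length vs'" using k by blast
    then show False using ws(2) sub uv \<open>ds' = ds\<close> by simp
  qed
  then have "length us + length ds + length vs \<le> wlength S e" using uv by simp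
  also have "wlength S e \<le> wlength S d" using eD dD by blast
  finally have "us = []" "vs = []" using ds by auto
  then show ?thesis using uv ds by simp
qed

end

section \<open>Signed permutations\<close>

lemma involution_permutes:
  assumes "p \<circ> p = id" "\<And>x. x \<notin> A \<Longrightarrow> p x = x"
  shows "p permutes A"
  unfolding permutes_def using assms by (metis comp_apply id_apply)

text \<open>For \<open>b = 2*r+1-a\<close> the second transposition agrees with the first one, and the reflection is a sign change.\<close>

definition reflection :: "nat \<Rightarrow> nat \<Rightarrow> nat \<Rightarrow> nat \<Rightarrow> nat" where
  "reflection r a b x = (if x = a then b else if x = b then a
     else if x = 2*r+1-a then 2*r+1-b else if x = 2*r+1-b then 2*r+1-a else x)"

text \<open>All generators of type D are numbered by \<open>{1..r}\<close>, the last one being the conjugate of \<open>sgen r (r-1)\<close>.\<close>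

definition dgen :: "nat \<Rightarrow> nat \<Rightarrow> nat \<Rightarrow> nat" where
  "dgen r i = (if i < r then sgen r i else sgen r r \<circ> sgen r (r-1) \<circ> sgen r r)"

text \<open>The generator \<open>dgen r i\<close> is the reflection that interchanges \<open>dgen_lo r i\<close> and \<open>dgen_hi r i\<close>.\<close>

definition dgen_lo :: "nat \<Rightarrow> nat \<Rightarrow> nat" where "dgen_lo r i = (if i < r then i else r - 1)"
definition dgen_hi :: "nat \<Rightarrow> nat \<Rightarrow> nat" where "dgen_hi r i = (if i < r then i + 1 else r + 1)"

definition flips :: "nat \<Rightarrow> nat set \<Rightarrow> (nat \<Rightarrow> nat) \<Rightarrow> nat" where
  "flips r M v = card {i \<in> M. i \<le> r \<and> v i > r}"

text \<open>A generator of either type is a reflection \<open>reflection r a b\<close> with \<open>a < b\<close> and \<open>a + b \<le> 2*r+1\<close>, and \<open>low\<close>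
  recovers \<open>a\<close> from it (\<open>low_reflection\<close>). This permits one notion of descent for both types.\<close>

definition low :: "(nat \<Rightarrow> nat) \<Rightarrow> nat" where
  "low s = (LEAST a. s a \<noteq> a)"

text \<open>A reflection shortens \<open>w\<close> from the left if and only if the two values that it exchanges appear in the wrong order.\<close>

definition left_desc :: "(nat \<Rightarrow> nat) \<Rightarrow> (nat \<Rightarrow> nat) \<Rightarrow> bool" where
  "left_desc s w \<longleftrightarrow> inv w (s (low s)) < inv w (low s)"

lemma WB_id [simp]: "id \<in> WB r"
  by (auto simp: WB_def permutes_id)

lemma WB_permutes: "w \<in> WB r \<Longrightarrow> w permutes {1..2*r}"
  by (simp add: WB_def)

lemma WB_range: "w \<in> WB r \<Longrightarrow> i \<in> {1..2*r} \<Longrightarrow> w i \<in> {1..2*r}"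
  using permutes_in_image[OF WB_permutes] by blast

lemma WB_outside: "w \<in> WB r \<Longrightarrow> i \<notin> {1..2*r} \<Longrightarrow> w i = i"
  using WB_permutes permutes_not_in by metis

lemma WB_mirror: "w \<in> WB r \<Longrightarrow> i \<in> {1..2*r} \<Longrightarrow> w (2*r+1-i) = 2*r+1 - w i"
  unfolding WB_def by (metis (mono_tags, lifting) add_diff_cancel_left' mem_Collect_eq)

lemma WB_inj: "w \<in> WB r \<Longrightarrow> w x = w y \<longleftrightarrow> x = y"
  using permutes_inj[OF WB_permutes] by (metis injD)

lemma WB_inv_apply [simp]: "w \<in> WB r \<Longrightarrow> inv w (w x) = x" "w \<in> WB r \<Longrightarrow> w (inv w x) = x"
  using permutes_inverses[OF WB_permutes] by auto

lemma WB_inv_comp [simp]: "w \<in> WB r \<Longrightarrow> inv w \<circ> w = id" "w \<in> WB r \<Longrightarrow> w \<circ> inv w = id"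
  by (auto simp: fun_eq_iff)

lemma WB_sum: "w \<in> WB r \<Longrightarrow> i \<in> {1..2*r} \<Longrightarrow> w i + w (2*r+1-i) = 2*r+1"
  by (simp add: WB_def)

lemma WB_comp [intro]:
  assumes "u \<in> WB r" "v \<in> WB r" shows "u \<circ> v \<in> WB r"
proof -
  have "(u \<circ> v) i + (u \<circ> v) (2*r+1-i) = 2*r+1" if "i \<in> {1..2*r}" for i
    using WB_sum[OF assms(1) WB_range[OF assms(2) that]] WB_mirror[OF assms(2) that] by simp
  then show ?thesis
    using permutes_compose[OF WB_permutes[OF assms(2)] WB_permutes[OF assms(1)]] by (simp add: WB_def)
qed

lemma WB_inv [intro]:
  assumes "u \<in> WB r" shows "inv u \<in> WB r"
proof -
  have "inv u i + inv u (2*r+1-i) = 2*r+1" if "i \<in> {1..2*r}" for i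
  proof -
    have p: "inv u permutes {1..2*r}" by (rule permutes_inv[OF WB_permutes[OF assms]])
    then have j: "inv u i \<in> {1..2*r}" using that permutes_in_image[OF p] by blast
    have "u (2*r+1 - inv u i) = 2*r+1-i" using WB_mirror[OF assms j] assms by simp
    then have "inv u (2*r+1-i) = 2*r+1 - inv u i" using assms by (metis WB_inv_apply(1))
    then show ?thesis using j by simp
  qed
  then show ?thesis using WB_permutes[OF assms] permutes_inv by (simp add: WB_def)
qed

lemma WB_inv_inv [simp]: "w \<in> WB r \<Longrightarrow> inv (inv w) = w"
  using inv_inv_eq permutes_bij[OF WB_permutes] by blast

lemma WB_inv_distrib: "u \<in> WB r \<Longrightarrow> v \<in> WB r \<Longrightarrow> inv (u \<circ> v) = inv v \<circ> inv u"
  using o_inv_distrib permutes_bij[OF WB_permutes] by blast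

lemma WB_cancel [simp]:
  "w \<in> WB r \<Longrightarrow> inv w \<circ> (w \<circ> x) = x" "w \<in> WB r \<Longrightarrow> w \<circ> (inv w \<circ> x) = x"
  "w \<in> WB r \<Longrightarrow> (x \<circ> w) \<circ> inv w = x" "w \<in> WB r \<Longrightarrow> (x \<circ> inv w) \<circ> w = x"
  by (auto simp: fun_eq_iff)

lemma finite_WB [simp]: "finite (WB r)"
  by (rule finite_subset[OF _ finite_permutations[of "{1..2*r}"]]) (auto simp: WB_def)

lemma WD_WB: "w \<in> WD r \<Longrightarrow> w \<in> WB r"
  by (simp add: WD_def)

lemma mirror_neq: "2*r+1-a \<noteq> (a::nat)"
  by presburger

lemma mirror_range: "i \<in> {1..2*r} \<Longrightarrow> 2*r+1-i \<in> {1..2*r::nat}"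
  by auto

lemma reflection_commute: "a \<in> {1..2*r} \<Longrightarrow> b \<in> {1..2*r} \<Longrightarrow> reflection r a b = reflection r b a"
  by (auto simp: reflection_def fun_eq_iff)

lemma reflection_mirror:
  "a \<in> {1..2*r} \<Longrightarrow> b \<in> {1..2*r} \<Longrightarrow> a \<noteq> b \<Longrightarrow> reflection r (2*r+1-a) (2*r+1-b) = reflection r a b"
  using mirror_neq[of r a] mirror_neq[of r b] by (auto simp: reflection_def fun_eq_iff)

lemma reflection_invol:
  assumes "a \<in> {1..2*r}" "b \<in> {1..2*r}" "a \<noteq> b"
  shows "reflection r a b \<circ> reflection r a b = id"
  using assms mirror_neq[of r a] mirror_neq[of r b] by (auto simp: reflection_def fun_eq_iff)

lemma reflection_WB:
  assumes "a \<in> {1..2*r}" "b \<in> {1..2*r}" "a \<noteq> b"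
  shows "reflection r a b \<in> WB r"
proof -
  have "reflection r a b permutes {1..2*r}"
    by (rule involution_permutes[OF reflection_invol[OF assms]]) (use assms in \<open>auto simp: reflection_def\<close>)
  moreover have "reflection r a b i + reflection r a b (2*r+1-i) = 2*r+1" if i: "i \<in> {1..2*r}" for i
  proof -
    have e: "2*r+1-i = a \<longleftrightarrow> i = 2*r+1-a" "2*r+1-i = b \<longleftrightarrow> i = 2*r+1-b"
      "2*r+1-i = 2*r+1-a \<longleftrightarrow> i = a" "2*r+1-i = 2*r+1-b \<longleftrightarrow> i = b"
      using assms i by auto
    consider "i = a" | "i = b" | "i = 2*r+1-a" "i \<noteq> b" "i \<noteq> a" | "i = 2*r+1-b" "i \<noteq> a" "i \<noteq> b"
      | "i \<noteq> a" "i \<noteq> b" "i \<noteq> 2*r+1-a" "i \<noteq> 2*r+1-b" by blast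
    then show ?thesis
      unfolding reflection_def e
      by cases (use assms i mirror_neq[of r a] mirror_neq[of r b] in \<open>simp_all, arith?\<close>)
  qed
  ultimately show ?thesis by (simp add: WB_def)
qed

lemma reflection_conj:
  assumes "w \<in> WB r" "x \<in> {1..2*r}" "y \<in> {1..2*r}"
  shows "reflection r (w x) (w y) \<circ> w = w \<circ> reflection r x y"
proof -
  have "2*r+1 - w x = w (2*r+1-x)" "2*r+1 - w y = w (2*r+1-y)"
    using WB_mirror assms by auto
  then show ?thesis by (auto simp: fun_eq_iff reflection_def WB_inj[OF assms(1)])
qed

text \<open>Mirror images are flipped together, so the letters \<open>u i\<close> may be reflected into the lower half before
  \<open>v\<close> is applied; a letter is then flipped by \<open>v \<circ> u\<close> if and only if exactly one of the two steps flips it.\<close>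

lemma flips_comp:
  assumes M: "M \<subseteq> {1..2*r}" "\<And>i. i \<in> M \<Longrightarrow> 2*r+1-i \<in> M" and u: "u \<in> WB r" and v: "v \<in> WB r"
  shows "even (flips r M (v \<circ> u)) \<longleftrightarrow> (even (flips r M u) \<longleftrightarrow> even (flips r (u ` M) v))"
proof -
  define M' where "M' = {i\<in>M. i \<le> r}"
  define a where "a = (\<lambda>i. if u i \<le> r then u i else 2*r+1 - u i)"
  have fin: "finite M'" unfolding M'_def using M(1) finite_subset by fastforce
  have rng: "u i \<in> {1..2*r}" if "i \<in> M'" for i using that M u WB_range unfolding M'_def by blast
  have mir: "u (2*r+1-i) = 2*r+1 - u i" if "i \<in> M'" for i
    using that M(1) WB_mirror[OF u] unfolding M'_def by blast
  have v_a: "v (u i) > r \<longleftrightarrow> (u i > r) \<noteq> (v (a i) > r)" if "i \<in> M'" for i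
    using WB_sum[OF v rng[OF that]] WB_mirror[OF v rng[OF that]] unfolding a_def by auto
  have inj: "inj_on a M'"
  proof (rule inj_onI)
    fix i j assume ij: "i \<in> M'" "j \<in> M'" "a i = a j"
    have le: "i \<le> r" "j \<le> r" using ij M'_def by auto
    consider "u i = u j" | "u i = 2*r+1 - u j"
      using ij rng[OF ij(1)] rng[OF ij(2)] unfolding a_def by (auto split: if_splits)
    then show "i = j"
    proof cases
      case 1
      then show ?thesis using WB_inj[OF u] by blast
    next
      case 2
      then have "i = 2*r+1-j" using mir[OF ij(2)] WB_inj[OF u] by metis
      then show ?thesis using le by simp
    qed
  qed
  have img: "a ` M' = {j \<in> u ` M. j \<le> r}"
  proof (intro equalityI subsetI)
    fix j assume "j \<in> a ` M'"
    then obtain i where i: "i \<in> M'" "j = a i" by auto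
    have "i \<in> M" "2*r+1-i \<in> M" using i M unfolding M'_def by auto
    then show "j \<in> {j \<in> u ` M. j \<le> r}"
      using i mir[OF i(1)] rng[OF i(1)] unfolding a_def
      by (auto split: if_splits) (metis image_eqI)
  next
    fix j assume "j \<in> {j \<in> u ` M. j \<le> r}"
    then obtain i where i: "i \<in> M" "j = u i" "j \<le> r" by auto
    show "j \<in> a ` M'"
    proof (cases "i \<le> r")
      case True
      then show ?thesis using i unfolding a_def M'_def by auto
    next
      case False
      have "i \<in> {1..2*r}" using i M by auto
      then have k: "2*r+1-i \<in> M'" "u (2*r+1-i) = 2*r+1-j" "j \<in> {1..2*r}"
        using i M False WB_mirror[OF u] WB_range[OF u] unfolding M'_def by auto
      then have "a (2*r+1-i) = j" using i unfolding a_def by auto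
      then show ?thesis using k by blast
    qed
  qed
  define X where "X = {i\<in>M'. u i > r}"
  define Y where "Y = {i\<in>M'. v (a i) > r}"
  have fXY: "finite X" "finite Y" unfolding X_def Y_def using fin by auto
  have "{i \<in> M. i \<le> r \<and> (v \<circ> u) i > r} = (X - Y) \<union> (Y - X)"
    unfolding X_def Y_def using v_a by (auto simp: M'_def)
  then have "flips r M (v \<circ> u) = card (X - Y) + card (Y - X)"
    unfolding flips_def using fXY by (simp add: card_Un_disjoint Diff_disjoint Int_Diff)
      (subst card_Un_disjoint, auto)
  moreover have "card X = card (X - Y) + card (X \<inter> Y)" "card Y = card (Y - X) + card (X \<inter> Y)"
    using fXY card_Diff_subset_Int[of X Y] card_Diff_subset_Int[of Y X]
      card_mono[of X "X \<inter> Y"] card_mono[of Y "X \<inter> Y"] by (auto simp: Int_commute)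
  moreover have "card X = flips r M u"
    unfolding X_def flips_def M'_def by (rule arg_cong[of _ _ card]) auto
  moreover have "card Y = flips r (u ` M) v"
  proof -
    have "a ` Y = {j \<in> a ` M'. v j > r}" unfolding Y_def by auto
    then have "a ` Y = {j \<in> u ` M. j \<le> r \<and> v j > r}" unfolding img by simp
    moreover have "card (a ` Y) = card Y"
      using inj card_image inj_on_subset unfolding Y_def by (metis (no_types, lifting) mem_Collect_eq subsetI)
    ultimately show ?thesis unfolding flips_def by simp
  qed
  ultimately show ?thesis by (auto simp: even_add)
qed

lemma WD_iff_flips: "w \<in> WD r \<longleftrightarrow> w \<in> WB r \<and> even (flips r {1..2*r} w)"
proof -
  have "{i \<in> {1..2*r}. i \<le> r \<and> w i > r} = {i\<in>{1..r}. w i > r}" by auto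
  then show ?thesis by (simp add: WD_def flips_def)
qed

lemma WD_comp_iff:
  assumes "u \<in> WB r" "v \<in> WB r" shows "u \<circ> v \<in> WD r \<longleftrightarrow> (u \<in> WD r \<longleftrightarrow> v \<in> WD r)"
proof -
  have "v ` {1..2*r} = {1..2*r}" using WB_permutes[OF assms(2)] permutes_image by blast
  then have "even (flips r {1..2*r} (u \<circ> v)) \<longleftrightarrow>
      (even (flips r {1..2*r} v) \<longleftrightarrow> even (flips r {1..2*r} u))"
    using flips_comp[OF subset_refl mirror_range assms(2,1)] by simp
  then show ?thesis using WD_iff_flips[of _ r] assms WB_comp[OF assms] by metis
qed

lemma WD_id [simp]: "id \<in> WD r"
proof -
  have e: "{i\<in>{1..r}. id i > r} = {}" by auto
  show ?thesis unfolding WD_def mem_Collect_eq e by simp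
qed

lemma WD_comp:
  assumes "u \<in> WD r" "v \<in> WD r" shows "u \<circ> v \<in> WD r"
  using WD_comp_iff[OF WD_WB[OF assms(1)] WD_WB[OF assms(2)]] assms by simp

lemma WD_inv_iff:
  assumes "w \<in> WB r" shows "inv w \<in> WD r \<longleftrightarrow> w \<in> WD r"
  using WD_comp_iff[OF assms WB_inv[OF assms]] assms by (simp only: WB_inv_comp WD_id simp_thms)

section \<open>The generators of types B and D\<close>

text \<open>The letter \<open>2*r-i\<close> gets a name of its own, so that the case distinctions below are free of subtraction.\<close>

lemma sgen_eval_aux:
  assumes "i \<in> {1..<r}"
  obtains a where "2*r-i = a" "2*r+1-i = Suc a" "Suc i < a" "2*r+1 - Suc i = a" "2*r+1 - Suc a = i"
    "2*r+1 - a = Suc i"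
proof -
  have "2*r+1-i = Suc (2*r-i)" "Suc i < 2*r-i" "2*r+1 - Suc i = 2*r-i" "2*r+1 - Suc (2*r-i) = i"
    "2*r+1 - (2*r-i) = Suc i" using assms by auto
  then show ?thesis using that by blast
qed

lemma sgen_eval:
  assumes "i \<in> {1..<r}"
  shows "sgen r i x = (if x = i then i+1 else if x = i+1 then i
     else if x = 2*r+1-i then 2*r-i else if x = 2*r-i then 2*r+1-i else x)"
proof -
  obtain a where a: "2*r-i = a" "2*r+1-i = Suc a" "Suc i < a" using sgen_eval_aux[OF assms] .
  show ?thesis using assms a(3) unfolding sgen_def transpose_def a by simp
qed

lemma sgen_r_eval: "sgen r r x = (if x = r then r+1 else if x = r+1 then r else x)"
  by (simp add: sgen_def transpose_def)

lemma sgen_reflection: "i \<in> {1..r} \<Longrightarrow> sgen r i = reflection r i (i+1)"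
proof (rule ext)
  fix x assume i: "i \<in> {1..r}"
  show "sgen r i x = reflection r i (i+1) x"
  proof (cases "i < r")
    case True
    then have "2*r+1-(i+1) = 2*r-i" "1 \<le> i" using i by auto
    then show ?thesis unfolding reflection_def using sgen_eval[of i r x] True by simp
  next
    case False
    then have "i = r" using i by simp
    then show ?thesis by (simp add: sgen_def transpose_def reflection_def)
  qed
qed

lemma reflection_apply [simp]: "reflection r a b a = b" "reflection r a b b = a"
  by (auto simp: reflection_def)

lemma low_reflection:
  assumes "1 \<le> a" "a < b" "a + b \<le> 2*r+1"
  shows "low (reflection r a b) = a"
  unfolding low_def
proof (rule Least_equality)
  show "reflection r a b a \<noteq> a" using assms by simp
  fix y assume "reflection r a b y \<noteq> y"
  then have "y = a \<or> y = b \<or> y = 2*r+1-a \<or> y = 2*r+1-b" by (auto simp: reflection_def split: if_splits)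
  then show "a \<le> y" using assms by auto
qed

text \<open>The folding condition compares the order of two letters before and after a generator. A generator reverses only
  the pair that it exchanges and the mirror image of this pair.\<close>

lemma sgen_inversion:
  assumes i: "i \<in> {1..r}" and "x < y" "sgen r i y < sgen r i x"
  shows "x = i \<and> y = i+1 \<or> x = 2*r-i \<and> y = 2*r+1-i"
proof (cases "i < r")
  case True
  then have i': "i \<in> {1..<r}" using i by simp
  obtain a where a: "2*r-i = a" "2*r+1-i = Suc a" "Suc i < a" using sgen_eval_aux[OF i'] .
  show ?thesis using assms(2,3) a(3) unfolding sgen_eval[OF i'] a by (auto split: if_splits)
next
  case False
  then have "i = r" using i by simp
  then show ?thesis using assms(2,3) by (auto simp: sgen_r_eval split: if_splits)
qed

locale rank =
  fixes r :: nat
  assumes r2: "2 \<le> r"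
begin

lemma dgen_last: "dgen r r = reflection r (r-1) (r+1)"
proof
  fix x
  obtain k where k: "r = k + 2" using r2 by (metis add.commute le_Suc_ex)
  have a: "sgen r r x = (if x = k+2 then k+3 else if x = k+3 then k+2 else x)" for x
    by (simp add: sgen_def transpose_def k)
  have b: "sgen r (r-1) x = (if x = k+1 then k+2 else if x = k+2 then k+1
    else if x = k+4 then k+3 else if x = k+3 then k+4 else x)" for x
    using sgen_eval[of "r-1" r x] r2 by (simp add: k)
  have c: "reflection r (r-1) (r+1) x = (if x = k+1 then k+3 else if x = k+3 then k+1
    else if x = k+4 then k+2 else if x = k+2 then k+4 else x)"
    by (simp add: reflection_def k)
  have d: "dgen r r x = sgen r r (sgen r (r-1) (sgen r r x))" by (simp add: dgen_def)
  show "dgen r r x = reflection r (r-1) (r+1) x" unfolding c d a b by simp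
qed

lemma dgen_reflection: "i \<in> {1..r} \<Longrightarrow> dgen r i = reflection r (dgen_lo r i) (dgen_hi r i)"
  using dgen_last sgen_reflection[of i r] by (cases "i < r") (auto simp: dgen_def dgen_lo_def dgen_hi_def)

text \<open>The last generator of type D also reverses the two mirror pairs that it moves. Such pairs are excluded here, as no
  generator of type D exchanges the members of a mirror pair.\<close>

lemma dgen_last_inversion:
  assumes "x < y" "dgen r r y < dgen r r x" "x + y \<noteq> 2*r+1"
  shows "x = r-1 \<and> y = r+1 \<or> x = r \<and> y = r+2"
proof -
  obtain k where k: "r = k + 2" using r2 by (metis add.commute le_Suc_ex)
  have c: "dgen r r x = (if x = k+1 then k+3 else if x = k+3 then k+1
    else if x = k+4 then k+2 else if x = k+2 then k+4 else x)" for x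
    unfolding dgen_last by (simp add: reflection_def k)
  have 3: "x + y \<noteq> 2*k+5" using assms(3) k by simp
  have "x = k+1 \<and> y = k+3 \<or> x = k+2 \<and> y = k+4"
    using assms(1,2) 3 unfolding c by (simp split: if_splits)
  moreover have "r - 1 = k+1" "r + 1 = k+3" "r + 2 = k+4" using k by simp_all
  ultimately show ?thesis using k by metis
qed

lemma d_range: "i \<in> {1..r} \<Longrightarrow> dgen_lo r i \<in> {1..2*r}" "i \<in> {1..r} \<Longrightarrow> dgen_hi r i \<in> {1..2*r}"
  "dgen_lo r i < dgen_hi r i" "i \<in> {1..r} \<Longrightarrow> dgen_lo r i + dgen_hi r i \<noteq> 2*r+1"
  using r2 by (auto simp: dgen_lo_def dgen_hi_def)

lemma sgen_WB: "i \<in> {1..r} \<Longrightarrow> sgen r i \<in> WB r"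
  using reflection_WB[of i r "i+1"] sgen_reflection by auto

lemma dgen_WB: "i \<in> {1..r} \<Longrightarrow> dgen r i \<in> WB r"
  using reflection_WB[of "dgen_lo r i" r "dgen_hi r i"] d_range[of i] dgen_reflection by auto

lemma sgen_invol [simp]: "i \<in> {1..r} \<Longrightarrow> sgen r i \<circ> sgen r i = id"
  using reflection_invol[of i r "i+1"] sgen_reflection by auto

lemma dgen_invol [simp]: "i \<in> {1..r} \<Longrightarrow> dgen r i \<circ> dgen r i = id"
  using reflection_invol[of "dgen_lo r i" r "dgen_hi r i"] d_range[of i] dgen_reflection by auto

lemma sgen_inv: "i \<in> {1..r} \<Longrightarrow> inv (sgen r i) = sgen r i"
  by (simp add: inv_unique_comp)

lemma dgen_inv: "i \<in> {1..r} \<Longrightarrow> inv (dgen r i) = dgen r i"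
  by (simp add: inv_unique_comp)

lemma sgen_cancel [simp]: "i \<in> {1..r} \<Longrightarrow> sgen r i \<circ> (sgen r i \<circ> w) = w"
  "i \<in> {1..r} \<Longrightarrow> (w \<circ> sgen r i) \<circ> sgen r i = w"
  by (metis comp_assoc id_comp sgen_invol) (metis comp_assoc comp_id sgen_invol)

lemma dgen_cancel [simp]: "i \<in> {1..r} \<Longrightarrow> dgen r i \<circ> (dgen r i \<circ> w) = w"
  "i \<in> {1..r} \<Longrightarrow> (w \<circ> dgen r i) \<circ> dgen r i = w"
  by (metis comp_assoc id_comp dgen_invol) (metis comp_assoc comp_id dgen_invol)

lemma gensD_dgen: "gensD r = dgen r ` {1..r}"
proof -
  have "{1..r} = insert r {1..<r}" using r2 by auto
  then show ?thesis unfolding gensD_def dgen_def by auto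
qed

lemma sgen_lt_WD: "i \<in> {1..<r} \<Longrightarrow> sgen r i \<in> WD r"
proof -
  assume i: "i \<in> {1..<r}"
  then have "{j\<in>{1..r}. sgen r i j > r} = {}"
    by (auto simp: sgen_eval)
  then show ?thesis using i sgen_WB[of i] unfolding WD_def by (simp del: Collect_empty_eq)
qed

lemma sgen_r_notWD: "sgen r r \<notin> WD r"
proof -
  have "{j\<in>{1..r}. sgen r r j > r} = {r}"
    using r2 by (auto simp: sgen_r_eval split: if_splits)
  then show ?thesis unfolding WD_def by simp
qed

lemma dgen_WD: "i \<in> {1..r} \<Longrightarrow> dgen r i \<in> WD r"
proof (cases "i < r")
  case True
  moreover assume "i \<in> {1..r}"
  ultimately show ?thesis using sgen_lt_WD by (simp add: dgen_def)
next
  case False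
  have "sgen r r \<in> WB r" "sgen r (r-1) \<in> WD r" using r2 sgen_WB sgen_lt_WD by auto
  then show ?thesis using False sgen_r_notWD WD_comp_iff WD_WB WB_comp
    by (simp add: dgen_def)
qed

lemma sr_comp_WD: "w \<in> WB r \<Longrightarrow> sgen r r \<circ> w \<in> WD r \<longleftrightarrow> w \<notin> WD r"
  "w \<in> WB r \<Longrightarrow> w \<circ> sgen r r \<in> WD r \<longleftrightarrow> w \<notin> WD r"
  using WD_comp_iff sgen_WB[of r] sgen_r_notWD r2 by auto

lemma low_sgen: "i \<in> {1..r} \<Longrightarrow> low (sgen r i) = i"
  using low_reflection[of i "i+1" r] by (simp add: sgen_reflection)

lemma low_dgen: "i \<in> {1..r} \<Longrightarrow> low (dgen r i) = dgen_lo r i"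
  using low_reflection[of "dgen_lo r i" "dgen_hi r i" r] r2 d_range(3)[of i]
  by (simp add: dgen_reflection) (auto simp add: dgen_lo_def dgen_hi_def split: if_splits)

lemma left_desc_sgen: "i \<in> {1..r} \<Longrightarrow> left_desc (sgen r i) w \<longleftrightarrow> inv w (i+1) < inv w i"
  by (simp add: left_desc_def low_sgen) (simp add: sgen_reflection)

lemma left_desc_dgen: "i \<in> {1..r} \<Longrightarrow> left_desc (dgen r i) w \<longleftrightarrow> inv w (dgen_hi r i) < inv w (dgen_lo r i)"
  by (simp add: left_desc_def low_dgen) (simp add: dgen_reflection)

lemma folding_B: "folding_system (gensB r) (WB r) left_desc"
proof
  fix s assume s: "s \<in> gensB r"
  then obtain i where i: "i \<in> {1..r}" "s = sgen r i" unfolding gensB_def by auto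
  show "s \<circ> s = id" using i by simp
  show "\<not> left_desc s id" using i by (simp add: left_desc_sgen)
  fix w assume w: "w \<in> WB r"
  show "s \<circ> w \<in> WB r" using i w sgen_WB WB_comp by simp
  show "left_desc s (s \<circ> w) \<longleftrightarrow> \<not> left_desc s w"
  proof -
    have "inv w (i+1) \<noteq> inv w i" using WB_inj[OF WB_inv[OF w]] by simp
    moreover have "sgen r i i = i+1" "sgen r i (i+1) = i" using i by (auto simp: sgen_reflection)
    moreover have "inv (s \<circ> w) = inv w \<circ> sgen r i"
      unfolding i(2) WB_inv_distrib[OF sgen_WB[OF i(1)] w] sgen_inv[OF i(1)] ..
    ultimately show ?thesis unfolding i(2) left_desc_sgen[OF i(1)] by auto
  qed
  fix t assume t: "t \<in> gensB r" and nd: "\<not> left_desc s w" and d: "left_desc s (w \<circ> t)"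
  obtain j where j: "j \<in> {1..r}" "t = sgen r j" using t unfolding gensB_def by auto
  define x y where "x = inv w i" and "y = inv w (i+1)"
  have xy: "x \<in> {1..2*r}" "y \<in> {1..2*r}" "x \<noteq> y"
    unfolding x_def y_def using i WB_range[OF WB_inv[OF w]] WB_inj[OF WB_inv[OF w]] by auto
  have 1: "x < y" using nd xy i unfolding x_def y_def by (simp add: left_desc_sgen)
  have 2: "sgen r j y < sgen r j x" using d i j w unfolding x_def y_def
    by (simp add: left_desc_sgen WB_inv_distrib[OF w sgen_WB[OF j(1)]] sgen_inv[OF j(1)])
  have "x = j \<and> y = j+1 \<or> x = 2*r-j \<and> y = 2*r+1-j"
    using sgen_inversion[OF j(1) 1 2] .
  then have "sgen r j = reflection r x y"
    using reflection_mirror[of j r "j+1"] reflection_commute[OF xy(1,2)] j by (auto simp: sgen_reflection)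
  moreover have "w x = i" "w y = i+1" unfolding x_def y_def using w by auto
  ultimately show "s \<circ> w = w \<circ> t" using reflection_conj[OF w xy(1,2)] i j by (simp add: sgen_reflection)
qed simp

lemma folding_D: "folding_system (gensD r) (WB r) left_desc"
proof
  fix s assume s: "s \<in> gensD r"
  then obtain i where i: "i \<in> {1..r}" "s = dgen r i" unfolding gensD_dgen by auto
  show "s \<circ> s = id" using i by simp
  show "\<not> left_desc s id" using i d_range(3)[of i] by (simp add: left_desc_dgen)
  fix w assume w: "w \<in> WB r"
  show "s \<circ> w \<in> WB r" using i w dgen_WB WB_comp by simp
  show "left_desc s (s \<circ> w) \<longleftrightarrow> \<not> left_desc s w"
  proof -
    have "inv w (dgen_hi r i) \<noteq> inv w (dgen_lo r i)" using WB_inj[OF WB_inv[OF w]] d_range(3)[of i] by simp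
    moreover have "dgen r i (dgen_lo r i) = dgen_hi r i" "dgen r i (dgen_hi r i) = dgen_lo r i"
      using i by (auto simp: dgen_reflection)
    moreover have "inv (s \<circ> w) = inv w \<circ> dgen r i"
      unfolding i(2) WB_inv_distrib[OF dgen_WB[OF i(1)] w] dgen_inv[OF i(1)] ..
    ultimately show ?thesis unfolding i(2) left_desc_dgen[OF i(1)] by auto
  qed
  fix t assume t: "t \<in> gensD r" and nd: "\<not> left_desc s w" and d: "left_desc s (w \<circ> t)"
  obtain j where j: "j \<in> {1..r}" "t = dgen r j" using t unfolding gensD_dgen by auto
  define x y where "x = inv w (dgen_lo r i)" and "y = inv w (dgen_hi r i)"
  have xy: "x \<in> {1..2*r}" "y \<in> {1..2*r}" "x \<noteq> y"
    unfolding x_def y_def using i WB_range[OF WB_inv[OF w]] WB_inj[OF WB_inv[OF w]] d_range[of i] by auto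
  have wxy: "w x = dgen_lo r i" "w y = dgen_hi r i" unfolding x_def y_def using w by auto
  have 0: "x + y \<noteq> 2*r+1"
    using WB_sum[OF w xy(1)] wxy d_range(4)[OF i(1)] by (metis add_diff_cancel_left')
  have 1: "x < y" using nd xy i unfolding x_def y_def by (simp add: left_desc_dgen)
  have 2: "dgen r j y < dgen r j x" using d i j w unfolding x_def y_def
    by (simp add: left_desc_dgen WB_inv_distrib[OF w dgen_WB[OF j(1)]] dgen_inv[OF j(1)])
  have "x = dgen_lo r j \<and> y = dgen_hi r j \<or> x = 2*r+1 - dgen_hi r j \<and> y = 2*r+1 - dgen_lo r j"
  proof (cases "j < r")
    case True
    then show ?thesis
      using sgen_inversion[OF j(1) 1] 2 by (auto simp: dgen_def dgen_lo_def dgen_hi_def)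
  next
    case False
    then show ?thesis
      using dgen_last_inversion[OF 1 _ 0] 2 j(1) r2 by (auto simp: dgen_lo_def dgen_hi_def)
  qed
  then have "dgen r j = reflection r x y"
    using reflection_mirror[of "dgen_lo r j" r "dgen_hi r j"] j d_range[of j] reflection_commute[of x r y] xy(1,2)
    by (auto simp: dgen_reflection)
  then show "s \<circ> w = w \<circ> t" using reflection_conj[OF w xy(1,2)] i j wxy by (simp add: dgen_reflection)
qed simp

sublocale B: folding_system "gensB r" "WB r" left_desc by (rule folding_B)
sublocale D: folding_system "gensD r" "WB r" left_desc by (rule folding_D)

end

section \<open>Block stabilisers and sorted representatives\<close>

text \<open>The fibres of a labelling are consecutive blocks of \<open>{1..2*r}\<close> that are symmetric under \<open>i \<mapsto> 2*r+1-i\<close>.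
  Block decompositions are encoded by labels because the sum of two labellings is a labelling of their common
  refinement.\<close>

definition labelling :: "nat \<Rightarrow> nat \<Rightarrow> (nat \<Rightarrow> nat) \<Rightarrow> bool" where
  "labelling r K \<beta> \<longleftrightarrow> (\<forall>i j. 1 \<le> i \<longrightarrow> i \<le> j \<longrightarrow> j \<le> 2*r \<longrightarrow> \<beta> i \<le> \<beta> j)
     \<and> (\<forall>i\<in>{1..2*r}. \<beta> i + \<beta> (2*r+1-i) = K)"

definition stabB :: "nat \<Rightarrow> (nat \<Rightarrow> nat) \<Rightarrow> (nat \<Rightarrow> nat) set" where
  "stabB r \<beta> = {w \<in> WB r. \<forall>i\<in>{1..2*r}. \<beta> (w i) = \<beta> i}"

definition stabD :: "nat \<Rightarrow> (nat \<Rightarrow> nat) \<Rightarrow> (nat \<Rightarrow> nat) set" where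
  "stabD r \<beta> = {w \<in> WD r. \<forall>i\<in>{1..2*r}. \<beta> (w i) = \<beta> i}"

text \<open>Mirror pairs are left out: they carry the parameter \<open>1\<close>. The other inversions come in mirror images of each other,
  so the cardinality is twice the exponent of \<open>q\<close>.\<close>

definition block_inversions :: "nat \<Rightarrow> (nat \<Rightarrow> nat) \<Rightarrow> (nat \<Rightarrow> nat) \<Rightarrow> (nat \<times> nat) set" where
  "block_inversions r \<beta> v = {(i,j). 1 \<le> i \<and> i < j \<and> j \<le> 2*r \<and> \<beta> i = \<beta> j \<and> i + j \<noteq> 2*r+1 \<and> v j < v i}"

definition block_gens :: "nat \<Rightarrow> (nat \<Rightarrow> nat) \<Rightarrow> nat set" where
  "block_gens r \<beta> = {i\<in>{1..r}. \<beta> (dgen_lo r i) = \<beta> (dgen_hi r i)}"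

lemma labelling_mono: "labelling r K \<beta> \<Longrightarrow> 1 \<le> i \<Longrightarrow> i \<le> j \<Longrightarrow> j \<le> 2*r \<Longrightarrow> \<beta> i \<le> \<beta> j"
  unfolding labelling_def by blast

lemma labelling_mirror: "labelling r K \<beta> \<Longrightarrow> i \<in> {1..2*r} \<Longrightarrow> \<beta> (2*r+1-i) = K - \<beta> i"
  unfolding labelling_def by (metis add_diff_cancel_left')

lemma labelling_reflection:
  assumes "labelling r K \<beta>" "a \<in> {1..2*r}" "b \<in> {1..2*r}" "\<beta> a = \<beta> b"
  shows "\<beta> (reflection r a b x) = \<beta> x"
  using labelling_mirror[OF assms(1,2)] labelling_mirror[OF assms(1,3)] assms(4)
  by (simp add: reflection_def)

lemma finite_block_inversions [simp]: "finite (block_inversions r \<beta> v)"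
  by (rule finite_subset[of _ "{1..2*r} \<times> {1..2*r}"]) (auto simp: block_inversions_def)

lemma stabB_WB: "w \<in> stabB r \<beta> \<Longrightarrow> w \<in> WB r" by (simp add: stabB_def)
lemma stabD_WD: "w \<in> stabD r \<beta> \<Longrightarrow> w \<in> WD r" by (simp add: stabD_def)
lemma stabD_WB: "w \<in> stabD r \<beta> \<Longrightarrow> w \<in> WB r" by (simp add: stabD_def WD_WB)
lemma stabD_stabB: "stabD r \<beta> = stabB r \<beta> \<inter> WD r" by (auto simp: stabD_def stabB_def WD_WB)

lemma stabB_id [simp]: "id \<in> stabB r \<beta>" by (simp add: stabB_def)

lemma stabB_comp:
  assumes "u \<in> stabB r \<beta>" "v \<in> stabB r \<beta>" shows "u \<circ> v \<in> stabB r \<beta>"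
  using assms WB_range[of v r] WB_comp[of u r v] by (simp add: stabB_def)

lemma stabB_inv:
  assumes "u \<in> stabB r \<beta>" shows "inv u \<in> stabB r \<beta>"
proof -
  have u: "u \<in> WB r" using assms by (simp add: stabB_def)
  have "\<beta> (inv u i) = \<beta> i" if "i \<in> {1..2*r}" for i
  proof -
    have "inv u i \<in> {1..2*r}" using WB_range[OF WB_inv[OF u] that] .
    then have "\<beta> (u (inv u i)) = \<beta> (inv u i)" using assms by (simp add: stabB_def)
    then show ?thesis using u by simp
  qed
  then show ?thesis using WB_inv[OF u] by (simp add: stabB_def)
qed

lemma stabD_id [simp]: "id \<in> stabD r \<beta>" by (simp add: stabD_stabB)

lemma stabD_comp: "u \<in> stabD r \<beta> \<Longrightarrow> v \<in> stabD r \<beta> \<Longrightarrow> u \<circ> v \<in> stabD r \<beta>"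
  unfolding stabD_stabB using stabB_comp WD_comp by (metis IntD1 IntD2 IntI)

lemma stabD_inv: "u \<in> stabD r \<beta> \<Longrightarrow> inv u \<in> stabD r \<beta>"
  unfolding stabD_stabB using stabB_inv[of u] WD_inv_iff[of u r] WD_WB[of u r] by simp

lemma finite_stabD [simp]: "finite (stabD r \<beta>)"
  by (rule finite_subset[OF _ finite_WB[of r]]) (auto simp: stabD_WB)

lemma sorted_less_iff:
  assumes "block_inversions r \<beta> v = {}" "v \<in> WB r" "a \<in> {1..2*r}" "b \<in> {1..2*r}" "\<beta> a = \<beta> b"
    "a + b \<noteq> 2*r+1"
  shows "v a < v b \<longleftrightarrow> a < b"
proof -
  have *: "v x < v y" if "x \<in> {1..2*r}" "y \<in> {1..2*r}" "\<beta> x = \<beta> y" "x + y \<noteq> 2*r+1" "x < y" for x y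
  proof -
    have "(x, y) \<notin> block_inversions r \<beta> v" using assms(1) by simp
    then have "\<not> v y < v x" using that unfolding block_inversions_def by auto
    moreover have "v x \<noteq> v y" using that(5) WB_inj[OF assms(2)] by simp
    ultimately show ?thesis by simp
  qed
  show ?thesis
    using *[of a b] *[of b a] assms(3-6) by (metis add.commute less_asym linorder_neqE_nat)
qed

context rank
begin

lemma inv_dgen_comp: "i \<in> {1..r} \<Longrightarrow> w \<in> WB r \<Longrightarrow> inv (dgen r i \<circ> w) = inv w \<circ> dgen r i"
  using WB_inv_distrib[OF dgen_WB] dgen_inv by metis

lemma inv_sgen_comp: "i \<in> {1..r} \<Longrightarrow> w \<in> WB r \<Longrightarrow> inv (sgen r i \<circ> w) = inv w \<circ> sgen r i"
  using WB_inv_distrib[OF sgen_WB] sgen_inv by metis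

lemma sgen_sgen [simp]: "i \<in> {1..r} \<Longrightarrow> sgen r i (sgen r i x) = x"
  using sgen_invol by (metis comp_apply id_apply)

text \<open>The generator permutes the inverted pairs among themselves, except for the pair that it exchanges and the mirror image
  of that pair, which it removes.\<close>

lemma block_inversions_sgen:
  assumes "labelling r K \<beta>" and i: "i \<in> {1..<r}" and eq: "\<beta> i = \<beta> (i+1)"
    and v: "v \<in> WB r" and d: "v (i+1) < v i"
  shows "card (block_inversions r \<beta> (v \<circ> sgen r i)) + 2 = card (block_inversions r \<beta> v)"
proof -
  define s where "s = sgen r i"
  define E where "E = {(i,i+1),(2*r-i,2*r+1-i)}"
  have s: "s \<in> WB r" "s (s x) = x" for x
    using i sgen_WB[of i] sgen_sgen[of i] unfolding s_def by simp_all
  have lb: "\<beta> (s x) = \<beta> x" for x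
    using labelling_reflection[OF assms(1) _ _ eq, of x] i sgen_reflection[of i r] unfolding s_def by simp
  have ev: "s i = i+1" "s (i+1) = i" "s (2*r-i) = 2*r+1-i" "s (2*r+1-i) = 2*r-i"
    using i unfolding s_def by (auto simp: sgen_eval)
  have ord: "s a < s b" if "a < b" "(a,b) \<notin> E" for a b
  proof -
    obtain m where m: "2*r-i = m" "2*r+1-i = Suc m" "Suc i < m" using sgen_eval_aux[OF i] .
    show ?thesis using that m(3) unfolding s_def E_def sgen_eval[OF i] m by (auto split: if_splits)
  qed
  have sm: "s a + s b \<noteq> 2*r+1" if "a \<in> {1..2*r}" "a + b \<noteq> 2*r+1" "b \<in> {1..2*r}" for a b
  proof
    assume "s a + s b = 2*r+1"
    then have "s b = s (2*r+1-a)" using WB_sum[OF s(1) that(1)] by simp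
    then have "b = 2*r+1-a" using WB_inj[OF s(1)] by blast
    then show False using that by simp
  qed
  have mir: "v (2*r+1-i) = 2*r+1 - v i" "v (2*r-i) = 2*r+1 - v (i+1)"
    using WB_mirror[OF v, of i] WB_mirror[OF v, of "i+1"] i by auto
  have rng: "v i \<in> {1..2*r}" "v (i+1) \<in> {1..2*r}" using i WB_range[OF v] by auto
  have dm: "v (2*r+1-i) < v (2*r-i)" unfolding mir using d rng by (metis atLeastAtMost_iff diff_less_mono2 le_imp_less_Suc Suc_eq_plus1)
  have labm: "\<beta> (2*r-i) = \<beta> (2*r+1-i)"
    using lb[of "2*r+1-i"] ev by simp
  have ED: "E \<subseteq> block_inversions r \<beta> v"
    unfolding E_def block_inversions_def using i eq d dm labm by auto
  have nE: "p \<notin> E" if "p \<in> block_inversions r \<beta> (v \<circ> s)" for p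
  proof
    assume "p \<in> E"
    then consider "p = (i,i+1)" | "p = (2*r-i,2*r+1-i)" unfolding E_def by blast
    moreover have *: "v (s (snd p)) < v (s (fst p))" using that by (auto simp: block_inversions_def)
    ultimately show False
    proof cases
      case 1
      show False using * d unfolding 1 fst_conv snd_conv ev by (rule less_asym)
    next
      case 2
      show False using * dm unfolding 2 fst_conv snd_conv ev by (rule less_asym)
    qed
  qed
  let ?f = "\<lambda>(a,b). (s a, s b)"
  have "bij_betw ?f (block_inversions r \<beta> (v \<circ> s)) (block_inversions r \<beta> v - E)"
  proof (rule bij_betw_byWitness[where f' = ?f])
    show "\<forall>p\<in>block_inversions r \<beta> (v \<circ> s). ?f (?f p) = p" "\<forall>p\<in>block_inversions r \<beta> v - E. ?f (?f p) = p"
      by (simp_all add: s(2) split_beta)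
    have step: "(s a, s b) \<in> block_inversions r \<beta> v'"
      if "(a,b) \<in> block_inversions r \<beta> v''" "(a,b) \<notin> E" "v' (s b) < v' (s a)" for a b v' v''
    proof -
      have r: "a \<in> {1..2*r}" "b \<in> {1..2*r}" "a < b" "a + b \<noteq> 2*r+1" "\<beta> a = \<beta> b"
        using that(1) by (auto simp: block_inversions_def)
      have "s a \<in> {1..2*r}" "s b \<in> {1..2*r}" using r WB_range[OF s(1)] by blast+
      then show ?thesis
        using ord[OF r(3) that(2)] sm[OF r(1,4,2)] lb r(5) that(3) by (simp add: block_inversions_def)
    qed
    show "?f ` block_inversions r \<beta> (v \<circ> s) \<subseteq> block_inversions r \<beta> v - E"
    proof
      fix p assume "p \<in> ?f ` block_inversions r \<beta> (v \<circ> s)"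
      then obtain a b where ab: "(a,b) \<in> block_inversions r \<beta> (v \<circ> s)" "p = (s a, s b)" by auto
      have *: "a < b" "v (s b) < v (s a)" using ab(1) by (auto simp: block_inversions_def)
      have "p \<notin> E"
      proof
        assume "p \<in> E"
        then consider "s a = i" "s b = i+1" | "s a = 2*r-i" "s b = 2*r+1-i"
          unfolding ab E_def by blast
        then have "s (s b) < s (s a)" by cases (simp_all only: ev, use i in auto)
        then show False using *(1) s(2) by simp
      qed
      then show "p \<in> block_inversions r \<beta> v - E"
        using step[OF ab(1) nE[OF ab(1)]] *(2) ab(2) by blast
    qed
    show "?f ` (block_inversions r \<beta> v - E) \<subseteq> block_inversions r \<beta> (v \<circ> s)"
    proof
      fix p assume "p \<in> ?f ` (block_inversions r \<beta> v - E)"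
      then obtain a b where ab: "(a,b) \<in> block_inversions r \<beta> v" "(a,b) \<notin> E" "p = (s a, s b)" by auto
      have "(v \<circ> s) (s b) < (v \<circ> s) (s a)" using ab(1) s(2) by (auto simp: block_inversions_def)
      then show "p \<in> block_inversions r \<beta> (v \<circ> s)" using step[OF ab(1,2)] ab(3) by blast
    qed
  qed
  then have "card (block_inversions r \<beta> (v \<circ> s)) = card (block_inversions r \<beta> v - E)" by (rule bij_betw_same_card)
  moreover have "card E = 2" unfolding E_def using i by auto
  ultimately show ?thesis
    using card_Diff_subset[OF _ ED] card_mono[OF _ ED] finite_subset[OF ED] by (simp add: s_def)
qed

text \<open>The only pair whose order is changed by \<open>sgen r r\<close> is a mirror pair, which is not counted.\<close>

lemma block_inversions_sgen_r:
  assumes "labelling r K \<beta>" and eq: "\<beta> r = \<beta> (r+1)" and v: "v \<in> WB r"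
  shows "card (block_inversions r \<beta> (v \<circ> sgen r r)) = card (block_inversions r \<beta> v)"
proof -
  define s where "s = sgen r r"
  have s: "s (s x) = x" for x
    using r2 sgen_sgen[of r] unfolding s_def by simp
  let ?f = "\<lambda>(a,b). (s a, s b)"
  have im: "?f ` block_inversions r \<beta> v' \<subseteq> block_inversions r \<beta> (v' \<circ> s)" for v'
  proof
    fix p assume "p \<in> ?f ` block_inversions r \<beta> v'"
    then obtain a b where ab: "(a,b) \<in> block_inversions r \<beta> v'" "p = (s a, s b)" by auto
    then have "a \<in> {1..2*r}" "b \<in> {1..2*r}" "a < b" "a + b \<noteq> 2*r+1" "\<beta> a = \<beta> b"
      "v' b < v' a" by (auto simp: block_inversions_def)
    then have "s a \<in> {1..2*r}" "s b \<in> {1..2*r}" "s a < s b" "s a + s b \<noteq> 2*r+1" "\<beta> (s a) = \<beta> (s b)"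
      "v' (s (s b)) < v' (s (s a))" using eq r2 unfolding s
      unfolding s_def sgen_r_eval by (auto split: if_splits)
    then show "p \<in> block_inversions r \<beta> (v' \<circ> s)" unfolding ab(2) block_inversions_def by auto
  qed
  have vss: "(v \<circ> s) \<circ> s = v" using s by (simp add: fun_eq_iff)
  have "bij_betw ?f (block_inversions r \<beta> (v \<circ> s)) (block_inversions r \<beta> v)"
    by (rule bij_betw_byWitness[where f' = ?f]) (use s im[of v] im[of "v \<circ> s"] vss in auto)
  then show ?thesis using bij_betw_same_card s_def by blast
qed

lemma block_gens_labelling: "i \<in> block_gens r \<beta> \<Longrightarrow> i \<in> {1..r}" by (simp add: block_gens_def)

lemma block_gens_last:
  assumes "labelling r K \<beta>" "r \<in> block_gens r \<beta>"
  shows "\<beta> (r-1) = \<beta> r" "\<beta> r = \<beta> (r+1)"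
proof -
  have "\<beta> (r-1) = \<beta> (r+1)" using assms by (simp add: block_gens_def dgen_lo_def dgen_hi_def)
  moreover have "\<beta> (r-1) \<le> \<beta> r" "\<beta> r \<le> \<beta> (r+1)" using labelling_mono[OF assms(1)] r2 by auto
  ultimately show "\<beta> (r-1) = \<beta> r" "\<beta> r = \<beta> (r+1)" by auto
qed

lemma block_inversions_dgen:
  assumes l: "labelling r K \<beta>" and i: "i \<in> block_gens r \<beta>" and w: "w \<in> WB r" and d: "left_desc (dgen r i) w"
  shows "card (block_inversions r \<beta> (inv (dgen r i \<circ> w))) + 2 = card (block_inversions r \<beta> (inv w))"
proof -
  have i': "i \<in> {1..r}" using i by (simp add: block_gens_def)
  have e: "inv (dgen r i \<circ> w) = inv w \<circ> dgen r i"
    by (rule inv_dgen_comp[OF i' w])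
  have d': "inv w (dgen_hi r i) < inv w (dgen_lo r i)" using d i' by (simp add: left_desc_dgen)
  show ?thesis
  proof (cases "i < r")
    case True
    then show ?thesis unfolding e using block_inversions_sgen[OF l _ _ WB_inv[OF w], of i] i d'
      by (simp add: dgen_def block_gens_def dgen_lo_def dgen_hi_def)
  next
    case False
    then have ir: "i = r" using i' by simp
    note lb = block_gens_last[OF l i[unfolded ir]]
    let ?s = "sgen r r" let ?t = "sgen r (r-1)"
    have W: "inv w \<in> WB r" "inv w \<circ> ?s \<in> WB r" "inv w \<circ> ?s \<circ> ?t \<in> WB r"
      using WB_inv[OF w] sgen_WB[of r] sgen_WB[of "r-1"] r2 by auto
    have "(inv w \<circ> ?s) (r-1+1) < (inv w \<circ> ?s) (r-1)"
      using d' r2 ir by (auto simp add: sgen_r_eval dgen_lo_def dgen_hi_def)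
    then have "card (block_inversions r \<beta> ((inv w \<circ> ?s) \<circ> ?t)) + 2 = card (block_inversions r \<beta> (inv w \<circ> ?s))"
      using block_inversions_sgen[OF l, of "r-1" "inv w \<circ> ?s"] W lb r2 by simp
    moreover have "card (block_inversions r \<beta> (inv w \<circ> ?s)) = card (block_inversions r \<beta> (inv w))"
      by (rule block_inversions_sgen_r[OF l lb(2) W(1)])
    moreover have "card (block_inversions r \<beta> (inv w \<circ> ?s \<circ> ?t \<circ> ?s)) = card (block_inversions r \<beta> (inv w \<circ> ?s \<circ> ?t))"
      by (rule block_inversions_sgen_r[OF l lb(2) W(3)])
    ultimately show ?thesis unfolding e using ir by (simp add: dgen_def comp_assoc)
  qed
qed

text \<open>In the lower half, the values in one block increase step by step. If a block reaches across the centre, then it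
  contains \<open>r-1\<close> and \<open>r+1\<close>, and the last generator of type D compares the two halves. Mirror symmetry gives the
  remaining pairs.\<close>

lemma sorted_if_no_desc:
  assumes l: "labelling r K \<beta>" and v: "v \<in> WB r"
    and d: "\<And>i. i \<in> block_gens r \<beta> \<Longrightarrow> v (dgen_lo r i) < v (dgen_hi r i)"
  shows "block_inversions r \<beta> v = {}"
proof -
  have chain: "v i < v j" if "1 \<le> i" "i < j" "j \<le> r" "\<beta> i = \<beta> j" for i j
    using that(2,3,4)
  proof (induction j)
    case 0
    then show ?case by simp
  next
    case (Suc j)
    have "\<beta> i \<le> \<beta> j" "\<beta> j \<le> \<beta> (Suc j)"
      using labelling_mono[OF l, of i j] labelling_mono[OF l, of j "Suc j"] Suc.prems that(1) by auto
    then have b: "\<beta> i = \<beta> j" "\<beta> j = \<beta> (Suc j)" using Suc.prems by auto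
    then have "j \<in> block_gens r \<beta>" using Suc.prems that(1) by (simp add: block_gens_def dgen_lo_def dgen_hi_def)
    then have "v j < v (Suc j)" using d[of j] Suc.prems by (simp add: dgen_lo_def dgen_hi_def)
    moreover have "i = j \<or> v i < v j" using Suc.IH Suc.prems b by (cases "i = j") auto
    ultimately show ?case by auto
  qed
  have half: "v i < v j" if "1 \<le> i" "i < j" "i + j < 2*r+1" "\<beta> i = \<beta> j" for i j
  proof (cases "j \<le> r")
    case True
    then show ?thesis using chain that by simp
  next
    case False
    define k where "k = 2*r+1-j"
    have k: "i < k" "k \<le> r" "1 \<le> k" "j = 2*r+1-k" using that False by (auto simp: k_def)
    have jr: "j \<le> 2*r" using k by arith
    have e: "\<beta> i = \<beta> x" if x: "i \<le> x" "x \<le> j" for x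
    proof -
      have "\<beta> i \<le> \<beta> x" "\<beta> x \<le> \<beta> j"
        using labelling_mono[OF l \<open>1 \<le> i\<close> x(1)] labelling_mono[OF l _ x(2) jr] x jr \<open>1 \<le> i\<close> by auto
      then show ?thesis using \<open>\<beta> i = \<beta> j\<close> by simp
    qed
    have "\<beta> i = \<beta> (r-1)" "\<beta> i = \<beta> k" "\<beta> i = \<beta> r" "\<beta> i = \<beta> (r+1)"
      using k False by (auto intro!: e)
    then have b: "\<beta> i = \<beta> (r-1)" "\<beta> k = \<beta> r" "\<beta> (r-1) = \<beta> (r+1)" by auto
    have "r \<in> block_gens r \<beta>" using b r2 by (simp add: block_gens_def dgen_lo_def dgen_hi_def)
    from d[OF this] have "v (r-1) < v (r+1)" by (simp add: dgen_lo_def dgen_hi_def)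
    moreover have "v i \<le> v (r-1)"
    proof (cases "i = r-1")
      case False
      then have "i < r-1" using k(1,2) by linarith
      then show ?thesis using chain[of i "r-1"] that(1) b(1) by simp
    qed simp
    moreover have "v k \<le> v r" using chain[of k r] k b by (cases "k = r") auto
    moreover have "v j = 2*r+1 - v k" using WB_mirror[OF v, of k] k by auto
    moreover have "v (r+1) = 2*r+1 - v r" using WB_mirror[OF v, of r] r2 by auto
    moreover have "v r \<in> {1..2*r}" using WB_range[OF v] r2 by simp
    ultimately show ?thesis by auto
  qed
  show ?thesis
  proof (rule ccontr)
    assume "block_inversions r \<beta> v \<noteq> {}"
    then obtain i j where ij: "1 \<le> i" "i < j" "j \<le> 2*r" "\<beta> i = \<beta> j" "i + j \<noteq> 2*r+1" "v j < v i"
      by (auto simp: block_inversions_def)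
    show False
    proof (cases "i + j < 2*r+1")
      case True
      then show False using half ij by fastforce
    next
      case False
      have "\<beta> (2*r+1-j) = \<beta> (2*r+1-i)" using labelling_mirror[OF l, of i] labelling_mirror[OF l, of j] ij by auto
      then have "v (2*r+1-j) < v (2*r+1-i)" using half[of "2*r+1-j" "2*r+1-i"] ij False by auto
      then show False using WB_mirror[OF v, of i] WB_mirror[OF v, of j] ij by auto
    qed
  qed
qed

text \<open>Labels prevent inversions between blocks, so \<open>u\<close> is increasing except possibly on mirror pairs. It is
  then the identity or the single sign change at \<open>r\<close>, which has the wrong parity.\<close>

lemma sorted_in_stabD_id:
  assumes l: "labelling r K \<beta>" and u: "u \<in> stabD r \<beta>" and s: "block_inversions r \<beta> u = {}"
  shows "u = id"
proof -
  have W: "u \<in> WB r" "u \<in> WD r" and lb: "\<And>i. i \<in> {1..2*r} \<Longrightarrow> \<beta> (u i) = \<beta> i"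
    using u by (auto simp: stabD_def WD_WB)
  have inc: "u i < u j" if "1 \<le> i" "i < j" "j \<le> 2*r" "i + j \<noteq> 2*r+1" for i j
  proof (cases "\<beta> i = \<beta> j")
    case True
    then show ?thesis using sorted_less_iff[OF s W(1), of i j] that by auto
  next
    case False
    have i: "i \<in> {1..2*r}" "j \<in> {1..2*r}" using that by auto
    have "\<beta> (u i) < \<beta> (u j)" using False lb i labelling_mono[OF l, of i j] that by auto
    then show ?thesis
      using labelling_mono[OF l, of "u j" "u i"] WB_range[OF W(1) i(1)] WB_range[OF W(1) i(2)]
      by (metis atLeastAtMost_iff not_le)
  qed
  have rng: "u i \<in> {1..2*r}" if "i \<in> {1..2*r}" for i using WB_range[OF W(1) that] .
  have r1: "u (r-1) \<le> r"
  proof -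
    have "u (r-1) < u r" "u (r-1) < u (r+1)" using inc[of "r-1" r] inc[of "r-1" "r+1"] r2 by auto
    moreover have "u (r+1) = 2*r+1 - u r" using WB_mirror[OF W(1), of r] r2 by auto
    ultimately show ?thesis using rng[of r] r2 by auto
  qed
  have le: "u i \<le> r" if "1 \<le> i" "i < r" for i
  proof (cases "i = r-1")
    case False
    then have "u i < u (r-1)" using that by (intro inc) auto
    then show ?thesis using r1 by simp
  qed (use r1 in simp)
  have "u r \<le> r"
  proof (rule ccontr)
    assume "\<not> u r \<le> r"
    moreover have "i = r" if "i \<in> {1..r}" "u i > r" for i
      using le[of i] that by (metis atLeastAtMost_iff le_neq_implies_less not_le)
    ultimately have "{i\<in>{1..r}. u i > r} = {r}" using r2 by auto
    then have "odd (card {i\<in>{1..r}. u i > r})" by simp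
    then show False using W(2) by (simp add: WD_def)
  qed
  then have le: "u i \<le> r" if "1 \<le> i" "i \<le> r" for i using le that by (cases "i = r") auto
  have ge: "i \<le> u i" if "1 \<le> i" "i \<le> r" for i
    using that
  proof (induction i)
    case (Suc i)
    show ?case
    proof (cases "i = 0")
      case True
      then show ?thesis using rng[of 1] r2 by auto
    next
      case False
      then show ?thesis using Suc inc[of i "Suc i"] by auto
    qed
  qed simp
  have up: "u (r - k) \<le> r - k" if "k < r" for k
    using that
  proof (induction k)
    case 0
    then show ?case using le[of r] r2 by simp
  next
    case (Suc k)
    have "u (r - Suc k) < u (r - k)" by (rule inc) (use Suc.prems in auto)
    moreover have "u (r - k) \<le> r - k" using Suc by simp
    moreover have "r - k = Suc (r - Suc k)" using Suc.prems by simp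
    ultimately show ?case by simp
  qed
  have eq: "u i = i" if "1 \<le> i" "i \<le> r" for i
    using ge[OF that] up[of "r - i"] that by auto
  have "u i = i" for i
  proof (cases "i \<in> {1..2*r}")
    case True
    show ?thesis
    proof (cases "i \<le> r")
      case False
      then have "u (2*r+1-i) = 2*r+1-i" using eq[of "2*r+1-i"] True by auto
      then show ?thesis using WB_mirror[OF W(1), of i] True rng[OF True] by auto
    qed (use eq True in auto)
  qed (use WB_outside[OF W(1)] in auto)
  then show ?thesis by (simp add: fun_eq_iff)
qed

lemma dgen_stabD: "labelling r K \<beta> \<Longrightarrow> i \<in> block_gens r \<beta> \<Longrightarrow> dgen r i \<in> stabD r \<beta>"
  using labelling_reflection[of r K \<beta> "dgen_lo r i" "dgen_hi r i"] d_range[of i] dgen_WD[of i]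
  by (auto simp: stabD_def block_gens_def dgen_reflection)

lemma sorted_or_desc:
  assumes l: "labelling r K \<beta>" and y: "y \<in> WB r"
  obtains "block_inversions r \<beta> (inv y) = {}" | i where "i \<in> block_gens r \<beta>" "left_desc (dgen r i) y"
proof (cases "\<exists>i\<in>block_gens r \<beta>. left_desc (dgen r i) y")
  case True
  then show ?thesis using that by blast
next
  case False
  have "inv y (dgen_lo r i) < inv y (dgen_hi r i)" if "i \<in> block_gens r \<beta>" for i
  proof -
    have "\<not> inv y (dgen_hi r i) < inv y (dgen_lo r i)" using that False left_desc_dgen[OF block_gens_labelling[OF that]] by blast
    moreover have "inv y (dgen_hi r i) \<noteq> inv y (dgen_lo r i)"
      using WB_inj[OF WB_inv[OF y]] d_range(3)[of i] by simp
    ultimately show ?thesis by simp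
  qed
  then show ?thesis using that sorted_if_no_desc[OF l WB_inv[OF y]] by blast
qed

text \<open>Induction along reduced words of the type D stabiliser: each step prolongs \<open>u\<close> from the left by a
  generator that is not a descent.\<close>

lemma stabD_induct [consumes 2, case_names id step]:
  assumes l: "labelling r K \<beta>" and u: "u \<in> stabD r \<beta>" and "P id"
    and step: "\<And>i u. i \<in> block_gens r \<beta> \<Longrightarrow> u \<in> stabD r \<beta> \<Longrightarrow> \<not> left_desc (dgen r i) u \<Longrightarrow> P u \<Longrightarrow> P (dgen r i \<circ> u)"
  shows "P u"
  using u
proof (induction "card (block_inversions r \<beta> (inv u))" arbitrary: u rule: less_induct)
  case less
  have W: "u \<in> WB r" using less.prems stabD_WB by blast
  from sorted_or_desc[OF l W] show ?case
  proof cases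
    case 1
    have "inv u = id" by (rule sorted_in_stabD_id[OF l stabD_inv[OF less.prems] 1])
    then have "u = id" using WB_inv_inv[OF W] by (metis inv_id)
    then show ?thesis using assms(3) by simp
  next
    case (2 i)
    have i: "i \<in> {1..r}" using 2 block_gens_labelling by blast
    let ?u = "dgen r i \<circ> u"
    have P: "?u \<in> stabD r \<beta>" using stabD_comp dgen_stabD[OF l 2(1)] less.prems by blast
    have "P ?u" using less.hyps[OF _ P] block_inversions_dgen[OF l 2(1) W 2(2)] by simp
    moreover have "\<not> left_desc (dgen r i) ?u" using D.desc_flip[OF _ W] gensD_dgen i 2 by blast
    ultimately have "P (dgen r i \<circ> ?u)" using step[OF 2(1) P] by blast
    then show ?thesis using i by simp
  qed
qed

lemma sorted_rep_exists:
  assumes l: "labelling r K \<beta>" and y: "y \<in> WB r"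
  shows "\<exists>u\<in>stabD r \<beta>. block_inversions r \<beta> (inv (u \<circ> y)) = {}"
  using y
proof (induction "card (block_inversions r \<beta> (inv y))" arbitrary: y rule: less_induct)
  case less
  from sorted_or_desc[OF l less.prems] show ?case
  proof cases
    case 1
    then have "block_inversions r \<beta> (inv (id \<circ> y)) = {}" by simp
    then show ?thesis using stabD_id by blast
  next
    case (2 i)
    have W: "dgen r i \<circ> y \<in> WB r" using less.prems dgen_WB[OF block_gens_labelling[OF 2(1)]] by blast
    have "card (block_inversions r \<beta> (inv (dgen r i \<circ> y))) < card (block_inversions r \<beta> (inv y))"
      using block_inversions_dgen[OF l 2(1) less.prems 2(2)] by simp
    from less.hyps[OF this W] obtain u where u: "u \<in> stabD r \<beta>"
      "block_inversions r \<beta> (inv (u \<circ> (dgen r i \<circ> y))) = {}" by blast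
    have "u \<circ> dgen r i \<in> stabD r \<beta>" by (rule stabD_comp[OF u(1) dgen_stabD[OF l 2(1)]])
    moreover have "block_inversions r \<beta> (inv ((u \<circ> dgen r i) \<circ> y)) = {}" using u(2) by (simp add: comp_assoc)
    ultimately show ?thesis by blast
  qed
qed

text \<open>Within a block and up to mirror pairs, the inverse of \<open>y\<close> preserves the order, so that comparing the positions of
  two letters of one block in \<open>u \<circ> y\<close> amounts to comparing them in \<open>u\<close>.\<close>

lemma sorted_left_desc:
  assumes l: "labelling r K \<beta>" and y: "y \<in> WB r" and s: "block_inversions r \<beta> (inv y) = {}" and u: "u \<in> stabD r \<beta>"
    and i: "i \<in> block_gens r \<beta>"
  shows "left_desc (dgen r i) (u \<circ> y) \<longleftrightarrow> left_desc (dgen r i) u"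
proof -
  note i' = block_gens_labelling[OF i]
  have uW: "u \<in> WB r" using u stabD_WB by blast
  let ?a = "inv u (dgen_hi r i)" and ?b = "inv u (dgen_lo r i)"
  have iu: "inv u \<in> stabD r \<beta>" using stabD_inv[OF u] .
  have ab: "?a \<in> {1..2*r}" "?b \<in> {1..2*r}" "\<beta> ?a = \<beta> ?b"
    using iu WB_range[OF WB_inv[OF uW]] d_range(1,2)[OF i'] i by (auto simp: stabD_def block_gens_def)
  have "?a + ?b \<noteq> 2*r+1"
  proof
    assume "?a + ?b = 2*r+1"
    then have "u ?a = 2*r+1 - u ?b" using WB_mirror[OF uW ab(2)] by (metis add_diff_cancel_right')
    then have "dgen_hi r i = 2*r+1 - dgen_lo r i" using uW by simp
    then show False using d_range(1,4)[OF i'] by simp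
  qed
  then show ?thesis
    using sorted_less_iff[OF s WB_inv[OF y] ab(1,2)] ab(3) i' y uW
    by (simp add: left_desc_dgen WB_inv_distrib)
qed

lemma sorted_rep_unique:
  assumes l: "labelling r K \<beta>" and y: "y \<in> WB r" and s: "block_inversions r \<beta> (inv y) = {}" and u: "u \<in> stabD r \<beta>"
    and s': "block_inversions r \<beta> (inv (u \<circ> y)) = {}"
  shows "u = id"
proof -
  have uW: "u \<in> WB r" using u stabD_WB by blast
  from sorted_or_desc[OF l uW] show ?thesis
  proof cases
    case 1
    then have "inv u = id" using sorted_in_stabD_id[OF l stabD_inv[OF u]] by blast
    then show ?thesis using WB_inv_inv[OF uW] by (metis inv_id)
  next
    case (2 i)
    then have "left_desc (dgen r i) (u \<circ> y)" using sorted_left_desc[OF l y s u] by blast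
    then have "card (block_inversions r \<beta> (inv (u \<circ> y))) > 0"
      using block_inversions_dgen[OF l 2(1) WB_comp[OF uW y]] by linarith
    then show ?thesis using s' by simp
  qed
qed

lemma stabD_words:
  assumes l: "labelling r K \<beta>" shows "stabD r \<beta> = words (dgen r ` block_gens r \<beta>)"
proof
  show "stabD r \<beta> \<subseteq> words (dgen r ` block_gens r \<beta>)"
  proof
    fix u assume "u \<in> stabD r \<beta>"
    with l show "u \<in> words (dgen r ` block_gens r \<beta>)"
    proof (induction rule: stabD_induct)
      case id
      show ?case by (rule words_id)
    next
      case (step i u)
      show ?case by (rule words_Cons) (use step in auto)
    qed
  qed
  show "words (dgen r ` block_gens r \<beta>) \<subseteq> stabD r \<beta>"
  proof
    fix w assume "w \<in> words (dgen r ` block_gens r \<beta>)"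
    then obtain ws where "w = compose_list ws" "set ws \<subseteq> dgen r ` block_gens r \<beta>" unfolding words_def by blast
    then show "w \<in> stabD r \<beta>"
    proof (induction ws arbitrary: w)
      case Nil
      then show ?case by (metis compose_list_Nil stabD_id)
    next
      case (Cons s ws)
      have "s \<in> stabD r \<beta>" "compose_list ws \<in> stabD r \<beta>" using Cons dgen_stabD[OF l] by auto
      then show ?case unfolding Cons.prems(1) compose_list_Cons by (rule stabD_comp)
    qed
  qed
qed

lemma words_gensD: "words (gensD r) = WD r"
proof -
  have l: "labelling r 0 (\<lambda>_. 0)" by (simp add: labelling_def)
  \<comment> \<open>A single block has the whole group as its stabiliser.\<close>
  have "block_gens r (\<lambda>_. 0) = {1..r}" "stabD r (\<lambda>_. 0) = WD r" by (auto simp: block_gens_def stabD_def)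
  then show ?thesis using stabD_words[OF l] by (simp only: gensD_dgen)
qed

lemma dgen_words_sgen:
  assumes "labelling r K \<beta>" "i \<in> block_gens r \<beta>"
  shows "dgen r i \<in> words (sgen r ` {i\<in>{1..r}. \<beta> i = \<beta> (i+1)})"
proof (cases "i < r")
  case True
  then show ?thesis using assms by (intro words_gen) (auto simp: block_gens_def dgen_def dgen_lo_def dgen_hi_def)
next
  case False
  then have ir: "i = r" using block_gens_labelling[OF assms(2)] by simp
  have "\<beta> (r-1) = \<beta> r" "\<beta> r = \<beta> (r+1)" using block_gens_last[OF assms(1)] assms(2) ir by auto
  then have "sgen r r \<in> words (sgen r ` {i\<in>{1..r}. \<beta> i = \<beta> (i+1)})"
    "sgen r (r-1) \<in> words (sgen r ` {i\<in>{1..r}. \<beta> i = \<beta> (i+1)})"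
    using r2 by (auto intro!: words_gen)
  then have "sgen r r \<circ> sgen r (r-1) \<circ> sgen r r \<in> words (sgen r ` {i\<in>{1..r}. \<beta> i = \<beta> (i+1)})"
    using words_comp by metis
  then show ?thesis unfolding ir dgen_def by simp
qed

lemma sgen_stabB: "labelling r K \<beta> \<Longrightarrow> i \<in> {1..r} \<Longrightarrow> \<beta> i = \<beta> (i+1) \<Longrightarrow> sgen r i \<in> stabB r \<beta>"
  using labelling_reflection[of r K \<beta> i "i+1"] sgen_WB[of i] by (auto simp: stabB_def sgen_reflection)

text \<open>Some letter of the lower half is moved to the upper half of its own block. This block then contains both
  \<open>r\<close> and \<open>r+1\<close>, so that \<open>sgen r r\<close> belongs to the stabiliser and can be split off from \<open>w\<close>.\<close>

lemma stabB_not_WD: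
  assumes l: "labelling r K \<beta>" and w: "w \<in> stabB r \<beta>" and n: "w \<notin> WD r"
  shows "\<beta> r = \<beta> (r+1)"
proof -
  have W: "w \<in> WB r" using w stabB_WB by blast
  have "{i\<in>{1..r}. w i > r} \<noteq> {}"
  proof
    assume e: "{i\<in>{1..r}. w i > r} = {}"
    show False using n W unfolding WD_def mem_Collect_eq e by simp
  qed
  then obtain i where i: "i \<in> {1..r}" "w i > r" by auto
  have "i \<in> {1..2*r}" using i by auto
  then have "\<beta> (w i) = \<beta> i" "w i \<in> {1..2*r}" using w WB_range[OF W] by (auto simp: stabB_def)
  then show ?thesis
    using labelling_mono[OF l, of i r] labelling_mono[OF l, of r "r+1"] labelling_mono[OF l, of "r+1" "w i"] i by auto
qed

lemma stabB_words:
  assumes l: "labelling r K \<beta>" shows "stabB r \<beta> = words (sgen r ` {i\<in>{1..r}. \<beta> i = \<beta> (i+1)})"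
    (is "_ = words ?S")
proof
  have stabD: "stabD r \<beta> \<subseteq> words ?S"
  proof
    fix u assume "u \<in> stabD r \<beta>"
    with l show "u \<in> words ?S"
    proof (induction rule: stabD_induct)
      case id
      show ?case by (rule words_id)
    next
      case (step i u)
      show ?case by (rule words_comp[OF dgen_words_sgen[OF l step(1)] step(4)])
    qed
  qed
  show "stabB r \<beta> \<subseteq> words ?S"
  proof
    fix w assume w: "w \<in> stabB r \<beta>"
    show "w \<in> words ?S"
    proof (cases "w \<in> WD r")
      case True
      then show ?thesis using stabD w by (auto simp: stabD_stabB)
    next
      case False
      have e: "\<beta> r = \<beta> (r+1)" by (rule stabB_not_WD[OF l w False])
      have s: "sgen r r \<in> ?S" using e r2 by auto
      have "sgen r r \<circ> w \<in> stabD r \<beta>"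
        unfolding stabD_stabB using stabB_comp[OF sgen_stabB[OF l _ e] w] sr_comp_WD(1)[OF stabB_WB[OF w]] False r2 by auto
      then have "sgen r r \<circ> (sgen r r \<circ> w) \<in> words ?S" by (rule words_Cons[OF s subsetD[OF stabD]])
      then show ?thesis using r2 by simp
    qed
  qed
  show "words ?S \<subseteq> stabB r \<beta>"
  proof
    fix w assume "w \<in> words ?S"
    then obtain ws where "w = compose_list ws" "set ws \<subseteq> ?S" unfolding words_def by blast
    then show "w \<in> stabB r \<beta>"
    proof (induction ws arbitrary: w)
      case Nil
      then show ?case by (metis compose_list_Nil stabB_id)
    next
      case (Cons s ws)
      have "s \<in> stabB r \<beta>" "compose_list ws \<in> stabB r \<beta>" using Cons sgen_stabB[OF l] by auto
      then show ?case unfolding Cons.prems(1) compose_list_Cons by (rule stabB_comp)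
    qed
  qed
qed

lemma words_gensB: "words (gensB r) = WB r"
proof -
  have l: "labelling r 0 (\<lambda>_. 0)" by (simp add: labelling_def)
  have "{i\<in>{1..r}. (0::nat) = 0} = {1..r}" "stabB r (\<lambda>_. 0) = WB r" by (auto simp: stabB_def)
  then show ?thesis using stabB_words[OF l] by (simp only: gensB_def)
qed

end

section \<open>The Hecke algebra: Matsumoto's theorem and multiplication rules\<close>

lemma hscalar_add: "hscalar (a + b) = (hscalar a + hscalar b :: 'r::finite hecke)"
  by transfer (simp add: scalar_def single_add hecke_cong.refl)

lemma hscalar_mult: "hscalar (a * b) = (hscalar a * hscalar b :: 'r::finite hecke)"
  by transfer (simp add: scalar_def mult_single hecke_cong.refl)

lemma hscalar_0 [simp]: "hscalar 0 = (0 :: 'r::finite hecke)"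
  by transfer (simp add: scalar_def hecke_cong.refl)

lemma hscalar_1 [simp]: "hscalar 1 = (1 :: 'r::finite hecke)"
  by transfer (simp add: scalar_def hecke_cong.refl)

lemma hscalar_diff: "hscalar (a - b) = (hscalar a - hscalar b :: 'r::finite hecke)"
  using hscalar_add[of "a - b" b, where 'r='r] by (simp add: algebra_simps)

lemma hscalar_sum: "hscalar (\<Sum>x\<in>A. f x) = (\<Sum>x\<in>A. hscalar (f x) :: 'r::finite hecke)"
  by (induction A rule: infinite_finite_induct) (simp_all add: hscalar_add)

lemma scalar_commute: "scalar c * x = x * scalar c"
proof (induction x rule: free_alg_induct)
  case (1 k d)
  show ?case by (simp add: scalar_def mult_single mult.commute)
next
  case (2 y z)
  then show ?case by (simp add: distrib_left distrib_right)
qed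

lemma hscalar_commute: "hscalar c * x = x * (hscalar c :: 'r::finite hecke)"
  by transfer (simp add: scalar_commute hecke_cong.refl)

lemma hscalar_left_commute: "x * (hscalar c * y) = hscalar c * (x * (y :: 'r::finite hecke))"
  by (metis hscalar_commute mult.assoc)

locale hecke_rank = rank r for r +
  fixes ty :: "'r::finite itself"
  assumes card_r: "CARD('r) = r"
begin

abbreviation T :: "nat \<Rightarrow> 'r hecke" where "T \<equiv> Tgen"

lemmas hecke_abs = Tgen.abs_eq hscalar.abs_eq times_hecke.abs_eq plus_hecke.abs_eq
  one_hecke.abs_eq hecke.abs_eq_iff card_r

lemma T_commute:
  assumes "i \<in> {1..r}" "j \<in> {1..r}" "\<bar>int i - int j\<bar> \<ge> 2"
  shows "T i * T j = T j * T i"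
  unfolding hecke_abs by (intro hecke_cong.base hecke_relation.commute assms)

lemma T_braid3:
  assumes "1 \<le> j" "j + 1 < r" shows "T j * T (j+1) * T j = T (j+1) * T j * T (j+1)"
  unfolding hecke_abs by (intro hecke_cong.base hecke_relation.braid3 assms)

lemma T_braid4: "T (r-1) * T r * T (r-1) * T r = T r * T (r-1) * T r * T (r-1)"
  unfolding hecke_abs by (intro hecke_cong.base hecke_relation.braid4 r2)

lemma T_quad:
  assumes "1 \<le> i" "i < r" shows "T i * T i = hscalar (q - 1) * T i + hscalar q"
  unfolding hecke_abs by (intro hecke_cong.base hecke_relation.quad assms)

lemma T_last: "T r * T r = 1"
  unfolding hecke_abs by (intro hecke_cong.base hecke_relation.quad_last) (use r2 in simp)

definition reduced :: "(nat \<Rightarrow> nat) \<Rightarrow> nat list \<Rightarrow> bool" where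
  "reduced w xs \<longleftrightarrow> set xs \<subseteq> {1..r} \<and> compose_list (map (sgen r) xs) = w
     \<and> length xs = wlength (gensB r) w"

definition prodT :: "nat list \<Rightarrow> 'r hecke" where
  "prodT xs = prod_list (map T xs)"

lemma prodT_simps [simp]: "prodT [] = 1" "prodT (i # xs) = T i * prodT xs"
  "prodT (xs @ ys) = prodT xs * prodT ys"
  by (simp_all add: prodT_def)

lemma gensB_words: "set xs \<subseteq> {1..r} \<Longrightarrow> set (map (sgen r) xs) \<subseteq> gensB r"
  by (auto simp: gensB_def)

lemma sgen_gensB: "i \<in> {1..r} \<Longrightarrow> sgen r i \<in> gensB r"
  by (auto simp: gensB_def)

lemma reduced_WB:
  assumes "reduced w xs" shows "w \<in> WB r"
proof -
  have "compose_list (map (sgen r) xs) \<in> WB r"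
    using assms B.compose_list_in[OF gensB_words] unfolding reduced_def by blast
  then show ?thesis using assms unfolding reduced_def by simp
qed

lemma reduced_exists:
  assumes "w \<in> WB r" shows "\<exists>xs. reduced w xs"
proof -
  obtain ws where ws: "set ws \<subseteq> gensB r" "compose_list ws = w" "length ws = wlength (gensB r) w"
    using reduced_word[of w "gensB r"] assms words_gensB by blast
  have "low s \<in> {1..r} \<and> sgen r (low s) = s" if "s \<in> set ws" for s
  proof -
    have "s \<in> gensB r" using that ws(1) by blast
    then obtain i where "i \<in> {1..r}" "s = sgen r i" unfolding gensB_def by blast
    then show ?thesis using low_sgen by simp
  qed
  then have "map (sgen r) (map low ws) = ws" "set (map low ws) \<subseteq> {1..r}"
    by (auto simp: map_idI)
  then have "reduced w (map low ws)" using ws unfolding reduced_def by simp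
  then show ?thesis by blast
qed

lemma reduced_step:
  assumes w: "w \<in> WB r" and i: "i \<in> {1..r}" and d: "left_desc (sgen r i) w" and k: "reduced (sgen r i \<circ> w) ks"
  shows "reduced w (i # ks)"
proof -
  have "compose_list (map (sgen r) (i # ks)) = sgen r i \<circ> (sgen r i \<circ> w)"
    using k unfolding reduced_def list.map compose_list_Cons by simp
  then have "compose_list (map (sgen r) (i # ks)) = w" using i by simp
  moreover have "wlength (gensB r) w = Suc (wlength (gensB r) (sgen r i \<circ> w))"
    by (rule B.wlength_desc) (use w i d words_gensB sgen_gensB in auto)
  ultimately show ?thesis using k i unfolding reduced_def by simp
qed

lemma reduced_Cons:
  assumes w: "w \<in> WB r" and i: "i \<in> {1..r}" and d: "\<not> left_desc (sgen r i) w" and k: "reduced w ks"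
  shows "reduced (sgen r i \<circ> w) (i # ks)"
proof (rule reduced_step)
  show "sgen r i \<circ> w \<in> WB r" using w sgen_WB[OF i] by blast
  show "left_desc (sgen r i) (sgen r i \<circ> w)" using B.desc_flip[OF sgen_gensB[OF i] w] d by blast
qed (use i k in simp_all)

lemma reduced_tail:
  assumes "reduced w (i # xs)"
  shows "i \<in> {1..r}" "left_desc (sgen r i) w" "reduced (sgen r i \<circ> w) xs"
proof -
  show i: "i \<in> {1..r}" using assms by (simp add: reduced_def)
  have w: "w \<in> WB r" by (rule reduced_WB[OF assms])
  let ?w = "sgen r i \<circ> w"
  have "w = sgen r i \<circ> compose_list (map (sgen r) xs)"
    using assms unfolding reduced_def list.map compose_list_Cons by blast
  then have c: "compose_list (map (sgen r) xs) = ?w" using i by simp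
  have "wlength (gensB r) (compose_list (map (sgen r) xs)) \<le> length xs"
    using wlength_le[OF gensB_words[of "xs"]] assms by (simp add: reduced_def)
  then have le: "wlength (gensB r) ?w \<le> length xs" unfolding c .
  have len: "Suc (length xs) = wlength (gensB r) w" using assms by (simp add: reduced_def)
  show d: "left_desc (sgen r i) w"
  proof (rule ccontr)
    assume "\<not> left_desc (sgen r i) w"
    then have "wlength (gensB r) ?w = Suc (wlength (gensB r) w)"
      using B.wlength_not_desc w i words_gensB sgen_gensB by blast
    then show False using le len by simp
  qed
  have "wlength (gensB r) w = Suc (wlength (gensB r) ?w)"
    using B.wlength_desc w i d words_gensB sgen_gensB by blast
  then show "reduced ?w xs" using assms c len by (simp add: reduced_def)
qed

lemma sgen_braid3:
  assumes "1 \<le> i" "i + 1 < r"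
  shows "sgen r i \<circ> sgen r (i+1) \<circ> sgen r i = sgen r (i+1) \<circ> sgen r i \<circ> sgen r (i+1)"
proof -
  have e: "sgen r i (i+1) = i" "sgen r i (i+2) = i+2" "sgen r (i+1) i = i" "sgen r (i+1) (i+1) = i+2"
    using assms by (auto simp: sgen_eval)
  have i: "i \<in> {1..r}" "i+1 \<in> {1..r}" "i \<in> {1..2*r}" "i+1 \<in> {1..2*r}" "i+2 \<in> {1..2*r}"
    using assms by auto
  have "sgen r i \<circ> sgen r (i+1) = reflection r i (i+2) \<circ> sgen r i"
    using reflection_conj[OF sgen_WB[OF i(1)] i(4,5)] sgen_reflection[OF i(2)] unfolding e by simp
  then have 1: "sgen r i \<circ> sgen r (i+1) \<circ> sgen r i = reflection r i (i+2)" using i by simp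
  have "sgen r (i+1) \<circ> sgen r i = reflection r i (i+2) \<circ> sgen r (i+1)"
    using reflection_conj[OF sgen_WB[OF i(2)] i(3,4)] sgen_reflection[OF i(1)] unfolding e by simp
  then show ?thesis using 1 i by simp
qed

lemma sgen_commute:
  assumes "1 \<le> i" "i + 2 \<le> j" "j \<le> r"
  shows "sgen r i \<circ> sgen r j = sgen r j \<circ> sgen r i"
proof -
  have "i \<in> {1..<r}" using assms by auto
  then have e: "sgen r i j = j" "sgen r i (j+1) = j+1"
    using assms by (auto simp: sgen_eval)
  have i: "i \<in> {1..r}" "j \<in> {1..r}" "j \<in> {1..2*r}" "j+1 \<in> {1..2*r}" using assms by auto
  show ?thesis
    using reflection_conj[OF sgen_WB[OF i(1)] i(3,4)] sgen_reflection[OF i(2)] unfolding e by simp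
qed

lemma sgen_last_eval:
  "sgen r (r-1) (r-1) = r" "sgen r (r-1) r = r-1" "sgen r (r-1) (r+1) = r+2" "sgen r (r-1) (r+2) = r+1"
  "sgen r r (r-1) = r-1" "sgen r r r = r+1" "sgen r r (r+1) = r" "sgen r r (r+2) = r+2"
proof -
  have i: "r-1 \<in> {1..<r}" using r2 by auto
  show "sgen r (r-1) (r-1) = r" "sgen r (r-1) r = r-1" "sgen r (r-1) (r+1) = r+2"
    "sgen r (r-1) (r+2) = r+1"
    unfolding sgen_eval[OF i] using r2 by auto
qed (use r2 in \<open>auto simp: sgen_r_eval\<close>)

lemma sgen_braid4:
  "sgen r (r-1) \<circ> sgen r r \<circ> sgen r (r-1) \<circ> sgen r r = sgen r r \<circ> sgen r (r-1) \<circ> sgen r r \<circ> sgen r (r-1)"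
proof -
  have "sgen r (r-1) = reflection r (r-1) r" using sgen_reflection[of "r-1" r] r2 by simp
  moreover have "reflection r (r+1) (r+2) = reflection r (r-1) r"
  proof -
    have m: "r \<in> {1..2*r}" "r-1 \<in> {1..2*r}" "r \<noteq> r-1" "2*r+1-r = r+1" "2*r+1-(r-1) = r+2"
      using r2 by auto
    show ?thesis using reflection_mirror[OF m(1,2,3)] reflection_commute[OF m(1,2)] unfolding m(4,5) by simp
  qed
  moreover have "dgen r r (r-1) = r+1" "dgen r r r = r+2" 
    by (simp_all only: dgen_def less_irrefl if_False comp_apply sgen_last_eval)
  moreover have "dgen r r \<in> WB r" "r-1 \<in> {1..2*r}" "r \<in> {1..2*r}" using dgen_WB r2 by auto
  ultimately have "sgen r (r-1) \<circ> dgen r r = dgen r r \<circ> sgen r (r-1)"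
    using reflection_conj[of "dgen r r" r "r-1" r] by simp
  then show ?thesis by (simp add: dgen_def comp_assoc)
qed

text \<open>Two reduced words with different first letters \<open>i\<close> and \<open>j\<close> are compared through a reduced
  word starting with the longest element of the dihedral group generated by the two letters.\<close>

lemma matsumoto_step:
  assumes IH: "\<And>w xs ys. length xs < n \<Longrightarrow> reduced w xs \<Longrightarrow> reduced w ys \<Longrightarrow> prodT xs = prodT ys"
    and xs: "reduced w (i # xs)" and ys: "reduced w (j # ys)" and n: "length xs < n" and ij: "i < j"
  shows "prodT (i # xs) = prodT (j # ys)"
proof -
  define v where "v = inv w"
  have w: "w \<in> WB r" using reduced_WB[OF xs] .
  have v: "v \<in> WB r" unfolding v_def using w by blast
  have i: "i \<in> {1..r}" "1 \<le> i" and j: "j \<in> {1..r}" "j \<le> r"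
    using reduced_tail(1)[OF xs] reduced_tail(1)[OF ys] by auto
  have di: "v (i+1) < v i" and dj: "v (j+1) < v j"
    using reduced_tail(2)[OF xs] reduced_tail(2)[OF ys] left_desc_sgen i j unfolding v_def by auto
  have isr: "reduced (sgen r i \<circ> w) xs" and jsr: "reduced (sgen r j \<circ> w) ys"
    using reduced_tail(3)[OF xs] reduced_tail(3)[OF ys] .
  have lenj: "length ys < n" using xs ys n by (simp add: reduced_def)
  have st: "reduced x (k # ks)" if "x \<in> WB r" "k \<in> {1..r}" "inv x (k+1) < inv x k" "reduced (sgen r k \<circ> x) ks"
    for x k ks using reduced_step[OF that(1,2) _ that(4)] that(2,3) left_desc_sgen by blast
  have W: "sgen r k \<circ> x \<in> WB r" if "k \<in> {1..r}" "x \<in> WB r" for k x using sgen_WB that by blast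
  note inv = inv_sgen_comp
  consider "i + 2 \<le> j" | "j = i + 1" "j < r" | "i = r - 1" "j = r" using ij j by fastforce
  then show ?thesis
  proof cases
    case 1
    have "i \<in> {1..<r}" using 1 i j by auto
    then have e: "sgen r i j = j" "sgen r i (j+1) = j+1"
      using 1 j by (auto simp: sgen_eval)
    have e2: "sgen r j i = i" "sgen r j (i+1) = i+1"
      using 1 i j by (cases "j < r"; auto simp: sgen_eval sgen_r_eval)+
    obtain ks where ks: "reduced (sgen r j \<circ> (sgen r i \<circ> w)) ks"
      using reduced_exists[OF W[OF j(1) W[OF i(1) w]]] by blast
    have 2: "sgen r i \<circ> (sgen r j \<circ> w) = sgen r j \<circ> (sgen r i \<circ> w)"
      using arg_cong[OF sgen_commute[OF i(2) 1 j(2)], of "\<lambda>x. x \<circ> w"] by (simp only: comp_assoc)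
    have "reduced (sgen r i \<circ> w) (j # ks)"
      by (rule st) (use W w i j ks dj in \<open>simp_all only: inv v_def[symmetric] comp_apply e\<close>)
    from IH[OF n isr this] have 3: "prodT xs = T j * prodT ks" by simp
    have "reduced (sgen r j \<circ> w) (i # ks)"
      by (rule st) (use W w i j ks di in \<open>simp_all only: inv v_def[symmetric] comp_apply e2 2\<close>)
    from IH[OF lenj jsr this] have 4: "prodT ys = T i * prodT ks" by simp
    have "T i * T j = T j * T i" by (rule T_commute) (use i j 1 in auto)
    then show ?thesis using 3 4 by (simp add: mult.assoc[symmetric])
  next
    case 2
    let ?i = "sgen r i" and ?j = "sgen r (i+1)"
    have j': "i+1 \<in> {1..r}" using j 2 by simp
    have r: "i \<in> {1..<r}" "i+1 \<in> {1..<r}" using 2 i by auto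
    have e: "?i i = i+1" "?i (i+1) = i" "?i (i+1+1) = i+1+1" "?j i = i" "?j (i+1) = i+1+1" "?j (i+1+1) = i+1"
      unfolding sgen_eval[OF r(1)] sgen_eval[OF r(2)] using r by auto
    have dj': "v (i+1+1) < v (i+1)" using dj 2 by simp
    have dij: "v (i+1+1) < v i" using di dj' by simp
    obtain ks where ks: "reduced (?i \<circ> (?j \<circ> (?i \<circ> w))) ks"
      using reduced_exists[OF W[OF i(1) W[OF j' W[OF i(1) w]]]] by blast
    have br: "?j \<circ> (?i \<circ> (?j \<circ> w)) = ?i \<circ> (?j \<circ> (?i \<circ> w))"
      using arg_cong[OF sgen_braid3, of i "\<lambda>x. x \<circ> w"] i 2 by (simp only: comp_assoc)
    have "reduced (?j \<circ> (?i \<circ> w)) (i # ks)"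
      by (rule st) (use W w i j' ks dj' in \<open>simp_all only: inv v_def[symmetric] comp_apply e\<close>)
    then have "reduced (?i \<circ> w) ((i+1) # i # ks)"
      by (rule st[rotated 3]) (use W w i j' dij in \<open>simp_all only: inv v_def[symmetric] comp_apply e\<close>)
    from IH[OF n isr this] have 3: "prodT xs = T (i+1) * (T i * prodT ks)" by simp
    have "reduced (?i \<circ> (?j \<circ> w)) ((i+1) # ks)"
      by (rule st) (use W w i j' ks di in \<open>simp_all only: inv v_def[symmetric] comp_apply e br\<close>)
    then have "reduced (?j \<circ> w) (i # (i+1) # ks)"
      by (rule st[rotated 3]) (use W w i j' dij in \<open>simp_all only: inv v_def[symmetric] comp_apply e\<close>)
    from IH[OF lenj jsr[unfolded 2(1)] this] have 4: "prodT ys = T i * (T (i+1) * prodT ks)" by simp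
    have "T i * T (i+1) * T i = T (i+1) * T i * T (i+1)" by (rule T_braid3) (use i 2 in auto)
    then show ?thesis using 3 4 2 by (simp add: mult.assoc[symmetric])
  next
    case 3
    let ?i = "sgen r (r-1)" and ?j = "sgen r r"
    have i': "r-1 \<in> {1..r}" and j': "r \<in> {1..r}" using i j 3 by auto
    have s: "r-1+1 = r" "r+2 = Suc (Suc r)" using r2 by auto
    note e = sgen_last_eval s
    have d1: "v r < v (r-1)" using di 3 r2 by simp
    have d2: "v (r+1) < v r" using dj 3 by simp
    have rr: "r \<in> {1..2*r}" "r-1 \<in> {1..2*r}" "2*r+1-r = r+1" "2*r+1-(r-1) = r+2" using r2 by auto
    have m: "v (r+1) = 2*r+1 - v r" "v (r+2) = 2*r+1 - v (r-1)"
      using WB_mirror[OF v rr(1)] WB_mirror[OF v rr(2)] unfolding rr(3,4) by blast+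
    have rg: "v (r-1) \<in> {1..2*r}" by (rule WB_range[OF v rr(2)])
    have d3: "v (r+2) < v (r+1)" unfolding m using d1 rg by auto
    have d4: "v (r+2) < v r" "v (r+2) < v (r-1)" "v (r+1) < v (r-1)" using d1 d2 d3 by auto
    obtain ks where ks: "reduced (?j \<circ> (?i \<circ> (?j \<circ> (?i \<circ> w)))) ks"
      using reduced_exists[OF W[OF j' W[OF i' W[OF j' W[OF i' w]]]]] by blast
    have br: "?i \<circ> (?j \<circ> (?i \<circ> (?j \<circ> w))) = ?j \<circ> (?i \<circ> (?j \<circ> (?i \<circ> w)))"
      using arg_cong[OF sgen_braid4, of "\<lambda>x. x \<circ> w"] by (simp only: comp_assoc)
    have "reduced (?i \<circ> (?j \<circ> (?i \<circ> w))) (r # ks)"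
      by (rule st) (use W w i' j' ks d2 in \<open>simp_all only: inv v_def[symmetric] comp_apply e(1-9)\<close>)
    then have "reduced (?j \<circ> (?i \<circ> w)) ((r-1) # r # ks)"
      by (rule st[rotated 3]) (use W w i' j' d4 in \<open>simp_all only: inv v_def[symmetric] comp_apply e(1-9)\<close>)
    then have "reduced (?i \<circ> w) (r # (r-1) # r # ks)"
      by (rule st[rotated 3]) (use W w i' j' d4 in \<open>simp_all only: inv v_def[symmetric] comp_apply e(1-9)\<close>)
    from IH[OF n isr[unfolded 3(1)] this] have 5: "prodT xs = T r * (T (r-1) * (T r * prodT ks))" by simp
    have "reduced (?j \<circ> (?i \<circ> (?j \<circ> w))) ((r-1) # ks)"
      by (rule st) (use W w i' j' ks d3 in \<open>simp_all only: inv v_def[symmetric] comp_apply e(1-9) br\<close>)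
    then have "reduced (?i \<circ> (?j \<circ> w)) (r # (r-1) # ks)"
      by (rule st[rotated 3]) (use W w i' j' d4 in \<open>simp_all only: inv v_def[symmetric] comp_apply e(1-9)\<close>)
    then have "reduced (?j \<circ> w) ((r-1) # r # (r-1) # ks)"
      by (rule st[rotated 3]) (use W w i' j' d4 in \<open>simp_all only: inv v_def[symmetric] comp_apply e(1-9)\<close>)
    from IH[OF lenj jsr[unfolded 3(2)] this] have 6: "prodT ys = T (r-1) * (T r * (T (r-1) * prodT ks))"
      by simp
    show ?thesis using 5 6 T_braid4 3 by (simp add: mult.assoc[symmetric])
  qed
qed

lemma matsumoto: "reduced w xs \<Longrightarrow> reduced w ys \<Longrightarrow> prodT xs = prodT ys"
proof (induction "length xs" arbitrary: w "xs" ys rule: less_induct)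
  case less
  have len: "length ys = length xs" using less.prems by (simp add: reduced_def)
  show ?case
  proof (cases "xs")
    case Nil
    then show ?thesis using len by simp
  next
    case (Cons i xs')
    then obtain j ys' where ys: "ys = j # ys'" using len by (cases ys) auto
    have IH: "\<And>w ks ls. length ks < length xs \<Longrightarrow> reduced w ks \<Longrightarrow> reduced w ls \<Longrightarrow> prodT ks = prodT ls"
      using less.hyps by blast
    consider "i = j" | "i < j" | "j < i" by linarith
    then show ?thesis
    proof cases
      case 1
      have "prodT xs' = prodT ys'"
        using IH[of xs' "sgen r i \<circ> w" ys'] reduced_tail(3) less.prems unfolding Cons ys 1 by simp
      then show ?thesis using Cons ys 1 by simp
    next
      case 2
      show ?thesis
        using matsumoto_step[where n="length xs" and w=w and i=i and xs=xs' and j=j and ys=ys', OF IH] less.prems 2 len unfolding Cons ys by simp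
    next
      case 3
      show ?thesis
        using matsumoto_step[where n="length xs" and w=w and i=j and xs=ys' and j=i and ys=xs', OF IH] less.prems 3 len unfolding Cons ys by simp
    qed
  qed
qed

abbreviation TW :: "(nat \<Rightarrow> nat) \<Rightarrow> 'r hecke" where "TW \<equiv> Tw"

lemma TW_reduced:
  assumes "reduced w xs" shows "TW w = prodT xs"
  unfolding Tw_def card_r
proof (rule the_equality)
  show "\<exists>ys. set ys \<subseteq> {1..r} \<and> compose_list (map (sgen r) ys) = w \<and>
      length ys = wlength (gensB r) w \<and> prodT xs = prod_list (map Tgen ys)"
    using assms unfolding reduced_def prodT_def by blast
  fix h :: "'r hecke" assume "\<exists>ys. set ys \<subseteq> {1..r} \<and> compose_list (map (sgen r) ys) = w \<and>
      length ys = wlength (gensB r) w \<and> h = prod_list (map Tgen ys)"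
  then obtain ys where "reduced w ys" "h = prodT ys" unfolding reduced_def prodT_def by blast
  then show "h = prodT xs" using matsumoto[OF _ assms] by simp
qed

lemma TW_id [simp]: "TW id = 1"
proof -
  have "reduced id []" by (simp add: reduced_def)
  from TW_reduced[OF this] show ?thesis by simp
qed

lemma TW_left:
  assumes "w \<in> WB r" "i \<in> {1..r}" "\<not> left_desc (sgen r i) w"
  shows "TW (sgen r i \<circ> w) = T i * TW w"
proof -
  obtain ks where "reduced w ks" using reduced_exists[OF assms(1)] by blast
  then show ?thesis using TW_reduced reduced_Cons[OF assms] by fastforce
qed

text \<open>The relation \<open>T r * T r = 1\<close> makes the rule independent of whether the length grows.\<close>

lemma TW_left_last:
  assumes "w \<in> WB r" shows "TW (sgen r r \<circ> w) = T r * TW w"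
proof (cases "left_desc (sgen r r) w")
  case False
  then show ?thesis using TW_left assms r2 by simp
next
  case True
  have r: "r \<in> {1..r}" using r2 by simp
  have "\<not> left_desc (sgen r r) (sgen r r \<circ> w)" "sgen r r \<circ> w \<in> WB r"
    using B.desc_flip[OF sgen_gensB[OF r] assms] True sgen_WB[OF r] assms by auto
  from TW_left[OF this(2) r this(1)] have "TW w = T r * TW (sgen r r \<circ> w)" using r by simp
  then have "T r * TW w = (T r * T r) * TW (sgen r r \<circ> w)" by (simp add: mult.assoc)
  then show ?thesis by (simp add: T_last)
qed

lemma reduced_rev:
  assumes "reduced w xs" shows "reduced (inv w) (rev xs)"
proof -
  have inv: "compose_list (map (sgen r) (rev ys)) = inv (compose_list (map (sgen r) ys))"
    if "set ys \<subseteq> {1..r}" for ys using that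
  proof (induction ys)
    case Nil
    have "compose_list (map (sgen r) (rev [])) = id" "inv (compose_list (map (sgen r) [])) = id"
      by (simp_all only: rev.simps list.map compose_list_Nil inv_id)
    then show ?case by metis
  next
    case (Cons i ys)
    have i: "i \<in> {1..r}" and "set ys \<subseteq> {1..r}" using Cons.prems by auto
    then have c: "compose_list (map (sgen r) ys) \<in> WB r" using B.compose_list_in[OF gensB_words] by blast
    have "compose_list (map (sgen r) (rev (i # ys))) = compose_list (map (sgen r) (rev ys)) \<circ> sgen r i"
      by (simp only: rev.simps map_append list.map compose_list_append compose_list_Cons
          compose_list_Nil comp_id)
    also have "\<dots> = inv (compose_list (map (sgen r) (i # ys)))"
      using inv_sgen_comp[OF i c] Cons by (simp only: list.map compose_list_Cons set_simps) simp
    finally show ?case .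
  qed
  have len: "wlength (gensB r) (inv x) \<le> wlength (gensB r) x" if x: "x \<in> WB r" for x
  proof -
    obtain ks where ks: "reduced x ks" using reduced_exists[OF x] by blast
    then have s: "set ks \<subseteq> {1..r}" by (simp add: reduced_def)
    have "wlength (gensB r) (compose_list (map (sgen r) (rev ks))) \<le> length (map (sgen r) (rev ks))"
      by (rule wlength_le[OF gensB_words]) (use s in simp)
    then show ?thesis using ks inv[OF s] by (simp add: reduced_def)
  qed
  have w: "w \<in> WB r" using reduced_WB[OF assms] .
  have "wlength (gensB r) (inv w) = wlength (gensB r) w"
    using len[OF w] len[OF WB_inv[OF w]] WB_inv_inv[OF w] by simp
  then show ?thesis using assms inv[of "xs"] by (simp add: reduced_def)
qed

lemma wlength_inv: "w \<in> WB r \<Longrightarrow> wlength (gensB r) (inv w) = wlength (gensB r) w"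
  using reduced_exists[of w] reduced_rev[of w] by (auto simp: reduced_def)

lemma TW_right:
  assumes w: "w \<in> WB r" and i: "i \<in> {1..r}" and d: "\<not> left_desc (sgen r i) (inv w)"
  shows "TW (w \<circ> sgen r i) = TW w * T i"
proof -
  obtain ks where ks: "reduced (inv w) ks" using reduced_exists[OF WB_inv[OF w]] by blast
  have "reduced (inv (sgen r i \<circ> inv w)) (rev (i # ks))"
    by (rule reduced_rev[OF reduced_Cons[OF WB_inv[OF w] i d ks]])
  then have "reduced (w \<circ> sgen r i) (rev ks @ [i])" using inv_sgen_comp[OF i WB_inv[OF w]] w by simp
  moreover have "reduced w (rev ks)" using reduced_rev[OF ks] w by simp
  ultimately show ?thesis using TW_reduced by fastforce
qed

lemma TW_right_last:
  assumes "w \<in> WB r" shows "TW (w \<circ> sgen r r) = TW w * T r"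
proof (cases "left_desc (sgen r r) (inv w)")
  case False
  then show ?thesis using TW_right assms r2 by simp
next
  case True
  have r: "r \<in> {1..r}" using r2 by simp
  have i: "inv (w \<circ> sgen r r) = sgen r r \<circ> inv w"
    using WB_inv_distrib[OF assms sgen_WB[OF r]] sgen_inv[OF r] by simp
  have "\<not> left_desc (sgen r r) (inv (w \<circ> sgen r r))" "w \<circ> sgen r r \<in> WB r"
    unfolding i using B.desc_flip[OF sgen_gensB[OF r] WB_inv[OF assms]] True sgen_WB[OF r] assms by auto
  from TW_right[OF this(2) r this(1)] have "TW w = TW (w \<circ> sgen r r) * T r" using r by simp
  then have "TW w * T r = TW (w \<circ> sgen r r) * (T r * T r)" by (simp add: mult.assoc)
  then show ?thesis by (simp add: T_last)
qed

text \<open>The product for \<open>i = r\<close> is the basis element of \<open>dgen r r\<close>, conjugate to \<open>T (r-1)\<close> by the involution \<open>T r\<close>. All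
  \<open>Tdgen i\<close> therefore satisfy the same quadratic relation and multiply the basis as a type D Hecke algebra does.\<close>

definition Tdgen :: "nat \<Rightarrow> 'r hecke" where
  "Tdgen i = (if i < r then T i else T r * T (r-1) * T r)"

text \<open>Multiplication by \<open>T r\<close> follows the group multiplication without a condition on lengths, so only the middle
  factor \<open>T (r-1)\<close> has to be tested; its descent condition for \<open>sgen r r \<circ> w\<close> is the one of \<open>dgen r r\<close> for \<open>w\<close>.\<close>

lemma Tdgen_left:
  assumes w: "w \<in> WB r" and i: "i \<in> {1..r}" and d: "\<not> left_desc (dgen r i) w"
  shows "TW (dgen r i \<circ> w) = Tdgen i * TW w"
proof (cases "i < r")
  case True
  then show ?thesis using TW_left[OF w i] d by (simp add: dgen_def Tdgen_def)
next
  case False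
  then have ir: "i = r" using i by simp
  have r: "r \<in> {1..r}" "r-1 \<in> {1..r}" using r2 by auto
  have W: "sgen r r \<circ> w \<in> WB r" "sgen r (r-1) \<circ> (sgen r r \<circ> w) \<in> WB r"
    using w sgen_WB r by blast+
  have "\<not> inv w (r+1) < inv w (r-1)" using d left_desc_dgen[OF r(1)] unfolding ir by (simp add: dgen_lo_def dgen_hi_def)
  moreover have "r-1+1 = r" using r2 by simp
  ultimately have "\<not> left_desc (sgen r (r-1)) (sgen r r \<circ> w)"
    unfolding left_desc_sgen[OF r(2)] inv_sgen_comp[OF r(1) w] comp_apply sgen_last_eval by (simp only: sgen_last_eval) simp
  from TW_left[OF W(1) r(2) this] show ?thesis
    using TW_left_last[OF w] TW_left_last[OF W(2)] ir
    by (simp add: dgen_def Tdgen_def comp_assoc mult.assoc)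
qed

lemma Tdgen_right:
  assumes w: "w \<in> WB r" and i: "i \<in> {1..r}" and d: "\<not> left_desc (dgen r i) (inv w)"
  shows "TW (w \<circ> dgen r i) = TW w * Tdgen i"
proof (cases "i < r")
  case True
  then show ?thesis using TW_right[OF w i] d by (simp add: dgen_def Tdgen_def)
next
  case False
  then have ir: "i = r" using i by simp
  have r: "r \<in> {1..r}" "r-1 \<in> {1..r}" using r2 by auto
  have W: "w \<circ> sgen r r \<in> WB r" "w \<circ> sgen r r \<circ> sgen r (r-1) \<in> WB r"
    using w sgen_WB r by blast+
  have "\<not> w (r+1) < w (r-1)" using d left_desc_dgen[OF r(1), of "inv w"] w unfolding ir
    by (simp add: dgen_lo_def dgen_hi_def)
  moreover have "r-1+1 = r" using r2 by simp
  ultimately have "\<not> left_desc (sgen r (r-1)) (inv (w \<circ> sgen r r))"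
    unfolding left_desc_sgen[OF r(2)] WB_inv_inv[OF W(1)] comp_apply by (simp only: sgen_last_eval) simp
  from TW_right[OF W(1) r(2) this] show ?thesis
    using TW_right_last[OF w] TW_right_last[OF W(2)] ir
    by (simp add: dgen_def Tdgen_def comp_assoc mult.assoc)
qed

lemma Tdgen_quad:
  assumes "i \<in> {1..r}" shows "Tdgen i * Tdgen i = hscalar (q - 1) * Tdgen i + hscalar q"
proof (cases "i < r")
  case True
  then show ?thesis using T_quad[of i] assms by (simp add: Tdgen_def)
next
  case False
  have "Tdgen i * Tdgen i = T r * (T (r-1) * ((T r * T r) * (T (r-1) * T r)))"
    using False by (simp add: Tdgen_def mult.assoc)
  also have "\<dots> = T r * ((T (r-1) * T (r-1)) * T r)" by (simp add: T_last mult.assoc)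
  also have "\<dots> = T r * (hscalar (q-1) * T (r-1) + hscalar q) * T r"
    using T_quad[of "r-1"] r2 by (simp add: mult.assoc)
  also have "\<dots> = hscalar (q-1) * (T r * T (r-1) * T r) + hscalar q * (T r * T r)"
    by (simp only: distrib_left distrib_right mult.assoc hscalar_left_commute)
  finally show ?thesis using False by (simp add: T_last Tdgen_def)
qed

lemma Tdgen_right_desc:
  assumes w: "w \<in> WB r" and i: "i \<in> {1..r}" and d: "left_desc (dgen r i) (inv w)"
  shows "TW w * Tdgen i = hscalar (q - 1) * TW w + hscalar q * TW (w \<circ> dgen r i)"
proof -
  let ?w = "w \<circ> dgen r i"
  have W: "?w \<in> WB r" using w dgen_WB[OF i] by blast
  have iw: "inv ?w = dgen r i \<circ> inv w"
    using WB_inv_distrib[OF w dgen_WB[OF i]] dgen_inv[OF i] by simp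
  have "dgen r i \<in> gensD r" using gensD_dgen i by blast
  then have "\<not> left_desc (dgen r i) (inv ?w)"
    unfolding iw using D.desc_flip[OF _ WB_inv[OF w]] d by blast
  from Tdgen_right[OF W i this] have e: "TW w = TW ?w * Tdgen i" using i by simp
  then have "TW w * Tdgen i = TW ?w * (Tdgen i * Tdgen i)" by (simp add: mult.assoc)
  also have "\<dots> = hscalar (q-1) * (TW ?w * Tdgen i) + hscalar q * TW ?w"
    unfolding Tdgen_quad[OF i] distrib_left hscalar_left_commute hscalar_commute[of _ "TW ?w"] ..
  finally show ?thesis using e by simp
qed

end

section \<open>Sums over cosets of block stabilisers\<close>

context hecke_rank
begin

definition Tsum :: "(nat \<Rightarrow> nat) set \<Rightarrow> 'r hecke" where
  "Tsum D = (\<Sum>w\<in>D. TW w)"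

text \<open>Cosets \<open>stabD r \<beta> \<circ> y\<close> are represented by elements with a sorted inverse, cosets \<open>y \<circ> stabD r \<beta>\<close> by sorted elements.\<close>

definition sortedL :: "(nat \<Rightarrow> nat) \<Rightarrow> (nat \<Rightarrow> nat) set \<Rightarrow> (nat \<Rightarrow> nat) set" where
  "sortedL \<beta> D = {y\<in>D. block_inversions r \<beta> (inv y) = {}}"

definition sortedR :: "(nat \<Rightarrow> nat) \<Rightarrow> (nat \<Rightarrow> nat) set \<Rightarrow> (nat \<Rightarrow> nat) set" where
  "sortedR \<beta> D = {y\<in>D. block_inversions r \<beta> y = {}}"

text \<open>Since the inverse of \<open>y\<close> is sorted, a reduced word of \<open>u\<close> also prolongs \<open>y\<close> step by step. The multiplication is a parameter in
  order to cover products \<open>y \<circ> u\<close> as well, by passing to inverses, where factors are interchanged.\<close>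

lemma sorted_multiplicative:
  fixes F :: "(nat \<Rightarrow> nat) \<Rightarrow> 'h" and mul :: "'h \<Rightarrow> 'h \<Rightarrow> 'h"
  assumes l: "labelling r K \<beta>" and y: "y \<in> WB r" and s: "block_inversions r \<beta> (inv y) = {}" and u: "u \<in> stabD r \<beta>"
    and unit: "mul (F id) (F y) = F y" and assoc: "\<And>a b c. mul (mul a b) c = mul a (mul b c)"
    and rule: "\<And>i w. i \<in> {1..r} \<Longrightarrow> w \<in> WB r \<Longrightarrow> \<not> left_desc (dgen r i) w \<Longrightarrow> F (dgen r i \<circ> w) = mul (t i) (F w)"
  shows "F (u \<circ> y) = mul (F u) (F y)"
  using l u
proof (induction rule: stabD_induct)
  case id
  show ?case unfolding unit id_comp ..
next
  case (step i u)
  have i: "i \<in> {1..r}" using step block_gens_labelling by blast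
  have u: "u \<in> WB r" using step stabD_WB by blast
  have "\<not> left_desc (dgen r i) (u \<circ> y)" using sorted_left_desc[OF l y s step(2,1)] step(3) by blast
  then have "F (dgen r i \<circ> (u \<circ> y)) = mul (t i) (F (u \<circ> y))" using rule[OF i WB_comp[OF u y]] by blast
  also have "\<dots> = mul (F (dgen r i \<circ> u)) (F y)" unfolding step(4) rule[OF i u step(3)] assoc ..
  finally show ?case unfolding comp_assoc .
qed

lemma TW_stabD_left:
  assumes "labelling r K \<beta>" "y \<in> WB r" "block_inversions r \<beta> (inv y) = {}" "u \<in> stabD r \<beta>"
  shows "TW (u \<circ> y) = TW u * TW y"
proof (rule sorted_multiplicative[OF assms, where t=Tdgen])
  show "TW id * TW y = TW y" unfolding TW_id by simp
qed (use Tdgen_left mult.assoc in blast)+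

lemma TW_stabD_right:
  assumes l: "labelling r K \<beta>" and y: "y \<in> WB r" and s: "block_inversions r \<beta> y = {}" and u: "u \<in> stabD r \<beta>"
  shows "TW (y \<circ> u) = TW y * TW u"
proof -
  have uW: "u \<in> WB r" using u stabD_WB by blast
  have "TW (inv (inv u \<circ> inv y)) = TW (inv (inv y)) * TW (inv (inv u))"
  proof (rule sorted_multiplicative[OF l WB_inv[OF y] _ stabD_inv[OF u], where F="\<lambda>w. TW (inv w)" and mul="\<lambda>a b. b * a" and t=Tdgen])
    show "block_inversions r \<beta> (inv (inv y)) = {}" using s y by simp
    fix i w assume i: "i \<in> {1..r}" and w: "w \<in> WB r" and d: "\<not> left_desc (dgen r i) w"
    show "TW (inv (dgen r i \<circ> w)) = TW (inv w) * Tdgen i"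
      unfolding inv_dgen_comp[OF i w] by (rule Tdgen_right[OF WB_inv[OF w] i]) (use w d in simp)
  qed (simp_all add: mult.assoc inv_id)
  moreover have "inv (inv u \<circ> inv y) = y \<circ> u"
    using WB_inv_distrib[OF WB_inv[OF uW] WB_inv[OF y]] y uW by simp
  ultimately show ?thesis using y uW by simp
qed

text \<open>Every coset of the stabiliser contains exactly one element with a sorted inverse.\<close>

lemma coset_bij:
  assumes l: "labelling r K \<beta>" and D: "D \<subseteq> WB r" and cl: "\<And>u y. u \<in> stabD r \<beta> \<Longrightarrow> y \<in> D \<Longrightarrow> u \<circ> y \<in> D"
  shows "bij_betw (\<lambda>(u,y). u \<circ> y) (stabD r \<beta> \<times> sortedL \<beta> D) D"
proof (rule bij_betw_imageI)
  show "inj_on (\<lambda>(u,y). u \<circ> y) (stabD r \<beta> \<times> sortedL \<beta> D)"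
  proof (rule inj_onI)
    fix p p' assume p: "p \<in> stabD r \<beta> \<times> sortedL \<beta> D" "p' \<in> stabD r \<beta> \<times> sortedL \<beta> D"
      and e: "(\<lambda>(u,y). u \<circ> y) p = (\<lambda>(u,y). u \<circ> y) p'"
    obtain u y u' y' where pp: "p = (u,y)" "p' = (u',y')" by (cases p, cases p')
    have *: "u \<in> stabD r \<beta>" "u' \<in> stabD r \<beta>" "y \<in> WB r" "y' \<in> WB r" "block_inversions r \<beta> (inv y) = {}"
      "block_inversions r \<beta> (inv y') = {}" "u \<in> WB r" "u' \<in> WB r"
      using p D stabD_WB unfolding pp sortedL_def by auto
    have uy: "u \<circ> y = u' \<circ> y'" using e unfolding pp by simp
    have "(inv u' \<circ> u) \<circ> y = inv u' \<circ> (u' \<circ> y')" unfolding comp_assoc uy ..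
    also have "\<dots> = y'" using * by simp
    finally have y': "(inv u' \<circ> u) \<circ> y = y'" .
    have "inv u' \<circ> u = id"
      by (rule sorted_rep_unique[OF l *(3,5)]) (use * stabD_comp stabD_inv y' in auto)
    moreover then have "u = u'" using * by (metis WB_cancel(2) comp_id)
    ultimately show "p = p'" using y' pp by simp
  qed
  show "(\<lambda>(u,y). u \<circ> y) ` (stabD r \<beta> \<times> sortedL \<beta> D) = D"
  proof (intro equalityI subsetI)
    fix w assume w: "w \<in> D"
    then have W: "w \<in> WB r" using D by blast
    obtain u where u: "u \<in> stabD r \<beta>" "block_inversions r \<beta> (inv (u \<circ> w)) = {}"
      using sorted_rep_exists[OF l W] by blast
    have "w = inv u \<circ> (u \<circ> w)" using stabD_WB[OF u(1)] by simp
    moreover have "u \<circ> w \<in> sortedL \<beta> D" using u cl w by (simp add: sortedL_def)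
    ultimately show "w \<in> (\<lambda>(u,y). u \<circ> y) ` (stabD r \<beta> \<times> sortedL \<beta> D)"
      using stabD_inv[OF u(1)] by (intro image_eqI[of _ _ "(inv u, u \<circ> w)"]) auto
  qed (use cl in \<open>auto simp: sortedL_def\<close>)
qed

text \<open>Every element of \<open>D\<close> factors uniquely into a stabiliser element and one with a sorted inverse, and the basis
  is multiplicative on such factorisations.\<close>

lemma left_decomp:
  assumes l: "labelling r K \<beta>" and D: "D \<subseteq> WB r" and cl: "\<And>u y. u \<in> stabD r \<beta> \<Longrightarrow> y \<in> D \<Longrightarrow> u \<circ> y \<in> D"
  shows "Tsum D = Tsum (stabD r \<beta>) * Tsum (sortedL \<beta> D)"
proof -
  have "Tsum (stabD r \<beta>) * Tsum (sortedL \<beta> D) = (\<Sum>(u,y)\<in>stabD r \<beta> \<times> sortedL \<beta> D. TW u * TW y)"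
    unfolding Tsum_def sum_product by (simp add: sum.cartesian_product)
  also have "\<dots> = (\<Sum>p\<in>stabD r \<beta> \<times> sortedL \<beta> D. TW ((\<lambda>(u,y). u \<circ> y) p))"
    by (rule sum.cong) (use D TW_stabD_left[OF l] in \<open>auto simp: sortedL_def\<close>)
  also have "\<dots> = Tsum D" unfolding Tsum_def by (rule sum.reindex_bij_betw[OF coset_bij[OF assms]])
  finally show ?thesis ..
qed

lemma right_decomp:
  assumes l: "labelling r K \<beta>" and D: "D \<subseteq> WB r" and cl: "\<And>u y. u \<in> stabD r \<beta> \<Longrightarrow> y \<in> D \<Longrightarrow> y \<circ> u \<in> D"
  shows "Tsum D = Tsum (sortedR \<beta> D) * Tsum (stabD r \<beta>)"
proof -
  have ii: "inv (inv w) = w" if "w \<in> D" for w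
    using that D WB_inv_inv[of w r] by blast
  have inj: "inj_on inv X" if "X \<subseteq> WB r" for X
    by (rule inj_on_inverseI[of _ inv]) (use that WB_inv_inv[of _ r] in blast)
  have iD: "inv ` D \<subseteq> WB r" using D by auto
  have icl: "u \<circ> y \<in> inv ` D" if u: "u \<in> stabD r \<beta>" and y: "y \<in> inv ` D" for u y
  proof -
    obtain z where z: "z \<in> D" "y = inv z" using y by blast
    have "u \<circ> y = inv (z \<circ> inv u)"
      using WB_inv_distrib[OF _ WB_inv[OF stabD_WB[OF u]], of z] z D stabD_WB[OF u] by auto
    then show ?thesis using cl[OF stabD_inv[OF u] z(1)] by blast
  qed
  have R: "inv ` sortedR \<beta> D = sortedL \<beta> (inv ` D)"
    using ii unfolding sortedR_def sortedL_def by auto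
  have RW: "sortedR \<beta> D \<subseteq> WB r" using D by (auto simp: sortedR_def)
  have PI: "inv ` stabD r \<beta> = stabD r \<beta>"
  proof
    show "inv ` stabD r \<beta> \<subseteq> stabD r \<beta>" using stabD_inv by blast
    show "stabD r \<beta> \<subseteq> inv ` stabD r \<beta>"
    proof
      fix u assume u: "u \<in> stabD r \<beta>"
      then have "u = inv (inv u)" using WB_inv_inv[OF stabD_WB] by metis
      then show "u \<in> inv ` stabD r \<beta>" using stabD_inv[OF u] by blast
    qed
  qed
  have "Tsum D = (\<Sum>w\<in>inv ` D. TW (inv w))"
    unfolding Tsum_def by (subst sum.reindex[OF inj[OF D]]) (auto simp: ii)
  also have "\<dots> = (\<Sum>p\<in>stabD r \<beta> \<times> sortedL \<beta> (inv ` D). TW (inv ((\<lambda>(u,y). u \<circ> y) p)))"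
    by (rule sum.reindex_bij_betw[OF coset_bij[OF l iD icl], symmetric])
  also have "\<dots> = (\<Sum>(u,y)\<in>stabD r \<beta> \<times> sortedL \<beta> (inv ` D). TW (inv y) * TW (inv u))"
  proof (rule sum.cong[OF HOL.refl], clarify)
    fix u y assume u: "u \<in> stabD r \<beta>" and y: "y \<in> sortedL \<beta> (inv ` D)"
    have yW: "y \<in> WB r" and s: "block_inversions r \<beta> (inv y) = {}" using y iD by (auto simp: sortedL_def)
    have "TW (inv y \<circ> inv u) = TW (inv y) * TW (inv u)"
      by (rule TW_stabD_right[OF l WB_inv[OF yW] s stabD_inv[OF u]])
    then show "TW (inv (u \<circ> y)) = TW (inv y) * TW (inv u)"
      using WB_inv_distrib[OF stabD_WB[OF u] yW] by simp
  qed
  also have "\<dots> = (\<Sum>u\<in>stabD r \<beta>. \<Sum>y\<in>sortedL \<beta> (inv ` D). TW (inv y) * TW (inv u))"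
    by (simp add: sum.cartesian_product)
  also have "\<dots> = (\<Sum>y\<in>sortedL \<beta> (inv ` D). TW (inv y)) * (\<Sum>u\<in>stabD r \<beta>. TW (inv u))"
    unfolding sum_product by (rule sum.swap)
  also have "(\<Sum>y\<in>sortedL \<beta> (inv ` D). TW (inv y)) = Tsum (sortedR \<beta> D)"
    unfolding R[symmetric] Tsum_def by (subst sum.reindex[OF inj[OF RW]]) (auto simp: ii sortedR_def)
  also have "(\<Sum>u\<in>stabD r \<beta>. TW (inv u)) = Tsum (stabD r \<beta>)"
  proof -
    have PW: "stabD r \<beta> \<subseteq> WB r" using stabD_WB by blast
    have "Tsum (inv ` stabD r \<beta>) = (\<Sum>u\<in>stabD r \<beta>. TW (inv u))"
      unfolding Tsum_def by (subst sum.reindex[OF inj[OF PW]]) simp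
    then show ?thesis unfolding PI by simp
  qed
  finally show ?thesis .
qed

text \<open>Right multiplication by the generator pairs the stabiliser elements that have it as a descent with those that
  do not. The sum over such a pair is an eigenvector of \<open>Tdgen i\<close> with eigenvalue \<open>q\<close>.\<close>

lemma stabD_Tdgen:
  assumes l: "labelling r K \<beta>" and i: "i \<in> block_gens r \<beta>"
  shows "Tsum (stabD r \<beta>) * Tdgen i = hscalar q * Tsum (stabD r \<beta>)"
proof -
  note i' = block_gens_labelling[OF i]
  let ?s = "dgen r i"
  define Pa where "Pa = {u\<in>stabD r \<beta>. \<not> left_desc ?s (inv u)}"
  define Pd where "Pd = {u\<in>stabD r \<beta>. left_desc ?s (inv u)}"
  have fin: "finite Pa" "finite Pd" unfolding Pa_def Pd_def by auto
  have split: "stabD r \<beta> = Pa \<union> Pd" "Pa \<inter> Pd = {}" unfolding Pa_def Pd_def by auto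
  have flip: "u \<circ> ?s \<in> stabD r \<beta> \<and> (left_desc ?s (inv (u \<circ> ?s)) \<longleftrightarrow> \<not> left_desc ?s (inv u))" if u: "u \<in> stabD r \<beta>" for u
  proof -
    have W: "u \<in> WB r" using u stabD_WB by blast
    have "inv (u \<circ> ?s) = ?s \<circ> inv u"
      using WB_inv_distrib[OF W dgen_WB[OF i']] dgen_inv[OF i'] by simp
    moreover have "?s \<in> gensD r" using gensD_dgen i' by blast
    ultimately show ?thesis
      using D.desc_flip[OF _ WB_inv[OF W]] stabD_comp[OF u dgen_stabD[OF l i]] by simp
  qed
  have bij: "bij_betw (\<lambda>u. u \<circ> ?s) Pa Pd" "bij_betw (\<lambda>u. u \<circ> ?s) Pd Pa"
    by (rule bij_betw_byWitness[where f'="\<lambda>u. u \<circ> ?s"];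
        use flip i' in \<open>auto simp: Pa_def Pd_def\<close>)+
  have sw: "(\<Sum>u\<in>Pa. TW (u \<circ> ?s)) = Tsum Pd" "(\<Sum>u\<in>Pd. TW (u \<circ> ?s)) = Tsum Pa"
    unfolding Tsum_def by (rule sum.reindex_bij_betw[OF bij(1)], rule sum.reindex_bij_betw[OF bij(2)])
  have "Tsum Pa * Tdgen i = (\<Sum>u\<in>Pa. TW (u \<circ> ?s))"
    unfolding Tsum_def sum_distrib_right
    by (rule sum.cong) (use Tdgen_right[OF stabD_WB i'] in \<open>auto simp: Pa_def\<close>)
  then have a: "Tsum Pa * Tdgen i = Tsum Pd" using sw by simp
  have "Tsum Pd * Tdgen i = (\<Sum>u\<in>Pd. hscalar (q - 1) * TW u + hscalar q * TW (u \<circ> ?s))"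
    unfolding Tsum_def sum_distrib_right
    by (rule sum.cong) (use Tdgen_right_desc[OF stabD_WB i'] in \<open>auto simp: Pd_def\<close>)
  then have d: "Tsum Pd * Tdgen i = hscalar (q - 1) * Tsum Pd + hscalar q * Tsum Pa"
    using sw by (simp add: sum.distrib sum_distrib_left[symmetric]) (simp add: Tsum_def)
  have t: "Tsum (stabD r \<beta>) = Tsum Pa + Tsum Pd"
    unfolding split(1) Tsum_def by (rule sum.union_disjoint[OF fin split(2)])
  have "Tsum (stabD r \<beta>) * Tdgen i = Tsum Pd + (hscalar (q - 1) * Tsum Pd + hscalar q * Tsum Pa)"
    unfolding t distrib_right a d ..
  also have "\<dots> = hscalar q * (Tsum Pa + Tsum Pd)"
    unfolding hscalar_diff by (simp add: algebra_simps)
  finally show ?thesis unfolding t .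
qed

lemma stabD_coset_gen:
  fixes y :: "nat \<Rightarrow> nat"
  assumes l: "labelling r K \<beta>" and g: "g \<in> stabD r \<beta>"
  shows "(\<lambda>u. u \<circ> (g \<circ> y)) ` stabD r \<beta> = (\<lambda>u. u \<circ> y) ` stabD r \<beta>"
proof (intro equalityI subsetI)
  fix w assume "w \<in> (\<lambda>u. u \<circ> (g \<circ> y)) ` stabD r \<beta>"
  then obtain u where "u \<in> stabD r \<beta>" "w = (u \<circ> g) \<circ> y" by (auto simp: comp_assoc)
  then show "w \<in> (\<lambda>u. u \<circ> y) ` stabD r \<beta>" using stabD_comp[OF _ g] by blast
next
  fix w assume "w \<in> (\<lambda>u. u \<circ> y) ` stabD r \<beta>"
  then obtain u where u: "u \<in> stabD r \<beta>" "w = u \<circ> y" by auto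
  have "w = (u \<circ> inv g) \<circ> (g \<circ> y)" unfolding u(2) by (simp only: comp_assoc WB_cancel(1)[OF stabD_WB[OF g]])
  then show "w \<in> (\<lambda>u. u \<circ> (g \<circ> y)) ` stabD r \<beta>" using stabD_comp[OF u(1) stabD_inv[OF g]] by blast
qed

text \<open>Descents are removed from \<open>y\<close> one after the other. Each of them is absorbed by the sum over the stabiliser
  with a factor \<open>q\<close>, leaves the coset unchanged and removes two inversions within the blocks.\<close>

lemma stabD_TW:
  assumes l: "labelling r K \<beta>" and y: "y \<in> WB r"
  shows "Tsum (stabD r \<beta>) * TW y
    = hscalar (q ^ (card (block_inversions r \<beta> (inv y)) div 2)) * Tsum ((\<lambda>u. u \<circ> y) ` stabD r \<beta>)"
  using y
proof (induction "card (block_inversions r \<beta> (inv y))" arbitrary: y rule: less_induct)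
  case less
  from sorted_or_desc[OF l less.prems] show ?case
  proof cases
    case 1
    have "inj_on (\<lambda>u. u \<circ> y) (stabD r \<beta>)"
      by (rule inj_on_inverseI[of _ "\<lambda>u. u \<circ> inv y"]) (use less.prems in simp)
    then have "Tsum ((\<lambda>u. u \<circ> y) ` stabD r \<beta>) = (\<Sum>u\<in>stabD r \<beta>. TW (u \<circ> y))"
      unfolding Tsum_def by (subst sum.reindex) auto
    also have "\<dots> = Tsum (stabD r \<beta>) * TW y"
      unfolding Tsum_def sum_distrib_right
      by (rule sum.cong) (use TW_stabD_left[OF l less.prems 1] in auto)
    finally show ?thesis using 1 by simp
  next
    case (2 i)
    note i' = block_gens_labelling[OF 2(1)]
    let ?y = "dgen r i \<circ> y"
    have W: "?y \<in> WB r" using dgen_WB[OF i'] less.prems by blast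
    have c: "card (block_inversions r \<beta> (inv y)) = card (block_inversions r \<beta> (inv ?y)) + 2"
      using block_inversions_dgen[OF l 2(1) less.prems 2(2)] by simp
    have "dgen r i \<in> gensD r" using gensD_dgen i' by blast
    then have "\<not> left_desc (dgen r i) ?y" using D.desc_flip[OF _ less.prems] 2(2) by blast
    from Tdgen_left[OF W i' this] have "TW y = Tdgen i * TW ?y" using i' by simp
    then have "Tsum (stabD r \<beta>) * TW y = hscalar q * (Tsum (stabD r \<beta>) * TW ?y)"
      using stabD_Tdgen[OF l 2(1)] by (metis mult.assoc)
    also have "\<dots> = hscalar q * (hscalar (q ^ (card (block_inversions r \<beta> (inv ?y)) div 2)) *
        Tsum ((\<lambda>u. u \<circ> ?y) ` stabD r \<beta>))"
      using less.hyps[OF _ W] c by simp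
    also have "\<dots> = hscalar (q ^ (card (block_inversions r \<beta> (inv y)) div 2)) * Tsum ((\<lambda>u. u \<circ> y) ` stabD r \<beta>)"
      unfolding stabD_coset_gen[OF l dgen_stabD[OF l 2(1)]] c mult.assoc[symmetric] hscalar_mult[symmetric]
      by simp
    finally show ?thesis .
  qed
qed

lemma heckeD_sum: "(\<And>x. x \<in> X \<Longrightarrow> f x \<in> heckeD) \<Longrightarrow> (\<Sum>x\<in>X. f x) \<in> (heckeD :: 'r hecke set)"
proof (induction X rule: infinite_finite_induct)
  case (insert x F)
  then show ?case unfolding heckeD_def by (simp add: gen_subalgebra.add)
qed (use gen_subalgebra.scalar[of 0] in \<open>auto simp: heckeD_def\<close>)

lemma heckeD_one: "1 \<in> (heckeD :: 'r hecke set)"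
  using gen_subalgebra.scalar[of 1] unfolding heckeD_def by simp

lemma heckeD_zero: "0 \<in> (heckeD :: 'r hecke set)"
  using gen_subalgebra.scalar[of 0] unfolding heckeD_def by simp

lemma heckeD_mult: "x \<in> heckeD \<Longrightarrow> y \<in> heckeD \<Longrightarrow> x * y \<in> (heckeD :: 'r hecke set)"
  unfolding heckeD_def by (rule gen_subalgebra.mult)

lemma Tdgen_heckeD:
  assumes "i \<in> {1..r}" shows "Tdgen i \<in> heckeD"
proof (cases "i < r")
  case True
  then have "T i \<in> Tgen ` {1..<CARD('r)}" using assms card_r by auto
  then show ?thesis using True unfolding heckeD_def Tdgen_def by (auto intro: gen_subalgebra.gen)
next
  case False
  then show ?thesis unfolding heckeD_def Tdgen_def card_r by (auto intro: gen_subalgebra.gen)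
qed

lemma TW_heckeD:
  assumes "w \<in> WD r" shows "TW w \<in> heckeD"
proof -
  have l: "labelling r 0 (\<lambda>_. 0)" by (simp add: labelling_def)
  have "w \<in> stabD r (\<lambda>_. 0)" using assms by (simp add: stabD_def)
  with l show ?thesis
  proof (induction rule: stabD_induct)
    case id
    show ?case unfolding TW_id by (rule heckeD_one)
  next
    case (step i u)
    show ?case
      unfolding Tdgen_left[OF stabD_WB[OF step(2)] block_gens_labelling[OF step(1)] step(3)]
      by (rule heckeD_mult[OF Tdgen_heckeD[OF block_gens_labelling[OF step(1)]] step(4)])
  qed
qed

lemma Tsum_heckeD: "D \<subseteq> WD r \<Longrightarrow> Tsum D \<in> heckeD"
  unfolding Tsum_def by (rule heckeD_sum) (use TW_heckeD in blast)

end

section \<open>Block labels, parabolic subgroups and double cosets\<close>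

text \<open>Orbits \<open>{x, sx x}\<close> and \<open>{y, sy y}\<close> with the same labels are matched and removed together, after which
  all fibres still have equal cardinalities.\<close>

lemma equivariant_bij:
  fixes f :: "'a \<Rightarrow> 'c" and g :: "'b \<Rightarrow> 'c"
  assumes "finite X" "finite Y"
    and X: "\<And>x. x \<in> X \<Longrightarrow> sx x \<in> X \<and> sx (sx x) = x \<and> sx x \<noteq> x \<and> f (sx x) = \<sigma> (f x)"
    and Y: "\<And>y. y \<in> Y \<Longrightarrow> sy y \<in> Y \<and> sy (sy y) = y \<and> sy y \<noteq> y \<and> g (sy y) = \<sigma> (g y)"
    and fib: "\<And>c. card {x\<in>X. f x = c} = card {y\<in>Y. g y = c}"
  shows "\<exists>v. bij_betw v X Y \<and> (\<forall>x\<in>X. g (v x) = f x \<and> v (sx x) = sy (v x))"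
  using assms
proof (induction "card X" arbitrary: X Y rule: less_induct)
  case less
  show ?case
  proof (cases "X = {}")
    case True
    have "Y = {}"
    proof (rule ccontr)
      assume "Y \<noteq> {}"
      then obtain y where "y \<in> {z\<in>Y. g z = g y}" by auto
      then have "card {z\<in>Y. g z = g y} \<noteq> 0" using less.prems(2) by auto
      then show False using less.prems(5)[of "g y"] True by simp
    qed
    then show ?thesis using True by (auto simp: bij_betw_def)
  next
    case False
    then obtain x where x: "x \<in> X" by blast
    have "card {z\<in>X. f z = f x} \<noteq> 0" using x less.prems(1) by auto
    then have "{z\<in>Y. g z = f x} \<noteq> {}" using less.prems(5)[of "f x"] by fastforce
    then obtain y where y: "y \<in> Y" "g y = f x" by blast
    let ?x = "sx x" and ?y = "sy y"
    have px: "?x \<in> X" "sx ?x = x" "?x \<noteq> x" "f ?x = \<sigma> (f x)" using less.prems(3)[OF x] by auto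
    have py: "?y \<in> Y" "sy ?y = y" "?y \<noteq> y" "g ?y = \<sigma> (f x)" using less.prems(4)[OF y(1)] y(2) by auto
    define X' where "X' = X - {x,?x}"
    define Y' where "Y' = Y - {y,?y}"
    have fin: "finite X'" "finite Y'" unfolding X'_def Y'_def using less.prems by auto
    have "card X' < card X" unfolding X'_def using x px less.prems(1) by (intro psubset_card_mono) auto
    moreover have "sx z \<in> X' \<and> sx (sx z) = z \<and> sx z \<noteq> z \<and> f (sx z) = \<sigma> (f z)" if "z \<in> X'" for z
      using less.prems(3)[of z] that px unfolding X'_def by (metis Diff_iff insert_iff singletonD)
    moreover have "sy z \<in> Y' \<and> sy (sy z) = z \<and> sy z \<noteq> z \<and> g (sy z) = \<sigma> (g z)" if "z \<in> Y'" for z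
      using less.prems(4)[of z] that py unfolding Y'_def by (metis Diff_iff insert_iff singletonD)
    moreover have "card {z\<in>X'. f z = c} = card {z\<in>Y'. g z = c}" for c
    proof -
      have "{z\<in>X'. f z = c} = {z\<in>X. f z = c} - {z\<in>{x,?x}. f z = c}" unfolding X'_def by auto
      moreover have "{z\<in>Y'. g z = c} = {z\<in>Y. g z = c} - {z\<in>{y,?y}. g z = c}" unfolding Y'_def by auto
      moreover have "card {z\<in>{x,?x}. f z = c} = card {z\<in>{y,?y}. g z = c}"
      proof -
        have "{z\<in>{x,?x}. f z = c} = (if f x = c then {x} else {}) \<union> (if \<sigma> (f x) = c then {?x} else {})"
          using px by auto
        moreover have "{z\<in>{y,?y}. g z = c} = (if f x = c then {y} else {}) \<union> (if \<sigma> (f x) = c then {?y} else {})"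
          using py y by auto
        ultimately show ?thesis using px(3) py(3) by simp
      qed
      moreover have "{z\<in>{x,?x}. f z = c} \<subseteq> {z\<in>X. f z = c}" "{z\<in>{y,?y}. g z = c} \<subseteq> {z\<in>Y. g z = c}"
        using x px y py by auto
      ultimately show ?thesis using less.prems(5)[of c] by (simp add: card_Diff_subset)
    qed
    ultimately obtain v where v: "bij_betw v X' Y'" "\<forall>z\<in>X'. g (v z) = f z \<and> v (sx z) = sy (v z)"
      using less.hyps[of X' Y'] fin by blast
    define v' where "v' = (\<lambda>z. if z = x then y else if z = ?x then ?y else v z)"
    have agree: "\<And>z. z \<in> X' \<Longrightarrow> v' z = v z" unfolding v'_def X'_def by auto
    have "bij_betw v' X' Y'" using v(1) agree bij_betw_cong by metis
    moreover have "bij_betw v' {x,?x} {y,?y}"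
      using px py unfolding v'_def bij_betw_def by (auto simp: inj_on_def)
    ultimately have "bij_betw v' (X' \<union> {x,?x}) (Y' \<union> {y,?y})"
      by (rule bij_betw_combine) (auto simp: Y'_def)
    moreover have "X' \<union> {x,?x} = X" "Y' \<union> {y,?y} = Y" using x px y py unfolding X'_def Y'_def by auto
    ultimately have "bij_betw v' X Y" by simp
    moreover have "g (v' z) = f z \<and> v' (sx z) = sy (v' z)" if zX: "z \<in> X" for z
    proof -
      consider "z = x" | "z = ?x" | "z \<in> X'" using zX unfolding X'_def by blast
      then show ?thesis
      proof cases
        case 3
        then have "sx z \<in> X'" using less.prems(3)[OF zX] px unfolding X'_def by (metis Diff_iff insert_iff singletonD)
        then show ?thesis using v(2) 3 agree by metis
      qed (use px py y in \<open>auto simp: v'_def\<close>)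
    qed
    ultimately show ?thesis by blast
  qed
qed

lemma symmetric_sum:
  fixes a :: "nat \<Rightarrow> nat"
  assumes "\<And>j. j \<in> {1..2*n+1} \<Longrightarrow> a (2*n+2-j) = a j"
  shows "(\<Sum>j=1..2*n+1. a j) = 2 * (\<Sum>j=1..n. a j) + a (n+1)"
proof -
  have "{1..2*n+1} = {1..n} \<union> ({n+1} \<union> {n+2..2*n+1})" by auto
  then have "(\<Sum>j=1..2*n+1. a j) = (\<Sum>j=1..n. a j) + (a (n+1) + (\<Sum>j=n+2..2*n+1. a j))"
    by (simp only: sum.union_disjoint finite_atLeastAtMost finite_insert finite_Un finite.emptyI)
       (subst sum.union_disjoint, auto)+
  moreover have "(\<Sum>j=n+2..2*n+1. a j) = (\<Sum>j=1..n. a j)"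
    by (rule sum.reindex_bij_witness[of _ "\<lambda>j. 2*n+2-j" "\<lambda>j. 2*n+2-j"]) (use assms in auto)
  ultimately show ?thesis by simp
qed

locale schur = hecke_rank r ty for r and ty :: "'r::finite itself" +
  fixes n :: nat
  assumes n1: "1 \<le> n"
begin

definition psum :: "vect \<Rightarrow> nat \<Rightarrow> nat" where
  "psum l k = (\<Sum>j=1..k. hat n l j)"

definition block_of :: "vect \<Rightarrow> nat \<Rightarrow> nat" where
  "block_of l x = (LEAST k. x \<le> psum l k)"

lemma psum_0 [simp]: "psum l 0 = 0" by (simp add: psum_def)

lemma psum_Suc: "psum l (Suc k) = psum l k + hat n l (Suc k)" by (simp add: psum_def)

lemma psum_mono: "i \<le> j \<Longrightarrow> psum l i \<le> psum l j"
  unfolding psum_def by (rule sum_mono2) auto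

lemma hat_mirror: "i \<in> {1..2*n+1} \<Longrightarrow> hat n l (2*n+2-i) = hat n l i"
proof -
  assume i: "i \<in> {1..2*n+1}"
  consider "i \<le> n" | "i = n+1" | "i \<ge> n+2" by linarith
  then show ?thesis
  proof cases
    case 1
    then have "2*n+2-i \<in> {n+2..2*n+1}" "2*n+2-(2*n+2-i) = i" using i by auto
    then show ?thesis using 1 i unfolding hat_def by auto
  next
    case 3
    then have "2*n+2-i \<in> {1..n}" using i by auto
    then show ?thesis using 3 i unfolding hat_def by auto
  qed (simp add: hat_def)
qed

lemma psum_small: "k \<le> n \<Longrightarrow> psum l k = (\<Sum>j=1..k. l j)"
  unfolding psum_def by (rule sum.cong) (auto simp: hat_def)

lemma psum_total:
  assumes "l \<in> Lam n r" shows "psum l (2*n+1) = 2*r"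
proof -
  have "psum l (2*n+1) = 2 * (\<Sum>j=1..n. hat n l j) + hat n l (n+1)"
    unfolding psum_def by (rule symmetric_sum) (rule hat_mirror)
  also have "(\<Sum>j=1..n. hat n l j) = (\<Sum>j=1..n. l j)" by (rule sum.cong) (auto simp: hat_def)
  also have "2 * (\<Sum>j=1..n. l j) + hat n l (n+1) = 2 * (\<Sum>j=1..n+1. l j)" by (simp add: hat_def)
  finally show ?thesis using assms by (simp add: Lam_def)
qed

lemma psum_mirror:
  assumes "l \<in> Lam n r" "k \<le> 2*n+1" shows "psum l k + psum l (2*n+1-k) = 2*r"
proof -
  have "psum l (2*n+1-k) = (\<Sum>j=k+1..2*n+1. hat n l j)"
    unfolding psum_def
    by (rule sum.reindex_bij_witness[of _ "\<lambda>j. 2*n+2-j" "\<lambda>j. 2*n+2-j"])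
       (use assms(2) hat_mirror in auto)
  moreover have "psum l (2*n+1) = psum l k + (\<Sum>j=k+1..2*n+1. hat n l j)"
    unfolding psum_def using sum.ub_add_nat[of 1 k "hat n l" "2*n+1-k"] assms(2) by simp
  ultimately show ?thesis using psum_total[OF assms(1)] by simp
qed

lemma block_of_iff:
  assumes "k \<ge> 1" shows "block_of l x = k \<and> x \<le> psum l k \<longleftrightarrow> psum l (k-1) < x \<and> x \<le> psum l k"
proof
  assume a: "block_of l x = k \<and> x \<le> psum l k"
  then have "\<not> x \<le> psum l (k-1)"
    using not_less_Least[of "k-1" "\<lambda>k. x \<le> psum l k"] assms unfolding block_of_def by auto
  then show "psum l (k-1) < x \<and> x \<le> psum l k" using a by simp
next
  assume a: "psum l (k-1) < x \<and> x \<le> psum l k"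
  have "block_of l x = k" unfolding block_of_def
  proof (rule Least_equality)
    fix j assume j: "x \<le> psum l j"
    show "k \<le> j"
    proof (rule ccontr)
      assume "\<not> k \<le> j"
      then have "psum l j \<le> psum l (k-1)" by (intro psum_mono) simp
      then show False using a j by simp
    qed
  qed (use a in simp)
  then show "block_of l x = k \<and> x \<le> psum l k" using a by simp
qed

lemma block_of_props:
  assumes l: "l \<in> Lam n r" and x: "x \<in> {1..2*r}"
  shows "block_of l x \<in> {1..2*n+1}" "psum l (block_of l x - 1) < x" "x \<le> psum l (block_of l x)"
proof -
  have ex: "x \<le> psum l (2*n+1)" using psum_total[OF l] x by simp
  show le: "x \<le> psum l (block_of l x)" unfolding block_of_def by (rule LeastI[of "\<lambda>k. x \<le> psum l k", OF ex])
  then have "block_of l x \<noteq> 0" using x by (metis psum_0 atLeastAtMost_iff le_zero_eq not_one_le_zero)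
  moreover have "block_of l x \<le> 2*n+1" unfolding block_of_def by (rule Least_le[of "\<lambda>k. x \<le> psum l k", OF ex])
  ultimately show "block_of l x \<in> {1..2*n+1}" by simp
  then show "psum l (block_of l x - 1) < x" using block_of_iff[of "block_of l x" l x] le by simp
qed

lemma block_of_eq_iff:
  assumes l: "l \<in> Lam n r" and x: "x \<in> {1..2*r}" and k: "k \<ge> 1"
  shows "block_of l x = k \<longleftrightarrow> psum l (k-1) < x \<and> x \<le> psum l k"
  using block_of_iff[OF k, of l x] block_of_props[OF l x] by blast

lemma block_of_le_iff:
  assumes l: "l \<in> Lam n r" and x: "x \<in> {1..2*r}"
  shows "block_of l x \<le> k \<longleftrightarrow> x \<le> psum l k"
  using block_of_props(3)[OF l x] psum_mono[of "block_of l x" k l] Least_le[of "\<lambda>k. x \<le> psum l k" k]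
  unfolding block_of_def by auto

lemma labelling_block_of:
  assumes l: "l \<in> Lam n r" shows "labelling r (2*n+2) (block_of l)"
  unfolding labelling_def
proof (intro conjI allI impI ballI)
  fix i j assume ij: "1 \<le> i" "i \<le> j" "j \<le> 2*r"
  then show "block_of l i \<le> block_of l j" using block_of_le_iff[OF l, of i "block_of l j"] block_of_props(3)[OF l, of j] by auto
next
  fix x assume x: "x \<in> {1..2*r}"
  let ?k = "block_of l x"
  note p = block_of_props[OF l x]
  have "psum l ?k + psum l (2*n+1-?k) = 2*r" by (rule psum_mirror[OF l]) (use p in auto)
  moreover have "psum l (?k-1) + psum l (2*n+1-(?k-1)) = 2*r" by (rule psum_mirror[OF l]) (use p in auto)
  moreover have "2*n+1-(?k-1) = 2*n+2-?k" "2*n+2-?k-1 = 2*n+1-?k" using p(1) by auto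
  ultimately have "psum l (2*n+2-?k-1) < 2*r+1-x \<and> 2*r+1-x \<le> psum l (2*n+2-?k)"
    using p(2,3) x by auto
  then have "block_of l (2*r+1-x) = 2*n+2-?k"
    using block_of_eq_iff[OF l mirror_range[OF x], of "2*n+2-?k"] p(1) by auto
  then show "block_of l x + block_of l (2*r+1-x) = 2*n+2" using p(1) by auto
qed

lemma block_block_of:
  assumes l: "l \<in> Lam n r" and i: "i \<in> {1..2*n+1}"
  shows "block (hat n l) i = {x\<in>{1..2*r}. block_of l x = i}"
proof -
  have "psum l (i-1) = (\<Sum>j=1..<i. hat n l j)"
    unfolding psum_def using i by (intro sum.cong) auto
  then have b: "block (hat n l) i = {psum l (i-1) + 1..psum l i}"
    unfolding block_def by (simp add: psum_def)
  have "psum l i \<le> 2*r" using psum_mono[of i "2*n+1" l] psum_total[OF l] i by simp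
  show ?thesis unfolding b
  proof (intro equalityI subsetI)
    fix x assume x: "x \<in> {psum l (i-1) + 1..psum l i}"
    then have x2: "x \<in> {1..2*r}" using \<open>psum l i \<le> 2*r\<close> by auto
    then show "x \<in> {x\<in>{1..2*r}. block_of l x = i}" using block_of_eq_iff[OF l x2, of i] x i by auto
  next
    fix x assume "x \<in> {x\<in>{1..2*r}. block_of l x = i}"
    then have x: "x \<in> {1..2*r}" "block_of l x = i" by auto
    then show "x \<in> {psum l (i-1) + 1..psum l i}" using block_of_eq_iff[OF l x(1), of i] i by auto
  qed
qed

lemma card_block:
  assumes l: "l \<in> Lam n r"
  shows "card {x\<in>{1..2*r}. block_of l x = i} = hat n l i"
proof (cases "i \<in> {1..2*n+1}")
  case True
  have "psum l (i-1) = (\<Sum>j=1..<i. hat n l j)"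
    unfolding psum_def using True by (intro sum.cong) auto
  then have "block (hat n l) i = {psum l (i-1) + 1..psum l i}"
    unfolding block_def by (simp add: psum_def)
  moreover have "psum l i = psum l (i-1) + hat n l i" using psum_Suc[of l "i-1"] True by simp
  ultimately have "card (block (hat n l) i) = hat n l i" by simp
  then show ?thesis using block_block_of[OF l True] by simp
next
  case False
  then have e: "{x\<in>{1..2*r}. block_of l x = i} = {}" using block_of_props(1)[OF l] by blast
  have "hat n l i = 0" using False unfolding hat_def by auto
  then show ?thesis unfolding e by simp
qed

text \<open>Counting the letters \<open>z\<close> instead of the values \<open>d z\<close> makes both labels functions of \<open>z\<close>.\<close>

lemma coset_mat_eq:
  assumes l: "l \<in> Lam n r" and m: "m \<in> Lam n r" and d: "d \<in> WB r"
  shows "coset_mat n l d m i j = card {z\<in>{1..2*r}. block_of l (d z) = i \<and> block_of m z = j}"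
proof (cases "i \<in> {1..2*n+1} \<and> j \<in> {1..2*n+1}")
  case True
  have "block (hat n l) i \<inter> d ` block (hat n m) j = d ` {z\<in>{1..2*r}. block_of l (d z) = i \<and> block_of m z = j}"
    using True block_block_of[OF l] block_block_of[OF m] WB_range[OF d] by auto
  moreover have "inj_on d X" for X using WB_inj[OF d] by (auto intro: inj_onI)
  ultimately show ?thesis using True unfolding coset_mat_def by (simp add: card_image)
next
  case False
  then have "{z\<in>{1..2*r}. block_of l (d z) = i \<and> block_of m z = j} = {}"
    using block_of_props(1)[OF l WB_range[OF d]] block_of_props(1)[OF m] by blast
  then show ?thesis using False unfolding coset_mat_def by (simp only: if_False card.empty)
qed

lemma Wpar_stabB:
  assumes l: "l \<in> Lam n r" shows "Wpar n r l = stabB r (block_of l)"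
proof -
  have J: "{j\<in>{1..r}. j \<notin> {\<Sum>k=1..i. l k |i. i \<in> {1..n}}} = {j\<in>{1..r}. block_of l j = block_of l (j+1)}"
  proof -
    have "block_of l j \<noteq> block_of l (j+1) \<longleftrightarrow> (\<exists>i\<in>{1..n}. j = (\<Sum>k=1..i. l k))" if j: "j \<in> {1..r}" for j
    proof
      have j2: "j \<in> {1..2*r}" "j+1 \<in> {1..2*r}" using j by auto
      {
        assume "block_of l j \<noteq> block_of l (j+1)"
        moreover have "block_of l j \<le> block_of l (j+1)" using labelling_mono[OF labelling_block_of[OF l], of j "j+1"] j by auto
        ultimately have lt: "\<not> block_of l (j+1) \<le> block_of l j" by simp
        define k where "k = block_of l j"
        have "j \<le> psum l k" using block_of_le_iff[OF l j2(1)] unfolding k_def by blast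
        moreover have "\<not> j+1 \<le> psum l k" using block_of_le_iff[OF l j2(2)] lt unfolding k_def by blast
        ultimately have jk: "j = psum l k" by simp
        have k: "k \<in> {1..2*n+1}" using block_of_props(1)[OF l j2(1)] unfolding k_def .
        show "\<exists>i\<in>{1..n}. j = (\<Sum>k=1..i. l k)"
        proof (cases "k \<le> n")
          case True
          then show ?thesis using k jk psum_small[of k l] by auto
        next
          case False
          have "psum l n + psum l (n+1) = 2*r" using psum_mirror[OF l, of n] by (simp add: algebra_simps)
          moreover have "psum l (n+1) \<le> psum l k" "psum l n \<le> psum l (n+1)"
            using False by (auto intro!: psum_mono)
          moreover have "j \<le> r" using j by simp
          ultimately have "psum l n = j" using jk by linarith
          then show ?thesis using psum_small[of n l] n1 by auto
        qed
      }
      {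
        assume "\<exists>i\<in>{1..n}. j = (\<Sum>k=1..i. l k)"
        then obtain i where i: "i \<in> {1..n}" "j = psum l i" using psum_small by auto
        then have "block_of l j \<le> i" "\<not> block_of l (j+1) \<le> i" using block_of_le_iff[OF l j2(1)] block_of_le_iff[OF l j2(2)] by auto
        then show "block_of l j \<noteq> block_of l (j+1)" by auto
      }
    qed
    then show ?thesis by blast
  qed
  let ?S = "sgen r ` {j\<in>{1..r}. block_of l j = block_of l (j+1)}"
  have "x \<in> stabB r (block_of l)" if "x \<in> gen_subgroup ?S" for x
    using that
  proof induction
    case one
    show ?case by (rule stabB_id)
  next
    case (gen g)
    then show ?case using sgen_stabB[OF labelling_block_of[OF l]] by blast
  next
    case (mult g g')
    show ?case by (rule stabB_comp[OF mult.IH])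
  next
    case (inverse g)
    show ?case by (rule stabB_inv[OF inverse.IH])
  qed
  moreover have "compose_list ws \<in> gen_subgroup ?S" if "set ws \<subseteq> ?S" for ws
    using that
  proof (induction ws)
    case Nil
    show ?case unfolding compose_list_Nil by (rule gen_subgroup.one)
  next
    case (Cons s ws)
    then show ?case unfolding compose_list_Cons
      by (intro gen_subgroup.mult[OF gen_subgroup.gen]) auto
  qed
  then have "words ?S \<subseteq> gen_subgroup ?S" unfolding words_def by blast
  ultimately show ?thesis unfolding Wpar_def J stabB_words[OF labelling_block_of[OF l]] using stabB_words[OF labelling_block_of[OF l]] by blast
qed

lemma coset_mat_invariant:
  assumes l: "l \<in> Lam n r" and m: "m \<in> Lam n r" and w: "w \<in> WB r"
    and u: "u \<in> stabB r (block_of l)" and v: "v \<in> stabB r (block_of m)"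
  shows "coset_mat n l (u \<circ> w \<circ> v) m = coset_mat n l w m"
proof (intro ext)
  fix i j
  have W: "u \<circ> w \<circ> v \<in> WB r" "v \<in> WB r" using u v w stabB_WB WB_comp by blast+
  let ?A = "{z\<in>{1..2*r}. block_of l ((u \<circ> w \<circ> v) z) = i \<and> block_of m z = j}"
  let ?B = "{z\<in>{1..2*r}. block_of l (w z) = i \<and> block_of m z = j}"
  have e: "block_of l ((u \<circ> w \<circ> v) z) = block_of l (w (v z))" "block_of m (v z) = block_of m z" "v z \<in> {1..2*r}"
    if "z \<in> {1..2*r}" for z
    using that u v WB_range[OF w WB_range[OF W(2) that]] WB_range[OF W(2) that] by (auto simp: stabB_def)
  have "v ` ?A = ?B"
  proof (intro equalityI subsetI)
    fix x assume x: "x \<in> ?B"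
    then have r: "inv v x \<in> {1..2*r}" using WB_range[OF WB_inv[OF W(2)]] by blast
    have "inv v x \<in> ?A" using e[OF r] r x W(2) by simp
    then show "x \<in> v ` ?A" by (rule rev_image_eqI) (rule WB_inv_apply(2)[OF W(2), symmetric])
  qed (use e in auto)
  moreover have "card (v ` ?A) = card ?A"
    by (rule card_image) (use WB_inj[OF W(2)] in \<open>auto intro: inj_onI\<close>)
  ultimately have "card ?A = card ?B" by argo
  then show "coset_mat n l (u \<circ> w \<circ> v) m i j = coset_mat n l w m i j"
    unfolding coset_mat_eq[OF l m W(1)] coset_mat_eq[OF l m w] .
qed

lemma WB_of_bij:
  assumes v: "bij_betw v {1..2*r} {1..2*r}" and s: "\<And>z. z \<in> {1..2*r} \<Longrightarrow> v (2*r+1-z) = 2*r+1 - v z"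
  shows "(\<lambda>z. if z \<in> {1..2*r} then v z else z) \<in> WB r"
proof -
  let ?v = "\<lambda>z. if z \<in> {1..2*r} then v z else z"
  have "bij_betw ?v {1..2*r} {1..2*r}" using v bij_betw_cong[of "{1..2*r}" v ?v] by simp
  then have "?v permutes {1..2*r}" by (rule bij_imp_permutes) auto
  moreover have "?v i + ?v (2*r+1-i) = 2*r+1" if "i \<in> {1..2*r}" for i
  proof -
    have "v i \<in> {1..2*r}" using bij_betwE[OF v] that by blast
    then show ?thesis using s[OF that] that mirror_range[OF that] by simp
  qed
  ultimately show ?thesis unfolding WB_def by blast
qed

text \<open>Equal matrices provide a mirror equivariant bijection \<open>v\<close> of the letters that matches the pairs of labels under
  \<open>w'\<close> with those under \<open>w\<close>. It preserves column labels, and \<open>w' \<circ> inv (w \<circ> v)\<close> preserves row labels.\<close>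

lemma same_coset_mat:
  assumes l: "l \<in> Lam n r" and m: "m \<in> Lam n r" and w: "w \<in> WB r" and w': "w' \<in> WB r"
    and e: "coset_mat n l w m = coset_mat n l w' m"
  shows "\<exists>u\<in>stabB r (block_of l). \<exists>v\<in>stabB r (block_of m). w' = u \<circ> w \<circ> v"
proof -
  let ?K = "2*n+2" and ?X = "{1..2*r}"
  let ?f = "\<lambda>z. (block_of l (w' z), block_of m z)" and ?g = "\<lambda>z. (block_of l (w z), block_of m z)"
  let ?s = "\<lambda>z. 2*r+1-z" and ?t = "\<lambda>(a,b). (?K - a, ?K - b)"
  have inv: "?s z \<in> ?X \<and> ?s (?s z) = z \<and> ?s z \<noteq> z \<and> (block_of l (x (?s z)), block_of m (?s z)) = ?t (block_of l (x z), block_of m z)"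
    if z: "z \<in> ?X" and x: "x \<in> WB r" for z x
    using mirror_range[OF z] mirror_neq[of r z] z labelling_mirror[OF labelling_block_of[OF m] z] WB_mirror[OF x z]
      labelling_mirror[OF labelling_block_of[OF l] WB_range[OF x z]] by auto
  have "card {z\<in>?X. ?f z = c} = card {z\<in>?X. ?g z = c}" for c
    using fun_cong[OF fun_cong[OF e, of "fst c"], of "snd c"]
    unfolding coset_mat_eq[OF l m w] coset_mat_eq[OF l m w'] by (cases c) simp
  then have "\<exists>v. bij_betw v ?X ?X \<and> (\<forall>x\<in>?X. ?g (v x) = ?f x \<and> v (?s x) = ?s (v x))"
    by (intro equivariant_bij[where \<sigma> = ?t]) (use inv w w' in auto)
  then obtain v where v: "bij_betw v ?X ?X" "\<And>x. x \<in> ?X \<Longrightarrow> ?g (v x) = ?f x \<and> v (?s x) = ?s (v x)"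
    by blast
  define v' where "v' = (\<lambda>z. if z \<in> ?X then v z else z)"
  have v'W: "v' \<in> WB r" unfolding v'_def by (rule WB_of_bij[OF v(1)]) (use v(2) in blast)
  then have v'P: "v' \<in> stabB r (block_of m)" unfolding stabB_def using v(2) by (auto simp: v'_def)
  define u where "u = w' \<circ> inv (w \<circ> v')"
  have W: "w \<circ> v' \<in> WB r" using w v'W by blast
  then have uW: "u \<in> WB r" unfolding u_def using w' by blast
  have "block_of l (u i) = block_of l i" if "i \<in> ?X" for i
  proof -
    let ?z = "inv (w \<circ> v') i"
    have z: "?z \<in> ?X" using WB_range[OF WB_inv[OF W] that] .
    have "block_of l (w' ?z) = block_of l (w (v' ?z))" using v(2)[OF z] z unfolding v'_def by simp
    also have "w (v' ?z) = i" using WB_inv_apply(2)[OF W, of i] by simp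
    finally have "block_of l (w' ?z) = block_of l i" .
    moreover have "u i = w' ?z" unfolding u_def by (rule comp_apply)
    ultimately show ?thesis by metis
  qed
  then have "u \<in> stabB r (block_of l)" unfolding stabB_def using uW by blast
  moreover have "w' = u \<circ> w \<circ> v'"
    using WB_inv_comp(1)[OF W] unfolding u_def by (simp only: comp_assoc comp_id)
  ultimately show ?thesis using v'P by blast
qed

lemma double_coset_stabB:
  assumes l: "l \<in> Lam n r" and m: "m \<in> Lam n r" and w: "w \<in> WB r"
  shows "double_coset (stabB r (block_of l)) w (stabB r (block_of m)) = {x\<in>WB r. coset_mat n l x m = coset_mat n l w m}"
proof (intro equalityI subsetI)
  fix x assume "x \<in> double_coset (stabB r (block_of l)) w (stabB r (block_of m))"
  then obtain u v where "x = u \<circ> w \<circ> v" "u \<in> stabB r (block_of l)" "v \<in> stabB r (block_of m)"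
    unfolding double_coset_def by blast
  then show "x \<in> {x\<in>WB r. coset_mat n l x m = coset_mat n l w m}"
    using coset_mat_invariant[OF l m w] stabB_WB w WB_comp by blast
next
  fix x assume "x \<in> {x\<in>WB r. coset_mat n l x m = coset_mat n l w m}"
  then show "x \<in> double_coset (stabB r (block_of l)) w (stabB r (block_of m))"
    using same_coset_mat[OF l m w, of x] unfolding double_coset_def by fastforce
qed

lemma ro_coset_mat:
  assumes l: "l \<in> Lam n r" and m: "m \<in> Lam n r" and w: "w \<in> WB r"
  shows "ro n (coset_mat n l w m) = hat n l"
proof
  fix i
  have "ro n (coset_mat n l w m) i = (\<Sum>j\<in>{1..2*n+1}. card {z\<in>{z\<in>{1..2*r}. block_of l (w z) = i}. block_of m z = j})"
    unfolding ro_def coset_mat_eq[OF assms] by (intro sum.cong arg_cong[of _ _ card]) auto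
  also have "\<dots> = card {z\<in>{1..2*r}. block_of l (w z) = i}"
  proof -
    have "{z\<in>{1..2*r}. block_of l (w z) = i} = (\<Union>j\<in>{1..2*n+1}. {z\<in>{z\<in>{1..2*r}. block_of l (w z) = i}. block_of m z = j})"
      using block_of_props(1)[OF m] by auto
    then have "card {z\<in>{1..2*r}. block_of l (w z) = i} =
        card (\<Union>j\<in>{1..2*n+1}. {z\<in>{z\<in>{1..2*r}. block_of l (w z) = i}. block_of m z = j})" by (rule arg_cong)
    also have "\<dots> = (\<Sum>j\<in>{1..2*n+1}. card {z\<in>{z\<in>{1..2*r}. block_of l (w z) = i}. block_of m z = j})"
      by (rule card_UN_disjoint) auto
    finally show ?thesis ..
  qed
  also have "\<dots> = card (w ` {z\<in>{1..2*r}. block_of l (w z) = i})"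
    by (rule card_image[symmetric]) (use WB_inj[OF w] in \<open>auto intro: inj_onI\<close>)
  also have "w ` {z\<in>{1..2*r}. block_of l (w z) = i} = {x\<in>{1..2*r}. block_of l x = i}"
  proof (intro equalityI subsetI)
    fix x assume x: "x \<in> {x\<in>{1..2*r}. block_of l x = i}"
    then have "inv w x \<in> {z\<in>{1..2*r}. block_of l (w z) = i}" using WB_range[OF WB_inv[OF w]] w by simp
    then show "x \<in> w ` {z\<in>{1..2*r}. block_of l (w z) = i}"
      by (rule rev_image_eqI) (rule WB_inv_apply(2)[OF w, symmetric])
  qed (use WB_range[OF w] in auto)
  finally show "ro n (coset_mat n l w m) i = hat n l i" unfolding card_block[OF l] .
qed

lemma hat_inj:
  assumes "l \<in> Lam n r" "l' \<in> Lam n s" "hat n l = hat n l'" shows "l = l'"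
proof
  fix i
  show "l i = l' i"
  proof (cases "i \<in> {1..n+1}")
    case True
    then show ?thesis using fun_cong[OF assms(3), of i] unfolding hat_def
      by (cases "i = n+1") (auto split: if_splits)
  qed (use assms(1,2) in \<open>simp add: Lam_def\<close>)
qed

lemma unhat_hat: "l \<in> Lam n r \<Longrightarrow> unhat n r (hat n l) = l"
  unfolding unhat_def using hat_inj by (intro the_equality) auto

end

lemma card_fibres:
  assumes "finite X" "finite I" shows "card {z\<in>X. f z \<in> I} = (\<Sum>i\<in>I. card {z\<in>X. f z = i})"
proof -
  have "{z\<in>X. f z \<in> I} = (\<Union>i\<in>I. {z\<in>X. f z = i})" by auto
  then show ?thesis using card_UN_disjoint[of I "\<lambda>i. {z\<in>X. f z = i}"] assms by auto
qed

context schur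
begin

lemma Xi_mirror: "A \<in> Xi n r \<Longrightarrow> i \<in> {1..2*n+1} \<Longrightarrow> j \<in> {1..2*n+1} \<Longrightarrow> A (2*n+2-i) (2*n+2-j) = A i j"
  unfolding Xi_def by auto

lemma Xi_outside: "A \<in> Xi n r \<Longrightarrow> \<not> (i \<in> {1..2*n+1} \<and> j \<in> {1..2*n+1}) \<Longrightarrow> A i j = 0"
  unfolding Xi_def by blast

lemma Xi_center_even:
  assumes A: "A \<in> Xi n r" and l: "l \<in> Lam n r" and ro: "ro n A = hat n l"
  shows "even (A (n+1) (n+1))"
proof -
  have "(\<Sum>j=1..2*n+1. A (n+1) j) = 2 * (\<Sum>j=1..n. A (n+1) j) + A (n+1) (n+1)"
    by (rule symmetric_sum) (use Xi_mirror[OF A, of "n+1"] in auto)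
  moreover have "(\<Sum>j=1..2*n+1. A (n+1) j) = 2 * l (n+1)"
    using fun_cong[OF ro, of "n+1"] by (simp add: ro_def hat_def)
  ultimately have "2 * (\<Sum>j=1..n. A (n+1) j) + A (n+1) (n+1) = 2 * l (n+1)" by simp
  then show ?thesis by presburger
qed

text \<open>The entries are replaced by cells with \<open>A i j\<close> points each. Reading the points by columns and by rows gives two
  bijections with the letters, which are compatible with the point reflection of the matrix; their composite is the
  required signed permutation.\<close>

lemma coset_mat_exists:
  assumes A: "A \<in> Xi n r" and l: "l \<in> Lam n r" and m: "m \<in> Lam n r"
    and ro: "ro n A = hat n l" and co: "co n A = hat n m"
  shows "\<exists>w\<in>WB r. coset_mat n l w m = A"
proof -
  let ?N = "{1..2*n+1}" and ?K = "2*n+2" and ?X = "{1..2*r}"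
  define Q where "Q = Sigma (?N \<times> ?N) (\<lambda>(i,j). {t. t < A i j})"
  \<comment> \<open>The points of a cell are reversed, so that no point of the central cell is fixed: its entry is even.\<close>
  let ?sq = "\<lambda>((i,j),t). ((?K-i,?K-j), A i j - 1 - t)"
  let ?s = "\<lambda>z. 2*r+1-z" and ?\<sigma> = "\<lambda>a. ?K - a"
  have finQ: "finite Q" unfolding Q_def by (rule finite_SigmaI) auto
  have sq: "?sq x \<in> Q \<and> ?sq (?sq x) = x \<and> ?sq x \<noteq> x \<and> fst (fst (?sq x)) = ?K - fst (fst x)
      \<and> snd (fst (?sq x)) = ?K - snd (fst x)" if x: "x \<in> Q" for x
  proof -
    obtain i j t where x: "x = ((i,j),t)" "i \<in> ?N" "j \<in> ?N" "t < A i j" using x unfolding Q_def by auto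
    have m: "A (?K-i) (?K-j) = A i j" "?K-i \<in> ?N" "?K-j \<in> ?N" "?K-(?K-i) = i" "?K-(?K-j) = j"
      using Xi_mirror[OF A x(2,3)] x(2,3) by auto
    have "?sq x \<noteq> x"
    proof
      assume "?sq x = x"
      then have "?K-i = i" "?K-j = j" "A i j - 1 - t = t" unfolding x by auto
      then have "i = n+1" "j = n+1" "A i j = 2*t+1" using x(4) by auto
      then show False using Xi_center_even[OF A l ro] by simp
    qed
    moreover have "A i j - 1 - t < A i j" "A i j - 1 - (A i j - 1 - t) = t" using x(4) by auto
    ultimately show ?thesis unfolding x(1) using m x unfolding Q_def by simp
  qed
  have cardrow: "card {q\<in>Q. fst (fst q) = c} = hat n l c" for c
  proof (cases "c \<in> ?N")
    case True
    have "{q\<in>Q. fst (fst q) = c} = Sigma ({c} \<times> ?N) (\<lambda>(i,j). {t. t < A i j})" unfolding Q_def using True by auto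
    then have "card {q\<in>Q. fst (fst q) = c} = (\<Sum>(i,j)\<in>{c} \<times> ?N. A i j)"
      by (simp add: card_SigmaI split_beta)
    also have "\<dots> = (\<Sum>j\<in>?N. A c j)" by (simp add: sum.cartesian_product[symmetric])
    finally show ?thesis using fun_cong[OF ro, of c] by (simp add: ro_def)
  next
    case False
    then have e: "{q\<in>Q. fst (fst q) = c} = {}" unfolding Q_def by auto
    show ?thesis unfolding e using False by (auto simp: hat_def)
  qed
  have cardcol: "card {q\<in>Q. snd (fst q) = c} = hat n m c" for c
  proof (cases "c \<in> ?N")
    case True
    have "{q\<in>Q. snd (fst q) = c} = Sigma (?N \<times> {c}) (\<lambda>(i,j). {t. t < A i j})" unfolding Q_def using True by auto
    then have "card {q\<in>Q. snd (fst q) = c} = (\<Sum>(i,j)\<in>?N \<times> {c}. A i j)"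
      by (simp add: card_SigmaI split_beta)
    also have "\<dots> = (\<Sum>i\<in>?N. A i c)" by (simp add: sum.cartesian_product[symmetric])
    finally show ?thesis using fun_cong[OF co, of c] by (simp add: co_def)
  next
    case False
    then have e: "{q\<in>Q. snd (fst q) = c} = {}" unfolding Q_def by auto
    show ?thesis unfolding e using False by (auto simp: hat_def)
  qed
  have sx: "?s z \<in> ?X \<and> ?s (?s z) = z \<and> ?s z \<noteq> z \<and> block_of k (?s z) = ?\<sigma> (block_of k z)"
    if z: "z \<in> ?X" and k: "k \<in> Lam n r" for z k
    using mirror_range[OF z] mirror_neq[of r z] z labelling_mirror[OF labelling_block_of[OF k] z] by auto
  have "\<exists>v. bij_betw v ?X Q \<and> (\<forall>x\<in>?X. snd (fst (v x)) = block_of m x \<and> v (?s x) = ?sq (v x))"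
    by (rule equivariant_bij[where \<sigma>="?\<sigma>"]) (use finQ sx m sq cardcol card_block[OF m] in auto)
  then obtain v1 where v1: "bij_betw v1 ?X Q" "\<And>x. x \<in> ?X \<Longrightarrow> snd (fst (v1 x)) = block_of m x"
    "\<And>x. x \<in> ?X \<Longrightarrow> v1 (?s x) = ?sq (v1 x)" by blast
  have "\<exists>v. bij_betw v Q ?X \<and> (\<forall>x\<in>Q. block_of l (v x) = fst (fst x) \<and> v (?sq x) = ?s (v x))"
    by (rule equivariant_bij[where \<sigma>="?\<sigma>"]) (use finQ sx l sq cardrow card_block[OF l] in auto)
  then obtain v2 where v2: "bij_betw v2 Q ?X" "\<And>x. x \<in> Q \<Longrightarrow> block_of l (v2 x) = fst (fst x)"
    "\<And>x. x \<in> Q \<Longrightarrow> v2 (?sq x) = ?s (v2 x)" by blast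
  define w where "w = (\<lambda>z. if z \<in> ?X then (v2 \<circ> v1) z else z)"
  have b: "bij_betw (v2 \<circ> v1) ?X ?X" by (rule bij_betw_trans[OF v1(1) v2(1)])
  have v1Q: "v1 z \<in> Q" if "z \<in> ?X" for z using bij_betwE[OF v1(1)] that by blast
  have wW: "w \<in> WB r" unfolding w_def
  proof (rule WB_of_bij[OF b])
    fix z assume z: "z \<in> ?X"
    show "(v2 \<circ> v1) (?s z) = ?s ((v2 \<circ> v1) z)"
      unfolding comp_apply v1(3)[OF z] v2(3)[OF v1Q[OF z]] ..
  qed
  have "coset_mat n l w m i j = A i j" for i j
  proof -
    have "coset_mat n l w m i j = card {z\<in>?X. fst (fst (v1 z)) = i \<and> snd (fst (v1 z)) = j}"
      unfolding coset_mat_eq[OF l m wW]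
      by (intro arg_cong[of _ _ card] Collect_cong) (use v1(2) v2(2) v1Q in \<open>auto simp: w_def\<close>)
    also have "\<dots> = card (v1 ` {z\<in>?X. fst (fst (v1 z)) = i \<and> snd (fst (v1 z)) = j})"
      by (rule card_image[symmetric], rule inj_on_subset[OF bij_betw_imp_inj_on[OF v1(1)]]) auto
    also have "v1 ` {z\<in>?X. fst (fst (v1 z)) = i \<and> snd (fst (v1 z)) = j} = {q\<in>Q. fst q = (i,j)}"
    proof -
      have "v1 ` ?X = Q" using v1(1) by (simp add: bij_betw_def)
      then show ?thesis by (auto simp: prod_eq_iff)
    qed
    also have "card {q\<in>Q. fst q = (i,j)} = A i j"
    proof (cases "i \<in> ?N \<and> j \<in> ?N")
      case True
      then have "{q\<in>Q. fst q = (i,j)} = {(i,j)} \<times> {t. t < A i j}" unfolding Q_def by auto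
      then show ?thesis by (simp add: card_cartesian_product)
    next
      case False
      then have e: "{q\<in>Q. fst q = (i,j)} = {}" unfolding Q_def by auto
      show ?thesis unfolding e using Xi_outside[OF A False] by simp
    qed
    finally show ?thesis .
  qed
  then show ?thesis using wW by blast
qed

lemma co_coset_mat:
  assumes l: "l \<in> Lam n r" and m: "m \<in> Lam n r" and w: "w \<in> WB r"
  shows "co n (coset_mat n l w m) = hat n m"
proof
  fix j
  have "co n (coset_mat n l w m) j = (\<Sum>i\<in>{1..2*n+1}. card {z\<in>{z\<in>{1..2*r}. block_of m z = j}. block_of l (w z) = i})"
    unfolding co_def coset_mat_eq[OF assms] by (intro sum.cong arg_cong[of _ _ card]) auto
  also have "\<dots> = card {z\<in>{z\<in>{1..2*r}. block_of m z = j}. block_of l (w z) \<in> {1..2*n+1}}"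
    by (rule card_fibres[symmetric]) auto
  also have "{z\<in>{z\<in>{1..2*r}. block_of m z = j}. block_of l (w z) \<in> {1..2*n+1}} = {z\<in>{1..2*r}. block_of m z = j}"
    using block_of_props(1)[OF l WB_range[OF w]] by blast
  finally show "co n (coset_mat n l w m) j = hat n m j" unfolding card_block[OF m] .
qed

lemma co_mid_nonzero:
  assumes co: "co n A = hat n m" and A: "A i (n+1) \<noteq> 0" and i: "i \<in> {1..2*n+1}"
  shows "m (n+1) \<noteq> 0"
proof -
  have "A i (n+1) \<le> (\<Sum>i=1..2*n+1. A i (n+1))" by (rule member_le_sum) (use i in auto)
  also have "\<dots> = 2 * m (n+1)" using fun_cong[OF co, of "n+1"] by (simp add: co_def hat_def)
  finally show ?thesis using A by auto
qed

lemma min_rep_exists: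
  assumes "D \<noteq> {}" shows "\<exists>d. is_min_rep S D d"
proof -
  obtain x where "x \<in> D" using assms by blast
  from ex_has_least_nat[of "\<lambda>x. x \<in> D", OF this, of "wlength S"] show ?thesis
    unfolding is_min_rep_def by blast
qed

text \<open>The matrix determines the compositions through its row and column sums, and the double coset by
  \<open>double_coset_stabB\<close>, so that the choices in the definition of \<open>d_of\<close> do not matter.\<close>

lemma d_of_props:
  assumes A: "A \<in> Xi n r" and l: "l \<in> Lam n r" and m: "m \<in> Lam n r"
    and ro: "ro n A = hat n l" and co: "co n A = hat n m"
  shows "is_min_rep (gensB r) {x\<in>WB r. coset_mat n l x m = A} (d_of n r A)"
proof -
  let ?D = "{x\<in>WB r. coset_mat n l x m = A}"
  obtain w where w: "w \<in> WB r" "coset_mat n l w m = A" using coset_mat_exists[OF assms] by blast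
  have dc: "double_coset (Wpar n r l) w (Wpar n r m) = ?D"
    unfolding Wpar_stabB[OF l] Wpar_stabB[OF m] double_coset_stabB[OF l m w(1)] w(2) ..
  obtain d where d: "is_min_rep (gensB r) ?D d" using min_rep_exists[of ?D] w by blast
  have "d_of n r A = d" unfolding d_of_def
  proof (rule the_equality)
    show "\<exists>l\<in>Lam n r. \<exists>m\<in>Lam n r. \<exists>w\<in>WB r.
        is_min_rep (gensB r) (double_coset (Wpar n r l) w (Wpar n r m)) d \<and> coset_mat n l d m = A"
      using l m w(1) d dc unfolding is_min_rep_def by blast
    fix e assume "\<exists>l\<in>Lam n r. \<exists>m\<in>Lam n r. \<exists>w\<in>WB r.
        is_min_rep (gensB r) (double_coset (Wpar n r l) w (Wpar n r m)) e \<and> coset_mat n l e m = A"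
    then obtain l' m' w' where e: "l' \<in> Lam n r" "m' \<in> Lam n r" "w' \<in> WB r" "coset_mat n l' e m' = A"
      "is_min_rep (gensB r) (double_coset (Wpar n r l') w' (Wpar n r m')) e" by blast
    have dc': "double_coset (Wpar n r l') w' (Wpar n r m') = {x\<in>WB r. coset_mat n l' x m' = coset_mat n l' w' m'}"
      unfolding Wpar_stabB[OF e(1)] Wpar_stabB[OF e(2)] double_coset_stabB[OF e(1-3)] ..
    have eW: "e \<in> WB r" "coset_mat n l' e m' = coset_mat n l' w' m'"
      using e(5) unfolding dc' is_min_rep_def by auto
    have "hat n l' = hat n l" "hat n m' = hat n m"
      using ro_coset_mat[OF e(1,2) eW(1)] co_coset_mat[OF e(1,2) eW(1)] e(4) ro co by auto
    then have same: "l' = l" "m' = m" using hat_inj e l m by blast+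
    have "double_coset (Wpar n r l') w' (Wpar n r m') = ?D"
      unfolding dc' using eW e(4) same by auto
    then have e': "is_min_rep (gensB r) ?D e" using e(5) by simp
    have J: "sgen r ` {i\<in>{1..r}. block_of l i = block_of l (i+1)} \<subseteq> gensB r" for l by (auto simp: gensB_def)
    note dw = dc[unfolded Wpar_stabB[OF l] Wpar_stabB[OF m] stabB_words[OF labelling_block_of[OF l]] stabB_words[OF labelling_block_of[OF m]]]
    have "w \<in> words (gensB r)" using w words_gensB by blast
    from B.min_rep_unique[OF J J this, of l m] d e' show "e = d" unfolding dw by blast
  qed
  then show ?thesis using d by simp
qed

text \<open>Exchanging two letters of one block stays in the double coset, and cannot shorten its shortest element.\<close>

lemma min_rep_increasing:
  assumes l: "l \<in> Lam n r" and m: "m \<in> Lam n r"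
    and d: "is_min_rep (gensB r) {x\<in>WB r. coset_mat n l x m = A} d"
    and j: "j \<in> {1..r}"
  shows "block_of m j = block_of m (j+1) \<Longrightarrow> d j < d (j+1)"
    and "block_of l j = block_of l (j+1) \<Longrightarrow> inv d j < inv d (j+1)"
proof -
  have dW: "d \<in> WB r" "coset_mat n l d m = A" using d unfolding is_min_rep_def by auto
  have min: "wlength (gensB r) d \<le> wlength (gensB r) x" if "x \<in> WB r" "coset_mat n l x m = A" for x
    using d that unfolding is_min_rep_def by blast
  have nd: "inv y j < inv y (j+1)"
    if "y \<in> WB r" "wlength (gensB r) y \<le> wlength (gensB r) (sgen r j \<circ> y)" for y
  proof -
    have "\<not> left_desc (sgen r j) y"
      using B.wlength_desc[of y "sgen r j"] that words_gensB sgen_gensB[OF j] by auto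
    moreover have "inv y j \<noteq> inv y (j+1)" using WB_inj[OF WB_inv[OF that(1)]] by simp
    ultimately show ?thesis using left_desc_sgen[OF j] by auto
  qed
  {
    assume "block_of m j = block_of m (j+1)"
    then have v: "sgen r j \<in> stabB r (block_of m)" by (rule sgen_stabB[OF labelling_block_of[OF m] j])
    have W: "d \<circ> sgen r j \<in> WB r" using dW sgen_WB[OF j] by blast
    have "coset_mat n l (id \<circ> d \<circ> sgen r j) m = A"
      unfolding coset_mat_invariant[OF l m dW(1) stabB_id v] dW(2) ..
    then have "wlength (gensB r) d \<le> wlength (gensB r) (d \<circ> sgen r j)" using min[OF W] by simp
    then have "wlength (gensB r) (inv d) \<le> wlength (gensB r) (inv (d \<circ> sgen r j))"
      by (simp only: wlength_inv[OF dW(1)] wlength_inv[OF W])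
    also have "inv (d \<circ> sgen r j) = sgen r j \<circ> inv d"
      using WB_inv_distrib[OF dW(1) sgen_WB[OF j]] sgen_inv[OF j] by simp
    finally have le: "wlength (gensB r) (inv d) \<le> wlength (gensB r) (sgen r j \<circ> inv d)" .
    from nd[OF WB_inv[OF dW(1)] le] show "d j < d (j+1)" unfolding WB_inv_inv[OF dW(1)] .
  }
  {
    assume "block_of l j = block_of l (j+1)"
    then have v: "sgen r j \<in> stabB r (block_of l)" by (rule sgen_stabB[OF labelling_block_of[OF l] j])
    have W: "sgen r j \<circ> d \<in> WB r" using dW sgen_WB[OF j] by blast
    have "coset_mat n l (sgen r j \<circ> d \<circ> id) m = A"
      unfolding coset_mat_invariant[OF l m dW(1) v stabB_id] dW(2) ..
    then have "wlength (gensB r) d \<le> wlength (gensB r) (sgen r j \<circ> d)" using min[OF W] by simp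
    then show "inv d j < inv d (j+1)" by (rule nd[OF dW(1)])
  }
qed

lemma block_of_half:
  assumes l: "l \<in> Lam n r" and x: "x \<in> {1..2*r}"
  shows "x \<le> r \<Longrightarrow> block_of l x \<le> n+1" "\<not> x \<le> r \<Longrightarrow> n+1 \<le> block_of l x"
proof -
  have s: "block_of l x + block_of l (2*r+1-x) = 2*n+2" using labelling_block_of[OF l] x unfolding labelling_def by blast
  {
    assume "x \<le> r"
    then have "block_of l x \<le> block_of l (2*r+1-x)" using labelling_mono[OF labelling_block_of[OF l], of x "2*r+1-x"] x by auto
    then show "block_of l x \<le> n+1" using s by simp
  }
  {
    assume "\<not> x \<le> r"
    then have "block_of l (2*r+1-x) \<le> block_of l x" using labelling_mono[OF labelling_block_of[OF l], of "2*r+1-x" x] x by auto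
    then show "n+1 \<le> block_of l x" using s by simp
  }
qed

lemma block_of_middle_convex:
  assumes l: "l \<in> Lam n r" and z: "1 \<le> z" "z \<le> r" and e: "block_of l z = n+1" and x: "z \<le> x" "x \<le> r+1"
  shows "block_of l x = n+1"
proof -
  have "block_of l (2*r+1-z) = n+1" using labelling_mirror[OF labelling_block_of[OF l], of z] z e by auto
  then show ?thesis
    using labelling_mono[OF labelling_block_of[OF l], of z x] labelling_mono[OF labelling_block_of[OF l], of x "2*r+1-z"] z x e by auto
qed

text \<open>In the middle block, \<open>v\<close> increases up to \<open>r+1\<close>, and \<open>v r < v (r+1) = 2*r+1 - v r\<close>.\<close>

lemma middle_not_flipped:
  assumes l: "l \<in> Lam n r" and v: "v \<in> WB r"
    and inc: "\<And>j. j \<in> {1..r} \<Longrightarrow> block_of l j = block_of l (j+1) \<Longrightarrow> v j < v (j+1)"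
    and z: "1 \<le> z" "z \<le> r" "block_of l z = n+1"
  shows "v z \<le> r"
proof -
  have r: "r \<in> {1..r}" "r \<in> {1..2*r}" using r2 by auto
  have "v r < v (r+1)"
    by (rule inc[OF r(1)]) (use block_of_middle_convex[OF l z, of r] block_of_middle_convex[OF l z, of "r+1"] z in simp)
  moreover have "v (r+1) = 2*r+1 - v r" using WB_mirror[OF v r(2)] by simp
  ultimately have "v r \<le> r" by simp
  moreover have "v z \<le> v (z + k)" if "z + k \<le> r" for k
    using that
  proof (induction k)
    case (Suc k)
    have "v (z+k) < v (z+k+1)"
      by (rule inc) (use Suc.prems z block_of_middle_convex[OF l z, of "z+k"] block_of_middle_convex[OF l z, of "z+k+1"] in auto)
    then show ?case using Suc by simp
  qed simp
  then have "v z \<le> v r" using z by (metis le_add_diff_inverse order_refl)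
  ultimately show ?thesis by simp
qed

definition middle :: "vect \<Rightarrow> nat set" where
  "middle l = {x\<in>{1..2*r}. block_of l x = n+1}"

text \<open>The number of letters that come from the upper half into the lower half of the middle row block. If the central
  entry vanishes, its parity separates the two type D double cosets with the same matrix and the same parity.\<close>

definition mid_flips :: "vect \<Rightarrow> (nat \<Rightarrow> nat) \<Rightarrow> nat" where
  "mid_flips l w = flips r (middle l) (inv w)"

lemma d_of_mid_flips:
  assumes l: "l \<in> Lam n r" and m: "m \<in> Lam n r"
    and d: "is_min_rep (gensB r) {x\<in>WB r. coset_mat n l x m = A} d"
  shows "mid_flips l d = 0"
proof -
  have dW: "d \<in> WB r" using d unfolding is_min_rep_def by auto
  have "{i \<in> middle l. i \<le> r \<and> inv d i > r} = {}"
    using middle_not_flipped[OF l WB_inv[OF dW] min_rep_increasing(2)[OF l m d]] unfolding middle_def by fastforce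
  then show ?thesis unfolding mid_flips_def flips_def by simp
qed

text \<open>Under the shortest element, no letter that crosses the centre has a middle row or column label. The crossing
  letters are therefore counted by the upper right corner of the matrix, whose sum defines \<open>sgnM\<close>.\<close>

lemma d_of_sign:
  assumes l: "l \<in> Lam n r" and m: "m \<in> Lam n r"
    and d: "is_min_rep (gensB r) {x\<in>WB r. coset_mat n l x m = A} d"
  shows "d \<in> WD r \<longleftrightarrow> sgnM n A = Pos"
proof -
  have dW: "d \<in> WB r" and dA: "coset_mat n l d m = A" using d unfolding is_min_rep_def by auto
  let ?X = "{1..2*r}"
  have m1: "d z > r" if z: "z \<in> ?X" "\<not> z \<le> r" "block_of m z = n+1" for z
  proof -
    have "block_of m (2*r+1-z) = n+1" using labelling_mirror[OF labelling_block_of[OF m] z(1)] z(3) by simp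
    then have "d (2*r+1-z) \<le> r"
      using middle_not_flipped[OF m dW min_rep_increasing(1)[OF l m d], of "2*r+1-z"] z by auto
    then show ?thesis using WB_mirror[OF dW z(1)] WB_range[OF dW z(1)] by auto
  qed
  have m2: "z \<le> r" if z: "z \<in> ?X" "d z \<le> r" "block_of l (d z) = n+1" for z
    using middle_not_flipped[OF l WB_inv[OF dW] min_rep_increasing(2)[OF l m d], of "d z"] z
      WB_range[OF dW z(1)] dW by auto
  have "card {i\<in>{1..r}. d i > r} = card {z\<in>?X. \<not> z \<le> r \<and> d z \<le> r}"
  proof (rule bij_betw_same_card, rule bij_betw_byWitness[where f'="\<lambda>z. 2*r+1-z" and f="\<lambda>z. 2*r+1-z"])
    show "(\<lambda>z. 2*r+1-z) ` {i\<in>{1..r}. d i > r} \<subseteq> {z\<in>?X. \<not> z \<le> r \<and> d z \<le> r}"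
    proof
      fix y assume "y \<in> (\<lambda>z. 2*r+1-z) ` {i\<in>{1..r}. d i > r}"
      then obtain i where i: "i \<in> {1..r}" "d i > r" "y = 2*r+1-i" by auto
      then have "i \<in> ?X" by auto
      from WB_mirror[OF dW this] show "y \<in> {z\<in>?X. \<not> z \<le> r \<and> d z \<le> r}" using i by auto
    qed
    show "(\<lambda>z. 2*r+1-z) ` {z\<in>?X. \<not> z \<le> r \<and> d z \<le> r} \<subseteq> {i\<in>{1..r}. d i > r}"
    proof
      fix y assume "y \<in> (\<lambda>z. 2*r+1-z) ` {z\<in>?X. \<not> z \<le> r \<and> d z \<le> r}"
      then obtain z where z: "z \<in> ?X" "\<not> z \<le> r" "d z \<le> r" "y = 2*r+1-z" by auto
      from WB_mirror[OF dW z(1)] show "y \<in> {i\<in>{1..r}. d i > r}" using z by auto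
    qed
  qed auto
  also have "{z\<in>?X. \<not> z \<le> r \<and> d z \<le> r} = {z\<in>?X. (block_of l (d z), block_of m z) \<in> {1..n} \<times> {n+2..2*n+1}}"
  proof (intro equalityI subsetI)
    fix z assume "z \<in> {z\<in>?X. \<not> z \<le> r \<and> d z \<le> r}"
    then have z: "z \<in> ?X" "\<not> z \<le> r" "d z \<le> r" by auto
    note dz = WB_range[OF dW z(1)]
    have "block_of m z \<noteq> n+1" using m1[OF z(1,2)] z(3) by auto
    moreover have "block_of l (d z) \<noteq> n+1" using m2[OF z(1,3)] z(2) by auto
    moreover have "n+1 \<le> block_of m z" "block_of l (d z) \<le> n+1"
      using block_of_half(2)[OF m z(1,2)] block_of_half(1)[OF l dz z(3)] by auto
    ultimately show "z \<in> {z\<in>?X. (block_of l (d z), block_of m z) \<in> {1..n} \<times> {n+2..2*n+1}}"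
      using z(1) block_of_props(1)[OF l dz] block_of_props(1)[OF m z(1)] by auto
  next
    fix z assume "z \<in> {z\<in>?X. (block_of l (d z), block_of m z) \<in> {1..n} \<times> {n+2..2*n+1}}"
    then have z: "z \<in> ?X" "block_of l (d z) \<le> n" "n+2 \<le> block_of m z" by auto
    show "z \<in> {z\<in>?X. \<not> z \<le> r \<and> d z \<le> r}"
      using z block_of_half(1)[OF m z(1)] block_of_half(2)[OF l WB_range[OF dW z(1)]] by force
  qed
  also have "card \<dots> = (\<Sum>p\<in>{1..n} \<times> {n+2..2*n+1}. card {z\<in>?X. (block_of l (d z), block_of m z) = p})"
    by (rule card_fibres) auto
  also have "\<dots> = (\<Sum>i=1..n. \<Sum>j=n+2..2*n+1. A i j)"
    unfolding sum.cartesian_product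
    by (rule sum.cong) (auto simp: dA[symmetric] coset_mat_eq[OF l m dW] prod_eq_iff)
  finally show ?thesis using dW unfolding WD_def sgnM_def by auto
qed

end

section \<open>Double cosets of type D\<close>

context schur
begin

text \<open>A letter that crosses the centre without leaving its block lies in the middle block.\<close>

lemma stabB_flips:
  assumes l: "l \<in> Lam n r" and u: "u \<in> stabB r (block_of l)"
  shows "{i\<in>middle l. i \<le> r \<and> u i > r} = {i\<in>{1..r}. u i > r}"
proof (intro equalityI subsetI)
  fix i assume "i \<in> {i\<in>{1..r}. u i > r}"
  then have i: "i \<in> {1..2*r}" "i \<le> r" "u i > r" by auto
  then have e: "block_of l (u i) = block_of l i" "u i \<in> {1..2*r}" using u WB_range[OF stabB_WB[OF u]] by (auto simp: stabB_def)
  have "block_of l i = n+1" using block_of_half(1)[OF l i(1,2)] block_of_half(2)[OF l e(2)] i(3) e(1) by auto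
  then show "i \<in> {i\<in>middle l. i \<le> r \<and> u i > r}" using i by (simp add: middle_def)
qed (auto simp: middle_def)

lemma stabB_WD_iff:
  assumes l: "l \<in> Lam n r" and u: "u \<in> stabB r (block_of l)"
  shows "u \<in> WD r \<longleftrightarrow> even (flips r (middle l) u)"
  using stabB_flips[OF assms] stabB_WB[OF u] unfolding WD_def flips_def by auto

lemma middle_sub: "middle l \<subseteq> {1..2*r}" by (auto simp: middle_def)

lemma middle_mirror: "l \<in> Lam n r \<Longrightarrow> i \<in> middle l \<Longrightarrow> 2*r+1-i \<in> middle l"
  unfolding middle_def using labelling_mirror[OF labelling_block_of, of l i] by auto

lemma stabB_middle:
  assumes u: "u \<in> stabB r (block_of l)" shows "u ` middle l = middle l"
proof (rule card_subset_eq)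
  show "finite (middle l)" by (simp add: middle_def)
  show "u ` middle l \<subseteq> middle l" using u WB_range[OF stabB_WB[OF u]] unfolding middle_def stabB_def by auto
  show "card (u ` middle l) = card (middle l)"
    by (rule card_image) (use WB_inj[OF stabB_WB[OF u]] in \<open>auto intro: inj_onI\<close>)
qed

lemma mid_flips_left:
  assumes l: "l \<in> Lam n r" and u: "u \<in> stabB r (block_of l)" and w: "w \<in> WB r"
  shows "even (mid_flips l (u \<circ> w)) \<longleftrightarrow> (even (mid_flips l w) \<longleftrightarrow> u \<in> WD r)"
proof -
  have uW: "u \<in> WB r" using stabB_WB[OF u] .
  have "even (flips r (middle l) (inv w \<circ> inv u)) \<longleftrightarrow>
      (even (flips r (middle l) (inv u)) \<longleftrightarrow> even (flips r (inv u ` middle l) (inv w)))"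
    by (rule flips_comp[OF middle_sub middle_mirror[OF l]]) (use uW w in auto)
  then show ?thesis
    unfolding mid_flips_def WB_inv_distrib[OF uW w] stabB_middle[OF stabB_inv[OF u]]
      stabB_WD_iff[OF l stabB_inv[OF u], symmetric] WD_inv_iff[OF uW] by blast
qed

text \<open>If the central entry vanishes, the letters of the middle row block lie outside the middle column block, where
  \<open>v\<close> cannot move them across the centre.\<close>

lemma mid_flips_right:
  assumes l: "l \<in> Lam n r" and m: "m \<in> Lam n r" and v: "v \<in> stabB r (block_of m)" and w: "w \<in> WB r"
    and c: "coset_mat n l w m (n+1) (n+1) = 0"
  shows "even (mid_flips l (w \<circ> v)) \<longleftrightarrow> even (mid_flips l w)"
proof -
  have vW: "v \<in> WB r" using stabB_WB[OF v] .
  have "{z\<in>{1..2*r}. block_of l (w z) = n+1 \<and> block_of m z = n+1} = {}"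
    using c unfolding coset_mat_eq[OF l m w] by (subst (asm) card_eq_0_iff) auto
  then have nm: "block_of m z \<noteq> n+1" if "z \<in> inv w ` middle l" for z
    using that w WB_range[OF WB_inv[OF w]] unfolding middle_def by auto
  have "{i \<in> inv w ` middle l. i \<le> r \<and> inv v i > r} = {}"
  proof (rule ccontr)
    assume "{i \<in> inv w ` middle l. i \<le> r \<and> inv v i > r} \<noteq> {}"
    then obtain i where i: "i \<in> inv w ` middle l" "i \<le> r" "inv v i > r" by auto
    have r: "i \<in> {1..2*r}" using i(1) WB_range[OF WB_inv[OF w]] middle_sub by blast
    then have "inv v i \<in> {1..2*r}" "block_of m (inv v i) = block_of m i"
      using stabB_inv[OF v] WB_range[OF WB_inv[OF vW]] by (auto simp: stabB_def)
    then have "block_of m i = n+1" using block_of_half(1)[OF m r i(2)] block_of_half(2)[OF m, of "inv v i"] i(3) by auto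
    then show False using nm[OF i(1)] by simp
  qed
  then have "flips r (inv w ` middle l) (inv v) = 0" unfolding flips_def by simp
  moreover have "even (flips r (middle l) (inv v \<circ> inv w)) \<longleftrightarrow>
      (even (flips r (middle l) (inv w)) \<longleftrightarrow> even (flips r (inv w ` middle l) (inv v)))"
    by (rule flips_comp[OF middle_sub middle_mirror[OF l]]) (use vW w in auto)
  ultimately show ?thesis unfolding mid_flips_def WB_inv_distrib[OF w vW] by simp
qed

text \<open>For a factorisation through the type B stabilisers, the parity and \<open>mid_flips\<close> determine the parities
  of both factors, as the right factor does not affect \<open>mid_flips\<close>.\<close>

lemma dcoset_sgn:
  assumes l: "l \<in> Lam n r" and m: "m \<in> Lam n r" and w: "w \<in> WB r"
    and c: "coset_mat n l w m (n+1) (n+1) = 0"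
  shows "double_coset (stabD r (block_of l)) w (stabD r (block_of m)) = {x\<in>WB r. coset_mat n l x m = coset_mat n l w m
    \<and> (x \<in> WD r \<longleftrightarrow> w \<in> WD r) \<and> (even (mid_flips l x) \<longleftrightarrow> even (mid_flips l w))}"
proof -
  have key: "u \<circ> w \<circ> v \<in> WB r \<and> coset_mat n l (u \<circ> w \<circ> v) m = coset_mat n l w m
      \<and> (even (mid_flips l (u \<circ> w \<circ> v)) \<longleftrightarrow> (even (mid_flips l w) \<longleftrightarrow> u \<in> WD r))
      \<and> (u \<circ> w \<circ> v \<in> WD r \<longleftrightarrow> ((u \<in> WD r \<longleftrightarrow> w \<in> WD r) \<longleftrightarrow> v \<in> WD r))"
    if u: "u \<in> stabB r (block_of l)" and v: "v \<in> stabB r (block_of m)" for u v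
  proof -
    have W: "u \<in> WB r" "v \<in> WB r" "u \<circ> w \<in> WB r" using u v w stabB_WB WB_comp by blast+
    have "coset_mat n l (u \<circ> w \<circ> id) m (n+1) (n+1) = 0"
      unfolding coset_mat_invariant[OF l m w u stabB_id] by (rule c)
    then have "even (mid_flips l (u \<circ> w \<circ> v)) \<longleftrightarrow> even (mid_flips l (u \<circ> w))"
      by (intro mid_flips_right[OF l m v W(3)]) simp
    then show ?thesis
      using coset_mat_invariant[OF l m w u v] mid_flips_left[OF l u w] WD_comp_iff[OF W(3,2)] WD_comp_iff[OF W(1) w]
        WB_comp[OF W(3,2)] by blast
  qed
  show ?thesis
  proof (intro equalityI subsetI)
    fix x assume "x \<in> double_coset (stabD r (block_of l)) w (stabD r (block_of m))"
    then obtain u v where uv: "x = u \<circ> w \<circ> v" "u \<in> stabB r (block_of l)" "v \<in> stabB r (block_of m)" "u \<in> WD r" "v \<in> WD r"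
      unfolding double_coset_def stabD_stabB by blast
    show "x \<in> {x\<in>WB r. coset_mat n l x m = coset_mat n l w m
        \<and> (x \<in> WD r \<longleftrightarrow> w \<in> WD r) \<and> (even (mid_flips l x) \<longleftrightarrow> even (mid_flips l w))}"
      using key[OF uv(2,3)] uv(4,5) unfolding uv(1) by blast
  next
    fix x assume "x \<in> {x\<in>WB r. coset_mat n l x m = coset_mat n l w m
        \<and> (x \<in> WD r \<longleftrightarrow> w \<in> WD r) \<and> (even (mid_flips l x) \<longleftrightarrow> even (mid_flips l w))}"
    then have x: "x \<in> WB r" "coset_mat n l w m = coset_mat n l x m"
      "x \<in> WD r \<longleftrightarrow> w \<in> WD r" "even (mid_flips l x) \<longleftrightarrow> even (mid_flips l w)" by auto
    obtain u v where uv: "u \<in> stabB r (block_of l)" "v \<in> stabB r (block_of m)" "x = u \<circ> w \<circ> v"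
      using same_coset_mat[OF l m w x(1,2)] by blast
    have "u \<in> WD r" "v \<in> WD r" using key[OF uv(1,2)] x(3,4) unfolding uv(3) by blast+
    then show "x \<in> double_coset (stabD r (block_of l)) w (stabD r (block_of m))"
      using uv unfolding double_coset_def stabD_stabB by blast
  qed
qed

text \<open>A letter of the middle column block that lies in the middle row block can be exchanged with its mirror
  image from the left or from the right, which corrects the parities of both factors.\<close>

lemma dcoset_bul:
  assumes l: "l \<in> Lam n r" and m: "m \<in> Lam n r" and w: "w \<in> WD r"
    and c: "coset_mat n l w m (n+1) (n+1) \<noteq> 0"
  shows "double_coset (stabD r (block_of l)) w (stabD r (block_of m)) = {x\<in>WD r. coset_mat n l x m = coset_mat n l w m}"
proof -
  have wW: "w \<in> WB r" using w WD_WB by blast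
  show ?thesis
  proof (intro equalityI subsetI)
    fix x assume "x \<in> double_coset (stabD r (block_of l)) w (stabD r (block_of m))"
    then obtain u v where uv: "x = u \<circ> w \<circ> v" "u \<in> stabB r (block_of l)" "v \<in> stabB r (block_of m)" "u \<in> WD r" "v \<in> WD r"
      unfolding double_coset_def stabD_stabB by blast
    then show "x \<in> {x\<in>WD r. coset_mat n l x m = coset_mat n l w m}"
      using coset_mat_invariant[OF l m wW uv(2,3)] WD_comp[OF WD_comp[OF uv(4) w] uv(5)] by blast
  next
    fix x assume "x \<in> {x\<in>WD r. coset_mat n l x m = coset_mat n l w m}"
    then have x: "x \<in> WB r" "coset_mat n l w m = coset_mat n l x m" "x \<in> WD r" using WD_WB by auto
    obtain u v where uv: "u \<in> stabB r (block_of l)" "v \<in> stabB r (block_of m)" "x = u \<circ> w \<circ> v"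
      using same_coset_mat[OF l m wW x(1,2)] by blast
    have W: "u \<in> WB r" "v \<in> WB r" using uv stabB_WB by blast+
    have p: "u \<in> WD r \<longleftrightarrow> v \<in> WD r"
      using x(3) w WD_comp_iff[OF WB_comp[OF W(1) wW] W(2)] WD_comp_iff[OF W(1) wW] unfolding uv(3) by blast
    show "x \<in> double_coset (stabD r (block_of l)) w (stabD r (block_of m))"
    proof (cases "u \<in> WD r")
      case True
      then show ?thesis using uv p unfolding double_coset_def stabD_stabB by blast
    next
      case False
      have "{z\<in>{1..2*r}. block_of l (w z) = n+1 \<and> block_of m z = n+1} \<noteq> {}"
      proof
        assume e: "{z\<in>{1..2*r}. block_of l (w z) = n+1 \<and> block_of m z = n+1} = {}"
        show False using c unfolding coset_mat_eq[OF l m wW] e by simp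
      qed
      then obtain z where z: "z \<in> {1..2*r}" "block_of l (w z) = n+1" "block_of m z = n+1" by blast
      let ?z = "2*r+1-z"
      have z': "?z \<in> {1..2*r}" "z \<noteq> ?z" "block_of m z = block_of m ?z" "w ?z = 2*r+1 - w z"
        using mirror_range[OF z(1)] mirror_neq[of r z] labelling_mirror[OF labelling_block_of[OF m] z(1)] z WB_mirror[OF wW z(1)]
        by auto
      have wz: "w z \<in> {1..2*r}" "w ?z \<in> {1..2*r}" using WB_range[OF wW z(1)] WB_range[OF wW z'(1)] by blast+
      have wne: "w z \<noteq> w ?z" using WB_inj[OF wW] z'(2) by simp
      define t s where "t = reflection r z ?z" and "s = reflection r (w z) (w ?z)"
      have tP: "t \<in> stabB r (block_of m)" unfolding t_def stabB_def
        using reflection_WB[OF z(1) z'(1,2)] labelling_reflection[OF labelling_block_of[OF m] z(1) z'(1,3)] by blast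
      have "block_of l (w z) = block_of l (w ?z)" using labelling_mirror[OF labelling_block_of[OF l] wz(1)] z'(4) z(2) by simp
      then have sP: "s \<in> stabB r (block_of l)" unfolding s_def stabB_def
        using reflection_WB[OF wz wne] labelling_reflection[OF labelling_block_of[OF l] wz] by blast
      have sw: "s \<circ> w = w \<circ> t" unfolding s_def t_def by (rule reflection_conj[OF wW z(1) z'(1)])
      have tt: "t \<circ> t = id" unfolding t_def by (rule reflection_invol[OF z(1) z'(1,2)])
      have tW: "t \<in> WB r" "s \<in> WB r" using tP sP stabB_WB by blast+
      have tn: "t \<notin> WD r"
      proof -
        have "{i\<in>{1..r}. t i > r} = {min z ?z}"
          using z(1) z'(1,2) unfolding t_def reflection_def by (auto simp: min_def split: if_splits)
        then have "odd (card {i\<in>{1..r}. t i > r})" by simp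
        then show ?thesis unfolding WD_def by blast
      qed
      then have sn: "s \<notin> WD r"
        using sw WD_comp_iff[OF tW(2) wW] WD_comp_iff[OF wW tW(1)] w by simp
      have "(u \<circ> s) \<circ> w \<circ> (t \<circ> v) = u \<circ> (s \<circ> w) \<circ> t \<circ> v" by (simp only: comp_assoc)
      also have "\<dots> = u \<circ> w \<circ> (t \<circ> t) \<circ> v" unfolding sw by (simp only: comp_assoc)
      also have "\<dots> = x" unfolding tt uv(3) by simp
      finally have "x = (u \<circ> s) \<circ> w \<circ> (t \<circ> v)" ..
      moreover have "u \<circ> s \<in> stabD r (block_of l)" "t \<circ> v \<in> stabD r (block_of m)"
        unfolding stabD_stabB using stabB_comp uv sP tP WD_comp_iff[OF W(1) tW(2)] WD_comp_iff[OF tW(1) W(2)]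
          False p sn tn by auto
      ultimately show ?thesis unfolding double_coset_def by blast
    qed
  qed
qed

lemma mid_iff:
  assumes l: "l \<in> Lam n r"
  shows "l (n+1) \<noteq> 0 \<Longrightarrow> block_of l r = n+1 \<and> block_of l (r+1) = n+1"
    and "l (n+1) = 0 \<Longrightarrow> x \<in> {1..2*r} \<Longrightarrow> block_of l x \<noteq> n+1"
proof -
  have r: "r \<in> {1..2*r}" "r+1 \<in> {1..2*r}" using r2 by auto
  {
    assume z: "l (n+1) \<noteq> 0"
    have "psum l n + l (n+1) = r" using l psum_small[of n l] unfolding Lam_def by simp
    then have "\<not> block_of l r \<le> n" using block_of_le_iff[OF l r(1), of n] z by simp
    moreover have "block_of l r \<le> n+1" using block_of_half(1)[OF l r(1)] by simp
    ultimately have "block_of l r = n+1" by simp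
    moreover have "block_of l r + block_of l (r+1) = 2*n+2"
    proof -
      have "block_of l r + block_of l (2*r+1-r) = 2*n+2" using labelling_block_of[OF l] r(1) unfolding labelling_def by blast
      then show ?thesis by (simp add: mult_2)
    qed
    ultimately show "block_of l r = n+1 \<and> block_of l (r+1) = n+1" by simp
  }
  {
    assume z: "l (n+1) = 0" and x: "x \<in> {1..2*r}"
    have "card {x\<in>{1..2*r}. block_of l x = n+1} = 0" unfolding card_block[OF l] using z by (simp add: hat_def)
    then show "block_of l x \<noteq> n+1" using x by (auto simp: card_eq_0_iff)
  }
qed

lemma sr_stabB: "l \<in> Lam n r \<Longrightarrow> l (n+1) \<noteq> 0 \<Longrightarrow> sgen r r \<in> stabB r (block_of l)"
  using sgen_stabB[OF labelling_block_of, of l r] mid_iff(1)[of l] r2 by auto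

lemma stabB_eq_stabD:
  assumes l: "l \<in> Lam n r" and z: "l (n+1) = 0" shows "stabB r (block_of l) = stabD r (block_of l)"
proof -
  have "middle l = {}" using mid_iff(2)[OF l z] unfolding middle_def by blast
  then have "flips r (middle l) u = 0" for u unfolding flips_def by simp
  then show ?thesis using stabB_WD_iff[OF l] unfolding stabD_stabB by auto
qed

definition sg :: "sign \<Rightarrow> nat \<Rightarrow> nat" where "sg e = s_sign r e"

lemma sg_simps [simp]: "sg Pos = id" "sg Neg = sgen r r" by (simp_all add: sg_def s_sign_def)

lemma sg_WB: "sg e \<in> WB r" using sgen_WB[of r] r2 by (cases e) auto
lemma sg_sg [simp]: "sg e \<circ> sg e = id" using sgen_invol[of r] r2 by (cases e) simp_all
lemma sg_WD_iff: "sg e \<in> WD r \<longleftrightarrow> e = Pos" using sgen_r_notWD by (cases e) simp_all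
text \<open>The stabiliser of a weight is the conjugate of a type D block stabiliser by \<open>sg (twist b)\<close>.\<close>

definition twist :: "dweight \<Rightarrow> sign" where
  "twist b = (case b of Bul _ \<Rightarrow> Pos | Sgn e _ \<Rightarrow> e)"

definition underlying :: "dweight \<Rightarrow> vect" where
  "underlying b = (case b of Bul l \<Rightarrow> l | Sgn _ l \<Rightarrow> l)"

lemma LamD_underlying: "b \<in> LamD n r \<Longrightarrow> underlying b \<in> Lam n r"
  unfolding LamD_def underlying_def by auto

lemma WDpar_eq:
  assumes "b \<in> LamD n r"
  shows "WDpar n r b = (\<lambda>u. sg (twist b) \<circ> u \<circ> sg (twist b)) ` stabD r (block_of (underlying b))"
proof -
  consider l where "b = Bul l" "l \<in> Lam n r" | e l where "b = Sgn e l" "l \<in> Lam n r" "l (n+1) = 0"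
    using assms unfolding LamD_def by blast
  then show ?thesis
  proof cases
    case (1 l)
    then show ?thesis using Wpar_stabB[of l] by (simp add: twist_def underlying_def stabD_stabB)
  next
    case (2 e l)
    then show ?thesis using Wpar_stabB[of l] stabB_eq_stabD[of l]
      by (cases e) (auto simp: twist_def underlying_def)
  qed
qed

lemma sgen_r_conj_dgen:
  assumes i: "i \<in> {1..r}" shows "sgen r r \<circ> dgen r i \<circ> sgen r r \<in> gensD r"
proof -
  have r: "r \<in> {1..r}" using r2 by simp
  consider "i + 2 \<le> r" | "i = r-1" | "i = r" using i by fastforce
  then show ?thesis
  proof cases
    case 1
    then have "sgen r i \<circ> sgen r r = sgen r r \<circ> sgen r i" using sgen_commute[of i r] i by simp
    then have "sgen r r \<circ> dgen r i \<circ> sgen r r = sgen r r \<circ> (sgen r r \<circ> sgen r i)"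
      using 1 r2 by (simp add: dgen_def comp_assoc)
    then have "sgen r r \<circ> dgen r i \<circ> sgen r r = dgen r i" using 1 r r2 by (simp add: dgen_def)
    then show ?thesis using gensD_dgen i by auto
  next
    case 2
    then have "sgen r r \<circ> dgen r i \<circ> sgen r r = dgen r r" using r2 by (simp add: dgen_def)
    then show ?thesis using gensD_dgen r by auto
  next
    case 3
    have "sgen r r \<circ> dgen r i \<circ> sgen r r = sgen r r \<circ> (sgen r r \<circ> sgen r (r-1) \<circ> sgen r r) \<circ> sgen r r"
      using 3 by (simp add: dgen_def)
    also have "\<dots> = (sgen r r \<circ> sgen r r) \<circ> sgen r (r-1) \<circ> (sgen r r \<circ> sgen r r)" by (simp only: comp_assoc)
    also have "\<dots> = dgen r (r-1)" using r r2 by (simp add: dgen_def)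
    finally show ?thesis using gensD_dgen r2 by auto
  qed
qed

text \<open>This applies to the conjugation by \<open>sgen r r\<close>, the diagram automorphism of type D.\<close>

lemma words_conj:
  fixes s :: "nat \<Rightarrow> nat"
  assumes "s \<circ> s = id" shows "words ((\<lambda>u. s \<circ> u \<circ> s) ` S) = (\<lambda>u. s \<circ> u \<circ> s) ` words S"
proof -
  have *: "compose_list (map (\<lambda>u. s \<circ> u \<circ> s) ws) = s \<circ> compose_list ws \<circ> s" for ws
  proof (induction ws)
    case Nil
    show ?case unfolding list.map compose_list_Nil comp_id using assms by simp
  next
    case (Cons a ws)
    have "compose_list (map (\<lambda>u. s \<circ> u \<circ> s) (a # ws)) = s \<circ> a \<circ> (s \<circ> s) \<circ> compose_list ws \<circ> s"
      unfolding list.map compose_list_Cons Cons by (simp only: comp_assoc)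
    then show ?case unfolding assms by (simp only: comp_assoc comp_id compose_list_Cons)
  qed
  show ?thesis
  proof (intro equalityI subsetI)
    fix w assume "w \<in> words ((\<lambda>u. s \<circ> u \<circ> s) ` S)"
    then obtain ws where ws: "set ws \<subseteq> (\<lambda>u. s \<circ> u \<circ> s) ` S" "w = compose_list ws" unfolding words_def by blast
    have "\<exists>vs. ws = map (\<lambda>u. s \<circ> u \<circ> s) vs \<and> set vs \<subseteq> S"
    proof -
      define g where "g = inv_into S (\<lambda>u. s \<circ> u \<circ> s)"
      have "map (\<lambda>u. s \<circ> u \<circ> s) (map g ws) = ws" "set (map g ws) \<subseteq> S"
        using ws(1) f_inv_into_f[of _ "\<lambda>u. s \<circ> u \<circ> s" S] inv_into_into[of _ "\<lambda>u. s \<circ> u \<circ> s" S]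
        unfolding g_def by (auto simp: map_idI subset_iff)
      then show ?thesis by metis
    qed
    then show "w \<in> (\<lambda>u. s \<circ> u \<circ> s) ` words S" using ws(2) * unfolding words_def by blast
  next
    fix w assume "w \<in> (\<lambda>u. s \<circ> u \<circ> s) ` words S"
    then obtain ws where ws: "set ws \<subseteq> S" "w = s \<circ> compose_list ws \<circ> s" unfolding words_def by blast
    have "w = compose_list (map (\<lambda>u. s \<circ> u \<circ> s) ws)" using ws(2) * by simp
    moreover have "set (map (\<lambda>u. s \<circ> u \<circ> s) ws) \<subseteq> (\<lambda>u. s \<circ> u \<circ> s) ` S" using ws(1) by auto
    ultimately show "w \<in> words ((\<lambda>u. s \<circ> u \<circ> s) ` S)" unfolding words_def by blast
  qed
qed

lemma WDpar_words:
  assumes b: "b \<in> LamD n r" shows "\<exists>J\<subseteq>gensD r. WDpar n r b = words J"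
proof -
  let ?s = "sg (twist b)" and ?I = "dgen r ` block_gens r (block_of (underlying b))"
  have "(\<lambda>u. ?s \<circ> u \<circ> ?s) ` ?I \<subseteq> gensD r"
  proof (cases "twist b")
    case Pos
    then show ?thesis using gensD_dgen block_gens_labelling by auto
  next
    case Neg
    then show ?thesis using sgen_r_conj_dgen block_gens_labelling by auto
  qed
  moreover have "WDpar n r b = words ((\<lambda>u. ?s \<circ> u \<circ> ?s) ` ?I)"
    unfolding WDpar_eq[OF b] words_conj[OF sg_sg] stabD_words[OF labelling_block_of[OF LamD_underlying[OF b]]] ..
  ultimately show ?thesis by blast
qed

lemma words_inv:
  assumes J: "J \<subseteq> gensD r" and u: "u \<in> words J" shows "u \<in> WB r" "inv u \<in> words J"
proof -
  show W: "u \<in> WB r" using D.words_in words_mono[OF J] u by blast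
  obtain ws where ws: "set ws \<subseteq> J" "u = compose_list ws" using u unfolding words_def by blast
  have "inv (compose_list ws) \<in> words J" if "set ws \<subseteq> J" for ws
    using that
  proof (induction ws)
    case Nil
    show ?case unfolding compose_list_Nil inv_id by (rule words_id)
  next
    case (Cons s ws)
    have s: "s \<in> J" "s \<in> gensD r" using Cons.prems J by auto
    then obtain i where i: "i \<in> {1..r}" "s = dgen r i" unfolding gensD_dgen by blast
    have c: "compose_list ws \<in> WB r" using D.compose_list_in[of ws] Cons.prems J by auto
    have "inv (compose_list ws) \<circ> s \<in> words J"
      using words_comp[OF Cons.IH words_gen[OF s(1)]] Cons.prems by simp
    then show ?case unfolding compose_list_Cons i(2) inv_dgen_comp[OF i(1) c] .
  qed
  then show "inv u \<in> words J" using ws by blast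
qed

text \<open>The minimal representative generates the double coset it was chosen from, so it may be replaced by any
  other representative.\<close>

lemma min_rep_coset:
  assumes a: "a \<in> LamD n r" and b: "b \<in> LamD n r" and x: "x \<in> WD r"
  shows "double_coset (WDpar n r a) (min_rep (gensD r) (double_coset (WDpar n r a) x (WDpar n r b))) (WDpar n r b)
    = double_coset (WDpar n r a) x (WDpar n r b)"
proof -
  obtain I where I: "I \<subseteq> gensD r" "WDpar n r a = words I" using WDpar_words[OF a] by blast
  obtain J where J: "J \<subseteq> gensD r" "WDpar n r b = words J" using WDpar_words[OF b] by blast
  let ?D = "double_coset (words I) x (words J)"
  have "id \<circ> x \<circ> id \<in> ?D" unfolding double_coset_def using words_id by blast
  then obtain d where d: "is_min_rep (gensD r) ?D d" using min_rep_exists[of ?D] by blast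
  have xw: "x \<in> words (gensD r)" using x words_gensD by simp
  have "min_rep (gensD r) ?D = d"
    unfolding min_rep_def by (rule the_equality[of "is_min_rep (gensD r) ?D", OF d]) (rule D.min_rep_unique[OF I(1) J(1) xw _ d])
  moreover have "d \<in> ?D" using d unfolding is_min_rep_def by blast
  then obtain u v where uv: "d = u \<circ> x \<circ> v" "u \<in> words I" "v \<in> words J" unfolding double_coset_def by blast
  have "double_coset (words I) d (words J) = ?D"
  proof (intro equalityI subsetI)
    fix y assume "y \<in> double_coset (words I) d (words J)"
    then obtain u' v' where y: "y = u' \<circ> d \<circ> v'" "u' \<in> words I" "v' \<in> words J" unfolding double_coset_def by blast
    have "y = (u' \<circ> u) \<circ> x \<circ> (v \<circ> v')" unfolding y uv(1) by (simp only: comp_assoc)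
    then show "y \<in> ?D" unfolding double_coset_def using words_comp[OF y(2) uv(2)] words_comp[OF uv(3) y(3)] by blast
  next
    fix y assume "y \<in> ?D"
    then obtain u' v' where y: "y = u' \<circ> x \<circ> v'" "u' \<in> words I" "v' \<in> words J" unfolding double_coset_def by blast
    note uI = words_inv[OF I(1) uv(2)] and vJ = words_inv[OF J(1) uv(3)]
    have "(u' \<circ> inv u) \<circ> d \<circ> (inv v \<circ> v') = u' \<circ> (inv u \<circ> u) \<circ> x \<circ> (v \<circ> inv v) \<circ> v'"
      unfolding uv(1) by (simp only: comp_assoc)
    then have "y = (u' \<circ> inv u) \<circ> d \<circ> (inv v \<circ> v')"
      unfolding y WB_inv_comp(1)[OF uI(1)] WB_inv_comp(2)[OF vJ(1)] by simp
    then show "y \<in> double_coset (words I) d (words J)"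
      unfolding double_coset_def using words_comp[OF y(2) uI(2)] words_comp[OF vJ(2) y(3)] by blast
  qed
  ultimately show ?thesis unfolding I(2) J(2) by simp
qed

end

section \<open>The homomorphisms as left multiplications\<close>

lemma inj_at_same [simp]: "inj_at a x a = x" by (simp add: inj_at_def)
lemma inj_at_zero [simp]: "inj_at a 0 = 0" by (auto simp: inj_at_def fun_eq_iff)
lemma inj_at_add: "inj_at a (x + y) = inj_at a x + inj_at a y" by (auto simp: inj_at_def fun_eq_iff)

lemma finite_Lam: "finite (Lam n k)"
proof -
  have "Lam n k \<subseteq> {f. \<forall>i. (i \<in> {1..n+1} \<longrightarrow> f i \<in> {0..k}) \<and> (i \<notin> {1..n+1} \<longrightarrow> f i = 0)}"
  proof
    fix l assume l: "l \<in> Lam n k"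
    have "l i \<le> k" if "i \<in> {1..n+1}" for i
      using member_le_sum[of i "{1..n+1}" l] that l unfolding Lam_def by auto
    then show "l \<in> {f. \<forall>i. (i \<in> {1..n+1} \<longrightarrow> f i \<in> {0..k}) \<and> (i \<notin> {1..n+1} \<longrightarrow> f i = 0)}"
      using l unfolding Lam_def by auto
  qed
  then show ?thesis by (rule finite_subset) (rule finite_set_of_finite_funs, auto)
qed

lemma finite_LamD: "finite (LamD n k)"
proof -
  have "LamD n k \<subseteq> Bul ` Lam n k \<union> Sgn Pos ` Lam n k \<union> Sgn Neg ` Lam n k"
  proof
    fix b assume b: "b \<in> LamD n k"
    show "b \<in> Bul ` Lam n k \<union> Sgn Pos ` Lam n k \<union> Sgn Neg ` Lam n k"
    proof (cases b)
      case (Sgn e l)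
      then show ?thesis using b unfolding LamD_def by (cases e) auto
    qed (use b in \<open>auto simp: LamD_def\<close>)
  qed
  then show ?thesis by (rule finite_subset) (simp add: finite_Lam)
qed

lemma sum_inj_at:
  assumes "finite F" shows "(\<Sum>c\<in>F. inj_at c (v c)) = (\<lambda>a. if a \<in> F then v a else 0)"
  using assms
proof (induction F)
  case (insert c F)
  then show ?case by (auto simp: fun_eq_iff inj_at_def)
qed (simp add: fun_eq_iff)

context schur
begin

abbreviation permT :: "(dweight \<Rightarrow> 'r hecke) set" where "permT \<equiv> permD n"

text \<open>Left multiplication by \<open>z\<close> from component \<open>b\<close> to component \<open>a\<close>. Like every element of \<open>schurD\<close> it
  vanishes outside the permutation module.\<close>

definition left_mult :: "dweight \<Rightarrow> dweight \<Rightarrow> 'r hecke \<Rightarrow> 'r endo" where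
  "left_mult a b z = (\<lambda>v. if v \<in> permT then inj_at a (z * v b) else 0)"

lemma permD_iff: "v \<in> permT \<longleftrightarrow> (\<forall>a\<in>LamD n r. \<exists>h\<in>heckeD. v a = xD n a * h) \<and> (\<forall>a. a \<notin> LamD n r \<longrightarrow> v a = 0)"
  unfolding permD_def card_r by auto

lemma heckeD_add: "x \<in> heckeD \<Longrightarrow> y \<in> heckeD \<Longrightarrow> x + y \<in> (heckeD :: 'r hecke set)"
  unfolding heckeD_def by (rule gen_subalgebra.add)

lemma permD_inj_at:
  assumes "c \<in> LamD n r" "h \<in> heckeD" shows "inj_at c (xD n c * h) \<in> permT"
  unfolding permD_iff
proof (intro conjI ballI allI impI)
  fix a assume "a \<in> LamD n r"
  show "\<exists>h'\<in>heckeD. inj_at c (xD n c * h) a = xD n a * h'"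
  proof (cases "a = c")
    case True
    then show ?thesis using assms by (auto simp: inj_at_def)
  next
    case False
    then show ?thesis using heckeD_zero by (intro bexI[of _ 0]) (auto simp: inj_at_def)
  qed
qed (use assms in \<open>auto simp: inj_at_def\<close>)

lemma permD_zero: "0 \<in> permT"
  unfolding permD_iff using heckeD_zero by (auto intro: bexI[of _ 0])

lemma permD_add:
  assumes "u \<in> permT" "v \<in> permT" shows "u + v \<in> permT"
  unfolding permD_iff
proof (intro conjI ballI allI impI)
  fix a assume a: "a \<in> LamD n r"
  obtain h where h: "h \<in> heckeD" "u a = xD n a * h" using assms(1) a unfolding permD_iff by blast
  obtain k where k: "k \<in> heckeD" "v a = xD n a * k" using assms(2) a unfolding permD_iff by blast
  show "\<exists>h\<in>heckeD. (u + v) a = xD n a * h"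
    using heckeD_add[OF h(1) k(1)] h(2) k(2) by (auto simp: distrib_left intro!: bexI[of _ "h+k"])
qed (use assms in \<open>auto simp: permD_iff\<close>)

lemma permD_scale:
  assumes "v \<in> permT" "k \<in> heckeD" shows "(\<lambda>a. v a * k) \<in> permT"
  unfolding permD_iff
proof (intro conjI ballI allI impI)
  fix a assume a: "a \<in> LamD n r"
  obtain h where h: "h \<in> heckeD" "v a = xD n a * h" using assms(1) a unfolding permD_iff by blast
  show "\<exists>h\<in>heckeD. v a * k = xD n a * h"
    using heckeD_mult[OF h(1) assms(2)] h(2) by (auto simp: mult.assoc intro!: bexI[of _ "h*k"])
qed (use assms in \<open>auto simp: permD_iff\<close>)

lemma left_mult_schurD:
  assumes a: "a \<in> LamD n r" and b: "b \<in> LamD n r" and y: "y \<in> heckeD" "z * xD n b = xD n a * y"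
  shows "left_mult a b z \<in> schurD n"
proof -
  have "inj_at a (z * v b) \<in> permT" if vP: "v \<in> permT" for v
  proof -
    obtain h where h: "h \<in> heckeD" "v b = xD n b * h" using vP b unfolding permD_iff by blast
    have "z * v b = xD n a * (y * h)" unfolding h(2) using y(2) by (metis mult.assoc)
    then show ?thesis using permD_inj_at[OF a heckeD_mult[OF y(1) h(1)]] by simp
  qed
  moreover have "inj_at a (z * (v b * h)) = (\<lambda>c. inj_at a (z * v b) c * h)" for v h
    by (auto simp: inj_at_def mult.assoc)
  ultimately show ?thesis
    unfolding schurD_def left_mult_def using permD_add permD_scale
    by (auto simp: distrib_left inj_at_add)
qed

text \<open>A homomorphism is determined by its values on the components, which are finite in number.\<close>

lemma phiD_left_mult:
  assumes a: "a \<in> LamD n r" and b: "b \<in> LamD n r" and y: "y \<in> heckeD" "z * xD n b = xD n a * y"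
    and z: "z * xD n b = Tsum (double_coset (WDpar n r a) d (WDpar n r b))"
  shows "phiD n a b d = left_mult a b z"
proof -
  let ?D = "double_coset (WDpar n r a) d (WDpar n r b)"
  define Q where "Q = (\<lambda>f::'r endo. f \<in> schurD n \<and> (\<forall>c\<in>LamD n r. \<forall>h\<in>heckeD.
      f (inj_at c (xD n c * h)) = (if b = c then inj_at a (Tsum ?D * h) else 0)))"
  have Q: "Q (left_mult a b z)" unfolding Q_def
  proof (intro conjI ballI)
    show "left_mult a b z \<in> schurD n" by (rule left_mult_schurD[OF a b y])
    fix c and h :: "'r hecke" assume c: "c \<in> LamD n r" "h \<in> heckeD"
    show "left_mult a b z (inj_at c (xD n c * h)) = (if b = c then inj_at a (Tsum ?D * h) else 0)"
    proof (cases "b = c")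
      case True
      then show ?thesis using permD_inj_at[OF c] unfolding left_mult_def z[symmetric] by (simp add: mult.assoc)
    next
      case False
      then show ?thesis using permD_inj_at[OF c] unfolding left_mult_def by (simp add: inj_at_def fun_eq_iff)
    qed
  qed
  have uniq: "f = left_mult a b z" if f: "Q f" for f
  proof
    fix v
    show "f v = left_mult a b z v"
    proof (cases "v \<in> permT")
      case False
      then show ?thesis using f unfolding Q_def left_mult_def schurD_def by auto
    next
      case True
      have add: "g (u + w) = g u + g w" if "Q g" "u \<in> permT" "w \<in> permT" for g u w
        using that unfolding Q_def schurD_def by blast
      have zero: "g 0 = 0" if "Q g" for g
        using add[OF that permD_zero permD_zero] by simp
      have comp: "inj_at c (v c) \<in> permT \<and> f (inj_at c (v c)) = left_mult a b z (inj_at c (v c))"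
        if c: "c \<in> LamD n r" for c
      proof -
        obtain h where h: "h \<in> heckeD" "v c = xD n c * h" using True c unfolding permD_iff by blast
        then show ?thesis using permD_inj_at[OF c h(1)] f Q c unfolding Q_def by simp
      qed
      have "(\<Sum>c\<in>F. inj_at c (v c)) \<in> permT \<and> f (\<Sum>c\<in>F. inj_at c (v c)) = left_mult a b z (\<Sum>c\<in>F. inj_at c (v c))"
        if "finite F" "F \<subseteq> LamD n r" for F
        using that
      proof (induction F)
        case empty
        show ?case unfolding sum.empty zero[OF f] zero[OF Q] using permD_zero by blast
      next
        case (insert c F)
        have c: "inj_at c (v c) \<in> permT" "f (inj_at c (v c)) = left_mult a b z (inj_at c (v c))"
          and F: "(\<Sum>c\<in>F. inj_at c (v c)) \<in> permT"
            "f (\<Sum>c\<in>F. inj_at c (v c)) = left_mult a b z (\<Sum>c\<in>F. inj_at c (v c))"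
          using comp[of c] insert by auto
        show ?case
          unfolding sum.insert[OF insert(1,2)] add[OF f c(1) F(1)] add[OF Q c(1) F(1)] c(2) F(2)
          using permD_add[OF c(1) F(1)] by blast
      qed
      from this[OF finite_LamD order_refl] have "f (\<Sum>c\<in>LamD n r. inj_at c (v c)) = left_mult a b z (\<Sum>c\<in>LamD n r. inj_at c (v c))"
        by blast
      moreover have "(\<Sum>c\<in>LamD n r. inj_at c (v c)) = v"
        unfolding sum_inj_at[OF finite_LamD] using True unfolding permD_iff by (auto simp: fun_eq_iff)
      ultimately show ?thesis by simp
    qed
  qed
  have "phiD n a b d = (THE f. Q f)"
    unfolding phiD_def Q_def card_r Tsum_def ..
  then show ?thesis using the_equality[of Q, OF Q uniq] by simp
qed

lemma TW_sg: "w \<in> WB r \<Longrightarrow> TW (sg e \<circ> w) = TW (sg e) * TW w" "w \<in> WB r \<Longrightarrow> TW (w \<circ> sg e) = TW w * TW (sg e)"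
proof -
  have r: "TW (sgen r r) = T r" using TW_left_last[OF WB_id] by simp
  assume w: "w \<in> WB r"
  show "TW (sg e \<circ> w) = TW (sg e) * TW w" using TW_left_last[OF w] r by (cases e) simp_all
  show "TW (w \<circ> sg e) = TW w * TW (sg e)" using TW_right_last[OF w] r by (cases e) simp_all
qed

lemma TW_sg_sg: "TW (sg e) * TW (sg e) = 1"
  using TW_sg(1)[OF sg_WB, of e e] by simp

lemma Tsum_sg:
  assumes "D \<subseteq> WB r" shows "Tsum ((\<lambda>w. w \<circ> sg e) ` D) = Tsum D * TW (sg e)"
proof -
  have "inj_on (\<lambda>w. w \<circ> sg e) D"
    by (rule inj_on_inverseI[of _ "\<lambda>w. w \<circ> sg e"]) (simp add: comp_assoc)
  then show ?thesis
    unfolding Tsum_def sum_distrib_right using assms TW_sg(2) by (subst sum.reindex) (auto intro!: sum.cong)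
qed

lemma xD_eq:
  assumes b: "b \<in> LamD n r"
  shows "xD n b = TW (sg (twist b)) * Tsum (stabD r (block_of (underlying b))) * TW (sg (twist b))"
proof -
  let ?s = "sg (twist b)" and ?P = "stabD r (block_of (underlying b))"
  have "inj_on (\<lambda>u. ?s \<circ> u \<circ> ?s) ?P"
  proof (rule inj_on_inverseI[of _ "\<lambda>u. ?s \<circ> u \<circ> ?s"])
    fix u
    have "?s \<circ> (?s \<circ> u \<circ> ?s) \<circ> ?s = (?s \<circ> ?s) \<circ> u \<circ> (?s \<circ> ?s)" by (simp only: comp_assoc)
    then show "?s \<circ> (?s \<circ> u \<circ> ?s) \<circ> ?s = u" by simp
  qed
  then have "xD n b = (\<Sum>u\<in>?P. TW (?s \<circ> u \<circ> ?s))"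
    unfolding xD_def card_r WDpar_eq[OF b] by (subst sum.reindex) auto
  also have "\<dots> = (\<Sum>u\<in>?P. TW ?s * TW u * TW ?s)"
  proof (rule sum.cong)
    fix u assume "u \<in> ?P"
    then have u: "u \<in> WB r" "?s \<circ> u \<in> WB r" using stabD_WB WB_comp[OF sg_WB] by blast+
    show "TW (?s \<circ> u \<circ> ?s) = TW ?s * TW u * TW ?s" unfolding TW_sg(2)[OF u(2)] TW_sg(1)[OF u(1)] ..
  qed simp
  finally show ?thesis unfolding Tsum_def sum_distrib_left sum_distrib_right .
qed

lemma double_coset_stabD_closed:
  assumes "w \<in> double_coset (stabD r \<beta>) d (stabD r \<gamma>)"
  shows "u \<in> stabD r \<beta> \<Longrightarrow> u \<circ> w \<in> double_coset (stabD r \<beta>) d (stabD r \<gamma>)"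
    and "u \<in> stabD r \<gamma> \<Longrightarrow> w \<circ> u \<in> double_coset (stabD r \<beta>) d (stabD r \<gamma>)"
proof -
  obtain a b where w: "w = a \<circ> d \<circ> b" "a \<in> stabD r \<beta>" "b \<in> stabD r \<gamma>"
    using assms unfolding double_coset_def by blast
  {
    assume u: "u \<in> stabD r \<beta>"
    have "u \<circ> w = (u \<circ> a) \<circ> d \<circ> b" unfolding w(1) by (simp only: comp_assoc)
    then show "u \<circ> w \<in> double_coset (stabD r \<beta>) d (stabD r \<gamma>)"
      unfolding double_coset_def using stabD_comp[OF u w(2)] w(3) by blast
  }
  {
    assume u: "u \<in> stabD r \<gamma>"
    have "w \<circ> u = a \<circ> d \<circ> (b \<circ> u)" unfolding w(1) by (simp only: comp_assoc)
    then show "w \<circ> u \<in> double_coset (stabD r \<beta>) d (stabD r \<gamma>)"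
      unfolding double_coset_def using stabD_comp[OF w(3) u] w(2) by blast
  }
qed

text \<open>Right multiplication by \<open>sg (twist b)\<close> moves the conjugation in the stabiliser of a negative weight out of the
  double coset. Then \<open>z\<close> is found by dividing the sum over \<open>D\<close> by the sum over the stabiliser from the right, while
  dividing it from the left shows that \<open>z * xD n b\<close> lies in the module of \<open>a\<close>.\<close>

lemma phi_left_mult:
  assumes a: "a \<in> LamD n r" "twist a = Pos" and b: "b \<in> LamD n r"
    and d0: "d0 \<in> WB r" "d0 \<circ> sg (twist b) \<in> WD r"
    and D: "D = double_coset (stabD r (block_of (underlying a))) d0 (stabD r (block_of (underlying b)))"
  defines "z \<equiv> Tsum (sortedR (block_of (underlying b)) D) * TW (sg (twist b))"
  shows "phiD n a b (min_rep (gensD r) (double_coset (WDpar n r a) (d0 \<circ> sg (twist b)) (WDpar n r b))) = left_mult a b z"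
    and "z * xD n b = Tsum D * TW (sg (twist b))"
    and "\<exists>y\<in>heckeD. z * xD n b = xD n a * y"
proof -
  let ?s = "sg (twist b)" and ?\<beta> = "block_of (underlying a)" and ?\<gamma> = "block_of (underlying b)"
  let ?dc = "double_coset (WDpar n r a) (d0 \<circ> ?s) (WDpar n r b)"
  note lb = labelling_block_of[OF LamD_underlying[OF a(1)]] labelling_block_of[OF LamD_underlying[OF b]]
  have DW: "D \<subseteq> WB r" unfolding D double_coset_def using d0 stabD_WB WB_comp by blast
  have cl: "\<And>u w. u \<in> stabD r ?\<beta> \<Longrightarrow> w \<in> D \<Longrightarrow> u \<circ> w \<in> D" "\<And>u w. u \<in> stabD r ?\<gamma> \<Longrightarrow> w \<in> D \<Longrightarrow> w \<circ> u \<in> D"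
    unfolding D using double_coset_stabD_closed by blast+
  have Wa: "WDpar n r a = stabD r ?\<beta>" unfolding WDpar_eq[OF a(1)] a(2) by simp
  have dc: "?dc = (\<lambda>w. w \<circ> ?s) ` D"
  proof (intro equalityI subsetI)
    fix w assume "w \<in> ?dc"
    then obtain u v where uv: "u \<in> stabD r ?\<beta>" "v \<in> stabD r ?\<gamma>" "w = u \<circ> (d0 \<circ> ?s) \<circ> (?s \<circ> v \<circ> ?s)"
      unfolding double_coset_def Wa WDpar_eq[OF b] by blast
    have "w = u \<circ> d0 \<circ> (?s \<circ> ?s) \<circ> v \<circ> ?s" unfolding uv(3) by (simp only: comp_assoc)
    then have "w = (u \<circ> d0 \<circ> v) \<circ> ?s" by simp
    then show "w \<in> (\<lambda>w. w \<circ> ?s) ` D" using uv(1,2) unfolding D double_coset_def by blast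
  next
    fix w assume "w \<in> (\<lambda>w. w \<circ> ?s) ` D"
    then obtain u v where uv: "u \<in> stabD r ?\<beta>" "v \<in> stabD r ?\<gamma>" "w = (u \<circ> d0 \<circ> v) \<circ> ?s"
      unfolding D double_coset_def by blast
    have "u \<circ> (d0 \<circ> ?s) \<circ> (?s \<circ> v \<circ> ?s) = u \<circ> d0 \<circ> (?s \<circ> ?s) \<circ> v \<circ> ?s" by (simp only: comp_assoc)
    then have "w = u \<circ> (d0 \<circ> ?s) \<circ> (?s \<circ> v \<circ> ?s)" unfolding uv(3) by (simp only: sg_sg comp_id)
    then show "w \<in> ?dc" using uv(1,2) unfolding double_coset_def Wa WDpar_eq[OF b] by blast
  qed
  have "z * xD n b = Tsum (sortedR ?\<gamma> D) * ((TW ?s * TW ?s) * (Tsum (stabD r ?\<gamma>) * TW ?s))"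
    unfolding z_def xD_eq[OF b] by (simp only: mult.assoc)
  also have "\<dots> = Tsum D * TW ?s"
  proof -
    have "Tsum (sortedR ?\<gamma> D) * Tsum (stabD r ?\<gamma>) = Tsum D" using right_decomp[OF lb(2) DW cl(2)] by simp
    then show ?thesis unfolding TW_sg_sg mult_1_left mult.assoc[symmetric] by simp
  qed
  finally show zx: "z * xD n b = Tsum D * TW ?s" .
  have xa: "xD n a = Tsum (stabD r ?\<beta>)" unfolding xD_eq[OF a(1)] a(2) by simp
  have LW: "sortedL ?\<beta> D \<subseteq> WB r" using DW by (auto simp: sortedL_def)
  have "(\<lambda>w. w \<circ> ?s) ` sortedL ?\<beta> D \<subseteq> WD r"
  proof
    fix w assume "w \<in> (\<lambda>w. w \<circ> ?s) ` sortedL ?\<beta> D"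
    then obtain u v where uv: "u \<in> stabD r ?\<beta>" "v \<in> stabD r ?\<gamma>" "w = (u \<circ> d0 \<circ> v) \<circ> ?s"
      unfolding sortedL_def D double_coset_def by blast
    have "w = u \<circ> ((d0 \<circ> ?s) \<circ> (?s \<circ> v \<circ> ?s))"
    proof -
      have "u \<circ> ((d0 \<circ> ?s) \<circ> (?s \<circ> v \<circ> ?s)) = u \<circ> d0 \<circ> (?s \<circ> ?s) \<circ> v \<circ> ?s" by (simp only: comp_assoc)
      then show ?thesis unfolding uv(3) by (simp only: sg_sg comp_id)
    qed
    moreover have "?s \<circ> v \<circ> ?s \<in> WD r"
      using WD_comp_iff[OF WB_comp[OF sg_WB stabD_WB[OF uv(2)]] sg_WB] WD_comp_iff[OF sg_WB stabD_WB[OF uv(2)]]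
        stabD_WD[OF uv(2)] by blast
    ultimately show "w \<in> WD r" using WD_comp d0(2) stabD_WD[OF uv(1)] by metis
  qed
  then have "Tsum (sortedL ?\<beta> D) * TW ?s \<in> heckeD"
    unfolding Tsum_sg[OF LW, symmetric] by (rule Tsum_heckeD)
  moreover have "z * xD n b = xD n a * (Tsum (sortedL ?\<beta> D) * TW ?s)"
  proof -
    have "Tsum D = Tsum (stabD r ?\<beta>) * Tsum (sortedL ?\<beta> D)" by (rule left_decomp[OF lb(1) DW cl(1)])
    then show ?thesis unfolding zx xa by (simp only: mult.assoc)
  qed
  ultimately show ex: "\<exists>y\<in>heckeD. z * xD n b = xD n a * y" by blast
  then obtain y where y: "y \<in> heckeD" "z * xD n b = xD n a * y" by blast
  show "phiD n a b (min_rep (gensD r) ?dc) = left_mult a b z"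
  proof (rule phiD_left_mult[OF a(1) b y])
    show "z * xD n b = Tsum (double_coset (WDpar n r a) (min_rep (gensD r) ?dc) (WDpar n r b))"
      by (subst min_rep_coset[OF a(1) b d0(2)]) (simp only: dc Tsum_sg[OF DW] zx)
  qed
qed

definition Dbul :: "vect \<Rightarrow> vect \<Rightarrow> mat \<Rightarrow> (nat \<Rightarrow> nat) set" where
  "Dbul l m A = {x\<in>WD r. coset_mat n l x m = A}"

text \<open>The double coset of \<open>SgnM e A e'\<close> becomes this set after right multiplication by the twist \<open>f\<close> of the column
  weight: \<open>e\<close> is the parity of \<open>mid_flips\<close>, and \<open>f\<close> the parity of the sign changes.\<close>

definition Dsgn :: "vect \<Rightarrow> vect \<Rightarrow> mat \<Rightarrow> sign \<Rightarrow> sign \<Rightarrow> (nat \<Rightarrow> nat) set" where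
  "Dsgn l m A e f = {x\<in>WB r. coset_mat n l x m = A \<and> (x \<in> WD r \<longleftrightarrow> f = Pos) \<and> (even (mid_flips l x) \<longleftrightarrow> e = Pos)}"

lemma Bul_LamD: "l \<in> Lam n r \<Longrightarrow> l (n+1) \<noteq> 0 \<Longrightarrow> Bul l \<in> LamD n r"
  unfolding LamD_def by blast

lemma Bul_simps [simp]: "underlying (Bul l) = l" "twist (Bul l) = Pos"
  by (simp_all add: underlying_def twist_def)

lemma bracket_LamD: "l \<in> Lam n r \<Longrightarrow> bracket n l e \<in> LamD n r"
  unfolding LamD_def bracket_def by auto

lemma bracket_underlying [simp]: "underlying (bracket n l e) = l"
  by (simp add: underlying_def bracket_def)

lemma phi_DotM:
  assumes A: "A \<in> Xi n r" and l: "l \<in> Lam n r" and m: "m \<in> Lam n r"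
    and ro: "ro n A = hat n l" and co: "co n A = hat n m"
    and z: "l (n+1) \<noteq> 0" "m (n+1) \<noteq> 0" and c: "A (n+1) (n+1) \<noteq> 0"
  defines "y \<equiv> Tsum (sortedR (block_of m) (Dbul l m A))"
  shows "phi n (DotM A) = left_mult (Bul l) (Bul m) y" and "y * xD n (Bul m) = Tsum (Dbul l m A)"
    and "\<exists>h\<in>heckeD. y * xD n (Bul m) = xD n (Bul l) * h"
proof -
  note d = d_of_props[OF A l m ro co]
  let ?d = "d_of n r A"
  have dW: "?d \<in> WB r" "coset_mat n l ?d m = A" using d unfolding is_min_rep_def by auto
  \<comment> \<open>The generator \<open>sgen r r\<close> stabilises the blocks of \<open>l\<close>, so it does not change the matrix.\<close>
  define d0 where "d0 = (if ?d \<in> WD r then ?d else sgen r r \<circ> ?d)"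
  have d0: "d0 \<in> WD r" unfolding d0_def using sr_comp_WD(1)[OF dW(1)] by simp
  have "coset_mat n l (sgen r r \<circ> ?d \<circ> id) m = A"
    unfolding coset_mat_invariant[OF l m dW(1) sr_stabB[OF l z(1)] stabB_id] by (rule dW(2))
  then have mat: "coset_mat n l d0 m = A" using dW(2) unfolding d0_def by simp
  have D: "Dbul l m A = double_coset (stabD r (block_of (underlying (Bul l)))) d0 (stabD r (block_of (underlying (Bul m))))"
    using dcoset_bul[OF l m d0] c unfolding mat Dbul_def by simp
  note P = phi_left_mult[OF Bul_LamD[OF l z(1)] Bul_simps(2) Bul_LamD[OF m z(2)] WD_WB[OF d0] _ D]
  have d0': "d0 \<circ> sg (twist (Bul m)) \<in> WD r" using d0 by simp
  have "(phi n (DotM A) :: 'r endo) = phiD n (Bul l) (Bul m)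
      (min_rep (gensD r) (double_coset (WDpar n r (Bul l)) (d0 \<circ> sg (twist (Bul m))) (WDpar n r (Bul m))))"
    by (simp only: phi.simps Let_def card_r ro co unhat_hat[OF l] unhat_hat[OF m] d0_def Bul_simps sg_simps comp_id)
  then show "phi n (DotM A) = left_mult (Bul l) (Bul m) y" unfolding P(1)[OF d0'] y_def by simp
  show "y * xD n (Bul m) = Tsum (Dbul l m A)" using P(2)[OF d0'] unfolding y_def by simp
  show "\<exists>h\<in>heckeD. y * xD n (Bul m) = xD n (Bul l) * h" using P(3)[OF d0'] unfolding y_def by simp
qed

text \<open>The representative is \<open>sg e \<circ> d_of n r A \<circ> sg e'\<close>. Since \<open>mid_flips\<close> vanishes on \<open>d_of n r A\<close>, the left
  factor, which lies in the stabiliser of \<open>l\<close>, gives it the parity \<open>e\<close>. The right factor is the twist of \<open>b\<close> if the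
  column weight has an empty middle block; otherwise it belongs to the column stabiliser.\<close>

lemma phi_SgnM:
  assumes A: "A \<in> Xi n r" and l: "l \<in> Lam n r" and m: "m \<in> Lam n r"
    and ro: "ro n A = hat n l" and co: "co n A = hat n m"
    and z: "l (n+1) \<noteq> 0" and c: "A (n+1) (n+1) = 0" and s: "e = e' \<longleftrightarrow> sgnM n A = Pos"
  defines "b \<equiv> bracket n m e'"
  defines "y \<equiv> Tsum (sortedR (block_of m) (Dsgn l m A e (twist b))) * TW (sg (twist b))"
  shows "phi n (SgnM e A e') = left_mult (Bul l) b y"
    and "y * xD n b = Tsum (Dsgn l m A e (twist b)) * TW (sg (twist b))"
    and "\<exists>h\<in>heckeD. y * xD n b = xD n (Bul l) * h"
proof -
  note d = d_of_props[OF A l m ro co]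
  let ?d = "d_of n r A" and ?f = "twist b"
  have dW: "?d \<in> WB r" "coset_mat n l ?d m = A" using d unfolding is_min_rep_def by auto
  \<comment> \<open>This factor is trivial if \<open>m\<close> has no middle block, and \<open>sg e'\<close> otherwise.\<close>
  define v where "v = sg e' \<circ> sg ?f"
  define d0 where "d0 = sg e \<circ> ?d \<circ> v"
  have vP: "v \<in> stabB r (block_of m)"
  proof (cases "m (n+1) = 0")
    case True
    then have "?f = e'" unfolding b_def bracket_def by (simp add: twist_def)
    then show ?thesis unfolding v_def by simp
  next
    case False
    then have "?f = Pos" unfolding b_def bracket_def by (simp add: twist_def)
    then show ?thesis unfolding v_def using sr_stabB[OF m False] by (cases e') auto
  qed
  have eP: "sg e \<in> stabB r (block_of l)" using sr_stabB[OF l z] by (cases e) auto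
  have W: "sg e \<in> WB r" "v \<in> WB r" "sg e \<circ> ?d \<in> WB r" "d0 \<in> WB r"
    unfolding d0_def using sg_WB stabB_WB[OF vP] dW WB_comp by blast+
  have mat: "coset_mat n l d0 m = A"
    unfolding d0_def coset_mat_invariant[OF l m dW(1) eP vP] by (rule dW(2))
  have d0s: "d0 \<circ> sg ?f = sg e \<circ> ?d \<circ> sg e'"
  proof -
    have "d0 \<circ> sg ?f = sg e \<circ> ?d \<circ> sg e' \<circ> (sg ?f \<circ> sg ?f)" unfolding d0_def v_def by (simp only: comp_assoc)
    then show ?thesis by simp
  qed
  have dsW: "?d \<in> WD r \<longleftrightarrow> e = e'" using d_of_sign[OF l m d] s by blast
  have par: "d0 \<circ> sg ?f \<in> WD r"
  proof -
    have "sg e \<circ> ?d \<in> WD r \<longleftrightarrow> (e = Pos \<longleftrightarrow> e = e')"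
      unfolding WD_comp_iff[OF W(1) dW(1)] sg_WD_iff dsW ..
    then have "sg e \<circ> ?d \<circ> sg e' \<in> WD r \<longleftrightarrow> ((e = Pos \<longleftrightarrow> e = e') \<longleftrightarrow> e' = Pos)"
      unfolding WD_comp_iff[OF W(3) sg_WB] sg_WD_iff by blast
    moreover have "(e = Pos \<longleftrightarrow> e = e') \<longleftrightarrow> e' = Pos" by (cases e; cases e') simp_all
    ultimately show ?thesis unfolding d0s by blast
  qed
  then have par': "d0 \<in> WD r \<longleftrightarrow> ?f = Pos" using WD_comp_iff[OF W(4) sg_WB] sg_WD_iff by blast
  have "coset_mat n l (sg e \<circ> ?d \<circ> id) m (n+1) (n+1) = 0"
    unfolding coset_mat_invariant[OF l m dW(1) eP stabB_id] dW(2) by (rule c)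
  then have "even (mid_flips l d0) \<longleftrightarrow> even (mid_flips l (sg e \<circ> ?d))"
    unfolding d0_def by (intro mid_flips_right[OF l m vP W(3)]) simp
  also have "\<dots> \<longleftrightarrow> e = Pos"
    using mid_flips_left[OF l eP dW(1)] d_of_mid_flips[OF l m d] sg_WD_iff by simp
  finally have mfd: "even (mid_flips l d0) \<longleftrightarrow> e = Pos" .
  have bL: "b \<in> LamD n r" "underlying b = m" unfolding b_def using bracket_LamD[OF m] by simp_all
  have D: "Dsgn l m A e ?f = double_coset (stabD r (block_of (underlying (Bul l)))) d0 (stabD r (block_of (underlying b)))"
    unfolding bL(2) Bul_simps Dsgn_def
    by (subst dcoset_sgn[OF l m W(4)]) (simp_all only: mat c par' mfd)
  note P = phi_left_mult[OF Bul_LamD[OF l z] Bul_simps(2) bL(1) W(4) par D]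
  have a: "bracket n l e = Bul l" using z by (simp add: bracket_def)
  have "(phi n (SgnM e A e') :: 'r endo) = phiD n (Bul l) b
      (min_rep (gensD r) (double_coset (WDpar n r (Bul l)) (d0 \<circ> sg ?f) (WDpar n r b)))"
    unfolding d0s
    by (simp only: phi.simps Let_def card_r ro co unhat_hat[OF l] unhat_hat[OF m] a b_def[symmetric] sg_def)
  then show "phi n (SgnM e A e') = left_mult (Bul l) b y" unfolding P(1) y_def bL(2) .
  show "y * xD n b = Tsum (Dsgn l m A e ?f) * TW (sg ?f)" using P(2) unfolding y_def bL(2) .
  show "\<exists>h\<in>heckeD. y * xD n b = xD n (Bul l) * h" using P(3) unfolding y_def bL(2) .
qed

end

section \<open>Moving one letter between adjacent blocks\<close>

text \<open>The row and column compositions of \<open>C\<close>: one position belongs to block \<open>h+1\<close> of \<open>lam\<close> and to block \<open>h\<close> of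
  \<open>mu\<close>, and \<open>gam\<close> describes the other positions. A permutation \<open>y\<close> places the letter \<open>c\<close> at the
  position \<open>y c\<close>.\<close>

locale letter_move = schur r ty n for r and ty :: "'r::finite itself" and n +
  fixes h :: nat and gam lam mu :: vect
  assumes h: "h \<in> {1..n}" and lam: "lam \<in> Lam n r" and mu: "mu \<in> Lam n r"
    and lam_gam: "\<And>i. lam i = gam i + (if i = h+1 then 1 else 0)"
    and mu_gam: "\<And>i. mu i = gam i + (if i = h then 1 else 0)"
    and gam_mid: "gam (n+1) \<noteq> 0"
begin

text \<open>The last position of block \<open>h\<close> of \<open>mu\<close>, which is the first one of block \<open>h+1\<close> of \<open>lam\<close>. All positions other
  than it and its mirror image have the same label under both compositions.\<close>

definition moving :: nat where "moving = psum mu h"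

text \<open>The sum of two increasing functions distinguishes exactly the pairs that one of them distinguishes
  (\<open>refined_eq_iff\<close>).\<close>

definition refined :: "nat \<Rightarrow> nat" where "refined x = block_of lam x + block_of mu x"

lemma lam_mid: "lam (n+1) \<noteq> 0" and mu_mid: "mu (n+1) \<noteq> 0"
  using gam_mid lam_gam mu_gam by auto

lemma psum_lam_mu:
  shows "psum lam h + 1 = psum mu h"
    and "k \<le> n \<Longrightarrow> k \<noteq> h \<Longrightarrow> psum lam k = psum mu k"
proof -
  have g: "(\<Sum>j=1..k. lam j) = (\<Sum>j=1..k. gam j) + (if h+1 \<le> k then 1 else 0)"
    "(\<Sum>j=1..k. mu j) = (\<Sum>j=1..k. gam j) + (if h \<le> k then 1 else 0)" for k
    using h unfolding lam_gam mu_gam by (simp_all add: sum.distrib)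
  show "psum lam h + 1 = psum mu h" using psum_small[of h] h g[of h] by simp
  show "k \<le> n \<Longrightarrow> k \<noteq> h \<Longrightarrow> psum lam k = psum mu k" using psum_small[of k] g[of k] by auto
qed

lemma moving_range: "1 \<le> moving" "moving < r" "moving \<in> {1..2*r}" "2*r+1-moving \<in> {1..2*r}" "moving \<noteq> 2*r+1-moving"
proof -
  show 1: "1 \<le> moving" using psum_lam_mu(1) unfolding moving_def by simp
  have "psum mu h \<le> psum mu n" by (rule psum_mono) (use h in simp)
  moreover have "psum mu n + mu (n+1) = r" using mu psum_small[of n mu] unfolding Lam_def by simp
  ultimately show 2: "moving < r" using mu_mid unfolding moving_def by simp
  show "moving \<in> {1..2*r}" "2*r+1-moving \<in> {1..2*r}" "moving \<noteq> 2*r+1-moving" using 1 2 by auto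
qed

lemma psum_lam_mu_all:
  assumes "x \<in> {1..2*r}" "x \<noteq> moving" "x \<noteq> 2*r+1-moving"
  shows "x \<le> psum lam k \<longleftrightarrow> x \<le> psum mu k"
proof -
  have sm: "x \<le> psum lam k \<longleftrightarrow> x \<le> psum mu k" if "x \<noteq> moving" "k \<le> n" for x k
    using psum_lam_mu(1) psum_lam_mu(2)[OF that(2)] that(1) unfolding moving_def by (cases "k = h") auto
  consider "k \<le> n" | "n < k" "k \<le> 2*n+1" | "2*n+1 < k" by linarith
  then show ?thesis
  proof cases
    case 1
    then show ?thesis using sm assms by simp
  next
    case 2
    define k' where "k' = 2*n+1-k"
    have k': "k' \<le> n" using 2 unfolding k'_def by simp
    have "psum lam k + psum lam k' = 2*r" "psum mu k + psum mu k' = 2*r"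
      using psum_mirror[OF lam 2(2)] psum_mirror[OF mu 2(2)] unfolding k'_def .
    moreover have "2*r+1-x \<noteq> moving" using assms moving_range by auto
    then have "2*r+1-x \<le> psum lam k' \<longleftrightarrow> 2*r+1-x \<le> psum mu k'" using sm k' by simp
    ultimately show ?thesis using assms(1) by auto
  next
    case 3
    then have "2*r \<le> psum lam k" "2*r \<le> psum mu k"
      using psum_mono[of "2*n+1" k] psum_total[OF lam] psum_total[OF mu] by (metis less_imp_le)+
    then show ?thesis using assms(1) by auto
  qed
qed

lemma block_of_other: "x \<in> {1..2*r} \<Longrightarrow> x \<noteq> moving \<Longrightarrow> x \<noteq> 2*r+1-moving \<Longrightarrow> block_of mu x = block_of lam x"
  using psum_lam_mu_all[of x] unfolding block_of_def by simp

lemma block_of_moving: "block_of mu moving = h" "block_of lam moving = h+1" "block_of mu (2*r+1-moving) = 2*n+2-h" "block_of lam (2*r+1-moving) = 2*n+1-h"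
proof -
  have hh: "h = h-1+1" "h-1 \<noteq> h" "h-1 \<le> n" using h by auto
  have "psum mu (h-1) = psum lam (h-1)" using psum_lam_mu(2)[OF hh(3,2)] by simp
  also have "\<dots> \<le> psum lam h" by (rule psum_mono) simp
  finally have "psum mu (h-1) < moving" using psum_lam_mu(1) unfolding moving_def by simp
  then show 1: "block_of mu moving = h" using block_of_eq_iff[OF mu moving_range(3), of h] h unfolding moving_def by simp
  have "moving \<le> psum lam (h+1)"
  proof (cases "h = n")
    case True
    have "psum lam n + psum lam (n+1) = 2*r" using psum_mirror[OF lam, of n] by (simp add: algebra_simps)
    moreover have "psum lam n + lam (n+1) = r" using lam psum_small[of n lam] unfolding Lam_def by simp
    ultimately show ?thesis using moving_range(2) True by simp
  next
    case False
    then have "psum lam (h+1) = psum mu (h+1)" using psum_lam_mu(2)[of "h+1"] h by simp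
    also have "psum mu h \<le> psum mu (h+1)" by (rule psum_mono) simp
    finally show ?thesis unfolding moving_def .
  qed
  moreover have "psum lam h < moving" using psum_lam_mu(1) unfolding moving_def by simp
  ultimately show 2: "block_of lam moving = h+1" using block_of_eq_iff[OF lam moving_range(3), of "h+1"] by simp
  show "block_of mu (2*r+1-moving) = 2*n+2-h" using labelling_mirror[OF labelling_block_of[OF mu] moving_range(3)] 1 by simp
  show "block_of lam (2*r+1-moving) = 2*n+1-h" using labelling_mirror[OF labelling_block_of[OF lam] moving_range(3)] 2 by simp
qed

lemma moving_first: "x \<in> {1..2*r} \<Longrightarrow> x < moving \<Longrightarrow> block_of lam x \<noteq> h+1"
  using block_of_le_iff[OF lam, of x h] psum_lam_mu(1) unfolding moving_def by auto

lemma moving_last: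
  assumes "x \<in> {1..2*r}" "x > 2*r+1-moving" shows "block_of lam x \<noteq> 2*n+1-h"
proof
  assume "block_of lam x = 2*n+1-h"
  then have "block_of lam (2*r+1-x) = h+1" using labelling_mirror[OF labelling_block_of[OF lam] assms(1)] h by auto
  moreover have "2*r+1-x < moving" using assms by auto
  ultimately show False using moving_first[OF mirror_range[OF assms(1)]] by blast
qed

lemma labelling_refined: "labelling r (4*n+4) refined"
  unfolding labelling_def
proof (intro conjI allI impI ballI)
  fix i j assume "1 \<le> i" "i \<le> j" "j \<le> 2*r"
  then show "refined i \<le> refined j"
    using labelling_mono[OF labelling_block_of[OF lam], of i j] labelling_mono[OF labelling_block_of[OF mu], of i j] unfolding refined_def by simp
next
  fix x assume x: "x \<in> {1..2*r}"
  have "block_of l x + block_of l (2*r+1-x) = 2*n+2" if "l \<in> Lam n r" for l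
    using labelling_block_of[OF that] x unfolding labelling_def by blast
  from this[OF lam] this[OF mu] show "refined x + refined (2*r+1-x) = 4*n+4" unfolding refined_def by simp
qed

lemma refined_eq_iff:
  assumes "x \<in> {1..2*r}" "y \<in> {1..2*r}"
  shows "refined x = refined y \<longleftrightarrow> block_of lam x = block_of lam y \<and> block_of mu x = block_of mu y"
proof -
  have "block_of lam x \<le> block_of lam y \<and> block_of mu x \<le> block_of mu y \<or> block_of lam y \<le> block_of lam x \<and> block_of mu y \<le> block_of mu x"
    using labelling_mono[OF labelling_block_of[OF lam]] labelling_mono[OF labelling_block_of[OF mu]] assms by (metis atLeastAtMost_iff nat_le_linear)
  then show ?thesis unfolding refined_def by auto
qed

text \<open>Only the moving position and its mirror image have different \<open>mu\<close>-labels from the rest of their \<open>lam\<close>-block, and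
  the \<open>mu\<close>-labels of these two are different.\<close>

lemma stabD_refined: "u \<in> stabD r refined \<longleftrightarrow> u \<in> stabD r (block_of lam) \<and> u moving = moving"
proof
  assume u: "u \<in> stabD r refined"
  then have W: "u \<in> WB r" using stabD_WB by blast
  have e: "block_of lam (u x) = block_of lam x \<and> block_of mu (u x) = block_of mu x" if "x \<in> {1..2*r}" for x
    using refined_eq_iff[OF WB_range[OF W that] that] u that unfolding stabD_def by blast
  have "u moving = moving"
  proof (rule ccontr)
    assume n: "u moving \<noteq> moving"
    note e' = e[OF moving_range(3)]
    show False
    proof (cases "u moving = 2*r+1-moving")
      case True
      then show False using e' block_of_moving h by auto
    next
      case False
      then show False using block_of_other[OF WB_range[OF W moving_range(3)] n] e' block_of_moving by simp
    qed
  qed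
  then show "u \<in> stabD r (block_of lam) \<and> u moving = moving" using e u unfolding stabD_def by blast
next
  assume u: "u \<in> stabD r (block_of lam) \<and> u moving = moving"
  then have W: "u \<in> WB r" using stabD_WB by blast
  have m: "u (2*r+1-moving) = 2*r+1-moving" using WB_mirror[OF W moving_range(3)] u by simp
  have "refined (u x) = refined x" if x: "x \<in> {1..2*r}" for x
  proof -
    have e: "block_of lam (u x) = block_of lam x" using u x unfolding stabD_def by blast
    consider "x = moving" | "x = 2*r+1-moving" | "x \<noteq> moving" "x \<noteq> 2*r+1-moving" by blast
    then show ?thesis
    proof cases
      case 3
      then have "u x \<noteq> moving" "u x \<noteq> 2*r+1-moving" using u m WB_inj[OF W] by metis+
      then show ?thesis using block_of_other[OF x 3] block_of_other[OF WB_range[OF W x]] e unfolding refined_def by simp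
    qed (use u m in auto)
  qed
  then show "u \<in> stabD r refined" using u unfolding stabD_def by blast
qed

lemma stabD_refined_mu: "stabD r refined \<subseteq> stabD r (block_of mu)"
proof
  fix u assume u: "u \<in> stabD r refined"
  then have W: "u \<in> WB r" using stabD_WB by blast
  have "block_of mu (u x) = block_of mu x" if "x \<in> {1..2*r}" for x
    using refined_eq_iff[OF WB_range[OF W that] that] u that unfolding stabD_def by blast
  then show "u \<in> stabD r (block_of mu)" using u unfolding stabD_def by blast
qed

text \<open>Between points with different \<open>lam\<close>-labels the order is preserved by the label preserving
  \<open>y\<close>, so that sortedness only matters within the common refinement of both block decompositions.\<close>

lemma sortedR_refined_mu:
  assumes y: "y \<in> stabD r (block_of lam)" and s: "block_inversions r refined y = {}"
  shows "block_inversions r (block_of mu) y = {}"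
proof (rule ccontr)
  assume "block_inversions r (block_of mu) y \<noteq> {}"
  then obtain i j where ij: "1 \<le> i" "i < j" "j \<le> 2*r" "block_of mu i = block_of mu j" "i + j \<noteq> 2*r+1" "y j < y i"
    unfolding block_inversions_def by auto
  have W: "y \<in> WB r" using y stabD_WB by blast
  have r: "i \<in> {1..2*r}" "j \<in> {1..2*r}" using ij by auto
  show False
  proof (cases "block_of lam i = block_of lam j")
    case True
    then have "(i,j) \<in> block_inversions r refined y" using ij unfolding block_inversions_def refined_def by auto
    then show False using s by simp
  next
    case False
    then have "block_of lam i < block_of lam j" using labelling_mono[OF labelling_block_of[OF lam], of i j] ij by simp
    then have "block_of lam (y i) < block_of lam (y j)" using y r unfolding stabD_def by auto
    then show False using labelling_mono[OF labelling_block_of[OF lam], of "y j" "y i"] ij(6) WB_range[OF W r(1)] WB_range[OF W r(2)] by auto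
  qed
qed

lemma sortedR_rep:
  assumes l: "labelling r K \<beta>" and u: "u \<in> WB r"
  shows "\<exists>t\<in>stabD r \<beta>. block_inversions r \<beta> (u \<circ> t) = {}"
proof -
  obtain t where t: "t \<in> stabD r \<beta>" "block_inversions r \<beta> (inv (t \<circ> inv u)) = {}"
    using sorted_rep_exists[OF l WB_inv[OF u]] by blast
  have "inv (t \<circ> inv u) = u \<circ> inv t"
    using WB_inv_distrib[OF stabD_WB[OF t(1)] WB_inv[OF u]] u by simp
  then show ?thesis using t stabD_inv[OF t(1)] by auto
qed

text \<open>An element \<open>u \<circ> v\<close> of the double coset can be written with \<open>u\<close> sorted for the refinement; then \<open>u\<close> is sorted for
  \<open>mu\<close> as well, and \<open>v\<close> is trivial because the sorted element of a coset is unique.\<close>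

lemma sortedR_double_coset:
  "sortedR (block_of mu) (double_coset (stabD r (block_of lam)) id (stabD r (block_of mu))) = sortedR refined (stabD r (block_of lam))"
proof (intro equalityI subsetI)
  fix y assume y: "y \<in> sortedR refined (stabD r (block_of lam))"
  then have "y \<in> stabD r (block_of lam)" unfolding sortedR_def by blast
  moreover have "y = y \<circ> id \<circ> id" by simp
  ultimately have "y \<in> double_coset (stabD r (block_of lam)) id (stabD r (block_of mu))"
    unfolding double_coset_def using stabD_id by blast
  then show "y \<in> sortedR (block_of mu) (double_coset (stabD r (block_of lam)) id (stabD r (block_of mu)))"
    using y sortedR_refined_mu unfolding sortedR_def by blast
next
  fix w assume w: "w \<in> sortedR (block_of mu) (double_coset (stabD r (block_of lam)) id (stabD r (block_of mu)))"
  then obtain u v where uv: "w = u \<circ> v" "u \<in> stabD r (block_of lam)" "v \<in> stabD r (block_of mu)" and s: "block_inversions r (block_of mu) w = {}"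
    unfolding sortedR_def double_coset_def by auto
  have uW: "u \<in> WB r" and vW: "v \<in> WB r" using uv stabD_WB by blast+
  obtain t where t: "t \<in> stabD r refined" "block_inversions r refined (u \<circ> t) = {}" using sortedR_rep[OF labelling_refined uW] by blast
  define u' where "u' = u \<circ> t"
  have tl: "t \<in> stabD r (block_of lam)" "t \<in> stabD r (block_of mu)" "t \<in> WB r" using t(1) stabD_refined stabD_refined_mu stabD_WB by blast+
  have u': "u' \<in> stabD r (block_of lam)" "u' \<in> WB r" unfolding u'_def using stabD_comp[OF uv(2) tl(1)] stabD_WB by blast+
  define v' where "v' = inv t \<circ> v"
  have v': "v' \<in> stabD r (block_of mu)" "v' \<in> WB r" unfolding v'_def using stabD_comp[OF stabD_inv[OF tl(2)] uv(3)] stabD_WB by blast+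
  have "u' \<circ> v' = u \<circ> (t \<circ> inv t) \<circ> v" unfolding u'_def v'_def by (simp only: comp_assoc)
  then have w': "w = u' \<circ> v'" unfolding uv(1) WB_inv_comp(2)[OF tl(3)] by simp
  have wi: "inv w = inv v' \<circ> inv u'" unfolding w' by (rule WB_inv_distrib[OF u'(2) v'(2)])
  have wW: "w \<in> WB r" unfolding w' using u' v' by blast
  have "inv v' = id"
  proof (rule sorted_rep_unique[OF labelling_block_of[OF mu] WB_inv[OF u'(2)] _ stabD_inv[OF v'(1)]])
    show "block_inversions r (block_of mu) (inv (inv u')) = {}"
      unfolding WB_inv_inv[OF u'(2)] by (rule sortedR_refined_mu[OF u'(1) t(2)[folded u'_def]])
    show "block_inversions r (block_of mu) (inv (inv v' \<circ> inv u')) = {}"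
      unfolding wi[symmetric] WB_inv_inv[OF wW] by (rule s)
  qed
  then have "v' = id" using WB_inv_inv[OF v'(2)] by (metis inv_id)
  then have "w = u'" using w' by simp
  then show "w \<in> sortedR refined (stabD r (block_of lam))" using u'(1) t(2) unfolding sortedR_def u'_def by simp
qed

definition row_letters :: "(nat \<Rightarrow> nat) \<Rightarrow> nat set" where
  "row_letters x = {c\<in>{1..2*r}. block_of lam (x c) = h+1}"

text \<open>The mirror image of \<open>c\<close> is left out because it forms a mirror pair with \<open>c\<close>, which does not count as an
  inversion.\<close>

definition letter_rank :: "(nat \<Rightarrow> nat) \<Rightarrow> nat \<Rightarrow> nat" where
  "letter_rank x c = card {z\<in>row_letters x. z < c \<and> z \<noteq> 2*r+1-c}"

lemma row_letters_stabD:
  assumes "u \<in> stabD r (block_of lam)" "x \<in> WB r" shows "row_letters (u \<circ> x) = row_letters x"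
  using assms(1) WB_range[OF assms(2)] unfolding row_letters_def stabD_def by auto

text \<open>Any letter of the row block can be brought to the moving position by a reflection within the block. The middle
  block of \<open>lam\<close> is not empty, so \<open>sgen r r\<close> corrects the parity without touching the moving position.\<close>

lemma row_letters_reps_exist:
  assumes x: "x \<in> WB r" and c: "c \<in> row_letters x"
  shows "\<exists>u\<in>stabD r (block_of lam). block_inversions r refined (inv (u \<circ> x)) = {} \<and> inv (u \<circ> x) moving = c"
proof -
  have cr: "c \<in> {1..2*r}" "block_of lam (x c) = h+1" using c unfolding row_letters_def by auto
  have xc: "x c \<in> {1..2*r}" using WB_range[OF x cr(1)] .
  define u0 where "u0 = (if x c = moving then id else reflection r (x c) moving)"
  have u0P: "u0 \<in> stabB r (block_of lam)"
    unfolding u0_def stabB_def using reflection_WB[OF xc moving_range(3)] labelling_reflection[OF labelling_block_of[OF lam] xc moving_range(3)] cr block_of_moving by auto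
  have u0m: "u0 (x c) = moving" unfolding u0_def by simp
  \<comment> \<open>The position \<open>moving < r\<close> is fixed by \<open>sgen r r\<close>.\<close>
  define u1 where "u1 = (if u0 \<in> WD r then u0 else sgen r r \<circ> u0)"
  have "sgen r r moving = moving" using moving_range(2) by (simp add: sgen_r_eval)
  then have u1m: "u1 (x c) = moving" unfolding u1_def using u0m by simp
  have u1P: "u1 \<in> stabD r (block_of lam)"
    unfolding u1_def stabD_stabB using u0P sr_comp_WD(1)[OF stabB_WB[OF u0P]] stabB_comp[OF sr_stabB[OF lam lam_mid] u0P] by simp
  have u1W: "u1 \<circ> x \<in> WB r" using stabD_WB[OF u1P] x by blast
  obtain t where t: "t \<in> stabD r refined" "block_inversions r refined (inv (t \<circ> (u1 \<circ> x))) = {}"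
    using sorted_rep_exists[OF labelling_refined u1W] by blast
  have tm: "t \<in> stabD r (block_of lam)" "t moving = moving" using t(1) stabD_refined by blast+
  define u where "u = t \<circ> u1"
  have uP: "u \<in> stabD r (block_of lam)" unfolding u_def by (rule stabD_comp[OF tm(1) u1P])
  have uW: "u \<circ> x \<in> WB r" using stabD_WB[OF uP] x by blast
  have "(u \<circ> x) c = moving" unfolding u_def using u1m tm(2) by simp
  then have "inv (u \<circ> x) moving = c" using WB_inv_apply(1)[OF uW] by metis
  moreover have "block_inversions r refined (inv (u \<circ> x)) = {}" using t(2) unfolding u_def by (simp add: comp_assoc)
  ultimately show ?thesis using uP by blast
qed

lemma row_letters_reps_unique:
  assumes x: "x \<in> WB r" and u: "u \<in> stabD r (block_of lam)" "u' \<in> stabD r (block_of lam)"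
    and s: "block_inversions r refined (inv (u \<circ> x)) = {}" "block_inversions r refined (inv (u' \<circ> x)) = {}"
    and e: "inv (u \<circ> x) moving = inv (u' \<circ> x) moving"
  shows "u \<circ> x = u' \<circ> x"
proof -
  have uW: "u \<in> WB r" "u' \<in> WB r" using u stabD_WB by blast+
  have W: "u \<circ> x \<in> WB r" "u' \<circ> x \<in> WB r" using uW x by blast+
  define t where "t = u' \<circ> inv u"
  have tP: "t \<in> stabD r (block_of lam)" unfolding t_def by (rule stabD_comp[OF u(2) stabD_inv[OF u(1)]])
  have tux: "t \<circ> (u \<circ> x) = u' \<circ> x"
  proof -
    have "t \<circ> (u \<circ> x) = u' \<circ> (inv u \<circ> u) \<circ> x" unfolding t_def by (simp only: comp_assoc)
    then show ?thesis unfolding WB_inv_comp(1)[OF uW(1)] by simp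
  qed
  have "t moving = t ((u \<circ> x) (inv (u \<circ> x) moving))" using WB_inv_apply(2)[OF W(1)] by simp
  also have "\<dots> = (u' \<circ> x) (inv (u \<circ> x) moving)" using fun_cong[OF tux] by simp
  also have "\<dots> = moving" unfolding e using WB_inv_apply(2)[OF W(2)] by simp
  finally have "t \<in> stabD r refined" using tP stabD_refined by blast
  then have "t = id" using sorted_rep_unique[OF labelling_refined W(1) s(1)] s(2) tux by metis
  then show ?thesis using tux by simp
qed

text \<open>Since \<open>inv y\<close> is sorted for the refinement, an inversion within a \<open>lam\<close>-block involves the moving position or its
  mirror image. The two kinds are mirror images of each other, which explains the factor two.\<close>

lemma card_block_inversions_move:
  assumes y: "y \<in> WB r" and s: "block_inversions r refined (inv y) = {}" and c: "inv y moving = c"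
  shows "card (block_inversions r (block_of lam) (inv y)) = 2 * letter_rank y c"
proof -
  define v where "v = inv y"
  have v: "v \<in> WB r" unfolding v_def using y by blast
  have vm: "v moving = c" "v (2*r+1-moving) = 2*r+1-c" using c WB_mirror[OF v moving_range(3)] unfolding v_def by auto
  have cr: "c \<in> {1..2*r}" using WB_range[OF v moving_range(3)] vm by simp
  define J where "J = {j\<in>{1..2*r}. block_of lam j = h+1 \<and> j \<noteq> moving \<and> j \<noteq> 2*r+1-moving \<and> v j < c}"
  let ?m = "2*r+1-moving"
  define E2 where "E2 = {i\<in>{1..2*r}. block_of lam i = 2*n+1-h \<and> i \<noteq> moving \<and> i \<noteq> ?m \<and> 2*r+1-c < v i}"
  have fin: "finite J" "finite E2" unfolding J_def E2_def by auto
  have "block_inversions r (block_of lam) v = Pair moving ` J \<union> (\<lambda>i. (i, ?m)) ` E2"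
  proof (intro equalityI subsetI)
    fix p assume "p \<in> block_inversions r (block_of lam) v"
    then obtain i j where p: "p = (i,j)" and ij: "1 \<le> i" "i < j" "j \<le> 2*r" "block_of lam i = block_of lam j" "i + j \<noteq> 2*r+1" "v j < v i"
      unfolding block_inversions_def by auto
    have r: "i \<in> {1..2*r}" "j \<in> {1..2*r}" using ij by auto
    have "(i,j) \<notin> block_inversions r refined v" using s unfolding v_def by simp
    then have "refined i \<noteq> refined j" using ij unfolding block_inversions_def by auto
    then have "block_of mu i \<noteq> block_of mu j" using refined_eq_iff[OF r] ij(4) by blast
    then consider "i = moving" | "i = ?m" | "j = moving" | "j = ?m" "i \<noteq> moving" "i \<noteq> ?m"
      using block_of_other[OF r(1)] block_of_other[OF r(2)] ij(4) by metis
    then show "p \<in> Pair moving ` J \<union> (\<lambda>i. (i, ?m)) ` E2"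
    proof cases
      case 1
      then have "j \<in> J" using ij r vm block_of_moving moving_range unfolding J_def by auto
      then show ?thesis using p 1 by blast
    next
      case 2
      then show ?thesis using moving_last[OF r(2)] ij block_of_moving by auto
    next
      case 3
      then show ?thesis using moving_first[OF r(1)] ij block_of_moving by auto
    next
      case 4
      then have "i \<in> E2" using ij r vm block_of_moving unfolding E2_def by auto
      then show ?thesis using p 4 by blast
    qed
  next
    fix p assume "p \<in> Pair moving ` J \<union> (\<lambda>i. (i, ?m)) ` E2"
    then consider j where "j \<in> J" "p = (moving,j)" | i where "i \<in> E2" "p = (i,?m)" by blast
    then show "p \<in> block_inversions r (block_of lam) v"
    proof cases
      case (1 j)
      then have j: "j \<in> {1..2*r}" "block_of lam j = h+1" "j \<noteq> moving" "j \<noteq> ?m" "v j < c" unfolding J_def by auto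
      have "moving < j" using moving_first[OF j(1)] j(2,3) by (meson linorder_neqE_nat)
      moreover have "moving + j \<noteq> 2*r+1" using j(4) by auto
      ultimately show ?thesis using 1 j block_of_moving moving_range vm unfolding block_inversions_def by auto
    next
      case (2 i)
      then have i: "i \<in> {1..2*r}" "block_of lam i = 2*n+1-h" "i \<noteq> moving" "i \<noteq> ?m" "2*r+1-c < v i" unfolding E2_def by auto
      have "i < ?m" using moving_last[OF i(1)] i(2,4) by (meson linorder_neqE_nat)
      moreover have "i + ?m \<noteq> 2*r+1" using i(3) moving_range by auto
      ultimately show ?thesis using 2 i block_of_moving moving_range vm unfolding block_inversions_def by auto
    qed
  qed
  moreover have "card (Pair moving ` J) = card J" by (rule card_image) (auto intro: inj_onI)
  moreover have "card ((\<lambda>i. (i, ?m)) ` E2) = card E2" by (rule card_image) (auto intro: inj_onI)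
  moreover have "Pair moving ` J \<inter> (\<lambda>i. (i, ?m)) ` E2 = {}" unfolding E2_def by auto
  ultimately have "card (block_inversions r (block_of lam) v) = card J + card E2"
    using fin by (simp add: card_Un_disjoint)
  moreover have "card E2 = card J"
  proof (rule bij_betw_same_card, rule bij_betw_byWitness[where f'="\<lambda>z. 2*r+1-z" and f="\<lambda>z. 2*r+1-z"])
    show "(\<lambda>z. 2*r+1-z) ` E2 \<subseteq> J"
    proof
      fix j assume "j \<in> (\<lambda>z. 2*r+1-z) ` E2"
      then obtain i where i: "i \<in> {1..2*r}" "block_of lam i = 2*n+1-h" "i \<noteq> moving" "i \<noteq> ?m" "2*r+1-c < v i" "j = 2*r+1-i"
        unfolding E2_def by auto
      have "block_of lam j = h+1" using labelling_mirror[OF labelling_block_of[OF lam] i(1)] i(2,6) h by auto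
      moreover have "v j < c" using WB_mirror[OF v i(1)] i(5,6) cr WB_range[OF v i(1)] by auto
      moreover have "j \<in> {1..2*r}" "j \<noteq> moving" "j \<noteq> ?m" using i moving_range by auto
      ultimately show "j \<in> J" unfolding J_def by blast
    qed
    show "(\<lambda>z. 2*r+1-z) ` J \<subseteq> E2"
    proof
      fix i assume "i \<in> (\<lambda>z. 2*r+1-z) ` J"
      then obtain j where j: "j \<in> {1..2*r}" "block_of lam j = h+1" "j \<noteq> moving" "j \<noteq> ?m" "v j < c" "i = 2*r+1-j"
        unfolding J_def by auto
      have "block_of lam i = 2*n+1-h" using labelling_mirror[OF labelling_block_of[OF lam] j(1)] j(2,6) h by auto
      moreover have "2*r+1-c < v i" using WB_mirror[OF v j(1)] j(5,6) cr WB_range[OF v j(1)] by auto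
      moreover have "i \<in> {1..2*r}" "i \<noteq> moving" "i \<noteq> ?m" using j moving_range by auto
      ultimately show "i \<in> E2" unfolding E2_def by blast
    qed
  qed (auto simp: J_def E2_def)
  moreover have "card J = letter_rank y c"
  proof -
    have "v ` J = {z\<in>row_letters y. z < c \<and> z \<noteq> 2*r+1-c}"
    proof (intro equalityI subsetI)
      fix z assume "z \<in> v ` J"
      then obtain j where j: "j \<in> {1..2*r}" "block_of lam j = h+1" "j \<noteq> moving" "j \<noteq> ?m" "v j < c" "z = v j"
        unfolding J_def by auto
      have "y z = j" unfolding j(6) v_def using y by simp
      moreover have "z \<noteq> 2*r+1-c" using j(4,6) vm(2) WB_inj[OF v] by metis
      ultimately show "z \<in> {z\<in>row_letters y. z < c \<and> z \<noteq> 2*r+1-c}"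
        using j WB_range[OF v j(1)] unfolding row_letters_def by auto
    next
      fix z assume "z \<in> {z\<in>row_letters y. z < c \<and> z \<noteq> 2*r+1-c}"
      then have z: "z \<in> {1..2*r}" "block_of lam (y z) = h+1" "z < c" "z \<noteq> 2*r+1-c" unfolding row_letters_def by auto
      have vz: "v (y z) = z" unfolding v_def using y by simp
      have "y z \<noteq> moving" "y z \<noteq> ?m" using vz vm z(3,4) by auto
      then have "y z \<in> J" using z vz WB_range[OF y z(1)] unfolding J_def by simp
      then show "z \<in> v ` J" using vz by (metis image_eqI)
    qed
    moreover have "card (v ` J) = card J" by (rule card_image) (use WB_inj[OF v] in \<open>auto intro: inj_onI\<close>)
    ultimately show ?thesis unfolding letter_rank_def by simp
  qed
  ultimately show ?thesis unfolding v_def by simp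
qed

end

section \<open>Structure constants\<close>

lemma qint_sum: "qint m = (\<Sum>i<m. q ^ i)"
proof -
  have "q ^ m - 1 = (q - 1) * (\<Sum>i<m. q ^ i)" by (rule power_diff_1_eq)
  moreover have "q - 1 \<noteq> 0" by (simp add: one_pCons)
  ultimately show ?thesis unfolding qint_def by (metis nonzero_mult_div_cancel_left)
qed

lemma qint_0 [simp]: "qint 0 = 0" and qint_Suc: "qint (Suc m) = qint m + q ^ m"
  by (simp_all add: qint_sum)

lemma qint_add: "qint (a + b) = qint a + q ^ a * qint b"
  by (induction b) (simp_all add: qint_Suc power_add algebra_simps)

lemma sum_q_rank:
  fixes S :: "nat set"
  assumes "finite S" shows "(\<Sum>c\<in>S. q ^ card {z\<in>S. z < c}) = qint (card S)"
  using assms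
proof (induction S rule: finite_linorder_max_induct)
  case (insert b S)
  have "{z\<in>insert b S. z < c} = {z\<in>S. z < c}" if "c \<in> S" for c using insert(2) that by force
  moreover have "{z\<in>insert b S. z < b} = S" using insert(2) by auto
  moreover have "b \<notin> S" using insert(2) by blast
  ultimately show ?case using insert by (simp add: qint_Suc add.commute)
qed simp

context letter_move
begin

lemma coset_mat_id: "coset_mat n lam id mu = Etheta n (h+1) h + diag (hat n gam)"
proof (intro ext)
  fix i j
  let ?X = "{1..2*r}" and ?m = "2*r+1-moving"
  let ?A = "{z\<in>?X. block_of lam z = i \<and> block_of mu z = j}"
  have "?A = {z\<in>{moving}. h+1 = i \<and> h = j} \<union> {z\<in>{?m}. 2*n+1-h = i \<and> 2*n+2-h = j}
      \<union> {z\<in>?X - {moving,?m}. block_of lam z = i \<and> i = j}"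
  proof (intro equalityI subsetI)
    fix z assume z: "z \<in> ?A"
    consider "z = moving" | "z = ?m" | "z \<noteq> moving" "z \<noteq> ?m" by blast
    then show "z \<in> {z\<in>{moving}. h+1 = i \<and> h = j} \<union> {z\<in>{?m}. 2*n+1-h = i \<and> 2*n+2-h = j}
      \<union> {z\<in>?X - {moving,?m}. block_of lam z = i \<and> i = j}"
      by cases (use z block_of_moving block_of_other[of z] in auto)
  next
    fix z assume z: "z \<in> {z\<in>{moving}. h+1 = i \<and> h = j} \<union> {z\<in>{?m}. 2*n+1-h = i \<and> 2*n+2-h = j}
      \<union> {z\<in>?X - {moving,?m}. block_of lam z = i \<and> i = j}"
    then show "z \<in> ?A" using block_of_moving moving_range(3,4) block_of_other[of z] by auto
  qed
  then have "card ?A = card ({z\<in>{moving}. h+1 = i \<and> h = j} \<union> {z\<in>{?m}. 2*n+1-h = i \<and> 2*n+2-h = j})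
      + card {z\<in>?X - {moving,?m}. block_of lam z = i \<and> i = j}"
    by (simp only:) (rule card_Un_disjoint, auto)
  moreover have "card ({z\<in>{moving}. h+1 = i \<and> h = j} \<union> {z\<in>{?m}. 2*n+1-h = i \<and> 2*n+2-h = j})
      = card {z\<in>{moving}. h+1 = i \<and> h = j} + card {z\<in>{?m}. 2*n+1-h = i \<and> 2*n+2-h = j}"
    by (rule card_Un_disjoint) (use moving_range(5) in auto)
  moreover have "card {z\<in>{moving}. h+1 = i \<and> h = j} = Emat (h+1) h i j" by (auto simp: Emat_def)
  moreover have "card {z\<in>{?m}. 2*n+1-h = i \<and> 2*n+2-h = j} = Emat (2*n+2-(h+1)) (2*n+2-h) i j"
    by (auto simp: Emat_def)
  moreover have "card {z\<in>?X - {moving,?m}. block_of lam z = i \<and> i = j} = diag (hat n gam) i j"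
  proof (cases "i = j")
    case True
    have e: "{z\<in>?X - {moving,?m}. block_of lam z = i} = {z\<in>?X. block_of lam z = i} - {z\<in>{moving,?m}. block_of lam z = i}" by auto
    have "card {z\<in>?X - {moving,?m}. block_of lam z = i} = hat n lam i - card {z\<in>{moving,?m}. block_of lam z = i}"
      unfolding e card_block[OF lam, of i, symmetric] using moving_range by (intro card_Diff_subset) auto
    moreover have "card {z\<in>{moving,?m}. block_of lam z = i} = (if i = h+1 then 1 else 0) + (if i = 2*n+1-h then 1 else 0)"
    proof -
      have "{z\<in>{moving,?m}. block_of lam z = i} = (if i = h+1 then {moving} else {}) \<union> (if i = 2*n+1-h then {?m} else {})"
        using block_of_moving by auto
      then show ?thesis using moving_range(5) by simp
    qed
    moreover have "hat n lam i = hat n gam i + ((if i = h+1 then 1 else 0) + (if i = 2*n+1-h then 1 else 0))"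
    proof -
      have hh: "1 \<le> h" "h \<le> n" using h by auto
      consider "i \<in> {1..n}" | "i = n+1" | "i \<in> {n+2..2*n+1}" | "i \<notin> {1..2*n+1}" by fastforce
      then show ?thesis
      proof cases
        case 1
        then have "i \<noteq> 2*n+1-h" using hh by auto
        then show ?thesis using 1 unfolding hat_def lam_gam by simp
      next
        case 2
        have "n+1 = h+1 \<longleftrightarrow> h = n" "n+1 = 2*n+1-h \<longleftrightarrow> h = n" using hh by auto
        then show ?thesis using 2 unfolding hat_def lam_gam by simp
      next
        case 3
        have "2*n+2-i = h+1 \<longleftrightarrow> i = 2*n+1-h" "i \<noteq> h+1" using 3 hh by auto
        then show ?thesis using 3 unfolding hat_def lam_gam by simp
      next
        case 4
        have "i \<noteq> h+1" "i \<noteq> 2*n+1-h" using 4 hh by auto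
        then show ?thesis using 4 unfolding hat_def lam_gam by auto
      qed
    qed
    ultimately show ?thesis using True by (simp add: diag_def)
  qed (simp add: diag_def)
  ultimately show "coset_mat n lam id mu i j = (Etheta n (h+1) h + diag (hat n gam)) i j"
    unfolding coset_mat_eq[OF lam mu WB_id] by (simp add: Etheta_def)
qed

text \<open>The resulting permutation is unique by \<open>row_letters_reps_unique\<close>.\<close>

definition coset_rep :: "(nat \<Rightarrow> nat) \<Rightarrow> nat \<Rightarrow> nat \<Rightarrow> nat" where
  "coset_rep x c = (SOME u. u \<in> stabD r (block_of lam) \<and> block_inversions r refined (inv (u \<circ> x)) = {} \<and> inv (u \<circ> x) moving = c) \<circ> x"

lemma coset_rep_props:
  assumes "x \<in> WB r" "c \<in> row_letters x"
  shows "\<exists>u\<in>stabD r (block_of lam). coset_rep x c = u \<circ> x \<and> block_inversions r refined (inv (coset_rep x c)) = {} \<and> inv (coset_rep x c) moving = c"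
proof -
  have "\<exists>u. u \<in> stabD r (block_of lam) \<and> block_inversions r refined (inv (u \<circ> x)) = {} \<and> inv (u \<circ> x) moving = c"
    using row_letters_reps_exist[OF assms] by blast
  from someI_ex[OF this] show ?thesis unfolding coset_rep_def by blast
qed

lemma coset_rep_WB:
  assumes "x \<in> WB r" "c \<in> row_letters x" shows "coset_rep x c \<in> WB r"
  using coset_rep_props[OF assms] stabD_WB assms(1) WB_comp by metis

text \<open>The elements with sorted inverse in the coset of \<open>x\<close> are indexed by the letter at their moving position.\<close>

lemma sum_over_reps:
  assumes x: "x \<in> WB r" and D: "D \<subseteq> WB r"
  shows "(\<Sum>y\<in>{y\<in>sortedL refined D. x \<in> (\<lambda>u. u \<circ> y) ` stabD r (block_of lam)}. q ^ (card (block_inversions r (block_of lam) (inv y)) div 2))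
    = (\<Sum>c\<in>{c\<in>row_letters x. coset_rep x c \<in> D}. q ^ letter_rank x c)"
proof (rule sum.reindex_bij_witness[of _ "coset_rep x" "\<lambda>y. inv y moving"])
  fix y assume y: "y \<in> {y\<in>sortedL refined D. x \<in> (\<lambda>u. u \<circ> y) ` stabD r (block_of lam)}"
  then obtain u where u: "u \<in> stabD r (block_of lam)" "x = u \<circ> y" by blast
  have uW: "u \<in> WB r" using u(1) stabD_WB by blast
  have yD: "y \<in> D" "block_inversions r refined (inv y) = {}" and yW: "y \<in> WB r" using y D unfolding sortedL_def by auto
  have yx: "inv u \<circ> x = y" unfolding u(2) using uW by simp
  have Lr: "row_letters x = row_letters y" unfolding u(2) by (rule row_letters_stabD[OF u(1) yW])
  have "y (inv y moving) = moving" using yW by simp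
  then have "inv y moving \<in> row_letters y"
    unfolding row_letters_def using block_of_moving WB_range[OF WB_inv[OF yW] moving_range(3)] by simp
  then have c: "inv y moving \<in> row_letters x" using Lr by simp
  obtain u' where u': "u' \<in> stabD r (block_of lam)" "coset_rep x (inv y moving) = u' \<circ> x"
    "block_inversions r refined (inv (coset_rep x (inv y moving))) = {}" "inv (coset_rep x (inv y moving)) moving = inv y moving"
    using coset_rep_props[OF x c] by blast
  have "u' \<circ> x = inv u \<circ> x"
    by (rule row_letters_reps_unique[OF x u'(1) stabD_inv[OF u(1)]]) (use u' yD yx in simp_all)
  then show r: "coset_rep x (inv y moving) = y" using u'(2) yx by simp
  show "inv y moving \<in> {c\<in>row_letters x. coset_rep x c \<in> D}" using c r yD(1) by simp
  show "q ^ letter_rank x (inv y moving) = q ^ (card (block_inversions r (block_of lam) (inv y)) div 2)"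
    unfolding card_block_inversions_move[OF yW yD(2) HOL.refl] letter_rank_def Lr by simp
next
  fix c assume "c \<in> {c\<in>row_letters x. coset_rep x c \<in> D}"
  then have c: "c \<in> row_letters x" "coset_rep x c \<in> D" by auto
  obtain u where u: "u \<in> stabD r (block_of lam)" "coset_rep x c = u \<circ> x" "block_inversions r refined (inv (coset_rep x c)) = {}" "inv (coset_rep x c) moving = c"
    using coset_rep_props[OF x c(1)] by blast
  show "inv (coset_rep x c) moving = c" by (rule u(4))
  have "x = inv u \<circ> coset_rep x c" unfolding u(2) using stabD_WB[OF u(1)] by simp
  then have "x \<in> (\<lambda>u. u \<circ> coset_rep x c) ` stabD r (block_of lam)" using stabD_inv[OF u(1)] by blast
  then show "coset_rep x c \<in> {y\<in>sortedL refined D. x \<in> (\<lambda>u. u \<circ> y) ` stabD r (block_of lam)}"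
    using c(2) u(3) unfolding sortedL_def by blast
qed

text \<open>The sum over the stabiliser of the refinement is split off from \<open>D\<close> on the left and completes the other factor to the
  sum over the stabiliser of \<open>lam\<close>, to which \<open>stabD_TW\<close> applies.\<close>

lemma product_expansion:
  assumes D: "D \<subseteq> WB r" and cl: "\<And>u y. u \<in> stabD r (block_of mu) \<Longrightarrow> y \<in> D \<Longrightarrow> u \<circ> y \<in> D"
  shows "Tsum (sortedR (block_of mu) (double_coset (stabD r (block_of lam)) id (stabD r (block_of mu)))) * Tsum D
    = (\<Sum>x\<in>WB r. hscalar (\<Sum>c\<in>{c\<in>row_letters x. coset_rep x c \<in> D}. q ^ letter_rank x c) * TW x)"
proof -
  let ?P = "stabD r (block_of lam)" and ?S = "sortedL refined D"
  let ?e = "\<lambda>y. q ^ (card (block_inversions r (block_of lam) (inv y)) div 2)"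
  have finS: "finite ?S" using finite_subset[OF D] unfolding sortedL_def by simp
  have PW: "?P \<subseteq> WB r" using stabD_WB by blast
  have right: "Tsum ?P = Tsum (sortedR refined ?P) * Tsum (stabD r refined)"
    by (rule right_decomp[OF labelling_refined PW]) (use stabD_comp stabD_refined in blast)
  have left: "Tsum D = Tsum (stabD r refined) * Tsum ?S"
    by (rule left_decomp[OF labelling_refined D]) (use cl stabD_refined_mu in blast)
  have "Tsum (sortedR (block_of mu) (double_coset ?P id (stabD r (block_of mu)))) * Tsum D = Tsum ?P * Tsum ?S"
    unfolding sortedR_double_coset right left by (rule mult.assoc[symmetric])
  also have "\<dots> = (\<Sum>y\<in>?S. Tsum ?P * TW y)" unfolding Tsum_def[of ?S] by (rule sum_distrib_left)
  also have "\<dots> = (\<Sum>y\<in>?S. \<Sum>x\<in>WB r. if x \<in> (\<lambda>u. u \<circ> y) ` ?P then hscalar (?e y) * TW x else 0)"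
  proof (rule sum.cong[OF HOL.refl])
    fix y assume "y \<in> ?S"
    then have y: "y \<in> WB r" using D unfolding sortedL_def by blast
    have sub: "(\<lambda>u. u \<circ> y) ` ?P \<subseteq> WB r" using PW y by blast
    have "Tsum ?P * TW y = (\<Sum>x\<in>(\<lambda>u. u \<circ> y) ` ?P. hscalar (?e y) * TW x)"
      unfolding stabD_TW[OF labelling_block_of[OF lam] y] Tsum_def[of "(\<lambda>u. u \<circ> y) ` ?P"] by (rule sum_distrib_left)
    also have "\<dots> = (\<Sum>x\<in>WB r. if x \<in> (\<lambda>u. u \<circ> y) ` ?P then hscalar (?e y) * TW x else 0)"
      using sub by (simp add: sum.inter_restrict[symmetric] Int_absorb1)
    finally show "Tsum ?P * TW y = (\<Sum>x\<in>WB r. if x \<in> (\<lambda>u. u \<circ> y) ` ?P then hscalar (?e y) * TW x else 0)" .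
  qed
  also have "\<dots> = (\<Sum>x\<in>WB r. \<Sum>y\<in>?S. if x \<in> (\<lambda>u. u \<circ> y) ` ?P then hscalar (?e y) * TW x else 0)"
    by (rule sum.swap)
  also have "\<dots> = (\<Sum>x\<in>WB r. hscalar (\<Sum>c\<in>{c\<in>row_letters x. coset_rep x c \<in> D}. q ^ letter_rank x c) * TW x)"
  proof (rule sum.cong[OF HOL.refl])
    fix x assume x: "x \<in> WB r"
    have "(\<Sum>y\<in>?S. if x \<in> (\<lambda>u. u \<circ> y) ` ?P then hscalar (?e y) * TW x else 0)
        = (\<Sum>y\<in>{y\<in>?S. x \<in> (\<lambda>u. u \<circ> y) ` ?P}. hscalar (?e y) * TW x)"
      by (rule sum.inter_filter[OF finS, symmetric])
    also have "\<dots> = hscalar (\<Sum>y\<in>{y\<in>?S. x \<in> (\<lambda>u. u \<circ> y) ` ?P}. ?e y) * TW x"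
      by (simp only: hscalar_sum sum_distrib_right)
    finally show "(\<Sum>y\<in>?S. if x \<in> (\<lambda>u. u \<circ> y) ` ?P then hscalar (?e y) * TW x else 0)
        = hscalar (\<Sum>c\<in>{c\<in>row_letters x. coset_rep x c \<in> D}. q ^ letter_rank x c) * TW x"
      unfolding sum_over_reps[OF x D] .
  qed
  finally show ?thesis .
qed

lemma sum_of_indicators:
  assumes "finite P" "\<And>p. p \<in> P \<Longrightarrow> D p \<subseteq> WB r"
  shows "(\<Sum>x\<in>WB r. hscalar (\<Sum>p\<in>P. if x \<in> D p then g p else 0) * TW x) = (\<Sum>p\<in>P. hscalar (g p) * Tsum (D p))"
proof -
  have "(\<Sum>x\<in>WB r. hscalar (\<Sum>p\<in>P. if x \<in> D p then g p else 0) * TW x)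
      = (\<Sum>x\<in>WB r. \<Sum>p\<in>P. if x \<in> D p then hscalar (g p) * TW x else 0)"
    unfolding hscalar_sum sum_distrib_right by (intro sum.cong) auto
  also have "\<dots> = (\<Sum>p\<in>P. \<Sum>x\<in>WB r. if x \<in> D p then hscalar (g p) * TW x else 0)"
    by (rule sum.swap)
  also have "\<dots> = (\<Sum>p\<in>P. hscalar (g p) * Tsum (D p))"
  proof (rule sum.cong[OF HOL.refl])
    fix p assume "p \<in> P"
    then have "WB r \<inter> D p = D p" using assms(2) by blast
    then show "(\<Sum>x\<in>WB r. if x \<in> D p then hscalar (g p) * TW x else 0) = hscalar (g p) * Tsum (D p)"
      unfolding Tsum_def sum_distrib_left by (simp add: sum.inter_restrict[symmetric])
  qed
  finally show ?thesis .
qed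

text \<open>Passing from \<open>mu\<close> to \<open>lam\<close> changes the row labels of \<open>c\<close> and its mirror image only.\<close>

lemma coset_mat_move:
  assumes nu: "nu \<in> Lam n r" and y: "y \<in> WB r" and c: "inv y moving = c"
  obtains B where "coset_mat n lam y nu = B + Etheta n (h+1) (block_of nu c)"
    "coset_mat n mu y nu = B + Etheta n h (block_of nu c)"
proof -
  let ?X = "{1..2*r}" and ?c = "2*r+1-c" and ?p = "block_of nu c"
  have v: "inv y \<in> WB r" using y by blast
  have cr: "c \<in> ?X" using WB_range[OF v moving_range(3)] c by simp
  have yc: "y c = moving" "y ?c = 2*r+1-moving"
    using c y WB_mirror[OF y cr] by auto
  have pm: "block_of nu ?c = 2*n+2-?p" using labelling_mirror[OF labelling_block_of[OF nu] cr] .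
  have ne: "c \<noteq> ?c" using mirror_neq[of r c] by metis
  define B where "B = (\<lambda>i j. card {z\<in>?X - {c,?c}. block_of lam (y z) = i \<and> block_of nu z = j})"
  have other: "block_of mu (y z) = block_of lam (y z)" if "z \<in> ?X - {c,?c}" for z
  proof (rule block_of_other)
    show "y z \<in> ?X" using WB_range[OF y] that by blast
    show "y z \<noteq> moving" "y z \<noteq> 2*r+1-moving" using that yc WB_inj[OF y] by (metis DiffD2 insertCI)+
  qed
  have gen: "coset_mat n l y nu i j = B i j + (Emat k ?p i j + Emat k' (2*n+2-?p) i j)"
    if l: "l \<in> Lam n r" and k: "block_of l moving = k" "block_of l (2*r+1-moving) = k'" and o: "\<And>z. z \<in> ?X - {c,?c} \<Longrightarrow> block_of l (y z) = block_of lam (y z)"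
    for l k k' i j
  proof -
    have "{z\<in>?X. block_of l (y z) = i \<and> block_of nu z = j} = {z\<in>?X - {c,?c}. block_of lam (y z) = i \<and> block_of nu z = j}
       \<union> ({z\<in>{c}. k = i \<and> ?p = j} \<union> {z\<in>{?c}. k' = i \<and> 2*n+2-?p = j})"
    proof (intro equalityI subsetI)
      fix z assume z: "z \<in> {z\<in>?X. block_of l (y z) = i \<and> block_of nu z = j}"
      then consider "z = c" | "z = ?c" | "z \<in> ?X - {c,?c}" by blast
      then show "z \<in> {z\<in>?X - {c,?c}. block_of lam (y z) = i \<and> block_of nu z = j}
       \<union> ({z\<in>{c}. k = i \<and> ?p = j} \<union> {z\<in>{?c}. k' = i \<and> 2*n+2-?p = j})"
        by cases (use z yc k pm o in auto)
    next
      fix z assume "z \<in> {z\<in>?X - {c,?c}. block_of lam (y z) = i \<and> block_of nu z = j}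
       \<union> ({z\<in>{c}. k = i \<and> ?p = j} \<union> {z\<in>{?c}. k' = i \<and> 2*n+2-?p = j})"
      then show "z \<in> {z\<in>?X. block_of l (y z) = i \<and> block_of nu z = j}"
        using yc k pm o cr mirror_range[OF cr] by auto
    qed
    moreover have "card ({z\<in>{c}. k = i \<and> ?p = j} \<union> {z\<in>{?c}. k' = i \<and> 2*n+2-?p = j})
        = Emat k ?p i j + Emat k' (2*n+2-?p) i j"
    proof -
      have "{z\<in>{c}. k = i \<and> ?p = j} = (if i = k \<and> j = ?p then {c} else {})"
        "{z\<in>{?c}. k' = i \<and> 2*n+2-?p = j} = (if i = k' \<and> j = 2*n+2-?p then {?c} else {})" by auto
      then show ?thesis unfolding Emat_def using ne by simp
    qed
    moreover have "card ({z\<in>?X - {c,?c}. block_of lam (y z) = i \<and> block_of nu z = j}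
       \<union> ({z\<in>{c}. k = i \<and> ?p = j} \<union> {z\<in>{?c}. k' = i \<and> 2*n+2-?p = j})) = B i j
       + card ({z\<in>{c}. k = i \<and> ?p = j} \<union> {z\<in>{?c}. k' = i \<and> 2*n+2-?p = j})"
      unfolding B_def by (rule card_Un_disjoint) auto
    ultimately show ?thesis unfolding coset_mat_eq[OF l nu y] by simp
  qed
  have "coset_mat n lam y nu = B + Etheta n (h+1) ?p"
  proof (intro ext)
    fix i j
    have "2*n+1-h = 2*n+2-(h+1)" using h by simp
    then show "coset_mat n lam y nu i j = (B + Etheta n (h+1) ?p) i j"
      using gen[OF lam block_of_moving(2) block_of_moving(4), of i j] by (simp add: Etheta_def)
  qed
  moreover have "coset_mat n mu y nu = B + Etheta n h ?p"
    using gen[OF mu block_of_moving(1) block_of_moving(3) other] by (intro ext) (simp add: Etheta_def)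
  ultimately show ?thesis by (rule that)
qed

lemma Etheta_le:
  assumes A: "A \<in> Xi n r" and p: "A h p > 0" shows "Etheta n h p i j \<le> A i j"
proof -
  have r: "h \<in> {1..2*n+1}" "p \<in> {1..2*n+1}" using Xi_outside[OF A, of h p] p by auto
  have "A (2*n+2-h) (2*n+2-p) = A h p" using Xi_mirror[OF A r] .
  moreover have "h \<noteq> 2*n+2-h" using h by auto
  ultimately show ?thesis using p unfolding Etheta_def Emat_def by auto
qed

lemma coset_mat_move_iff:
  assumes A: "A \<in> Xi n r" and nu: "nu \<in> Lam n r" and y: "y \<in> WB r" and c: "inv y moving = c"
  shows "coset_mat n mu y nu = A \<longleftrightarrow> A h (block_of nu c) > 0 \<and> coset_mat n lam y nu = shift n h A (block_of nu c)"
proof -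
  let ?p = "block_of nu c"
  obtain B where B: "coset_mat n lam y nu = B + Etheta n (h+1) ?p" "coset_mat n mu y nu = B + Etheta n h ?p"
    using coset_mat_move[OF nu y c] .
  have E: "Etheta n h ?p h ?p \<ge> 1" unfolding Etheta_def Emat_def by simp
  show ?thesis
  proof
    assume a: "coset_mat n mu y nu = A"
    have AB: "A i j = B i j + Etheta n h ?p i j" for i j
      using fun_cong[OF fun_cong[OF a[unfolded B(2)], of i], of j] by simp
    have "A h ?p > 0" using AB[of h ?p] E by simp
    moreover have "coset_mat n lam y nu = shift n h A ?p"
      unfolding B(1) shift_def by (intro ext) (simp add: AB)
    ultimately show "A h ?p > 0 \<and> coset_mat n lam y nu = shift n h A ?p" by blast
  next
    assume a: "A h ?p > 0 \<and> coset_mat n lam y nu = shift n h A ?p"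
    then have "B + Etheta n (h+1) ?p = A - Etheta n h ?p + Etheta n (h+1) ?p" unfolding B(1) shift_def by blast
    then have "(B + Etheta n (h+1) ?p) i j = (A - Etheta n h ?p + Etheta n (h+1) ?p) i j" for i j
      by (rule fun_cong[OF fun_cong])
    then have "B i j = A i j - Etheta n h ?p i j" for i j by simp
    then have "B i j + Etheta n h ?p i j = A i j" for i j using Etheta_le[OF A, of ?p i j] a by simp
    then show "coset_mat n mu y nu = A" unfolding B(2) by (intro ext) simp
  qed
qed

lemma mid_flips_move_lt:
  assumes "h < n" shows "mid_flips mu y = mid_flips lam y"
proof -
  have "block_of mu x = n+1 \<longleftrightarrow> block_of lam x = n+1" if x: "x \<in> {1..2*r}" for x
  proof -
    consider "x = moving" | "x = 2*r+1-moving" | "x \<noteq> moving" "x \<noteq> 2*r+1-moving" by blast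
    then show ?thesis by cases (use block_of_moving block_of_other[OF x] assms h in auto)
  qed
  then have "middle mu = middle lam" unfolding middle_def by blast
  then show ?thesis unfolding mid_flips_def by simp
qed

text \<open>For \<open>h = n\<close> the moving position is the only one of the lower half that belongs to the middle block of \<open>lam\<close> but
  not to that of \<open>mu\<close>.\<close>

lemma mid_flips_move_eq:
  assumes hn: "h = n" and y: "y \<in> WB r"
  shows "mid_flips lam y = mid_flips mu y + (if inv y moving > r then 1 else 0)"
proof -
  have "block_of lam x = n+1 \<longleftrightarrow> block_of mu x = n+1 \<or> x = moving \<or> x = 2*r+1-moving" if x: "x \<in> {1..2*r}" for x
  proof -
    consider "x = moving" | "x = 2*r+1-moving" | "x \<noteq> moving" "x \<noteq> 2*r+1-moving" by blast
    then show ?thesis by cases (use block_of_moving block_of_other[OF x] hn in auto)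
  qed
  moreover have "\<not> 2*r+1-moving \<le> r" using moving_range(2) by simp
  ultimately have "{i\<in>middle lam. i \<le> r \<and> inv y i > r} = {i\<in>middle mu. i \<le> r \<and> inv y i > r}
      \<union> (if inv y moving > r then {moving} else {})"
    unfolding middle_def using moving_range by auto
  moreover have "moving \<notin> middle mu" unfolding middle_def using block_of_moving hn by simp
  moreover have "finite {i\<in>middle mu. i \<le> r \<and> inv y i > r}" by (simp add: middle_def)
  ultimately show ?thesis unfolding mid_flips_def flips_def by simp
qed

definition cell_letters :: "vect \<Rightarrow> (nat \<Rightarrow> nat) \<Rightarrow> nat \<Rightarrow> nat set" where
  "cell_letters nu x p = {c\<in>row_letters x. block_of nu c = p}"

lemma cell_letters_finite [simp]: "finite (cell_letters nu x p)" "finite (row_letters x)"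
  by (simp_all add: cell_letters_def row_letters_def)

lemma card_cell_letters:
  assumes "nu \<in> Lam n r" "x \<in> WB r" shows "card (cell_letters nu x p) = coset_mat n lam x nu (h+1) p"
  unfolding coset_mat_eq[OF lam assms] cell_letters_def row_letters_def by (rule arg_cong[of _ _ card]) auto

text \<open>The letters to the left of \<open>c\<close> in its row block are those in earlier column blocks and those to the left of \<open>c\<close> in
  its own; the mirror image of \<open>c\<close> is one of them if and only if \<open>c\<close> lies in the upper half and the row block is the
  middle one.\<close>

lemma letter_rank_eq:
  assumes nu: "nu \<in> Lam n r" and x: "x \<in> WB r" and c: "c \<in> cell_letters nu x p"
  shows "letter_rank x c + (if 2*r+1-c \<in> row_letters x \<and> 2*r+1-c < c then 1 else 0)
    = (\<Sum>j=1..<p. coset_mat n lam x nu (h+1) j) + card {z\<in>cell_letters nu x p. z < c}"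
proof -
  have cr: "c \<in> {1..2*r}" "block_of nu c = p" using c unfolding cell_letters_def row_letters_def by auto
  have "{z\<in>row_letters x. z < c} = {z\<in>row_letters x. z < c \<and> z \<noteq> 2*r+1-c}
      \<union> (if 2*r+1-c \<in> row_letters x \<and> 2*r+1-c < c then {2*r+1-c} else {})" by auto
  then have "card {z\<in>row_letters x. z < c} = letter_rank x c + (if 2*r+1-c \<in> row_letters x \<and> 2*r+1-c < c then 1 else 0)"
    unfolding letter_rank_def by (simp add: card_Un_disjoint)
  moreover have "{z\<in>row_letters x. z < c} = {z\<in>row_letters x. block_of nu z \<in> {1..<p}} \<union> {z\<in>cell_letters nu x p. z < c}"
  proof (intro equalityI subsetI)
    fix z assume "z \<in> {z\<in>row_letters x. z < c}"
    then have z: "z \<in> row_letters x" "z < c" "z \<in> {1..2*r}" unfolding row_letters_def by auto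
    have "block_of nu z \<le> p" using labelling_mono[OF labelling_block_of[OF nu], of z c] z cr by auto
    then show "z \<in> {z\<in>row_letters x. block_of nu z \<in> {1..<p}} \<union> {z\<in>cell_letters nu x p. z < c}"
      using z block_of_props(1)[OF nu z(3)] unfolding cell_letters_def by auto
  next
    fix z assume z: "z \<in> {z\<in>row_letters x. block_of nu z \<in> {1..<p}} \<union> {z\<in>cell_letters nu x p. z < c}"
    show "z \<in> {z\<in>row_letters x. z < c}"
    proof (cases "block_of nu z < p")
      case True
      then have zr: "z \<in> row_letters x" "z \<in> {1..2*r}" using z unfolding cell_letters_def row_letters_def by auto
      have "\<not> c \<le> z" using labelling_mono[OF labelling_block_of[OF nu], of c z] True cr zr by auto
      then show ?thesis using zr by simp
    qed (use z in \<open>auto simp: cell_letters_def\<close>)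
  qed
  then have "card {z\<in>row_letters x. z < c} = card {z\<in>row_letters x. block_of nu z \<in> {1..<p}} + card {z\<in>cell_letters nu x p. z < c}"
    by (simp only:) (rule card_Un_disjoint, auto simp: cell_letters_def)
  moreover have "card {z\<in>row_letters x. block_of nu z \<in> {1..<p}} = (\<Sum>j=1..<p. coset_mat n lam x nu (h+1) j)"
    unfolding card_cell_letters[OF nu x, symmetric] cell_letters_def by (rule card_fibres) auto
  ultimately show ?thesis by simp
qed

lemma mirror_row_letters:
  assumes x: "x \<in> WB r" and c: "c \<in> row_letters x"
  shows "2*r+1-c \<in> row_letters x \<longleftrightarrow> h = n"
proof -
  have cr: "c \<in> {1..2*r}" "block_of lam (x c) = h+1" using c unfolding row_letters_def by auto
  have "block_of lam (x (2*r+1-c)) = 2*n+1-h"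
    using labelling_mirror[OF labelling_block_of[OF lam] WB_range[OF x cr(1)]] WB_mirror[OF x cr(1)] cr(2) by simp
  then show ?thesis unfolding row_letters_def using mirror_range[OF cr(1)] h by auto
qed

lemma shift_eval:
  assumes A: "A \<in> Xi n r" and p: "A h p > 0" and j: "j \<in> {1..2*n+1}"
  shows "shift n h A p (h+1) j = A (h+1) j + (if j = p then 1 else 0) + (if h = n \<and> j = 2*n+2-p then 1 else 0)"
proof -
  have r: "p \<in> {1..2*n+1}" using Xi_outside[OF A, of h p] p by auto
  have "h+1 \<noteq> 2*n+2-h" using h by presburger
  moreover have "h+1 = 2*n+2-(h+1) \<longleftrightarrow> h = n" using h by auto
  ultimately show ?thesis unfolding shift_def Etheta_def Emat_def using r j by simp
qed

text \<open>Except in the central cell, the ranks are consecutive numbers starting with the sum of the entries to the left: if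
  \<open>h = n\<close> and \<open>p > n+1\<close>, the additional letter in the mirror image of the column block and the omission of the
  mirror image of \<open>c\<close> cancel. In the central cell the upper half \<open>U\<close> of the letters is affected by the omission while
  the lower half \<open>L\<close> is not, so that the ranks of both halves overlap in one number.\<close>

lemma coefficient_sum:
  assumes A: "A \<in> Xi n r" and nu: "nu \<in> Lam n r" and mu_ro: "ro n A = hat n mu" and x: "x \<in> WB r"
    and p: "A h p > 0" and M: "coset_mat n lam x nu = shift n h A p"
  shows "(\<Sum>c\<in>cell_letters nu x p. q ^ letter_rank x c) = g' n h A p"
    and "h = n \<Longrightarrow> p = n+1 \<Longrightarrow> A (n+1) (n+1) = 0 \<Longrightarrow> c \<in> cell_letters nu x p \<Longrightarrow> letter_rank x c = (\<Sum>j=1..<n+1. A (n+1) j)"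
proof -
  have pr: "p \<in> {1..2*n+1}" using Xi_outside[OF A, of h p] p by auto
  let ?s = "\<Sum>j=1..<p. A (h+1) j" and ?S = "cell_letters nu x p"
  have cardS: "card ?S = A (h+1) p + 1 + (if h = n \<and> p = n+1 then 1 else 0)"
    unfolding card_cell_letters[OF nu x] M shift_eval[OF A p pr] using pr by auto
  have sumM: "(\<Sum>j=1..<p. shift n h A p (h+1) j) = ?s + (if h = n \<and> n+1 < p then 1 else 0)"
  proof -
    have "(\<Sum>j=1..<p. shift n h A p (h+1) j) = (\<Sum>j=1..<p. A (h+1) j + (if j = 2*n+2-p then if h = n then 1 else 0 else 0))"
      by (rule sum.cong) (use shift_eval[OF A p] pr in auto)
    also have "\<dots> = ?s + (if 2*n+2-p \<in> {1..<p} then if h = n then 1 else 0 else 0)"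
      unfolding sum.distrib by (simp add: sum.delta)
    finally show ?thesis using pr by auto
  qed
  have half: "2*r+1-c < c \<longleftrightarrow> r < c" if "c \<in> ?S" for c using that unfolding cell_letters_def row_letters_def by auto
  have N: "letter_rank x c + (if h = n \<and> r < c then 1 else 0) = ?s + (if h = n \<and> n+1 < p then 1 else 0) + card {z\<in>?S. z < c}"
    if c: "c \<in> ?S" for c
  proof -
    have "c \<in> row_letters x" using c unfolding cell_letters_def by blast
    then show ?thesis using letter_rank_eq[OF nu x c] mirror_row_letters[OF x] half[OF c] unfolding M sumM by auto
  qed
  have lo: "c \<le> r" if "c \<in> ?S" "p < n+1" for c
    using block_of_half(2)[OF nu, of c] that unfolding cell_letters_def row_letters_def by auto
  have hi: "r < c" if "c \<in> ?S" "n+1 < p" for c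
    using block_of_half(1)[OF nu, of c] that unfolding cell_letters_def row_letters_def by fastforce
  let ?k = "A (n+1) (n+1) div 2"
  define L where "L = {c\<in>?S. c \<le> r}"
  define U where "U = {c\<in>?S. r < c}"
  have LU: "?S = L \<union> U" "L \<inter> U = {}" "finite L" "finite U" unfolding L_def U_def by auto
  have mid: "card L = ?k + 1" "card U = ?k + 1" "\<And>c. c \<in> L \<Longrightarrow> letter_rank x c = ?s + card {z\<in>L. z < c}"
    "\<And>c. c \<in> U \<Longrightarrow> letter_rank x c = ?s + ?k + card {z\<in>U. z < c}"
    if hp: "h = n" "p = n+1"
  proof -
    have mir: "2*r+1-c \<in> ?S" if "c \<in> ?S" for c
    proof -
      have c: "c \<in> row_letters x" "c \<in> {1..2*r}" "block_of nu c = n+1" using that hp unfolding cell_letters_def row_letters_def by auto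
      have "2*r+1-c \<in> row_letters x" using mirror_row_letters[OF x c(1)] hp by blast
      then show ?thesis using labelling_mirror[OF labelling_block_of[OF nu] c(2)] c(3) hp unfolding cell_letters_def by auto
    qed
    have S2: "c \<in> {1..2*r}" if "c \<in> ?S" for c using that unfolding cell_letters_def row_letters_def by blast
    have mm: "2*r+1-(2*r+1-c) = c" if "c \<in> ?S" for c using S2[OF that] by simp
    have "card L = card U"
    proof (rule bij_betw_same_card, rule bij_betw_byWitness[where f'="\<lambda>z. 2*r+1-z" and f="\<lambda>z. 2*r+1-z"])
      show "(\<lambda>z. 2*r+1-z) ` L \<subseteq> U" using mir unfolding L_def U_def by auto
      show "(\<lambda>z. 2*r+1-z) ` U \<subseteq> L" using mir S2 unfolding L_def U_def by fastforce
    qed (use mm in \<open>auto simp: L_def U_def\<close>)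
    moreover have "card ?S = card L + card U" unfolding LU(1) by (rule card_Un_disjoint[OF LU(3,4,2)])
    moreover have "even (A (n+1) (n+1))" by (rule Xi_center_even[OF A mu mu_ro])
    ultimately show cL: "card L = ?k + 1" and "card U = ?k + 1" using cardS hp by auto
    {
      fix c assume c: "c \<in> L"
      have "{z\<in>?S. z < c} = {z\<in>L. z < c}" using c unfolding L_def by auto
      then show "letter_rank x c = ?s + card {z\<in>L. z < c}" using N[of c] c hp unfolding L_def by auto
    }
    {
      fix c assume c: "c \<in> U"
      have "{z\<in>?S. z < c} = L \<union> {z\<in>U. z < c}" using c unfolding L_def U_def by auto
      then have "card {z\<in>?S. z < c} = card L + card {z\<in>U. z < c}"
        by (simp only:) (rule card_Un_disjoint, use LU in auto)
      then show "letter_rank x c = ?s + ?k + card {z\<in>U. z < c}" using N[of c] c hp cL unfolding U_def by auto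
    }
  qed
  show "(\<Sum>c\<in>?S. q ^ letter_rank x c) = g' n h A p"
  proof (cases "h = n \<and> p = n+1")
    case True
    have even: "even (A (n+1) (n+1))" by (rule Xi_center_even[OF A mu mu_ro])
    have "(\<Sum>c\<in>?S. q ^ letter_rank x c) = (\<Sum>c\<in>L. q ^ letter_rank x c) + (\<Sum>c\<in>U. q ^ letter_rank x c)"
      by (subst (1) LU(1)) (rule sum.union_disjoint[OF LU(3,4,2)])
    also have "(\<Sum>c\<in>L. q ^ letter_rank x c) = q ^ ?s * qint (?k + 1)"
      using mid(1,3) True by (simp add: power_add sum_distrib_left[symmetric] sum_q_rank[OF LU(3)])
    also have "(\<Sum>c\<in>U. q ^ letter_rank x c) = q ^ ?s * (q ^ ?k * qint (?k + 1))"
      using mid(2,4) True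
      by (simp add: power_add sum_distrib_left[symmetric] sum_q_rank[OF LU(4)] mult.assoc)
    also have "q ^ ?s * qint (?k + 1) + q ^ ?s * (q ^ ?k * qint (?k + 1))
        = q ^ ?s * (qint (?k + (?k + 1)) + q ^ ?k)"
      unfolding qint_add[of ?k "?k + 1"] by (simp add: qint_Suc algebra_simps)
    also have "?k + (?k + 1) = A (n+1) (n+1) + 1" using even by auto
    finally show ?thesis using p True unfolding g'_def by simp
  next
    case False
    have "letter_rank x c = ?s + card {z\<in>?S. z < c}" if c: "c \<in> ?S" for c
      using N[OF c] lo[OF c] hi[OF c] False by (cases "p < n+1"; cases "n+1 < p"; cases "h = n") auto
    then have "(\<Sum>c\<in>?S. q ^ letter_rank x c) = q ^ ?s * qint (card ?S)"
      by (simp add: power_add sum_distrib_left[symmetric] sum_q_rank)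
    moreover have "h < n \<or> p \<noteq> n+1" using False h by auto
    ultimately show ?thesis using p False unfolding g'_def cardS by auto
  qed
  assume hp: "h = n" "p = n+1" and z: "A (n+1) (n+1) = 0" and c: "c \<in> ?S"
  have one: "{w\<in>X. w < c} = {}" if "c \<in> X" "card X = 1" for X :: "nat set"
    using that by (auto simp: card_1_singleton_iff)
  consider "c \<in> L" | "c \<in> U" using c LU(1) by blast
  then show "letter_rank x c = (\<Sum>j=1..<n+1. A (n+1) j)"
  proof cases
    case 1
    then show ?thesis using mid(3)[OF hp 1] one[OF 1] mid(1)[OF hp] z hp by simp
  next
    case 2
    then show ?thesis using mid(4)[OF hp 2] one[OF 2] mid(2)[OF hp] z hp by simp
  qed
qed

lemma coefficient_reduction:
  assumes x: "x \<in> WB r" and nu: "nu \<in> Lam n r"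
    and inner: "\<And>p. p \<in> {1..2*n+1} \<Longrightarrow> (\<Sum>c\<in>{c\<in>cell_letters nu x p. coset_rep x c \<in> D}. q ^ letter_rank x c) = (if x \<in> E p then g p else 0)"
  shows "(\<Sum>c\<in>{c\<in>row_letters x. coset_rep x c \<in> D}. q ^ letter_rank x c) = (\<Sum>p=1..2*n+1. if x \<in> E p then g p else 0)"
proof -
  have "(\<Sum>c\<in>{c\<in>row_letters x. coset_rep x c \<in> D}. q ^ letter_rank x c)
      = (\<Sum>p\<in>{1..2*n+1}. \<Sum>c\<in>{c\<in>{c\<in>row_letters x. coset_rep x c \<in> D}. block_of nu c = p}. q ^ letter_rank x c)"
    by (rule sum.group[symmetric]) (use block_of_props(1)[OF nu] in \<open>auto simp: row_letters_def\<close>)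
  also have "\<dots> = (\<Sum>p\<in>{1..2*n+1}. if x \<in> E p then g p else 0)"
  proof (rule sum.cong[OF HOL.refl])
    fix p assume p: "p \<in> {1..2*n+1}"
    have "{c\<in>{c\<in>row_letters x. coset_rep x c \<in> D}. block_of nu c = p} = {c\<in>cell_letters nu x p. coset_rep x c \<in> D}" unfolding cell_letters_def by auto
    then show "(\<Sum>c\<in>{c\<in>{c\<in>row_letters x. coset_rep x c \<in> D}. block_of nu c = p}. q ^ letter_rank x c) = (if x \<in> E p then g p else 0)"
      using inner[OF p] by simp
  qed
  finally show ?thesis .
qed

text \<open>Grouping the letters \<open>c\<close> in \<open>product_expansion\<close> by column blocks reduces the multiplication to the sums over
  single cells.\<close>

lemma multiply_by_move:
  assumes D: "D \<subseteq> WB r" and cl: "\<And>u y. u \<in> stabD r (block_of mu) \<Longrightarrow> y \<in> D \<Longrightarrow> u \<circ> y \<in> D"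
    and nu: "nu \<in> Lam n r" and E: "\<And>p. E p \<subseteq> WB r"
    and inner: "\<And>x p. x \<in> WB r \<Longrightarrow> p \<in> {1..2*n+1} \<Longrightarrow>
      (\<Sum>c\<in>{c\<in>cell_letters nu x p. coset_rep x c \<in> D}. q ^ letter_rank x c) = (if x \<in> E p then g p else 0)"
  shows "Tsum (sortedR (block_of mu) (double_coset (stabD r (block_of lam)) id (stabD r (block_of mu)))) * Tsum D
    = (\<Sum>p=1..2*n+1. hscalar (g p) * Tsum (E p))"
proof -
  have "(\<Sum>x\<in>WB r. hscalar (\<Sum>c\<in>{c\<in>row_letters x. coset_rep x c \<in> D}. q ^ letter_rank x c) * TW x)
      = (\<Sum>x\<in>WB r. hscalar (\<Sum>p=1..2*n+1. if x \<in> E p then g p else 0) * TW x)"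
    by (rule sum.cong[OF HOL.refl]) (simp only: coefficient_reduction[OF _ nu inner])
  also have "\<dots> = (\<Sum>p=1..2*n+1. hscalar (g p) * Tsum (E p))"
    by (rule sum_of_indicators) (use E in auto)
  finally have e: "(\<Sum>x\<in>WB r. hscalar (\<Sum>c\<in>{c\<in>row_letters x. coset_rep x c \<in> D}. q ^ letter_rank x c) * TW x)
      = (\<Sum>p=1..2*n+1. hscalar (g p) * Tsum (E p))" .
  show ?thesis unfolding e[symmetric] by (rule product_expansion[OF D]) (rule cl)
qed

text \<open>The representative differs from \<open>x\<close> by an element of the type D stabiliser of \<open>lam\<close>, which changes neither the
  \<open>lam\<close>-matrix nor any parity.\<close>

lemma coset_rep_membership:
  assumes A: "A \<in> Xi n r" and nu: "nu \<in> Lam n r" and x: "x \<in> WB r" and c: "c \<in> cell_letters nu x p"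
  shows "coset_rep x c \<in> WB r"
    and "coset_mat n mu (coset_rep x c) nu = A \<longleftrightarrow> A h p > 0 \<and> coset_mat n lam x nu = shift n h A p"
    and "coset_rep x c \<in> WD r \<longleftrightarrow> x \<in> WD r"
    and "even (mid_flips lam (coset_rep x c)) \<longleftrightarrow> even (mid_flips lam x)"
    and "inv (coset_rep x c) moving = c"
proof -
  have cL: "c \<in> row_letters x" "block_of nu c = p" using c unfolding cell_letters_def by auto
  obtain u where u: "u \<in> stabD r (block_of lam)" "coset_rep x c = u \<circ> x" "inv (coset_rep x c) moving = c" using coset_rep_props[OF x cL(1)] by blast
  show W: "coset_rep x c \<in> WB r" by (rule coset_rep_WB[OF x cL(1)])
  have uB: "u \<in> stabB r (block_of lam)" "u \<in> WD r" using u(1) unfolding stabD_stabB by auto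
  have "coset_mat n lam (u \<circ> x \<circ> id) nu = coset_mat n lam x nu"
    by (rule coset_mat_invariant[OF lam nu x uB(1) stabB_id])
  then have "coset_mat n lam (coset_rep x c) nu = coset_mat n lam x nu" using u(2) by simp
  then show "coset_mat n mu (coset_rep x c) nu = A \<longleftrightarrow> A h p > 0 \<and> coset_mat n lam x nu = shift n h A p"
    using coset_mat_move_iff[OF A nu W u(3)] cL(2) by simp
  show "coset_rep x c \<in> WD r \<longleftrightarrow> x \<in> WD r" unfolding u(2) using WD_comp_iff[OF stabB_WB[OF uB(1)] x] uB(2) by blast
  show "even (mid_flips lam (coset_rep x c)) \<longleftrightarrow> even (mid_flips lam x)" unfolding u(2) using mid_flips_left[OF lam uB(1) x] uB(2) by blast
  show "inv (coset_rep x c) moving = c" by (rule u(3))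
qed

lemma coefficient_uniform:
  assumes A: "A \<in> Xi n r" and nu: "nu \<in> Lam n r" and ro: "ro n A = hat n mu" and x: "x \<in> WB r"
    and mem: "\<And>c. c \<in> cell_letters nu x p \<Longrightarrow> coset_rep x c \<in> D \<longleftrightarrow> A h p > 0 \<and> coset_mat n lam x nu = shift n h A p \<and> Q"
    and E: "x \<in> E \<longleftrightarrow> coset_mat n lam x nu = shift n h A p \<and> Q"
  shows "(\<Sum>c\<in>{c\<in>cell_letters nu x p. coset_rep x c \<in> D}. q ^ letter_rank x c) = (if x \<in> E then g' n h A p else 0)"
proof (cases "A h p > 0 \<and> coset_mat n lam x nu = shift n h A p \<and> Q")
  case True
  then have e: "{c\<in>cell_letters nu x p. coset_rep x c \<in> D} = cell_letters nu x p" using mem by blast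
  show ?thesis unfolding e using coefficient_sum(1)[OF A nu ro x] True E by simp
next
  case False
  then have e: "{c\<in>cell_letters nu x p. coset_rep x c \<in> D} = {}" using mem by blast
  show ?thesis unfolding e using False E by (auto simp: g'_def)
qed

lemma Dbul_closed: "nu \<in> Lam n r \<Longrightarrow> u \<in> stabD r (block_of mu) \<Longrightarrow> y \<in> Dbul mu nu A \<Longrightarrow> u \<circ> y \<in> Dbul mu nu A"
  using coset_mat_invariant[OF mu, of nu y u id] WD_comp[of u r y] WD_WB[of y r]
  unfolding Dbul_def stabD_stabB by simp

lemma Dsgn_closed:
  assumes nu: "nu \<in> Lam n r" and u: "u \<in> stabD r (block_of mu)" and y: "y \<in> Dsgn mu nu A e f"
  shows "u \<circ> y \<in> Dsgn mu nu A e f"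
proof -
  have y': "y \<in> WB r" "coset_mat n mu y nu = A" "y \<in> WD r \<longleftrightarrow> f = Pos" "even (mid_flips mu y) \<longleftrightarrow> e = Pos"
    using y unfolding Dsgn_def by auto
  have u': "u \<in> stabB r (block_of mu)" "u \<in> WD r" "u \<in> WB r" using u stabD_WB unfolding stabD_stabB by auto
  show ?thesis
    using coset_mat_invariant[OF mu nu y'(1) u'(1) stabB_id] y'(2) WD_comp_iff[OF u'(3) y'(1)] y'(3)
      mid_flips_left[OF mu u'(1) y'(1)] y'(4) u'(2) WB_comp[OF u'(3) y'(1)]
    unfolding Dsgn_def comp_id by blast
qed

lemma multiply_bul:
  assumes A: "A \<in> Xi n r" and nu: "nu \<in> Lam n r" and ro: "ro n A = hat n mu"
  shows "Tsum (sortedR (block_of mu) (double_coset (stabD r (block_of lam)) id (stabD r (block_of mu)))) * Tsum (Dbul mu nu A)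
    = (\<Sum>p=1..2*n+1. hscalar (g' n h A p) * Tsum (Dbul lam nu (shift n h A p)))"
proof (rule multiply_by_move[OF _ Dbul_closed[OF nu] nu])
  fix x p assume x: "x \<in> WB r" "p \<in> {1..2*n+1}"
  show "(\<Sum>c\<in>{c\<in>cell_letters nu x p. coset_rep x c \<in> Dbul mu nu A}. q ^ letter_rank x c)
      = (if x \<in> Dbul lam nu (shift n h A p) then g' n h A p else 0)"
    by (rule coefficient_uniform[OF A nu ro x(1), where Q="x \<in> WD r"])
       (use coset_rep_membership[OF A nu x(1)] in \<open>auto simp: Dbul_def\<close>)
qed (auto simp: Dbul_def WD_WB)

lemma multiply_sgn_lt:
  assumes A: "A \<in> Xi n r" and nu: "nu \<in> Lam n r" and ro: "ro n A = hat n mu" and hn: "h < n"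
  shows "Tsum (sortedR (block_of mu) (double_coset (stabD r (block_of lam)) id (stabD r (block_of mu)))) * Tsum (Dsgn mu nu A e f)
    = (\<Sum>p=1..2*n+1. hscalar (g' n h A p) * Tsum (Dsgn lam nu (shift n h A p) e f))"
proof (rule multiply_by_move[OF _ Dsgn_closed[OF nu] nu])
  fix x p assume x: "x \<in> WB r" "p \<in> {1..2*n+1}"
  show "(\<Sum>c\<in>{c\<in>cell_letters nu x p. coset_rep x c \<in> Dsgn mu nu A e f}. q ^ letter_rank x c)
      = (if x \<in> Dsgn lam nu (shift n h A p) e f then g' n h A p else 0)"
    by (rule coefficient_uniform[OF A nu ro x(1), where Q="(x \<in> WD r \<longleftrightarrow> f = Pos) \<and> (even (mid_flips lam x) \<longleftrightarrow> e = Pos)"])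
       (use coset_rep_membership[OF A nu x(1)] x(1) in \<open>auto simp: Dsgn_def mid_flips_move_lt[OF hn]\<close>)
qed (auto simp: Dsgn_def)

text \<open>For \<open>nu\<close> with a middle block, \<open>f = Pos\<close>, and this is the double coset of a matrix with nonzero central entry. Both
  values of \<open>mid_flips\<close> are included.\<close>

definition Dpar :: "vect \<Rightarrow> mat \<Rightarrow> sign \<Rightarrow> (nat \<Rightarrow> nat) set" where
  "Dpar nu A f = {x\<in>WB r. coset_mat n lam x nu = A \<and> (x \<in> WD r \<longleftrightarrow> f = Pos)}"

text \<open>The matrix of \<open>x\<close> has two letters in the central cell, which are mirror images of each other. They produce opposite parities
  of \<open>mid_flips\<close>, so that exactly one of them contributes.\<close>

lemma coefficient_middle:
  assumes A: "A \<in> Xi n r" and nu: "nu \<in> Lam n r" and ro: "ro n A = hat n mu" and hn: "h = n"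
    and z: "A (n+1) (n+1) = 0" and x: "x \<in> WB r"
  shows "(\<Sum>c\<in>{c\<in>cell_letters nu x (n+1). coset_rep x c \<in> Dsgn mu nu A e f}. q ^ letter_rank x c)
      = (if x \<in> Dpar nu (shift n h A (n+1)) f then g' n h A (n+1) div 2 else 0)"
proof (cases "A h (n+1) > 0 \<and> x \<in> Dpar nu (shift n h A (n+1)) f")
  case True
  let ?s = "\<Sum>j=1..<n+1. A (n+1) j"
  have M: "coset_mat n lam x nu = shift n h A (n+1)" using True unfolding Dpar_def by blast
  let ?X = "{c\<in>cell_letters nu x (n+1). coset_rep x c \<in> Dsgn mu nu A e f}"
  define P where "P = (\<lambda>c. (even (mid_flips lam x) \<longleftrightarrow> e = Pos) \<longleftrightarrow> c \<le> r)"
  have mem: "coset_rep x c \<in> Dsgn mu nu A e f \<longleftrightarrow> P c" if c: "c \<in> cell_letters nu x (n+1)" for c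
  proof -
    note m = coset_rep_membership[OF A nu x c]
    have "even (mid_flips lam x) \<longleftrightarrow> (even (mid_flips mu (coset_rep x c)) \<longleftrightarrow> c \<le> r)"
      using mid_flips_move_eq[OF hn m(1)] m(4,5) by (cases "c \<le> r") auto
    then show ?thesis using m(1-3) True unfolding Dsgn_def Dpar_def P_def by auto
  qed
  have "card (cell_letters nu x (n+1)) = 2"
    unfolding card_cell_letters[OF nu x] M using shift_eval[OF A, of "n+1" "n+1"] True z hn by simp
  then have "cell_letters nu x (n+1) \<noteq> {}" by auto
  then obtain c where c: "c \<in> cell_letters nu x (n+1)" by blast
  let ?c = "2*r+1-c"
  have cr: "c \<in> row_letters x" "c \<in> {1..2*r}" "block_of nu c = n+1" using c unfolding cell_letters_def row_letters_def by auto
  have "?c \<in> row_letters x" using mirror_row_letters[OF x cr(1)] hn by blast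
  then have c': "?c \<in> cell_letters nu x (n+1)"
    using labelling_mirror[OF labelling_block_of[OF nu] cr(2)] cr(3) unfolding cell_letters_def by auto
  have ne: "?c \<noteq> c" by (rule mirror_neq)
  have L: "cell_letters nu x (n+1) = {c,?c}"
    by (rule card_subset_eq[symmetric]) (use c c' ne \<open>card (cell_letters nu x (n+1)) = 2\<close> in auto)
  have "P ?c \<longleftrightarrow> \<not> P c" unfolding P_def using cr(2) by auto
  then have "\<exists>d. ?X = {d}" using mem[OF c] mem[OF c'] L by (cases "P c") auto
  then obtain d where d: "?X = {d}" by blast
  then have "d \<in> cell_letters nu x (n+1)" by blast
  have A0: "A h (n+1) > 0" using True by blast
  have "letter_rank x d = ?s"
    by (rule coefficient_sum(2)[OF A nu ro x A0 M hn HOL.refl z \<open>d \<in> cell_letters nu x (n+1)\<close>])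
  moreover have "g' n h A (n+1) = q ^ ?s * 2"
    using A0 hn z unfolding g'_def by (simp add: qint_Suc)
  ultimately show ?thesis using True unfolding d by simp
next
  case False
  have e: "{c\<in>cell_letters nu x (n+1). coset_rep x c \<in> Dsgn mu nu A e f} = {}"
  proof -
    have "coset_rep x c \<notin> Dsgn mu nu A e f" if c: "c \<in> cell_letters nu x (n+1)" for c
    proof
      assume d: "coset_rep x c \<in> Dsgn mu nu A e f"
      note m = coset_rep_membership(2,3)[OF A nu x c]
      have "A h (n+1) > 0" "x \<in> Dpar nu (shift n h A (n+1)) f"
        using d m x unfolding Dsgn_def Dpar_def by blast+
      then show False using False by blast
    qed
    then show ?thesis by blast
  qed
  show ?thesis unfolding e using False by (auto simp: g'_def)
qed

lemma multiply_sgn_eq: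
  assumes A: "A \<in> Xi n r" and nu: "nu \<in> Lam n r" and ro: "ro n A = hat n mu" and hn: "h = n"
    and z: "A (n+1) (n+1) = 0"
  shows "Tsum (sortedR (block_of mu) (double_coset (stabD r (block_of lam)) id (stabD r (block_of mu)))) * Tsum (Dsgn mu nu A e f)
    = (\<Sum>p=1..<n+1. hscalar (g' n h A p) * Tsum (Dsgn lam nu (shift n h A p) e f))
     + hscalar (g' n h A (n+1) div 2) * Tsum (Dpar nu (shift n h A (n+1)) f)
     + (\<Sum>p=n+2..2*n+1. hscalar (g' n h A p) * Tsum (Dsgn lam nu (shift n h A p) (-e) f))"
proof -
  define E where "E = (\<lambda>p. if p = n+1 then Dpar nu (shift n h A p) f
    else Dsgn lam nu (shift n h A p) (if p < n+1 then e else -e) f)"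
  define g where "g = (\<lambda>p. if p = n+1 then g' n h A p div 2 else g' n h A p)"
  have "Tsum (sortedR (block_of mu) (double_coset (stabD r (block_of lam)) id (stabD r (block_of mu)))) * Tsum (Dsgn mu nu A e f)
      = (\<Sum>p=1..2*n+1. hscalar (g p) * Tsum (E p))"
  proof (rule multiply_by_move[OF _ Dsgn_closed[OF nu] nu])
    fix x p assume x: "x \<in> WB r" and p: "p \<in> {1..2*n+1}"
    show "(\<Sum>c\<in>{c\<in>cell_letters nu x p. coset_rep x c \<in> Dsgn mu nu A e f}. q ^ letter_rank x c) = (if x \<in> E p then g p else 0)"
    proof (cases "p = n+1")
      case True
      show ?thesis unfolding True E_def g_def using coefficient_middle[OF A nu ro hn z x] by simp
    next
      case False
      let ?e = "if p < n+1 then e else -e"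
      have neg: "- e = Pos \<longleftrightarrow> e \<noteq> Pos" by (cases e) simp_all
      have mid_flips: "(even (mid_flips mu (coset_rep x c)) \<longleftrightarrow> e = Pos) \<longleftrightarrow> (even (mid_flips lam x) \<longleftrightarrow> ?e = Pos)" if c: "c \<in> cell_letters nu x p" for c
      proof -
        note m = coset_rep_membership[OF A nu x c]
        have cr: "c \<in> {1..2*r}" "block_of nu c = p" using c unfolding cell_letters_def row_letters_def by auto
        have "c \<le> r \<longleftrightarrow> p < n+1"
        proof (cases "c \<le> r")
          case True
          then show ?thesis using block_of_half(1)[OF nu cr(1) True] cr(2) False by simp
        next
          case ge: False
          then show ?thesis using block_of_half(2)[OF nu cr(1) ge] cr(2) False by simp
        qed
        moreover have "even (mid_flips lam x) \<longleftrightarrow> (even (mid_flips mu (coset_rep x c)) \<longleftrightarrow> c \<le> r)"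
          using mid_flips_move_eq[OF hn m(1)] m(4,5) by (cases "c \<le> r") auto
        ultimately show ?thesis using neg by auto
      qed
      have E: "E p = Dsgn lam nu (shift n h A p) ?e f" and g: "g p = g' n h A p"
        unfolding E_def g_def using False by simp_all
      show ?thesis unfolding g
        by (rule coefficient_uniform[OF A nu ro x, where Q="(x \<in> WD r \<longleftrightarrow> f = Pos) \<and> (even (mid_flips lam x) \<longleftrightarrow> ?e = Pos)"])
           (use coset_rep_membership(1-3)[OF A nu x] mid_flips x in \<open>auto simp: Dsgn_def E\<close>)
    qed
  qed (auto simp: Dsgn_def E_def Dpar_def)
  also have "\<dots> = (\<Sum>p\<in>{1..<n+1}. hscalar (g p) * Tsum (E p)) + (\<Sum>p\<in>{n+1..2*n+1}. hscalar (g p) * Tsum (E p))"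
  proof -
    have "{1..2*n+1} = {1..<n+1} \<union> {n+1..2*n+1}" by auto
    then have "(\<Sum>p=1..2*n+1. hscalar (g p) * Tsum (E p)) = (\<Sum>p\<in>{1..<n+1} \<union> {n+1..2*n+1}. hscalar (g p) * Tsum (E p))"
      by (rule arg_cong[of _ _ "sum (\<lambda>p. hscalar (g p) * Tsum (E p))"])
    also have "\<dots> = (\<Sum>p\<in>{1..<n+1}. hscalar (g p) * Tsum (E p)) + (\<Sum>p\<in>{n+1..2*n+1}. hscalar (g p) * Tsum (E p))"
      by (rule sum.union_disjoint) auto
    finally show ?thesis .
  qed
  also have "(\<Sum>p\<in>{n+1..2*n+1}. hscalar (g p) * Tsum (E p)) = hscalar (g (n+1)) * Tsum (E (n+1))
      + (\<Sum>p\<in>{n+2..2*n+1}. hscalar (g p) * Tsum (E p))"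
    by (subst sum.atLeast_Suc_atMost) auto
  also have "(\<Sum>p\<in>{1..<n+1}. hscalar (g p) * Tsum (E p))
      = (\<Sum>p\<in>{1..<n+1}. hscalar (g' n h A p) * Tsum (Dsgn lam nu (shift n h A p) e f))"
    by (rule sum.cong) (auto simp: E_def g_def)
  also have "(\<Sum>p\<in>{n+2..2*n+1}. hscalar (g p) * Tsum (E p))
      = (\<Sum>p\<in>{n+2..2*n+1}. hscalar (g' n h A p) * Tsum (Dsgn lam nu (shift n h A p) (-e) f))"
    by (rule sum.cong) (auto simp: E_def g_def)
  also have "hscalar (g (n+1)) * Tsum (E (n+1)) = hscalar (g' n h A (n+1) div 2) * Tsum (Dpar nu (shift n h A (n+1)) f)"
    by (simp add: E_def g_def)
  finally show ?thesis by (simp only: add.assoc)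
qed

end

section \<open>The multiplication formulas\<close>

lemma endo_scale_zero: "0 *\<^sub>S f = (0 :: 'r::finite endo)"
  by (simp add: endo_scale_def fun_eq_iff)

context schur
begin

lemma left_mult_comp:
  assumes c: "c \<in> LamD n r" and b: "b \<in> LamD n r" and z2: "\<exists>h\<in>heckeD. z2 * xD n b = xD n c * h"
  shows "left_mult a c z1 \<circ> left_mult c b z2 = left_mult a b (z1 * z2)"
proof
  fix v
  show "(left_mult a c z1 \<circ> left_mult c b z2) v = left_mult a b (z1 * z2) v"
  proof (cases "v \<in> permT")
    case True
    then obtain h where h: "h \<in> heckeD" "v b = xD n b * h" using b unfolding permD_iff by blast
    obtain k where k: "k \<in> heckeD" "z2 * xD n b = xD n c * k" using z2 by blast
    have "z2 * v b = xD n c * (k * h)" unfolding h(2) using k(2) by (metis mult.assoc)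
    then have "inj_at c (z2 * v b) \<in> permT" using permD_inj_at[OF c heckeD_mult[OF k(1) h(1)]] by simp
    then show ?thesis using True unfolding left_mult_def by (simp add: mult.assoc)
  next
    case False
    then show ?thesis using permD_zero unfolding left_mult_def by simp
  qed
qed

lemma left_mult_cong:
  assumes b: "b \<in> LamD n r" and z: "z * xD n b = z' * xD n b"
  shows "left_mult a b z = left_mult a b z'"
proof
  fix v
  show "left_mult a b z v = left_mult a b z' v"
  proof (cases "v \<in> permT")
    case True
    then obtain h where h: "h \<in> heckeD" "v b = xD n b * h" using b unfolding permD_iff by blast
    have "z * v b = z' * v b" unfolding h(2) using z by (metis mult.assoc)
    then show ?thesis unfolding left_mult_def by simp
  qed (simp add: left_mult_def)
qed

lemma left_mult_scale: "g *\<^sub>S left_mult a b z = left_mult a b (hscalar g * z)"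
  by (auto simp: endo_scale_def left_mult_def inj_at_def fun_eq_iff mult.assoc)

lemma left_mult_add: "left_mult a b z + left_mult a b z' = left_mult a b (z + z')"
  by (auto simp: left_mult_def inj_at_def fun_eq_iff distrib_right)

lemma left_mult_zero: "left_mult a b 0 = 0"
  by (auto simp: left_mult_def inj_at_def fun_eq_iff)

text \<open>The homomorphism \<open>f\<close> is a left multiplication that takes the generator \<open>xD n b\<close> to \<open>x\<close>. This
  determines \<open>f\<close> and is compatible with linear combinations, so that an identity in the Hecke algebra yields one
  between homomorphisms.\<close>

definition represents :: "dweight \<Rightarrow> dweight \<Rightarrow> 'r hecke \<Rightarrow> 'r endo \<Rightarrow> bool" where
  "represents a b x f \<longleftrightarrow> (\<exists>z. f = left_mult a b z \<and> z * xD n b = x)"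

lemma represents_unique: "b \<in> LamD n r \<Longrightarrow> represents a b x f \<Longrightarrow> represents a b x f' \<Longrightarrow> f = f'"
  unfolding represents_def using left_mult_cong by metis

lemma represents_scale: "represents a b x f \<Longrightarrow> represents a b (hscalar g * x) (g *\<^sub>S f)"
  unfolding represents_def using left_mult_scale by (metis mult.assoc)

lemma represents_zero: "represents a b 0 0"
  unfolding represents_def using left_mult_zero by (metis mult_zero_left)

lemma represents_add: "represents a b x f \<Longrightarrow> represents a b x' f' \<Longrightarrow> represents a b (x + x') (f + f')"
  unfolding represents_def using left_mult_add distrib_right by metis

lemma represents_sum:
  assumes "\<And>p. p \<in> P \<Longrightarrow> represents a b (x p) (f p)"
  shows "represents a b (\<Sum>p\<in>P. x p) (\<Sum>p\<in>P. f p)"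
  using assms
  by (induction P rule: infinite_finite_induct) (simp_all add: represents_zero represents_add)

lemma coset_mat_Xi:
  assumes l: "l \<in> Lam n r" and m: "m \<in> Lam n r" and w: "w \<in> WB r"
  shows "coset_mat n l w m \<in> Xi n r"
proof -
  have "coset_mat n l w m i j = coset_mat n l w m (2*n+2-i) (2*n+2-j)"
    if i: "i \<in> {1..2*n+1}" and j: "j \<in> {1..2*n+1}" for i j
    unfolding coset_mat_eq[OF assms]
  proof (rule bij_betw_same_card, rule bij_betw_byWitness[where f'="\<lambda>z. 2*r+1-z" and f="\<lambda>z. 2*r+1-z"])
    have step: "(\<lambda>z. 2*r+1-z) ` {z\<in>{1..2*r}. block_of l (w z) = i \<and> block_of m z = j}
        \<subseteq> {z\<in>{1..2*r}. block_of l (w z) = 2*n+2-i \<and> block_of m z = 2*n+2-j}" for i j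
    proof
      fix y assume "y \<in> (\<lambda>z. 2*r+1-z) ` {z\<in>{1..2*r}. block_of l (w z) = i \<and> block_of m z = j}"
      then obtain z where z: "z \<in> {1..2*r}" "block_of l (w z) = i" "block_of m z = j" "y = 2*r+1-z" by blast
      show "y \<in> {z\<in>{1..2*r}. block_of l (w z) = 2*n+2-i \<and> block_of m z = 2*n+2-j}"
        using mirror_range[OF z(1)] WB_mirror[OF w z(1)] labelling_mirror[OF labelling_block_of[OF m] z(1)]
          labelling_mirror[OF labelling_block_of[OF l] WB_range[OF w z(1)]] z(2-4) by simp
    qed
    show "(\<lambda>z. 2*r+1-z) ` {z\<in>{1..2*r}. block_of l (w z) = i \<and> block_of m z = j}
        \<subseteq> {z\<in>{1..2*r}. block_of l (w z) = 2*n+2-i \<and> block_of m z = 2*n+2-j}" by (rule step)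
    have "2*n+2-(2*n+2-i) = i" "2*n+2-(2*n+2-j) = j" using i j by auto
    then show "(\<lambda>z. 2*r+1-z) ` {z\<in>{1..2*r}. block_of l (w z) = 2*n+2-i \<and> block_of m z = 2*n+2-j}
        \<subseteq> {z\<in>{1..2*r}. block_of l (w z) = i \<and> block_of m z = j}" using step[of "2*n+2-i" "2*n+2-j"] by simp
  qed auto
  moreover have "coset_mat n l w m i j = 0" if "\<not> (i \<in> {1..2*n+1} \<and> j \<in> {1..2*n+1})" for i j
    unfolding coset_mat_def by (rule if_not_P) (rule that)
  moreover have "(\<Sum>i=1..2*n+1. \<Sum>j=1..2*n+1. coset_mat n l w m i j) = 2*r"
    using ro_coset_mat[OF assms] psum_total[OF l] unfolding ro_def psum_def by (simp only: fun_eq_iff)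
  ultimately show ?thesis unfolding Xi_def by blast
qed

end

context letter_move
begin

text \<open>The matrix \<open>A\<close> is realised by a permutation that has a letter of column block \<open>p\<close> at the moving position; its matrix for
  the row composition \<open>lam\<close> is the shifted one.\<close>

lemma shift_props:
  assumes A: "A \<in> Xi n r" and nu: "nu \<in> Lam n r" and ro: "ro n A = hat n mu" and co: "co n A = hat n nu"
    and p: "A h p > 0"
  shows "shift n h A p \<in> Xi n r" "ro n (shift n h A p) = hat n lam" "co n (shift n h A p) = hat n nu"
proof -
  obtain w where w: "w \<in> WB r" "coset_mat n mu w nu = A" using coset_mat_exists[OF A mu nu ro co] by blast
  have "{z\<in>{1..2*r}. block_of mu (w z) = h \<and> block_of nu z = p} \<noteq> {}"
  proof
    assume e: "{z\<in>{1..2*r}. block_of mu (w z) = h \<and> block_of nu z = p} = {}"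
    show False using p unfolding w(2)[symmetric] coset_mat_eq[OF mu nu w(1)] e by simp
  qed
  then obtain c where c: "c \<in> {1..2*r}" "block_of mu (w c) = h" "block_of nu c = p" by blast
  have wc: "w c \<in> {1..2*r}" using WB_range[OF w(1) c(1)] .
  define u where "u = (if w c = moving then id else reflection r (w c) moving)"
  have uP: "u \<in> stabB r (block_of mu)"
    unfolding u_def stabB_def using reflection_WB[OF wc moving_range(3)] labelling_reflection[OF labelling_block_of[OF mu] wc moving_range(3)] c block_of_moving by auto
  have um: "u (w c) = moving" unfolding u_def by simp
  define y where "y = u \<circ> w"
  have y: "y \<in> WB r" unfolding y_def using stabB_WB[OF uP] w(1) by blast
  have "coset_mat n mu (u \<circ> w \<circ> id) nu = A" unfolding coset_mat_invariant[OF mu nu w(1) uP stabB_id] by (rule w(2))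
  then have "coset_mat n mu y nu = A" unfolding y_def by simp
  moreover have "inv y moving = c" using um WB_inv_apply(1)[OF y, of c] unfolding y_def by simp
  ultimately have e: "coset_mat n lam y nu = shift n h A p"
    using coset_mat_move_iff[OF A nu y] c(3) by blast
  show "shift n h A p \<in> Xi n r" "ro n (shift n h A p) = hat n lam" "co n (shift n h A p) = hat n nu"
    unfolding e[symmetric] using coset_mat_Xi[OF lam nu y] ro_coset_mat[OF lam nu y] co_coset_mat[OF lam nu y] by blast+
qed

lemma shift_center: "shift n h A p (n+1) (n+1) = A (n+1) (n+1) + (if h = n \<and> p = n+1 then 2 else 0)"
proof -
  have "n+1 \<noteq> h" "n+1 \<noteq> 2*n+2-h" using h by auto
  then have "Etheta n h p (n+1) (n+1) = 0" unfolding Etheta_def Emat_def by simp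
  moreover have "n+1 = 2*n+2-(h+1) \<longleftrightarrow> h = n" "n+1 = h+1 \<longleftrightarrow> h = n" "n+1 = 2*n+2-p \<longleftrightarrow> p = n+1" "n+1 = p \<longleftrightarrow> p = n+1"
    using h by auto
  then have "Etheta n (h+1) p (n+1) (n+1) = (if h = n \<and> p = n+1 then 2 else 0)"
    unfolding Etheta_def Emat_def plus_fun_def by (simp only:) (simp split: if_split)
  ultimately show ?thesis unfolding shift_def by simp
qed

text \<open>The entry \<open>(h,p)\<close> moves to row \<open>h+1\<close>, and it leaves the upper right corner if and only if \<open>h = n\<close> and \<open>p > n+1\<close>.\<close>

lemma shift_sign:
  assumes A: "A \<in> Xi n r" and p: "A h p > 0"
  shows "sgnM n (shift n h A p) = (if h = n \<and> n+1 < p then - sgnM n A else sgnM n A)"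
proof -
  have pr: "p \<in> {1..2*n+1}" using Xi_outside[OF A, of h p] p by auto
  let ?I = "{1..n} \<times> {n+2..2*n+1}"
  have "(\<Sum>(i,j)\<in>?I. shift n h A p i j + (if (i,j) = (h,p) then 1 else 0))
      = (\<Sum>(i,j)\<in>?I. A i j + (if (i,j) = (h+1,p) then 1 else 0))"
  proof (rule sum.cong[OF HOL.refl], clarify)
    fix i j assume i: "i \<in> {1..n}"
    have "i \<noteq> 2*n+2-h" "i \<noteq> 2*n+2-(h+1)" using i h by auto
    then have "Etheta n h p i j = (if (i,j) = (h,p) then 1 else 0)" "Etheta n (h+1) p i j = (if (i,j) = (h+1,p) then 1 else 0)"
      unfolding Etheta_def Emat_def by auto
    then show "shift n h A p i j + (if (i,j) = (h,p) then 1 else 0) = A i j + (if (i,j) = (h+1,p) then 1 else 0)"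
      using Etheta_le[OF A p, of i j] unfolding shift_def by auto
  qed
  moreover have "(\<Sum>(i,j)\<in>?I. B i j + (if (i,j) = c then 1 else 0)) = (\<Sum>i=1..n. \<Sum>j=n+2..2*n+1. B i j) + (if c \<in> ?I then 1 else 0)"
    for B :: mat and c
    unfolding sum.cartesian_product by (simp add: split_beta sum.distrib sum.delta)
  ultimately have e: "(\<Sum>i=1..n. \<Sum>j=n+2..2*n+1. shift n h A p i j) + (if (h,p) \<in> ?I then 1 else 0)
      = (\<Sum>i=1..n. \<Sum>j=n+2..2*n+1. A i j) + (if (h+1,p) \<in> ?I then 1 else 0)" by (simp only:)
  have I: "(h,p) \<in> ?I \<longleftrightarrow> n+1 < p" "(h+1,p) \<in> ?I \<longleftrightarrow> n+1 < p \<and> h \<noteq> n" using h pr by auto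
  show ?thesis
  proof (cases "h = n \<and> n+1 < p")
    case True
    then have "(\<Sum>i=1..n. \<Sum>j=n+2..2*n+1. shift n h A p i j) + 1 = (\<Sum>i=1..n. \<Sum>j=n+2..2*n+1. A i j)"
      using e unfolding I by (simp only: simp_thms if_True if_False add_0_right)
    then have "even (\<Sum>i=1..n. \<Sum>j=n+2..2*n+1. A i j) \<longleftrightarrow> odd (\<Sum>i=1..n. \<Sum>j=n+2..2*n+1. shift n h A p i j)"
      by (metis even_plus_one_iff)
    then show ?thesis using True unfolding sgnM_def by (simp only: if_True simp_thms) (simp split: if_split)
  next
    case False
    then have "(\<Sum>i=1..n. \<Sum>j=n+2..2*n+1. shift n h A p i j) = (\<Sum>i=1..n. \<Sum>j=n+2..2*n+1. A i j)"
      using e unfolding I by (cases "n+1 < p") (simp_all only: simp_thms if_True if_False add_0_right add_right_cancel)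
    then show ?thesis using False unfolding sgnM_def by (simp only: if_False)
  qed
qed

text \<open>The double coset of \<open>C\<close> is that of the identity (\<open>coset_mat_id\<close>).\<close>

lemma phi_C_comp:
  assumes C: "C \<in> Xi n r" "ro n C = hat n lam" "co n C = hat n mu" "C = coset_mat n lam id mu" "C (n+1) (n+1) \<noteq> 0"
    and b: "b \<in> LamD n r" and f: "f = left_mult (Bul mu) b z" "z * xD n b = Tsum D * t" "\<exists>k\<in>heckeD. z * xD n b = xD n (Bul mu) * k"
  shows "represents (Bul lam) b
    ((Tsum (sortedR (block_of mu) (double_coset (stabD r (block_of lam)) id (stabD r (block_of mu)))) * Tsum D) * t) (phi n (DotM C) \<circ> f)"
proof -
  have "Dbul lam mu C = double_coset (stabD r (block_of lam)) id (stabD r (block_of mu))"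
    using dcoset_bul[OF lam mu WD_id] C(4,5) unfolding Dbul_def by simp
  then have "phi n (DotM C) = left_mult (Bul lam) (Bul mu)
      (Tsum (sortedR (block_of mu) (double_coset (stabD r (block_of lam)) id (stabD r (block_of mu)))))"
    using phi_DotM(1)[OF C(1) lam mu C(2,3) lam_mid mu_mid C(5)] by simp
  then have "phi n (DotM C) \<circ> f = left_mult (Bul lam) b
      (Tsum (sortedR (block_of mu) (double_coset (stabD r (block_of lam)) id (stabD r (block_of mu)))) * z)"
    unfolding f(1) using left_mult_comp[OF Bul_LamD[OF mu mu_mid] b f(3)] by simp
  then show ?thesis unfolding represents_def using f(2) by (metis mult.assoc)
qed

lemma formula_bul:
  assumes C: "C \<in> Xi n r" "ro n C = hat n lam" "co n C = hat n mu" "C = coset_mat n lam id mu" "C (n+1) (n+1) \<noteq> 0"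
    and A: "A \<in> Xi n r" and nu: "nu \<in> Lam n r" and ro: "ro n A = hat n mu" and co: "co n A = hat n nu"
    and c: "A (n+1) (n+1) \<noteq> 0"
  shows "(phi n (DotM C) \<circ> phi n (DotM A) :: 'r endo) = (\<Sum>p=1..2*n+1. g' n h A p *\<^sub>S phi n (DotM (shift n h A p)))"
proof -
  have nz: "nu (n+1) \<noteq> 0" by (rule co_mid_nonzero[OF co c]) simp
  note b = Bul_LamD[OF nu nz]
  note P = phi_DotM[OF A mu nu ro co mu_mid nz c]
  have "represents (Bul lam) (Bul nu)
      ((Tsum (sortedR (block_of mu) (double_coset (stabD r (block_of lam)) id (stabD r (block_of mu)))) * Tsum (Dbul mu nu A)) * 1) (phi n (DotM C) \<circ> phi n (DotM A))"
    by (rule phi_C_comp[OF C b P(1) _ P(3)]) (simp add: P(2))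
  moreover have "represents (Bul lam) (Bul nu) (\<Sum>p=1..2*n+1. hscalar (g' n h A p) * Tsum (Dbul lam nu (shift n h A p)))
      (\<Sum>p=1..2*n+1. g' n h A p *\<^sub>S phi n (DotM (shift n h A p)))"
  proof (rule represents_sum)
    fix p
    show "represents (Bul lam) (Bul nu) (hscalar (g' n h A p) * Tsum (Dbul lam nu (shift n h A p)))
        (g' n h A p *\<^sub>S phi n (DotM (shift n h A p)))"
    proof (cases "A h p > 0")
      case True
      note s = shift_props[OF A nu ro co True]
      have "shift n h A p (n+1) (n+1) \<noteq> 0" using c shift_center[of A p] by simp
      note Q = phi_DotM[OF s(1) lam nu s(2,3) lam_mid nz this]
      show ?thesis by (rule represents_scale) (use Q(1,2) in \<open>auto simp: represents_def\<close>)
    next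
      case False
      then show ?thesis using represents_zero by (simp add: g'_def endo_scale_zero)
    qed
  qed
  ultimately show ?thesis using represents_unique[OF b] multiply_bul[OF A nu ro] by simp
qed

lemma represents_SgnM:
  assumes A: "A \<in> Xi n r" and l: "l \<in> Lam n r" and nu: "nu \<in> Lam n r" and ro: "ro n A = hat n l" and co: "co n A = hat n nu"
    and z: "l (n+1) \<noteq> 0" and c: "A (n+1) (n+1) = 0" and s: "e = e' \<longleftrightarrow> sgnM n A = Pos"
  defines "b \<equiv> bracket n nu e'"
  shows "represents (Bul l) b (Tsum (Dsgn l nu A e (twist b)) * TW (sg (twist b))) (phi n (SgnM e A e'))"
  unfolding represents_def b_def using phi_SgnM(1,2)[OF A l nu ro co z c s] by blast

text \<open>The sign of the shifted matrix changes precisely for \<open>h = n\<close> and \<open>p > n+1\<close>, as does the parity of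
  \<open>mid_flips\<close>, so that the symbols on the right are admissible and carry the signs produced by \<open>multiply_sgn_eq\<close>.\<close>

lemma formula_sgn:
  assumes C: "C \<in> Xi n r" "ro n C = hat n lam" "co n C = hat n mu" "C = coset_mat n lam id mu" "C (n+1) (n+1) \<noteq> 0"
    and A: "A \<in> Xi n r" and nu: "nu \<in> Lam n r" and ro: "ro n A = hat n mu" and co: "co n A = hat n nu"
    and c: "A (n+1) (n+1) = 0" and s: "e = e' \<longleftrightarrow> sgnM n A = Pos"
  shows "(phi n (DotM C) \<circ> phi n (SgnM e A e') :: 'r endo)
      = (if h < n
         then (\<Sum>p=1..2*n+1. g' n h A p *\<^sub>S phi n (SgnM e (shift n h A p) e'))
         else (\<Sum>p=1..<n+1. g' n n A p *\<^sub>S phi n (SgnM e (shift n n A p) e'))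
            + (g' n n A (n+1) div 2) *\<^sub>S phi n (DotM (shift n n A (n+1)))
            + (\<Sum>p=n+2..2*n+1. g' n n A p *\<^sub>S phi n (SgnM (-e) (shift n n A p) e')))"
proof -
  define b where "b = bracket n nu e'"
  let ?f = "twist b" and ?t = "TW (sg (twist b))" and ?a = "Bul lam"
  let ?Z = "Tsum (sortedR (block_of mu) (double_coset (stabD r (block_of lam)) id (stabD r (block_of mu))))"
  have b: "b \<in> LamD n r" unfolding b_def by (rule bracket_LamD[OF nu])
  note P = phi_SgnM[OF A mu nu ro co mu_mid c s, folded b_def]
  have lhs: "represents ?a b ((?Z * Tsum (Dsgn mu nu A e ?f)) * ?t) (phi n (DotM C) \<circ> phi n (SgnM e A e'))"
    by (rule phi_C_comp[OF C b P])
  have summand: "represents ?a b (hscalar (g' n h A p) * (Tsum (Dsgn lam nu (shift n h A p) d ?f) * ?t))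
      (g' n h A p *\<^sub>S phi n (SgnM d (shift n h A p) e'))"
    if pc: "\<not> (h = n \<and> p = n+1)" and d: "d = (if h = n \<and> n+1 < p then -e else e)" for p d
  proof (cases "A h p > 0")
    case True
    note sp = shift_props[OF A nu ro co True]
    have c': "shift n h A p (n+1) (n+1) = 0" using c shift_center[of A p] pc by auto
    have s': "d = e' \<longleftrightarrow> sgnM n (shift n h A p) = Pos"
      unfolding shift_sign[OF A True] d using s by (cases e; cases e'; cases "sgnM n A") auto
    show ?thesis
      by (rule represents_scale) (use represents_SgnM[OF sp(1) lam nu sp(2,3) lam_mid c' s'] in \<open>simp add: b_def\<close>)
  next
    case False
    then show ?thesis using represents_zero by (simp add: g'_def endo_scale_zero)
  qed
  show ?thesis
  proof (cases "h < n")
    case True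
    have "represents ?a b (\<Sum>p=1..2*n+1. hscalar (g' n h A p) * (Tsum (Dsgn lam nu (shift n h A p) e ?f) * ?t))
        (\<Sum>p=1..2*n+1. g' n h A p *\<^sub>S phi n (SgnM e (shift n h A p) e'))"
      by (rule represents_sum, rule summand) (use True in auto)
    moreover have "(?Z * Tsum (Dsgn mu nu A e ?f)) * ?t
        = (\<Sum>p=1..2*n+1. hscalar (g' n h A p) * (Tsum (Dsgn lam nu (shift n h A p) e ?f) * ?t))"
      unfolding multiply_sgn_lt[OF A nu ro True] sum_distrib_right mult.assoc ..
    ultimately show ?thesis using represents_unique[OF b lhs] True by simp
  next
    case False
    then have hn: "h = n" using h by auto
    have mid: "represents ?a b (hscalar (g' n h A (n+1) div 2) * (Tsum (Dpar nu (shift n h A (n+1)) ?f) * ?t))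
        ((g' n h A (n+1) div 2) *\<^sub>S phi n (DotM (shift n h A (n+1))))"
    proof (cases "A h (n+1) > 0")
      case True
      note sp = shift_props[OF A nu ro co True]
      have nz: "nu (n+1) \<noteq> 0" by (rule co_mid_nonzero[OF co, of h]) (use True h in auto)
      have bb: "b = Bul nu" unfolding b_def bracket_def using nz by simp
      have D: "Dpar nu (shift n h A (n+1)) ?f = Dbul lam nu (shift n h A (n+1))"
        unfolding bb Dpar_def Dbul_def by (auto simp: WD_WB)
      have "shift n h A (n+1) (n+1) (n+1) \<noteq> 0" using shift_center[of A "n+1"] hn by simp
      note Q = phi_DotM[OF sp(1) lam nu sp(2,3) lam_mid nz this]
      show ?thesis unfolding D
        by (rule represents_scale) (use Q(1,2) in \<open>auto simp: represents_def bb\<close>)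
    next
      case False
      then show ?thesis using represents_zero by (simp add: g'_def endo_scale_zero)
    qed
    have lo: "represents ?a b (\<Sum>p=1..<n+1. hscalar (g' n h A p) * (Tsum (Dsgn lam nu (shift n h A p) e ?f) * ?t))
        (\<Sum>p=1..<n+1. g' n h A p *\<^sub>S phi n (SgnM e (shift n h A p) e'))"
      by (rule represents_sum, rule summand) auto
    have hi: "represents ?a b (\<Sum>p=n+2..2*n+1. hscalar (g' n h A p) * (Tsum (Dsgn lam nu (shift n h A p) (-e) ?f) * ?t))
        (\<Sum>p=n+2..2*n+1. g' n h A p *\<^sub>S phi n (SgnM (-e) (shift n h A p) e'))"
      by (rule represents_sum, rule summand) (use hn in auto)
    have "(?Z * Tsum (Dsgn mu nu A e ?f)) * ?t
        = (\<Sum>p=1..<n+1. hscalar (g' n h A p) * (Tsum (Dsgn lam nu (shift n h A p) e ?f) * ?t))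
        + hscalar (g' n h A (n+1) div 2) * (Tsum (Dpar nu (shift n h A (n+1)) ?f) * ?t)
        + (\<Sum>p=n+2..2*n+1. hscalar (g' n h A p) * (Tsum (Dsgn lam nu (shift n h A p) (-e) ?f) * ?t))"
      unfolding multiply_sgn_eq[OF A nu ro hn c] distrib_right sum_distrib_right mult.assoc ..
    then have "represents ?a b ((?Z * Tsum (Dsgn mu nu A e ?f)) * ?t)
        ((\<Sum>p=1..<n+1. g' n h A p *\<^sub>S phi n (SgnM e (shift n h A p) e'))
         + (g' n h A (n+1) div 2) *\<^sub>S phi n (DotM (shift n h A (n+1)))
         + (\<Sum>p=n+2..2*n+1. g' n h A p *\<^sub>S phi n (SgnM (-e) (shift n h A p) e')))"
      using represents_add[OF represents_add[OF lo mid] hi] by simp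
    from represents_unique[OF b lhs this] show ?thesis using False hn by simp
  qed
qed

end

theorem theorem7p1:
  fixes n r h :: nat and A C :: mat and gam lam mu nu :: vect and \<epsilon> :: sign
  assumes "CARD('r::finite) = r"
    and "n \<ge> 1" and "r \<ge> 4"
    and "h \<in> {1..n}"
    and "A \<in> Xi n r" and "C \<in> Xi n r"
    and "gam \<in> Lam n (r - 1)" and "C = Etheta n (h+1) h + diag (hat n gam)"
    and "lam \<in> Lam n r" and "mu \<in> Lam n r" and "nu \<in> Lam n r"
    and "ro n C = hat n lam" and "co n C = hat n mu" and "ro n A = hat n mu"
    and "co n A = hat n nu"
    and "\<epsilon> = sgnM n A"
    and "C (n+1) (n+1) \<noteq> 0"
  shows "(A \<in> Xi_bul n r \<longrightarrow>
      (phi n (DotM C) \<circ> phi n (DotM A) :: 'r endo)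
      = (\<Sum>p=1..2*n+1. g' n h A p *\<^sub>S phi n (DotM (shift n h A p))))
    \<and> (A \<in> Xi_bul_circ_circ n r \<union> Xi_bul_circ_bul n r \<longrightarrow>
      (phi n (DotM C) \<circ> phi n (SgnM Pos A \<epsilon>) :: 'r endo)
      = (if h < n
         then (\<Sum>p=1..2*n+1. g' n h A p *\<^sub>S phi n (SgnM Pos (shift n h A p) \<epsilon>))
         else (\<Sum>p=1..<n+1. g' n n A p *\<^sub>S phi n (SgnM Pos (shift n n A p) \<epsilon>))
            + (g' n n A (n+1) div 2) *\<^sub>S phi n (DotM (shift n n A (n+1)))
            + (\<Sum>p=n+2..2*n+1. g' n n A p *\<^sub>S phi n (SgnM Neg (shift n n A p) \<epsilon>)))
      \<and>
      (phi n (DotM C) \<circ> phi n (SgnM Neg A (- \<epsilon>)) :: 'r endo)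
      = (if h < n
         then (\<Sum>p=1..2*n+1. g' n h A p *\<^sub>S phi n (SgnM Neg (shift n h A p) (- \<epsilon>)))
         else (\<Sum>p=1..<n+1. g' n n A p *\<^sub>S phi n (SgnM Neg (shift n n A p) (- \<epsilon>)))
            + (g' n n A (n+1) div 2) *\<^sub>S phi n (DotM (shift n n A (n+1)))
            + (\<Sum>p=n+2..2*n+1. g' n n A p *\<^sub>S phi n (SgnM Pos (shift n n A p) (- \<epsilon>)))))"
proof -
  have card: "CARD('r) = r" and n1: "1 \<le> n" and r4: "4 \<le> r" and h: "h \<in> {1..n}" and C: "C \<in> Xi n r"
    and gam: "gam \<in> Lam n (r-1)" and Cd: "C = Etheta n (h+1) h + diag (hat n gam)" and c: "C (n+1) (n+1) \<noteq> 0"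
    using assms by auto
  define l where "l = (\<lambda>i. gam i + (if i = h+1 then 1 else 0))"
  define m where "m = (\<lambda>i. gam i + (if i = h then 1 else 0))"
  have "(\<Sum>i=1..n+1. gam i) = r-1" using gam unfolding Lam_def by blast
  then have lL: "l \<in> Lam n r" and mL: "m \<in> Lam n r"
    using gam h r4 unfolding Lam_def l_def m_def by (auto simp: sum.distrib)
  have "Etheta n (h+1) h (n+1) (n+1) = 0" using h unfolding Etheta_def Emat_def by auto
  then have gz: "gam (n+1) \<noteq> 0" using c unfolding Cd by (auto simp: diag_def hat_def)
  interpret L: letter_move r "TYPE('r)" n h gam l m
    by unfold_locales (use card n1 r4 h lL mL gz in \<open>auto simp: l_def m_def\<close>)
  have Cm: "C = coset_mat n l id m" unfolding Cd L.coset_mat_id ..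
  have "hat n l = hat n lam" "hat n m = hat n mu"
    using L.ro_coset_mat[OF lL mL WB_id] L.co_coset_mat[OF lL mL WB_id] assms(12,13) unfolding Cm by auto
  then have same: "l = lam" "m = mu" using L.hat_inj[OF lL assms(9)] L.hat_inj[OF mL assms(10)] by blast+
  note Cs = C assms(12,13)[folded same] Cm c
  note As = assms(5,11) assms(14)[folded same] assms(15)
  have eps: "Pos = \<epsilon> \<longleftrightarrow> sgnM n A = Pos" "Neg = - \<epsilon> \<longleftrightarrow> sgnM n A = Pos"
    unfolding assms(16) by (cases "sgnM n A"; simp)+
  have z: "A (n+1) (n+1) = 0" if "A \<in> Xi_bul_circ_circ n r \<union> Xi_bul_circ_bul n r"
    using that unfolding Xi_bul_circ_circ_def Xi_bul_circ_bul_def by blast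
  show ?thesis
    using L.formula_bul[OF Cs As] L.formula_sgn[OF Cs As z eps(1)] L.formula_sgn[OF Cs As z eps(2)]
    unfolding Xi_bul_def by (simp only: mem_Collect_eq uminus_sign.simps) blast
qed

end
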